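(* Let $u$ be the mild solution of the stochastic heat equation with piecewise constant coefficients described in the context, with $\sigma:\mathbb{R}\to\mathbb{R}$ globally Lipschitz. Fix $0<T_1<T_2$ and $x\in\mathbb{R}$. For $n\ge 1$ put $\delta=\frac{T_2-T_1}{n}$ and $t_i=T_1+i\delta$ for $i=0,1,\dots,n$. Let $$\eta=\frac12\left((1-\beta)^2+\sqrt{\frac{a_1}{a_2}}\,(1+\beta)^2\right),\qquad \tau(x)=\eta^2\mathbf 1_{\{x=0\}}+\mathbf 1_{\{x\neq 0\}}.$$ Then the following limit holds in probability: $$\lim_{n\to\infty}\sum_{i=1}^{n}\bigl(u(t_i,x)-u(t_{i-1},x)\bigr)^4=\frac{6\,\tau(x)}{\pi A(x)}\int_{T_1}^{T_2}\sigma^4(u(r,x))\,dr .$$ Moreover, there is a finite constant $C_{T_1,T_2,x}>0$, independent of $n$, such that for all sufficiently large $n$, $$\mathbb{E}\left|\sum_{i=1}^{n}\bigl(u(t_i,x)-u(t_{i-1},x)\bigr)^4-\frac{6\,\tau(x)}{\pi A(x)}\int_{T_1}^{T_2}\sigma^4(u(r,x))\,dr\right|\le C_{T_1,T_2,x}\,n^{-3/20}.$$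
   Context: Fix positive constants $a_1,a_2,\rho_1,\rho_2$ and set $A(x)=a_1\mathbf 1_{\{x\le 0\}}+a_2\mathbf 1_{\{x>0\}}$, $\rho(x)=\rho_1\mathbf 1_{\{x\le 0\}}+\rho_2\mathbf 1_{\{x>0\}}$, $\mathcal L=\frac{1}{2\rho(x)}\frac{d}{dx}\bigl(\rho(x)A(x)\frac{d}{dx}\bigr)$. Set $f(y)=\frac{y}{\sqrt{a_1}}\mathbf 1_{\{y\le0\}}+\frac{y}{\sqrt{a_2}}\mathbf 1_{\{y>0\}}$, $\alpha=1-\frac{\rho_1a_1}{\rho_2a_2}$, $\beta=\frac{\sqrt{a_1}+\sqrt{a_2}(\alpha-1)}{\sqrt{a_1}-\sqrt{a_2}(\alpha-1)}$. The fundamental solution of $\partial_t u=\mathcal L u$ is, for $t>0$ and $x,y\in\mathbb R$, $$G(t,x,y)=\frac{1}{\sqrt{2\pi t}}\left(\frac{\mathbf 1_{\{y\le0\}}}{\sqrt{a_1}}+\frac{\mathbf 1_{\{y>0\}}}{\sqrt{a_2}}\right)\left\{\exp\left(-\frac{(f(x)-f(y))^2}{2t}\right)+\beta\,\mathrm{sign}(y)\exp\left(-\frac{(|f(x)|+|f(y)|)^2}{2t}\right)\right\},$$ and $G(t,x,y)=0$ for $t\le0$. On a probability space $(\Omega,\mathcal F,\mathbb P)$, $W$ is a space-time white noise: a centered Gaussian family $\{W(t,B)\}$, indexed by $t\ge0$ and Borel sets $B\subset\mathbb R$ of finite Lebesgue measure, with $\mathbb E[W(t,B)W(s,C)]=(t\wedge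 s)\lambda(B\cap C)$, $\lambda$ being Lebesgue measure. $\mathcal F_t$ is the sigma-algebra generated by $\{W(s,B):0\le s\le t\}$ (augmented in the usual way). Integrals $\int\int X(s,y)\,W(ds,dy)$ are Walsh stochastic integrals of predictable, square-integrable random fields $X$; all random fields are jointly measurable and adapted. $\sigma:\mathbb R\to\mathbb R$ satisfies $|\sigma(x)-\sigma(y)|\le M|x-y|$ for all $x,y$ and some $M>0$. The mild solution $u$ of $\partial_t u=\mathcal L u+\sigma(u)\dot W$, $u(0,x)=0$, is the random field (unique up to modification) satisfying $\sup_{(t,x)\in[0,T]\times\mathbb R}\mathbb E|u(t,x)|^p<\infty$ for all $T>0$, $p\ge2$, and, for all $t\ge 0$, $x\in\mathbb R$, almost surely $$u(t,x)=\int_0^t\int_{\mathbb R}\sigma(u(s,y))G(t-s,x,y)\,W(ds,dy).$$ *)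

theory Defs
  imports "HOL-Probability.Probability"
begin

section \<open>Coefficients and fundamental solution\<close>

definition coeffA :: "real \<Rightarrow> real \<Rightarrow> real \<Rightarrow> real" where
  "coeffA a1 a2 x = a1 * indicator {..0} x + a2 * indicator {0<..} x"

definition f_scale :: "real \<Rightarrow> real \<Rightarrow> real \<Rightarrow> real" where
  "f_scale a1 a2 y = y / sqrt a1 * indicator {..0} y + y / sqrt a2 * indicator {0<..} y"

definition alpha_const :: "real \<Rightarrow> real \<Rightarrow> real \<Rightarrow> real \<Rightarrow> real" where
  "alpha_const a1 a2 \<rho>1 \<rho>2 = 1 - (\<rho>1 * a1) / (\<rho>2 * a2)"

definition beta_const :: "real \<Rightarrow> real \<Rightarrow> real \<Rightarrow> real \<Rightarrow> real" where
  "beta_const a1 a2 \<rho>1 \<rho>2 =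
    (let \<alpha> = alpha_const a1 a2 \<rho>1 \<rho>2 in
      (sqrt a1 + sqrt a2 * (\<alpha> - 1)) / (sqrt a1 - sqrt a2 * (\<alpha> - 1)))"

text \<open>
  The fundamental solution of \<open>\<partial>\<^sub>t u = \<L> u\<close> for
  \<open>\<L> = 1 / (2 \<rho>(x)) d/dx (\<rho>(x) A(x) d/dx)\<close>, where \<open>A\<close> and \<open>\<rho>\<close> take the values
  \<open>a1\<close>, \<open>\<rho>1\<close> on \<open>x \<le> 0\<close> and \<open>a2\<close>, \<open>\<rho>2\<close> on \<open>x > 0\<close>.
\<close>

definition heat_kernel ::
  "real \<Rightarrow> real \<Rightarrow> real \<Rightarrow> real \<Rightarrow> real \<Rightarrow> real \<Rightarrow> real \<Rightarrow> real" where
  "heat_kernel a1 a2 \<rho>1 \<rho>2 t x y =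
    (let f = f_scale a1 a2; \<beta> = beta_const a1 a2 \<rho>1 \<rho>2 in
      if t > 0 then
        1 / sqrt (2 * pi * t)
        * (indicator {..0} y / sqrt a1 + indicator {0<..} y / sqrt a2)
        * (exp (- ((f x - f y)\<^sup>2 / (2 * t)))
            + \<beta> * sgn y * exp (- ((\<bar>f x\<bar> + \<bar>f y\<bar>)\<^sup>2 / (2 * t))))
      else 0)"

definition eta_const :: "real \<Rightarrow> real \<Rightarrow> real \<Rightarrow> real \<Rightarrow> real" where
  "eta_const a1 a2 \<rho>1 \<rho>2 =
    (let \<beta> = beta_const a1 a2 \<rho>1 \<rho>2 in
      1 / 2 * ((1 - \<beta>)\<^sup>2 + sqrt (a1 / a2) * (1 + \<beta>)\<^sup>2))"

definition tau_fun :: "real \<Rightarrow> real \<Rightarrow> real \<Rightarrow> real \<Rightarrow> real \<Rightarrow> real" where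
  "tau_fun a1 a2 \<rho>1 \<rho>2 x =
    (eta_const a1 a2 \<rho>1 \<rho>2)\<^sup>2 * indicator {0} x + indicator (- {0}) x"


section \<open>Space-time white noise\<close>

text \<open>The point mass at 0 counts as a (degenerate) centered Gaussian law.\<close>

definition centered_gaussian :: "'a measure \<Rightarrow> ('a \<Rightarrow> real) \<Rightarrow> bool" where
  "centered_gaussian M X \<longleftrightarrow>
    X \<in> borel_measurable M \<and>
    ((AE \<omega> in M. X \<omega> = 0) \<or> (\<exists>s>0. distributed M lborel X (normal_density 0 s)))"

definition centered_gaussian_family ::
  "'a measure \<Rightarrow> 'i set \<Rightarrow> ('i \<Rightarrow> 'a \<Rightarrow> real) \<Rightarrow> bool" where
  "centered_gaussian_family M I X \<longleftrightarrow>
    (\<forall>J c. finite J \<and> J \<subseteq> I \<longrightarrow> centered_gaussian M (\<lambda>\<omega>. \<Sum>j\<in>J. c j * X j \<omega>))"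

definition finite_borel :: "real set set" where
  "finite_borel = {B \<in> sets borel. emeasure lborel B < \<infinity>}"

definition white_noise :: "'a measure \<Rightarrow> (real \<Rightarrow> real set \<Rightarrow> 'a \<Rightarrow> real) \<Rightarrow> bool" where
  "white_noise M W \<longleftrightarrow>
    centered_gaussian_family M ({0..} \<times> finite_borel) (\<lambda>(t, B). W t B) \<and>
    (\<forall>t\<ge>0. \<forall>s\<ge>0. \<forall>B\<in>finite_borel. \<forall>C\<in>finite_borel.
      (\<integral>\<omega>. W t B \<omega> * W s C \<omega> \<partial>M) = min t s * measure lborel (B \<inter> C))"

text \<open>
  The usual augmentation: \<open>noise_sets\<close> adjoins the null sets of \<open>M\<close>, and
  \<open>noise_filtration\<close> passes to the right-continuous version.  Only the \<open>\<sigma>\<close>-algebra of the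
  measure \<open>noise_filtration M W t\<close> is meaningful (\<open>sigma\<close> carries the zero measure).
\<close>

definition noise_sets ::
  "'a measure \<Rightarrow> (real \<Rightarrow> real set \<Rightarrow> 'a \<Rightarrow> real) \<Rightarrow> real \<Rightarrow> 'a set set" where
  "noise_sets M W t = sigma_sets (space M)
    ({W s B -` S \<inter> space M | s B S. 0 \<le> s \<and> s \<le> t \<and> B \<in> finite_borel \<and> S \<in> sets borel}
      \<union> null_sets M)"

definition noise_filtration ::
  "'a measure \<Rightarrow> (real \<Rightarrow> real set \<Rightarrow> 'a \<Rightarrow> real) \<Rightarrow> real \<Rightarrow> 'a measure" where
  "noise_filtration M W t = sigma (space M) (\<Inter>s\<in>{t<..}. noise_sets M W s)"


section \<open>Walsh stochastic integral\<close>

text \<open>Random fields are functions of \<open>(\<omega>, s, y)\<close> with \<open>s \<ge> 0\<close>.\<close>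

definition predictable_space ::
  "'a measure \<Rightarrow> (real \<Rightarrow> real set \<Rightarrow> 'a \<Rightarrow> real) \<Rightarrow> ('a \<times> real \<times> real) measure" where
  "predictable_space M W = sigma (space M \<times> {0..} \<times> UNIV)
    ({E \<times> {a<..b} \<times> B | E a b B.
        0 \<le> a \<and> a \<le> b \<and> E \<in> sets (noise_filtration M W a) \<and> B \<in> sets borel}
      \<union> {E \<times> {0} \<times> B | E B. E \<in> sets (noise_filtration M W 0) \<and> B \<in> sets borel})"

definition field_measure :: "'a measure \<Rightarrow> real \<Rightarrow> ('a \<times> real \<times> real) measure" where
  "field_measure M t = M \<Otimes>\<^sub>M (restrict_space lborel {0..t} \<Otimes>\<^sub>M lborel)"

text \<open>
  A list entry \<open>(X, a, b, B)\<close> stands for the elementary field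
  \<open>(\<omega>, s, y) \<mapsto> X(\<omega>) 1_{(a,b]}(s) 1_B(y)\<close>.
\<close>

type_synonym 'a simple_field = "(('a \<Rightarrow> real) \<times> real \<times> real \<times> real set) list"

definition is_simple_field ::
  "'a measure \<Rightarrow> (real \<Rightarrow> real set \<Rightarrow> 'a \<Rightarrow> real) \<Rightarrow> 'a simple_field \<Rightarrow> bool" where
  "is_simple_field M W S \<longleftrightarrow>
    (\<forall>(X, a, b, B) \<in> set S.
      0 \<le> a \<and> a \<le> b \<and> B \<in> finite_borel \<and>
      X \<in> borel_measurable (noise_filtration M W a) \<and> bounded (X ` space M))"

definition simple_field_eval :: "'a simple_field \<Rightarrow> 'a \<times> real \<times> real \<Rightarrow> real" where
  "simple_field_eval S = (\<lambda>(\<omega>, s, y).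
    \<Sum>(X, a, b, B)\<leftarrow>S. X \<omega> * indicator {a<..b} s * indicator B y)"

definition simple_field_integral ::
  "(real \<Rightarrow> real set \<Rightarrow> 'a \<Rightarrow> real) \<Rightarrow> 'a simple_field \<Rightarrow> real \<Rightarrow> 'a \<Rightarrow> real" where
  "simple_field_integral W S t \<omega> =
    (\<Sum>(X, a, b, B)\<leftarrow>S. X \<omega> * (W (min t b) B \<omega> - W (min t a) B \<omega>))"

text \<open>
  \<open>has_walsh_integral M W X t I\<close>: the random variable \<open>I\<close> is (a version of) the integral of \<open>X\<close>
  over \<open>[0,t] \<times> \<real>\<close> with respect to \<open>W\<close>, the \<open>L\<^sup>2\<close>-limit of the integrals of simple fields that
  approximate \<open>X\<close> in \<open>L\<^sup>2(dP ds dy)\<close>.  By the isometry \<open>I\<close> does not depend on the approximating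
  sequence, up to almost sure equality.  As usual, an integrand is identified with any predictable
  field that agrees with it almost everywhere.
\<close>

definition has_walsh_integral ::
  "'a measure \<Rightarrow> (real \<Rightarrow> real set \<Rightarrow> 'a \<Rightarrow> real) \<Rightarrow>
    ('a \<times> real \<times> real \<Rightarrow> real) \<Rightarrow> real \<Rightarrow> ('a \<Rightarrow> real) \<Rightarrow> bool" where
  "has_walsh_integral M W X t I \<longleftrightarrow>
    X \<in> borel_measurable (field_measure M t) \<and>
    (\<exists>Y \<in> borel_measurable (predictable_space M W). AE z in field_measure M t. X z = Y z) \<and>
    (\<integral>\<^sup>+ z. ennreal ((X z)\<^sup>2) \<partial>field_measure M t) < \<infinity> \<and>
    I \<in> borel_measurable M \<and>
    (\<exists>S. (\<forall>n. is_simple_field M W (S n)) \<and>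
      (\<lambda>n::nat. \<integral>\<^sup>+ z. ennreal ((simple_field_eval (S n) z - X z)\<^sup>2) \<partial>field_measure M t)
        \<longlonglongrightarrow> 0 \<and>
      (\<lambda>n. \<integral>\<^sup>+ \<omega>. ennreal ((simple_field_integral W (S n) t \<omega> - I \<omega>)\<^sup>2) \<partial>M)
        \<longlonglongrightarrow> 0)"


section \<open>Mild solution\<close>

definition mild_solution ::
  "real \<Rightarrow> real \<Rightarrow> real \<Rightarrow> real \<Rightarrow> (real \<Rightarrow> real) \<Rightarrow> 'a measure \<Rightarrow>
    (real \<Rightarrow> real set \<Rightarrow> 'a \<Rightarrow> real) \<Rightarrow> (real \<Rightarrow> real \<Rightarrow> 'a \<Rightarrow> real) \<Rightarrow> bool" where
  "mild_solution a1 a2 \<rho>1 \<rho>2 \<sigma> M W u \<longleftrightarrow>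
    (\<lambda>(\<omega>, t, x). u t x \<omega>) \<in> borel_measurable (M \<Otimes>\<^sub>M (restrict_space borel {0..} \<Otimes>\<^sub>M borel)) \<and>
    (\<forall>t\<ge>0. \<forall>x. u t x \<in> borel_measurable (noise_filtration M W t)) \<and>
    (\<forall>T>0. \<forall>p\<ge>2. (SUP (t, x) \<in> {0..T} \<times> UNIV. \<integral>\<^sup>+ \<omega>. ennreal (\<bar>u t x \<omega>\<bar> powr p) \<partial>M) < \<infinity>) \<and>
    (\<forall>t\<ge>0. \<forall>x. has_walsh_integral M W
        (\<lambda>(\<omega>, s, y). \<sigma> (u s y \<omega>) * heat_kernel a1 a2 \<rho>1 \<rho>2 (t - s) x y) t (u t x))"


section \<open>Quartic variation and convergence in probability\<close>

definition quartic_variation ::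
  "(real \<Rightarrow> real \<Rightarrow> 'a \<Rightarrow> real) \<Rightarrow> real \<Rightarrow> real \<Rightarrow> real \<Rightarrow> nat \<Rightarrow> 'a \<Rightarrow> real" where
  "quartic_variation u T1 T2 x n \<omega> =
    (let t = (\<lambda>i. T1 + real i * ((T2 - T1) / real n)) in
      \<Sum>i=1..n. (u (t i) x \<omega> - u (t (i - 1)) x \<omega>) ^ 4)"

definition tendsto_in_prob ::
  "'a measure \<Rightarrow> (nat \<Rightarrow> 'a \<Rightarrow> real) \<Rightarrow> ('a \<Rightarrow> real) \<Rightarrow> bool" where
  "tendsto_in_prob M X Y \<longleftrightarrow>
    (\<forall>n. X n \<in> borel_measurable M) \<and> Y \<in> borel_measurable M \<and>
    (\<forall>\<epsilon>>0. (\<lambda>n. measure M {\<omega> \<in> space M. \<bar>X n \<omega> - Y \<omega>\<bar> > \<epsilon>}) \<longlonglongrightarrow> 0)"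

end

theory Submission
 imports Defs
begin

text \<open>
  Write \<open>h\<close> for the mesh and let \<open>w\<close> be a much longer window (\<open>h = q^20\<close>, \<open>w = q^16\<close>).  The increment of
  \<open>u(\<cdot>, x)\<close> over \<open>[t, t + h]\<close> is carried by the noise after time \<open>t - w\<close>: the kernel difference has little
  mass before that time, and on the window \<open>\<sigma>(u(s, y))\<close> may be frozen at \<open>z = \<sigma>(u(t - 2 w, x))\<close>.
  In \<open>L\<^sup>4\<close> the increment is therefore close to \<open>z N\<close>, where \<open>N\<close> is centred Gaussian,
  independent of the past at time \<open>t - w\<close>, with variance close to \<open>\<kappa> sqrt (2 h / \<pi>)\<close> and \<open>\<kappa>\<^sup>2 = \<tau>(x) / A(x)\<close>.
  The variables \<open>z\<^sup>4 (N\<^sup>4 - E N\<^sup>4)\<close> of two increments are uncorrelated once their windows are disjoint, so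
  that their sum is small in \<open>L\<^sup>2\<close>, and \<open>\<Sum> z\<^sup>4 E N\<^sup>4\<close> is a Riemann sum of the limit.

  Fourth moments of Walsh integrals are bounded without Burkholder's inequality: the fourth moment of a
  simple integral is controlled directly, and an \<open>L\<^sup>2\<close>-continuous field times an almost everywhere continuous
  kernel is a limit of its discretisations on a grid.
\<close>

text \<open>The exponents 20 and 16 balance two errors. Cutting off the noise before the window
  costs \<open>h^2 / w^(3/2)\<close> in squared L2 norm, freezing the coefficient costs the order
  \<open>w\<close>; they agree for \<open>w^5 = h^4\<close>, and then both are of order
  \<open>q^16\<close>. In L4 an increment has size \<open>q^5\<close> and its approximation error
  size \<open>q^8\<close>, so fourth powers differ in L1 by \<open>q^8 * (q^5)^3 = q^23\<close>.
  Over about \<open>q^(-20)\<close> increments this adds up to \<open>q^3\<close>, the rate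
  \<open>n^(-3/20)\<close>; the martingale part (\<open>q^8\<close>), the variances
  (\<open>q^6\<close>) and the Riemann sum (\<open>q^4\<close>) contribute less. The filtration is
  right-continuous, so a value of the solution at time \<open>s\<close> is known to be measurable
  for the noise up to times strictly later than \<open>s\<close>. Independence of a Gaussian
  variable from a past is encoded by characteristic functions restricted to events of that past, a
  form that survives L2 limits.\<close>

lemmas bi_add = Bochner_Integration.integrable_add
  and bi_bound = Bochner_Integration.integrable_bound
  and bi_diff = Bochner_Integration.integrable_diff
  and bi_sum = Bochner_Integration.integrable_sum
  and bo_add = Bochner_Integration.integral_add
  and bo_cong = Bochner_Integration.integral_cong
  and bo_diff = Bochner_Integration.integral_diff
  and bo_sum = Bochner_Integration.integral_sum

abbreviation bm :: "'b measure => ('b => 'c :: topological_space) set" where "bm N \<equiv> borel_measurable N"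

abbreviation tends_to :: "(nat => 'b :: topological_space) => 'b => bool" (infixr "---->" 60)
 where "X ----> L \<equiv> X \<longlonglongrightarrow> L"

abbreviation nni :: "'b measure => ('b => real) => ennreal" where "nni N F \<equiv> \<integral>\<^sup>+z. ennreal (F z) \<partial>N"

abbreviation nn2 :: "'b measure => ('b => real) => ennreal" where "nn2 N F \<equiv> nni N (\<lambda>z. (F z)^2)"

section \<open>Gaussian variables and independence\<close>

text \<open>\<open>f / m\<close> is a probability density; the law of \<open>X\<close> under it
  turns Fourier transforms weighted by \<open>f\<close> into characteristic functions, to which
  uniqueness of laws applies.\<close>

lemma (in prob_space) weighted_distribution:
 fixes f X :: "'a => real"
 assumes [measurable]: "X \<in> bm M" and f: "integrable M f" "\<And>om. 0 \<le> f om"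
  and m: "(\<integral>om. f om \<partial>M) = m" "0 < m"
 defines "\<mu> \<equiv> distr (density M (\<lambda>om. ennreal (f om / m))) borel X"
 shows "real_distribution \<mu>"
  and "\<And>\<phi> :: real => 'b :: {banach, second_countable_topology}. \<phi> \<in> bm borel ==>
     (\<integral>x. \<phi> x \<partial>\<mu>) = (\<integral>om. (f om / m) *\<^sub>R \<phi> (X om) \<partial>M)"
proof -
 have [measurable]: "f \<in> bm M" using f by auto
 have "nni M (\<lambda>om. f om / m) = ennreal (\<integral>om. f om / m \<partial>M)"
  using f m by (intro nn_integral_eq_integral) auto
 also have "\<dots> = 1" using m by simp
 finally have one: "nni M (\<lambda>om. f om / m) = 1" .
 interpret D: prob_space "density M (\<lambda>om. ennreal (f om / m))"
  by (rule prob_spaceI) (simp add: emeasure_density one cong: nn_integral_cong)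
 show "real_distribution \<mu>"
  unfolding \<mu>_def by (intro D.real_distribution_distr) simp
 fix \<phi> :: "real => 'b" assume [measurable]: "\<phi> \<in> bm borel"
 have "(\<integral>x. \<phi> x \<partial>\<mu>) = (\<integral>om. \<phi> (X om) \<partial>density M (\<lambda>om. ennreal (f om / m)))"
  unfolding \<mu>_def by (rule integral_distr) simp_all
 also have "\<dots> = (\<integral>om. (f om / m) *\<^sub>R \<phi> (X om) \<partial>M)"
  using f m by (intro integral_density) auto
 finally show "(\<integral>x. \<phi> x \<partial>\<mu>) = (\<integral>om. (f om / m) *\<^sub>R \<phi> (X om) \<partial>M)" .
qed

lemma (in prob_space) integrable_scaleR_iexp:
 fixes Z X :: "'a => real"
 assumes [measurable]: "X \<in> bm M" and Z: "integrable M Z"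
 shows "integrable M (\<lambda>om. Z om *\<^sub>R iexp (c * X om))"
proof (rule bi_bound[OF Z])
 have [measurable]: "Z \<in> bm M" using Z by auto
 show "(\<lambda>om. Z om *\<^sub>R iexp (c * X om)) \<in> bm M" by measurable
qed (simp flip: of_real_mult)

text \<open>The positive and negative parts of \<open>Z\<close> have equal mass (the case
  \<open>c = 0\<close>). Normalised, they weight the law of \<open>X\<close> to two laws with equal
  characteristic functions, which coincide by Levy's uniqueness theorem.\<close>

lemma (in prob_space) fourier_zero_real:
 fixes Z X :: "'a => real"
 assumes X[measurable]: "X \<in> bm M" and Z: "integrable M Z"
  and zero: "\<And>c. (\<integral>om. Z om *\<^sub>R iexp (c * X om) \<partial>M) = 0" and S[measurable]: "S \<in> sets borel"
 shows "(\<integral>om. Z om * indicator S (X om) \<partial>M) = 0"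
proof -
 define P N where "P om = max (Z om) 0" and "N om = max (- Z om) 0" for om
 have Zm[measurable]: "Z \<in> bm M" using Z by auto
 have iP: "integrable M P" and iN: "integrable M N"
  unfolding P_def N_def using Z by auto
 have ZPN: "Z om = P om - N om" for om by (simp add: P_def N_def)
 have "(\<integral>om. Z om *\<^sub>R (1 :: complex) \<partial>M) = 0" using zero[of 0] by simp
 then have "(\<integral>om. Z om \<partial>M) = 0" using Z by simp
 then have mm: "(\<integral>om. P om \<partial>M) = (\<integral>om. N om \<partial>M)"
  using iP iN by (simp add: ZPN)
 define m where "m = (\<integral>om. P om \<partial>M)"
 have m0: "0 \<le> m" unfolding m_def by (simp add: P_def)
 show ?thesis
 proof (cases "m = 0")
  \<comment> \<open>No normalisation is possible here, but then both parts vanish almost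
    everywhere.\<close>
  case True
  have "(\<integral>om. P om \<partial>M) = 0" "(\<integral>om. N om \<partial>M) = 0" using True mm m_def by simp_all
  moreover have "0 \<le> P om" "0 \<le> N om" for om by (simp_all add: P_def N_def)
  ultimately have "AE om in M. P om = 0" "AE om in M. N om = 0"
   using integral_nonneg_eq_0_iff_AE[OF iP] integral_nonneg_eq_0_iff_AE[OF iN] by simp_all
  then have "AE om in M. Z om * indicator S (X om) = 0"
   by eventually_elim (simp add: ZPN)
  then show ?thesis by (simp add: integral_eq_zero_AE)
 next
  case False
  then have mp: "0 < m" using m0 by simp
  let ?D = "\<lambda>f. distr (density M (\<lambda>om. ennreal (f om / m))) borel X"
  note wP = weighted_distribution[OF X iP _ m_def[symmetric] mp]
  have mN: "(\<integral>om. N om \<partial>M) = m" using mm m_def by simp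
  note wN = weighted_distribution[OF X iN _ mN mp]
  have P0: "0 \<le> P om" and N0: "0 \<le> N om" for om by (simp_all add: P_def N_def)
  have "char (?D P) = char (?D N)"
  proof
   fix t
   have "char (?D P) t - char (?D N) t
     = (\<integral>om. (P om / m) *\<^sub>R iexp (t * X om) \<partial>M) - (\<integral>om. (N om / m) *\<^sub>R iexp (t * X om) \<partial>M)"
    unfolding char_def using P0 N0 by (subst wP(2) wN(2); simp)+
   also have "\<dots> = (\<integral>om. (P om / m) *\<^sub>R iexp (t * X om) - (N om / m) *\<^sub>R iexp (t * X om) \<partial>M)"
    using iP iN by (intro bo_diff[symmetric] integrable_scaleR_iexp) auto
   also have "\<dots> = (\<integral>om. (1 / m) *\<^sub>R (Z om *\<^sub>R iexp (t * X om)) \<partial>M)"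
    by (intro bo_cong refl)
     (simp add: ZPN scaleR_conv_of_real divide_simps left_diff_distrib)
   also have "\<dots> = 0" by (simp only: integral_scaleR_right zero scaleR_zero_right)
   finally show "char (?D P) t = char (?D N) t" by simp
  qed
  then have eq: "?D P = ?D N" using wP(1) wN(1) P0 N0 by (intro Levy_uniqueness) auto
  have "(\<integral>om. (P om / m) *\<^sub>R indicator S (X om) \<partial>M) = (\<integral>om. (N om / m) *\<^sub>R (indicator S (X om) :: real) \<partial>M)"
   using wP(2)[OF P0, of "indicator S :: real => real"] wN(2)[OF N0, of "indicator S :: real => real"]
   by (simp add: eq)
  then have e2: "(\<integral>om. P om * indicator S (X om) \<partial>M) = (\<integral>om. N om * indicator S (X om) \<partial>M)"
   using mp by simp
  have "integrable M (\<lambda>om. P om * indicator S (X om))" "integrable M (\<lambda>om. N om * indicator S (X om))"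
   by (intro bi_bound[OF iP] bi_bound[OF iN];
     simp add: P_def N_def indicator_def)+
  then show ?thesis using e2 by (simp add: ZPN left_diff_distrib)
 qed
qed

text \<open>Conjugating the hypothesis for \<open>- c\<close> gives the same hypothesis for
  \<open>cnj (Z om)\<close>; hence the real and the imaginary part satisfy it separately.\<close>

lemma (in prob_space) fourier_zero:
 fixes Z :: "'a => complex" and X :: "'a => real"
 assumes X[measurable]: "X \<in> bm M" and Z: "integrable M Z"
  and zero: "\<And>c. (\<integral>om. Z om * iexp (c * X om) \<partial>M) = 0" and S[measurable]: "S \<in> sets borel"
 shows "(\<integral>om. Z om * indicator S (X om) \<partial>M) = 0"
proof -
 have Zm[measurable]: "Z \<in> bm M" using Z by auto
 have iZe: "integrable M (\<lambda>om. Z om * iexp (c * X om))" for c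
  by (rule bi_bound[OF Z]) (auto simp: norm_mult simp flip: of_real_mult)
 have iZS: "integrable M (\<lambda>om. Z om * indicator S (X om))"
  by (rule bi_bound[OF Z]) (auto simp: norm_mult indicator_def)
 have [measurable]: "(\<lambda>om. cnj (Z om)) \<in> bm M"
  by (rule borel_measurable_continuous_on[OF _ Zm]) (intro continuous_intros)
 have cz: "(\<integral>om. cnj (Z om) * iexp (c * X om) \<partial>M) = 0" for c
 proof -
  have "(\<integral>om. cnj (Z om) * iexp (c * X om) \<partial>M) = (\<integral>om. cnj (Z om * iexp ((-c) * X om)) \<partial>M)"
   by (intro bo_cong refl) (simp add: exp_cnj)
  also have "\<dots> = cnj (\<integral>om. Z om * iexp ((-c) * X om) \<partial>M)"
   by (rule Bochner_Integration.integral_cnj)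
  finally show ?thesis using zero[of "-c"] by simp
 qed
 have icZe: "integrable M (\<lambda>om. cnj (Z om) * iexp (c * X om))" for c
  by (rule bi_bound[OF Z]) (auto simp: norm_mult simp flip: of_real_mult)
 have "(\<integral>om. Re (Z om) *\<^sub>R iexp (c * X om) \<partial>M) = 0" for c
 proof -
  have "(\<integral>om. Re (Z om) *\<^sub>R iexp (c * X om) \<partial>M)
    = (\<integral>om. (Z om * iexp (c * X om) + cnj (Z om) * iexp (c * X om)) / 2 \<partial>M)"
   by (intro bo_cong refl)
    (simp add: distrib_right[symmetric] complex_add_cnj scaleR_conv_of_real)
  also have "\<dots> = 0" using zero cz iZe icZe by simp
  finally show ?thesis .
 qed
 then have R: "(\<integral>om. Re (Z om) * indicator S (X om) \<partial>M) = 0"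
  using Z by (intro fourier_zero_real) auto
 have "(\<integral>om. Im (Z om) *\<^sub>R iexp (c * X om) \<partial>M) = 0" for c
 proof -
  have "(\<integral>om. Im (Z om) *\<^sub>R iexp (c * X om) \<partial>M)
    = (\<integral>om. (Z om * iexp (c * X om) - cnj (Z om) * iexp (c * X om)) / (2 * \<i>) \<partial>M)"
   by (intro bo_cong refl)
    (simp add: left_diff_distrib[symmetric] complex_diff_cnj scaleR_conv_of_real field_simps)
  also have "\<dots> = 0" using zero cz iZe icZe by simp
  finally show ?thesis .
 qed
 then have I: "(\<integral>om. Im (Z om) * indicator S (X om) \<partial>M) = 0"
  using Z by (intro fourier_zero_real) auto
 have re: "Re (Z om * indicator S (X om)) = Re (Z om) * indicator S (X om)"
  and im: "Im (Z om * indicator S (X om)) = Im (Z om) * indicator S (X om)" for om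
  by (auto simp: indicator_def)
 show ?thesis
  by (intro complex_eqI)
   (simp_all only: integral_Re[OF iZS, symmetric] integral_Im[OF iZS, symmetric] re im R I zero_complex.simps)
qed

lemma (in prob_space) L2_limit_AE_subseq:
 fixes X :: "nat => 'a => real"
 assumes [measurable]: "\<And>n. X n \<in> bm M" "Y \<in> bm M"
  and lim: "(\<lambda>n. nn2 M (\<lambda>om. X n om - Y om)) ----> 0"
 obtains r where "strict_mono r" "AE om in M. (\<lambda>n. X (r n) om) ----> Y om"
proof -
 \<comment> \<open>Finitely many of the distances may be infinite; the shift by \<open>N\<close>
   leaves integrable functions, as L1 convergence requires.\<close>
 obtain N where N: "\<And>n. n \<ge> N ==> (nn2 M (\<lambda>om. X n om - Y om)) < 1"
  using order_tendstoD(2)[OF lim, of 1] by (auto simp: eventually_sequentially)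
 let ?f = "\<lambda>n om. (X (n + N) om - Y om)^2"
 have int: "integrable M (?f n)" for n
  using N[of "n + N"] less_trans[of _ 1 \<infinity>]
  by (intro integrableI_bounded) (auto simp: less_top intro: less_trans)
 have "(\<lambda>n. \<integral>\<^sup>+om. norm (?f n om - 0) \<partial>M) ----> 0"
  using LIMSEQ_ignore_initial_segment[OF lim, of N] by simp
 then have "(\<lambda>n. \<integral>om. norm (?f n om - 0) \<partial>M) ----> 0"
  using int by (subst (asm) nn_integral_eq_integral) (auto simp: ennreal_0[symmetric] simp del: ennreal_0 intro!: integrable_norm)
 then obtain r where r: "strict_mono r" "AE om in M. (\<lambda>n. ?f (r n) om) ----> 0"
  using tendsto_L1_AE_subseq[of M ?f] int by auto
 have "AE om in M. (\<lambda>n. X (r n + N) om) ----> Y om"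
  using r(2)
 proof eventually_elim
  case (elim om)
  then have "(\<lambda>n. \<bar>X (r n + N) om - Y om\<bar>) ----> 0"
   using tendsto_real_sqrt[OF elim] by simp
  then show ?case by (simp add: tendsto_rabs_zero_iff LIM_zero_iff)
 qed
 moreover have "strict_mono (\<lambda>n. r n + N)" using r(1) by (simp add: strict_mono_def)
 ultimately show ?thesis using that by blast
qed

lemma (in prob_space) centered_gaussian_moment:
 assumes "centered_gaussian M X"
 shows "integrable M (\<lambda>om. X om ^ k)"
proof -
 have [measurable]: "X \<in> bm M" using assms by (simp add: centered_gaussian_def)
 from assms consider "AE om in M. X om = 0" | s where "s > 0" "distributed M lborel X (normal_density 0 s)"
  by (auto simp: centered_gaussian_def)
 then show ?thesis
 proof cases
  case 1
  then have "AE om in M. X om ^ k = 0 ^ k" by eventually_elim simp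
  then show ?thesis by (subst integrable_cong_AE[where g = "\<lambda>_. 0 ^ k"]) auto
 next
  case 2
  have "integrable lborel (\<lambda>x. normal_density 0 s x * x ^ k)"
   using integrable_normal_moment[OF 2(1), of 0 k] by simp
  then show ?thesis
   using distributed_integrable[OF 2(2), of "\<lambda>x. x ^ k"] by simp
 qed
qed

lemma (in prob_space) centered_gaussian_char:
 assumes "centered_gaussian M X"
 shows "(\<integral>om. iexp (\<theta> * X om) \<partial>M) = complex_of_real (exp (- (\<theta>^2 * (\<integral>om. (X om)^2 \<partial>M) / 2)))"
proof -
 have [measurable]: "X \<in> bm M" using assms by (simp add: centered_gaussian_def)
 from assms consider "AE om in M. X om = 0" | s where "s > 0" "distributed M lborel X (normal_density 0 s)"
  by (auto simp: centered_gaussian_def)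
 then show ?thesis
 proof cases
  case 1
  have "(\<integral>om. iexp (\<theta> * X om) \<partial>M) = (\<integral>om. 1 \<partial>M)"
   by (rule integral_cong_AE) (use 1 in auto)
  moreover have "(\<integral>om. (X om)^2 \<partial>M) = (\<integral>om. 0 \<partial>M)"
   by (rule integral_cong_AE) (use 1 in auto)
  ultimately show ?thesis by (simp add: prob_space)
 next
  case 2
  have v: "(\<integral>om. (X om)^2 \<partial>M) = s^2"
   using normal_distributed_variance[OF 2] normal_distributed_expectation[OF 2(1) _] 2(2)
   by simp
  have "distributed M lborel (\<lambda>om. (X om - 0) / s) std_normal_density"
   using normal_standard_normal_convert[OF 2(1), of X 0] 2(2) by blast
  then have d: "distr M lborel (\<lambda>om. X om / s) = std_normal_distribution"
   by (simp add: distributed_def)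
  have "(\<integral>om. iexp (\<theta> * X om) \<partial>M) = (\<integral>om. iexp ((\<theta> * s) * (X om / s)) \<partial>M)"
   using 2(1) by simp
  also have "\<dots> = (\<integral>x. iexp ((\<theta> * s) * x) \<partial>distr M lborel (\<lambda>om. X om / s))"
   by (subst integral_distr) simp_all
  also have "\<dots> = char std_normal_distribution (\<theta> * s)" by (simp add: d char_def)
  also have "\<dots> = complex_of_real (exp (- ((\<theta> * s)^2 / 2)))"
   using char_std_normal_distribution by (auto simp: fun_eq_iff)
  finally show ?thesis by (simp add: v power_mult_distrib)
 qed
qed

text \<open>The characteristic function identifies the law of \<open>X\<close> with that of
  \<open>sqrt V\<close> times a standard normal variable. This form includes the point mass for
  \<open>V = 0\<close>, so the moments need no case distinction.\<close>

lemma (in prob_space) gaussian_char_moments: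
 assumes [measurable]: "X \<in> bm M" and V: "0 \<le> V"
  and char: "\<And>\<theta>. (\<integral>om. iexp (\<theta> * X om) \<partial>M) = complex_of_real (exp (- (\<theta>^2 * V / 2)))"
 shows "integrable M (\<lambda>om. X om ^ k)"
  and "(\<integral>om. X om ^ k \<partial>M) = sqrt V ^ k * (\<integral>x. x ^ k \<partial>std_normal_distribution)"
proof -
 interpret N: real_distribution std_normal_distribution by (rule real_dist_normal_dist)
 let ?S = "distr std_normal_distribution borel (\<lambda>x. sqrt V * x)"
 have "Characteristic_Functions.char (distr M borel X) = Characteristic_Functions.char ?S"
 proof
  fix t
  have "Characteristic_Functions.char ?S t = Characteristic_Functions.char std_normal_distribution (t * sqrt V)"
   unfolding char_def by (subst integral_distr) (simp_all add: mult_ac)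
  also have "\<dots> = complex_of_real (exp (- ((t * sqrt V)^2 / 2)))"
   using char_std_normal_distribution by (auto simp: fun_eq_iff)
  also have "\<dots> = (\<integral>om. iexp (t * X om) \<partial>M)"
   unfolding char using V by (simp add: power_mult_distrib)
  also have "\<dots> = Characteristic_Functions.char (distr M borel X) t"
   unfolding char_def by (subst integral_distr) simp_all
  finally show "Characteristic_Functions.char (distr M borel X) t = Characteristic_Functions.char ?S t" ..
 qed
 then have eq: "distr M borel X = ?S"
  by (intro Levy_uniqueness real_distribution_distr N.real_distribution_distr) auto
 have i: "integrable std_normal_distribution (\<lambda>x. (sqrt V * x) ^ k)"
  unfolding power_mult_distrib by (intro integrable_mult_right integrable_std_normal_distribution_moment)
 have "integrable (distr M borel X) (\<lambda>x. x ^ k)"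
  unfolding eq by (subst integrable_distr_eq) (use i in simp_all)
 then show "integrable M (\<lambda>om. X om ^ k)" by (subst (asm) integrable_distr_eq) simp_all
 have "(\<integral>om. X om ^ k \<partial>M) = (\<integral>x. x ^ k \<partial>distr M borel X)"
  by (subst integral_distr) simp_all
 also have "\<dots> = (\<integral>x. (sqrt V * x) ^ k \<partial>std_normal_distribution)"
  unfolding eq by (subst integral_distr) simp_all
 finally show "(\<integral>om. X om ^ k \<partial>M) = sqrt V ^ k * (\<integral>x. x ^ k \<partial>std_normal_distribution)"
  by (simp add: power_mult_distrib)
qed

text \<open>Says that \<open>N\<close> is centred Gaussian with variance \<open>V\<close> and
  independent of \<open>F\<close>. The condition is linear in the indicator, so it extends from a
  generator by a Dynkin argument, and its integrand is bounded, so it passes to L2 limits of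
  \<open>N\<close>.\<close>

definition gauss_indep :: "'a measure => 'a measure => ('a => real) => real => bool" where
 "gauss_indep M F N V \<longleftrightarrow> N \<in> bm M \<and> 0 \<le> V \<and>
  (\<forall>A\<in>sets F. \<forall>\<theta>. (\<integral>om. indicator A om * (iexp (\<theta> * N om) - complex_of_real (exp (- (\<theta>^2 * V / 2)))) \<partial>M) = 0)"

lemma (in prob_space) gauss_indep_char:
 assumes F: "subalgebra M F" and N: "gauss_indep M F N V"
 shows "(\<integral>om. iexp (\<theta> * N om) \<partial>M) = complex_of_real (exp (- (\<theta>^2 * V / 2)))"
proof -
 have [measurable]: "N \<in> bm M" using N by (simp add: gauss_indep_def)
 have i: "integrable M (\<lambda>om. iexp (\<theta> * N om))"
  using integrable_scaleR_iexp[of N "\<lambda>_. 1" \<theta>] by simp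
 have sp: "space F = space M" using F by (simp add: subalgebra_def)
 have "0 = (\<integral>om. indicator (space F) om * (iexp (\<theta> * N om) - complex_of_real (exp (- (\<theta>^2 * V / 2)))) \<partial>M)"
  using N by (auto simp: gauss_indep_def)
 also have "\<dots> = (\<integral>om. iexp (\<theta> * N om) - complex_of_real (exp (- (\<theta>^2 * V / 2))) \<partial>M)"
  by (intro bo_cong) (auto simp: sp)
 also have "\<dots> = (\<integral>om. iexp (\<theta> * N om) \<partial>M) - complex_of_real (exp (- (\<theta>^2 * V / 2)))"
  using i by (subst bo_diff) (auto simp: prob_space)
 finally show ?thesis by simp
qed

text \<open>The Fourier transform of \<open>indicator A om - prob A\<close> against \<open>N\<close>
  vanishes, so \<open>fourier_zero_real\<close> gives the product rule for every Borel set
  \<open>S\<close>.\<close>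

lemma (in prob_space) gauss_indep_prod:
 assumes F: "subalgebra M F" and N: "gauss_indep M F N V" and A: "A \<in> sets F" and S[measurable]: "S \<in> sets borel"
 shows "prob (A \<inter> (N -` S \<inter> space M)) = prob A * prob (N -` S \<inter> space M)"
proof -
 have [measurable]: "N \<in> bm M" using N by (simp add: gauss_indep_def)
 have [measurable]: "A \<in> sets M" using F A by (auto simp: subalgebra_def)
 let ?Z = "\<lambda>om. indicator A om - prob A :: real"
 have iZ: "integrable M ?Z"
  by (intro bi_diff integrable_real_indicator) (auto simp: less_top[symmetric])
 have "(\<integral>om. ?Z om *\<^sub>R iexp (c * N om) \<partial>M) = 0" for c
 proof -
  let ?e = "complex_of_real (exp (- (c^2 * V / 2)))"
  have i: "integrable M (\<lambda>om. iexp (c * N om))"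
   using integrable_scaleR_iexp[of N "\<lambda>_. 1" c] by simp
  have i3: "integrable M (\<lambda>om. indicator A om * ?e)"
   by (rule bi_bound[OF integrable_const[of ?e]]) (auto simp: indicator_def)
  have i2: "integrable M (\<lambda>om. indicator A om * (iexp (c * N om) - ?e))"
   by (rule bi_bound[OF bi_diff[OF i integrable_const[of ?e]]])
    (auto simp: indicator_def)
  have "(\<integral>om. ?Z om *\<^sub>R iexp (c * N om) \<partial>M)
   = (\<integral>om. indicator A om * (iexp (c * N om) - ?e) + (indicator A om * ?e - prob A * iexp (c * N om)) \<partial>M)"
   by (intro bo_cong refl) (auto simp: indicator_def algebra_simps scaleR_conv_of_real)
  also have "\<dots> = (\<integral>om. indicator A om * (iexp (c * N om) - ?e) \<partial>M)
    + (\<integral>om. indicator A om * ?e - prob A * iexp (c * N om) \<partial>M)"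
   by (rule bo_add[OF i2
      bi_diff[OF i3 integrable_mult_right[OF i]]])
  also have "(\<integral>om. indicator A om * ?e - prob A * iexp (c * N om) \<partial>M) = (\<integral>om. indicator A om * ?e \<partial>M) - prob A * ?e"
   using gauss_indep_char[OF F N, of c]
   by (subst bo_diff[OF i3 integrable_mult_right[OF i]]) auto
  also have "(\<integral>om. indicator A om * ?e \<partial>M) = prob A * ?e"
  proof -
   have "(\<integral>om. indicator A om * ?e \<partial>M) = (\<integral>om. complex_of_real (indicator A om * exp (- (c^2 * V / 2))) \<partial>M)"
    by (intro bo_cong refl) (auto simp: indicator_def)
   then show ?thesis unfolding integral_complex_of_real by simp
  qed
  finally show ?thesis using N A by (simp add: gauss_indep_def)
 qed
 from fourier_zero_real[OF _ iZ this S]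
 have "(\<integral>om. ?Z om * indicator S (N om) \<partial>M) = 0" by simp
 also have "(\<integral>om. ?Z om * indicator S (N om) \<partial>M)
  = (\<integral>om. indicator (A \<inter> (N -` S \<inter> space M)) om - prob A * indicator (N -` S \<inter> space M) om \<partial>M)"
  by (intro bo_cong refl) (auto simp: indicator_def)
 also have "\<dots> = prob (A \<inter> (N -` S \<inter> space M)) - prob A * prob (N -` S \<inter> space M)"
  by (subst bo_diff)
   (auto intro!: integrable_real_indicator integrable_mult_right simp: less_top[symmetric])
 finally show ?thesis by simp
qed

text \<open>The product rule on intersection-stable generators makes \<open>X\<close> and
  \<open>N\<close> independent. All later moment computations use independence in this form.\<close>

lemma (in prob_space) gauss_indep_expectation:
 assumes F: "subalgebra M F" and N: "gauss_indep M F N V"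
  and X: "X \<in> bm F" "integrable M X"
 shows "integrable M (\<lambda>om. X om * N om ^ k)"
  and "(\<integral>om. X om * N om ^ k \<partial>M)
   = (\<integral>om. X om \<partial>M) * (sqrt V ^ k * (\<integral>x. x ^ k \<partial>std_normal_distribution))"
proof -
 have [measurable]: "N \<in> bm M" using N by (simp add: gauss_indep_def)
 have [measurable]: "X \<in> bm M" using X by simp
 have V: "0 \<le> V" using N by (simp add: gauss_indep_def)
 have sp: "space F = space M" using F by (simp add: subalgebra_def)
 have stab: "Int_stable {f -` A \<inter> space M |A. A \<in> sets borel}" for f :: "'a => real"
 proof (rule Int_stableI, clarify)
  fix A B :: "real set" assume "A \<in> sets borel" "B \<in> sets borel"
  then show "\<exists>C. (f -` A \<inter> space M) \<inter> (f -` B \<inter> space M) = f -` C \<inter> space M \<and> C \<in> sets borel"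
   by (intro exI[of _ "A \<inter> B"]) auto
 qed
 have ind: "indep_var borel X borel N"
  unfolding indep_var_eq
 proof (intro conjI)
  show "indep_set (sigma_sets (space M) {X -` A \<inter> space M |A. A \<in> sets borel})
    (sigma_sets (space M) {N -` A \<inter> space M |A. A \<in> sets borel})"
  proof (rule indep_set_sigma_sets)
   show "indep_set {X -` A \<inter> space M |A. A \<in> sets borel} {N -` A \<inter> space M |A. A \<in> sets borel}"
    unfolding indep_sets2_eq
   proof (intro conjI ballI)
    fix a b assume "a \<in> {X -` A \<inter> space M |A. A \<in> sets borel}" "b \<in> {N -` A \<inter> space M |A. A \<in> sets borel}"
    then obtain A B where ab: "a = X -` A \<inter> space M" "A \<in> sets borel" "b = N -` B \<inter> space M" "B \<in> sets borel" by auto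
    have "a \<in> sets F" using X(1) ab measurable_sets[of X F borel A] by (simp add: sp)
    then show "prob (a \<inter> b) = prob a * prob b"
     unfolding ab(3) by (rule gauss_indep_prod[OF F N _ ab(4)])
   qed auto
  qed (auto simp: stab)
 qed simp_all
 note mom = gaussian_char_moments[OF _ V gauss_indep_char[OF F N], of k]
 have ind2: "indep_var borel X borel (\<lambda>om. N om ^ k)"
  using indep_var_compose[OF ind, of "\<lambda>x. x" borel "\<lambda>x. x ^ k" borel] by (simp add: comp_def)
 have iN: "integrable M (\<lambda>om. N om ^ k)" using mom(1) by simp
 show "integrable M (\<lambda>om. X om * N om ^ k)"
  by (rule indep_var_integrable[OF ind2 X(2) iN])
 show "(\<integral>om. X om * N om ^ k \<partial>M)
   = (\<integral>om. X om \<partial>M) * (sqrt V ^ k * (\<integral>x. x ^ k \<partial>std_normal_distribution))"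
  using indep_var_lebesgue_integral[OF ind2 X(2) iN] mom(2) by simp
qed

section \<open>White noise\<close>

text \<open>The defining integrand is bounded by 2, so dominated convergence applies along an almost
  surely convergent subsequence. This serves for increments that start just after a given time and
  for Wiener integrals.\<close>

lemma (in prob_space) gauss_indep_limit:
 assumes F: "subalgebra M F" and N: "\<And>n. gauss_indep M F (X n) (v n)"
  and [measurable]: "Y \<in> bm M"
  and lim: "(\<lambda>n. nn2 M (\<lambda>om. X n om - Y om)) ----> 0" and v: "v ----> V"
 shows "gauss_indep M F Y V"
proof -
 have [measurable]: "X n \<in> bm M" for n using N[of n] by (simp add: gauss_indep_def)
 have V0: "0 \<le> V" using v by (rule LIMSEQ_le_const) (use N in \<open>auto simp: gauss_indep_def\<close>)
 obtain r where r: "strict_mono r" and ae: "AE om in M. (\<lambda>n. X (r n) om) ----> Y om"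
  by (rule L2_limit_AE_subseq[OF _ _ lim]) simp_all
 have vr: "(\<lambda>n. v (r n)) ----> V" using LIMSEQ_subseq_LIMSEQ[OF v r] by (simp add: comp_def)
 have "(\<integral>om. indicator A om * (iexp (\<theta> * Y om) - complex_of_real (exp (- (\<theta>^2 * V / 2)))) \<partial>M) = 0"
  if A: "A \<in> sets F" for A \<theta>
 proof -
  have [measurable]: "A \<in> sets M" using F A by (auto simp: subalgebra_def)
  have "(\<lambda>n. \<integral>om. indicator A om * (iexp (\<theta> * X (r n) om) - complex_of_real (exp (- (\<theta>^2 * v (r n) / 2)))) \<partial>M)
   ----> (\<integral>om. indicator A om * (iexp (\<theta> * Y om) - complex_of_real (exp (- (\<theta>^2 * V / 2)))) \<partial>M)"
  proof (rule integral_dominated_convergence[where w = "\<lambda>_. 2"])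
   show "AE om in M. (\<lambda>n. indicator A om * (iexp (\<theta> * X (r n) om) - complex_of_real (exp (- (\<theta>^2 * v (r n) / 2)))))
     ----> indicator A om * (iexp (\<theta> * Y om) - complex_of_real (exp (- (\<theta>^2 * V / 2))))"
    using ae by eventually_elim (intro tendsto_intros vr; simp)
   fix n
   have "cmod (iexp (\<theta> * X (r n) om) - complex_of_real (exp (- (\<theta>^2 * v (r n) / 2)))) \<le> 2" for om
   proof -
    have "0 \<le> v (r n)" using N by (simp add: gauss_indep_def)
    then have "cmod (complex_of_real (exp (- (\<theta>^2 * v (r n) / 2)))) \<le> 1" by simp
    moreover have "cmod (iexp (\<theta> * X (r n) om)) = 1" by (rule norm_exp_i_times)
    ultimately show ?thesis
     using norm_triangle_ineq4[of "iexp (\<theta> * X (r n) om)" "complex_of_real (exp (- (\<theta>^2 * v (r n) / 2)))"] by linarith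
   qed
   then show "AE om in M. cmod (indicator A om * (iexp (\<theta> * X (r n) om) - complex_of_real (exp (- (\<theta>^2 * v (r n) / 2))))) \<le> 2"
    by (auto simp: indicator_def)
  qed simp_all
  moreover have "(\<lambda>n. \<integral>om. indicator A om * (iexp (\<theta> * X (r n) om) - complex_of_real (exp (- (\<theta>^2 * v (r n) / 2)))) \<partial>M) = (\<lambda>_. 0)"
   using N A unfolding gauss_indep_def by (intro ext) blast
  ultimately show ?thesis by (simp only: tendsto_const_iff[OF sequentially_bot])
 qed
 then show ?thesis unfolding gauss_indep_def using V0 by auto
qed

locale wnoise = prob_space M for M :: "'a measure" +
 fixes W :: "real => real set => 'a => real"
 assumes white: "white_noise M W"
begin

abbreviation IX :: "(real \<times> real set) set" where "IX \<equiv> {0..} \<times> finite_borel"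
definition Wi :: "real \<times> real set => 'a => real" where "Wi i = W (fst i) (snd i)"
definition cv :: "real \<times> real set => real \<times> real set => real" where
 "cv i j = min (fst i) (fst j) * measure lborel (snd i \<inter> snd j)"
definition lc :: "(real \<times> real set => real) => (real \<times> real set) set => 'a => real" where
 "lc c U om = (\<Sum>j\<in>U. c j * Wi j om)"

lemma lc_gaussian: "finite U ==> U \<subseteq> IX ==> centered_gaussian M (lc c U)"
 using white unfolding white_noise_def centered_gaussian_family_def lc_def Wi_def
 by (simp add: case_prod_beta)

lemma Wi_gaussian: "i \<in> IX ==> centered_gaussian M (Wi i)"
 using lc_gaussian[of "{i}" "\<lambda>_. 1"] by (simp add: lc_def[abs_def])

lemma Wi_measurable: "i \<in> IX ==> Wi i \<in> bm M"
 using Wi_gaussian by (simp add: centered_gaussian_def)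

lemma Wi_prod_integrable:
 assumes "i \<in> IX" "j \<in> IX"
 shows "integrable M (\<lambda>om. Wi i om * Wi j om)"
proof (rule bi_bound)
 show "integrable M (\<lambda>om. (Wi i om)^2 + (Wi j om)^2)"
  using centered_gaussian_moment Wi_gaussian assms by (intro bi_add) auto
 have "\<bar>a * b\<bar> \<le> \<bar>a^2 + b^2\<bar>" for a b :: real
 proof -
  have "2 * \<bar>a\<bar> * \<bar>b\<bar> \<le> \<bar>a\<bar>^2 + \<bar>b\<bar>^2" by (rule sum_squares_bound)
  moreover have "0 \<le> \<bar>a\<bar> * \<bar>b\<bar>" by simp
  ultimately have "\<bar>a\<bar> * \<bar>b\<bar> \<le> a^2 + b^2" unfolding power2_abs by linarith
  then show ?thesis by (simp add: abs_mult)
 qed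
 then show "AE om in M. norm (Wi i om * Wi j om) \<le> norm ((Wi i om)^2 + (Wi j om)^2)" by simp
qed (use Wi_measurable assms in simp)

lemma Wi_cov: "i \<in> IX ==> j \<in> IX ==> (\<integral>om. Wi i om * Wi j om \<partial>M) = cv i j"
 using white unfolding white_noise_def Wi_def cv_def by (auto simp: mem_Times_iff)

lemma lc_prod:
 assumes "finite U" "U \<subseteq> IX" "finite V" "V \<subseteq> IX"
 shows "(\<integral>om. lc c U om * lc d V om \<partial>M) = (\<Sum>i\<in>U. \<Sum>j\<in>V. c i * d j * cv i j)"
proof -
 have "(\<integral>om. lc c U om * lc d V om \<partial>M) = (\<integral>om. (\<Sum>i\<in>U. \<Sum>j\<in>V. c i * d j * (Wi i om * Wi j om)) \<partial>M)"
  by (intro bo_cong refl) (simp add: lc_def sum_product mult_ac)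
 also have "\<dots> = (\<Sum>i\<in>U. \<Sum>j\<in>V. c i * d j * (\<integral>om. Wi i om * Wi j om \<partial>M))"
 proof -
  have i: "integrable M (\<lambda>om. c i * d j * (Wi i om * Wi j om))" if "i \<in> U" "j \<in> V" for i j
   using Wi_prod_integrable[of i j] that assms by (intro integrable_mult_right) blast
  have "(\<integral>om. (\<Sum>i\<in>U. \<Sum>j\<in>V. c i * d j * (Wi i om * Wi j om)) \<partial>M)
    = (\<Sum>i\<in>U. \<integral>om. (\<Sum>j\<in>V. c i * d j * (Wi i om * Wi j om)) \<partial>M)"
   by (intro bo_sum bi_sum i)
  also have "\<dots> = (\<Sum>i\<in>U. \<Sum>j\<in>V. \<integral>om. c i * d j * (Wi i om * Wi j om) \<partial>M)"
   by (intro sum.cong refl bo_sum i)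
  finally show ?thesis by simp
 qed
 also have "\<dots> = (\<Sum>i\<in>U. \<Sum>j\<in>V. c i * d j * cv i j)"
  using assms Wi_cov by (intro sum.cong refl) (auto simp: subset_iff)
 finally show ?thesis .
qed

text \<open>For jointly Gaussian variables orthogonality is independence. Without indicators the
  claim is the factorisation of a Gaussian characteristic function. An indicator of
  \<open>Wi k\<close> is inserted by \<open>fourier_zero\<close>, which needs the claim with an
  additional factor \<open>iexp (t * Wi k om)\<close>; this is why the factor with an arbitrary
  \<open>c\<close> is carried through the induction.\<close>

lemma lc_rect:
 fixes c d :: "real \<times> real set => real" and \<theta> :: real and U :: "(real \<times> real set) set"
 assumes U: "finite U" "U \<subseteq> IX" and J0: "J0 \<subseteq> U" and orth: "\<And>j. j \<in> J0 ==> (\<Sum>i\<in>U. d i * cv i j) = 0"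
  and S: "\<And>j. S j \<in> sets borel"
  and J: "finite J" "J \<subseteq> J0" and c: "\<And>j. j \<in> U - J0 ==> c j = 0"
 defines "e \<equiv> complex_of_real (exp (- (\<theta>^2 * (\<integral>om. (lc d U om)^2 \<partial>M) / 2)))"
 shows "(\<integral>om. (\<Prod>j\<in>J. indicator (S j) (Wi j om)) * iexp (lc c U om) * (iexp (\<theta> * lc d U om) - e) \<partial>M) = 0"
 using J c
proof (induction J arbitrary: c)
 case empty
 have lm: "lc c U \<in> bm M" for c using lc_gaussian[OF U] by (simp add: centered_gaussian_def)
 have i: "integrable M (\<lambda>om. iexp (lc c U om))" for c
  using integrable_scaleR_iexp[OF lm, of "\<lambda>_. 1" 1] by simp
 have E: "(\<integral>om. iexp (lc c U om) \<partial>M) = complex_of_real (exp (- ((\<integral>om. (lc c U om)^2 \<partial>M) / 2)))" for c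
  using centered_gaussian_char[OF lc_gaussian[OF U], of 1 c] by simp
 have sum: "lc c U om + \<theta> * lc d U om = lc (\<lambda>j. c j + \<theta> * d j) U om" for om
  by (simp add: lc_def sum_distrib_left sum.distrib[symmetric] algebra_simps)
 have sq: "(\<integral>om. (lc c U om)^2 \<partial>M) = (\<Sum>i\<in>U. \<Sum>j\<in>U. c i * c j * cv i j)" for c
  using lc_prod[OF U U] by (simp add: power2_eq_square)
 have cvc: "cv i j = cv j i" for i j by (simp add: cv_def Int_commute min.commute)
 \<comment> \<open>For \<open>j\<close> in \<open>J0\<close> the inner sum vanishes by
   \<open>orth\<close>, for all other \<open>j\<close> the coefficient \<open>c j\<close>
   does.\<close>
 have o1: "(\<Sum>i\<in>U. \<Sum>j\<in>U. c j * d i * cv i j) = 0"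
 proof -
  have "(\<Sum>i\<in>U. \<Sum>j\<in>U. c j * d i * cv i j) = (\<Sum>j\<in>U. c j * (\<Sum>i\<in>U. d i * cv i j))"
   by (subst sum.swap) (simp add: sum_distrib_left mult_ac)
  also have "\<dots> = 0"
  proof (intro sum.neutral ballI)
   fix j assume "j \<in> U"
   then show "c j * (\<Sum>i\<in>U. d i * cv i j) = 0" using orth[of j] empty(2)[of j] by (cases "j \<in> J0") auto
  qed
  finally show ?thesis .
 qed
 have o2: "(\<Sum>i\<in>U. \<Sum>j\<in>U. c i * d j * cv i j) = 0"
  using o1 by (subst sum.swap) (simp add: cvc)
 have "(\<integral>om. (lc (\<lambda>j. c j + \<theta> * d j) U om)^2 \<partial>M)
   = (\<integral>om. (lc c U om)^2 \<partial>M) + \<theta> * (\<Sum>i\<in>U. \<Sum>j\<in>U. c i * d j * cv i j)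
    + \<theta> * (\<Sum>i\<in>U. \<Sum>j\<in>U. c j * d i * cv i j) + \<theta>^2 * (\<integral>om. (lc d U om)^2 \<partial>M)"
 proof -
  have t: "(c i + \<theta> * d i) * (c j + \<theta> * d j) * cv i j = c i * c j * cv i j + \<theta> * (c i * d j * cv i j)
    + \<theta> * (c j * d i * cv i j) + \<theta>^2 * (d i * d j * cv i j)" for i j
   by (simp add: algebra_simps power2_eq_square)
  show ?thesis unfolding sq t by (simp only: sum.distrib sum_distrib_left)
 qed
 then have var: "(\<integral>om. (lc (\<lambda>j. c j + \<theta> * d j) U om)^2 \<partial>M) = (\<integral>om. (lc c U om)^2 \<partial>M) + \<theta>^2 * (\<integral>om. (lc d U om)^2 \<partial>M)"
  using o1 o2 by simp
 have ee: "iexp (lc (\<lambda>j. c j + \<theta> * d j) U om) = iexp (lc c U om) * iexp (\<theta> * lc d U om)" for om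
  unfolding sum[symmetric] of_real_add distrib_left exp_add ..
 have "(\<integral>om. iexp (lc c U om) * (iexp (\<theta> * lc d U om) - e) \<partial>M)
   = (\<integral>om. iexp (lc (\<lambda>j. c j + \<theta> * d j) U om) - iexp (lc c U om) * e \<partial>M)"
  unfolding ee right_diff_distrib ..
 also have "\<dots> = (\<integral>om. iexp (lc (\<lambda>j. c j + \<theta> * d j) U om) \<partial>M) - (\<integral>om. iexp (lc c U om) \<partial>M) * e"
  by (subst bo_diff[OF i integrable_mult_left[OF i]]) simp
 also have "\<dots> = 0"
  unfolding E var e_def of_real_mult[symmetric] exp_add[symmetric] by (simp add: add_divide_distrib)
 finally show ?case by simp
next
 case (insert k J)
 have k: "k \<in> J0" "k \<in> U" "J \<subseteq> J0" using insert.prems J0 by auto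
 have lm[measurable]: "lc c U \<in> bm M" for c using lc_gaussian[OF U] by (simp add: centered_gaussian_def)
 have wm[measurable]: "j \<in> J0 ==> Wi j \<in> bm M" for j using Wi_measurable J0 U by auto
 note S[measurable]
 let ?Z = "\<lambda>om. (\<Prod>j\<in>J. indicator (S j) (Wi j om)) * iexp (lc c U om) * (iexp (\<theta> * lc d U om) - e)"
 have [measurable]: "(\<lambda>om. \<Prod>j\<in>J. indicator (S j) (Wi j om) :: complex) \<in> bm M"
  using k wm by (intro borel_measurable_prod) auto
 have Zm: "?Z \<in> bm M" by measurable
 have ne: "cmod e \<le> 1" unfolding e_def by simp
 have "cmod (\<Prod>j\<in>J. indicator (S j) (Wi j om)) \<le> 1" for om
  unfolding prod_norm[symmetric] by (rule prod_le_1) (auto simp: indicator_def)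
 moreover have "cmod (iexp (\<theta> * lc d U om) - e) \<le> 2" for om
  using norm_triangle_ineq4[of "iexp (\<theta> * lc d U om)" e] ne norm_exp_i_times[of "\<theta> * lc d U om"] by linarith
 ultimately have "cmod (\<Prod>j\<in>J. indicator (S j) (Wi j om)) * 1 * cmod (iexp (\<theta> * lc d U om) - e) \<le> 1 * 1 * 2" for om
  by (intro mult_mono) auto
 then have Zb: "cmod (?Z om) \<le> 2" for om
  unfolding norm_mult norm_exp_i_times by simp
 have iZ: "integrable M ?Z" by (rule integrable_const_bound[OF _ Zm, of 2]) (use Zb in simp)
 have "(\<integral>om. ?Z om * iexp (t * Wi k om) \<partial>M) = 0" for t
 proof -
  \<comment> \<open>Raising the coefficient of \<open>Wi k\<close> by \<open>t\<close> produces
    exactly the Fourier factor.\<close>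
  let ?c = "c(k := c k + t)"
  have l: "lc ?c U om = lc c U om + t * Wi k om" for om
  proof -
   have "lc ?c U om = (\<Sum>j\<in>U. c j * Wi j om + (if j = k then t * Wi k om else 0))"
    unfolding lc_def by (intro sum.cong refl) (auto simp: distrib_right)
   then show ?thesis using k U by (simp add: sum.distrib lc_def)
  qed
  have "(\<integral>om. (\<Prod>j\<in>J. indicator (S j) (Wi j om)) * iexp (lc ?c U om) * (iexp (\<theta> * lc d U om) - e) \<partial>M) = 0"
   by (rule insert.IH) (use k insert.prems in auto)
  moreover have "iexp (lc ?c U om) = iexp (lc c U om) * iexp (t * Wi k om)" for om
   unfolding l by (simp add: distrib_left exp_add)
  ultimately show ?thesis by (simp only: mult_ac)
 qed
 from fourier_zero[OF wm[OF k(1)] iZ this S[of k]]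
 moreover have "(\<Prod>j\<in>insert k J. indicator (S j) (Wi j om) :: complex)
   = indicator (S k) (Wi k om) * (\<Prod>j\<in>J. indicator (S j) (Wi j om))" for om
  using insert.hyps by simp
 ultimately show ?case by (simp only: mult_ac)
qed

end

section \<open>Linear combinations given by lists, and sigma-algebras generated by index
  sets\<close>

context wnoise
begin

text \<open>Lists allow an index to occur repeatedly, as happens when endpoints such as
  \<open>min b t\<close> and \<open>a\<close> coincide; \<open>cf\<close> collects the
  coefficients.\<close>

definition ll :: "(real \<times> real \<times> real set) list => 'a => real" where
 "ll xs om = (\<Sum>(c, i)\<leftarrow>xs. c * Wi i om)"

lemma ll_simps [simp]: "ll [] om = 0" "ll ((c, i) # xs) om = c * Wi i om + ll xs om"
 by (simp_all add: ll_def)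

definition cf :: "(real \<times> real \<times> real set) list => real \<times> real set => real" where
 "cf xs j = (\<Sum>(c, i)\<leftarrow>xs. if i = j then c else 0)"

lemma cf_sum:
 assumes "finite U" "snd ` set xs \<subseteq> U"
 shows "(\<Sum>j\<in>U. cf xs j * (\<phi> j :: real)) = (\<Sum>(c, i)\<leftarrow>xs. c * \<phi> i)"
 using assms(2)
proof (induction xs)
 case Nil
 then show ?case by (simp add: cf_def)
next
 case (Cons x xs)
 obtain c i where x: "x = (c, i)" by (cases x)
 have i: "i \<in> U" using Cons.prems x by auto
 have "(\<Sum>j\<in>U. cf (x # xs) j * \<phi> j) = (\<Sum>j\<in>U. (if i = j then c * \<phi> j else 0) + cf xs j * \<phi> j)"
  by (intro sum.cong refl) (simp add: cf_def x distrib_right)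
 also have "\<dots> = c * \<phi> i + (\<Sum>j\<in>U. cf xs j * \<phi> j)"
  using assms(1) i by (simp add: sum.distrib sum.delta)
 finally show ?case using Cons by (simp add: x)
qed

lemma ll_lc: "finite U ==> snd ` set xs \<subseteq> U ==> ll xs = lc (cf xs) U"
 by (rule ext) (simp add: ll_def lc_def cf_sum)

lemma ll_gaussian: "snd ` set xs \<subseteq> IX ==> centered_gaussian M (ll xs)"
 by (subst ll_lc[of "snd ` set xs"]) (auto intro!: lc_gaussian)

lemma ll_measurable: "snd ` set xs \<subseteq> IX ==> ll xs \<in> bm M"
 using ll_gaussian by (simp add: centered_gaussian_def)

lemma ll_prod:
 assumes "snd ` set xs \<subseteq> IX" "snd ` set ys \<subseteq> IX"
 shows "(\<integral>om. ll xs om * ll ys om \<partial>M) = (\<Sum>(c, i)\<leftarrow>xs. c * (\<Sum>(d, j)\<leftarrow>ys. d * cv i j))"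
proof -
 have "(\<integral>om. ll xs om * ll ys om \<partial>M) = (\<integral>om. lc (cf xs) (snd ` set xs) om * lc (cf ys) (snd ` set ys) om \<partial>M)"
  by (simp add: ll_lc[of "snd ` set xs" xs] ll_lc[of "snd ` set ys" ys])
 also have "\<dots> = (\<Sum>i\<in>snd ` set xs. \<Sum>j\<in>snd ` set ys. cf xs i * cf ys j * cv i j)"
  by (rule lc_prod) (use assms in auto)
 also have "\<dots> = (\<Sum>i\<in>snd ` set xs. cf xs i * (\<Sum>j\<in>snd ` set ys. cf ys j * cv i j))"
  by (simp add: sum_distrib_left mult_ac)
 finally show ?thesis by (simp add: cf_sum)
qed

definition gens :: "(real \<times> real set) set => 'a set set" where
 "gens J = {Wi j -` S \<inter> space M | j S. j \<in> J \<and> S \<in> sets borel} \<union> null_sets M"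

text \<open>Besides \<open>upto_time t\<close>, the fourth moment bound uses index sets that also
  contain later noise on regions disjoint from a given set.\<close>

definition sub :: "(real \<times> real set) set => 'a measure" where
 "sub J = sigma (space M) (gens J)"

lemma gens_sets: "J \<subseteq> IX ==> gens J \<subseteq> sets M"
proof
 fix A assume J: "J \<subseteq> IX" and "A \<in> gens J"
 then consider "A \<in> null_sets M" | j S where "j \<in> J" "S \<in> sets borel" "A = Wi j -` S \<inter> space M"
  unfolding gens_def by blast
 then show "A \<in> sets M"
 proof cases
  case (2 j S)
  then show ?thesis using measurable_sets[OF Wi_measurable, of j S] J by blast
 qed auto
qed

lemma sub_sets: "J \<subseteq> IX ==> sets (sub J) = sigma_sets (space M) (gens J)"
 and sub_space: "J \<subseteq> IX ==> space (sub J) = space M"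
 using gens_sets[of J] sets.space_closed[of M] unfolding sub_def
 by (auto intro!: sets_measure_of space_measure_of)

lemma sub_subalgebra: "J \<subseteq> IX ==> subalgebra M (sub J)"
 unfolding subalgebra_def using sets.sigma_sets_subset[OF gens_sets] by (simp add: sub_sets sub_space)

lemma sub_mono: "J \<subseteq> J' ==> J' \<subseteq> IX ==> sets (sub J) \<subseteq> sets (sub J')"
 by (simp add: sub_sets) (intro sigma_sets_mono', auto simp: gens_def)

lemma Wi_sub:
 assumes "J \<subseteq> IX" "j \<in> J"
 shows "Wi j \<in> bm (sub J)"
proof (rule measurableI)
 fix S :: "real set" assume "S \<in> sets borel"
 then have "Wi j -` S \<inter> space M \<in> gens J" using assms(2) unfolding gens_def by blast
 then show "Wi j -` S \<inter> space (sub J) \<in> sets (sub J)" using assms by (simp add: sub_sets sub_space)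
qed simp

text \<open>Events described by finitely many \<open>Wi j\<close>, together with the null sets, form
  an intersection-stable generator. On them the integral vanishes by \<open>lc_rect\<close>, and
  this is preserved by complements and disjoint unions.\<close>

lemma gauss_list:
 assumes xs: "snd ` set xs \<subseteq> IX" and J: "J \<subseteq> IX" and orth: "\<And>j. j \<in> J ==> (\<Sum>(c, i)\<leftarrow>xs. c * cv i j) = 0"
 shows "gauss_indep M (sub J) (ll xs) (\<integral>om. (ll xs om)^2 \<partial>M)"
proof -
 note ll_measurable[OF xs, measurable]
 let ?e = "\<lambda>\<theta>. complex_of_real (exp (- (\<theta>^2 * (\<integral>om. (ll xs om)^2 \<partial>M) / 2)))"
 let ?Y = "\<lambda>\<theta> om. iexp (\<theta> * ll xs om) - ?e \<theta>"
 define G where "G = {{om \<in> space M. \<forall>j\<in>K. Wi j om \<in> S j} | K S. finite K \<and> K \<subseteq> J \<and> (\<forall>j. S j \<in> sets borel)} \<union> null_sets M"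
 have GM: "G \<subseteq> sets M"
 proof -
  have "{om \<in> space M. \<forall>j\<in>K. Wi j om \<in> S j} \<in> sets M"
   if "finite K" "K \<subseteq> J" "\<forall>j. S j \<in> sets borel" for K S
  proof (rule sets.sets_Collect_finite_All[OF _ that(1)])
   fix j assume "j \<in> K"
   then have [measurable]: "Wi j \<in> bm M" using that J Wi_measurable by blast
   have [measurable]: "S j \<in> sets borel" using that by blast
   show "{om \<in> space M. Wi j om \<in> S j} \<in> sets M" by measurable
  qed
  then show ?thesis by (auto simp: G_def)
 qed
 have st: "Int_stable G"
 proof (rule Int_stableI)
  fix a b assume ab: "a \<in> G" "b \<in> G"
  show "a \<inter> b \<in> G"
  proof (cases "a \<in> null_sets M \<or> b \<in> null_sets M")
   case True
   then have "a \<inter> b \<in> null_sets M" using ab GM by (meson null_set_Int1 null_set_Int2 subsetD)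
   then show ?thesis by (simp add: G_def)
  next
   case False
   then obtain K S K' S' where a: "a = {om \<in> space M. \<forall>j\<in>K. Wi j om \<in> S j}" "finite K" "K \<subseteq> J" "\<forall>j. S j \<in> sets borel"
    and b: "b = {om \<in> space M. \<forall>j\<in>K'. Wi j om \<in> S' j}" "finite K'" "K' \<subseteq> J" "\<forall>j. S' j \<in> sets borel"
    using ab by (auto simp: G_def)
   have "a \<inter> b = {om \<in> space M. \<forall>j\<in>K \<union> K'. Wi j om \<in> (if j \<in> K then S j else UNIV) \<inter> (if j \<in> K' then S' j else UNIV)}"
    unfolding a(1) b(1) by auto
   then show ?thesis unfolding G_def using a b
    by (intro UnI1 CollectI exI[of _ "K \<union> K'"] exI[of _ "\<lambda>j. (if j \<in> K then S j else UNIV) \<inter> (if j \<in> K' then S' j else UNIV)"]) auto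
  qed
 qed
 have pw: "G \<subseteq> Pow (space M)" using GM sets.space_closed by auto
 have sG: "gens J \<subseteq> G"
 proof
  fix A assume "A \<in> gens J"
  then consider "A \<in> null_sets M" | j S where "j \<in> J" "S \<in> sets borel" "A = Wi j -` S \<inter> space M"
   by (auto simp: gens_def)
  then show "A \<in> G"
  proof cases
   case (2 j S)
   then have "A = {om \<in> space M. \<forall>i\<in>{j}. Wi i om \<in> (\<lambda>_. S) i}" by auto
   then have "A \<in> {{om \<in> space M. \<forall>j\<in>K. Wi j om \<in> S j} | K S. finite K \<and> K \<subseteq> J \<and> (\<forall>j. S j \<in> sets borel)}"
    using 2 by (intro CollectI exI[of _ "{j}"] exI[of _ "\<lambda>_. S"]) simp
   then show ?thesis unfolding G_def by (rule UnI1)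
  qed (simp add: G_def)
 qed
 have Yb: "cmod (?Y \<theta> om) \<le> 2" for \<theta> om
 proof -
  have "cmod (?e \<theta>) \<le> 1" by simp
  then show ?thesis using norm_triangle_ineq4[of "iexp (\<theta> * ll xs om)" "?e \<theta>"] norm_exp_i_times[of "\<theta> * ll xs om"] by linarith
 qed
 have Yi: "integrable M (?Y \<theta>)" for \<theta>
  by (rule integrable_const_bound[of _ 2]) (use Yb in auto)
 have "(LINT om:A|M. ?Y \<theta> om) = 0" if A: "A \<in> sets (sub J)" for A \<theta>
 proof -
  have "A \<in> sigma_sets (space M) G"
   using A sigma_sets_mono'[OF sG] by (auto simp: sub_sets[OF J])
  then show ?thesis
  proof (induction A rule: sigma_sets_induct_disjoint[OF st pw, consumes 1, case_names basic empty compl union])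
   case (basic A)
   show ?case
   proof (cases "A \<in> null_sets M")
    case True
    from AE_not_in[OF this] show ?thesis
     unfolding set_lebesgue_integral_def by (intro integral_eq_zero_AE, eventually_elim) simp
   next
    case False
    with basic obtain K S where A: "A = {om \<in> space M. \<forall>j\<in>K. Wi j om \<in> S j}" "finite K" "K \<subseteq> J" "\<forall>j. S j \<in> sets borel"
     by (auto simp: G_def)
    let ?U = "snd ` set xs \<union> K"
    have U: "finite ?U" "?U \<subseteq> IX" using A xs J by auto
    have eq: "ll xs = lc (cf xs) ?U" using U by (intro ll_lc) auto
    have "(\<integral>om. (\<Prod>j\<in>K. indicator (S j) (Wi j om)) * iexp (lc (\<lambda>_. 0) ?U om) * (iexp (\<theta> * lc (cf xs) ?U om)
     - complex_of_real (exp (- (\<theta>^2 * (\<integral>om. (lc (cf xs) ?U om)^2 \<partial>M) / 2)))) \<partial>M) = 0"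
    proof (rule lc_rect[OF U, of K])
     fix j assume "j \<in> K"
     then show "(\<Sum>i\<in>?U. cf xs i * cv i j) = 0"
      using orth[of j] A U(1) by (subst cf_sum) auto
    qed (use A in auto)
    moreover have "(\<Prod>j\<in>K. indicator (S j) (Wi j om) :: complex) = indicator A om" if "om \<in> space M" for om
    proof (cases "om \<in> A")
     case True
     then show ?thesis using A by (auto simp: indicator_def intro!: prod.neutral)
    next
     case False
     then show ?thesis using A that by (auto simp: indicator_def)
    qed
    ultimately have "(\<integral>om. indicator A om * ?Y \<theta> om \<partial>M) = 0"
     unfolding eq by (simp add: lc_def[of "\<lambda>_. 0"] cong: bo_cong)
    moreover have "indicator A om *\<^sub>R ?Y \<theta> om = indicator A om * ?Y \<theta> om" for om
     by (auto simp: indicator_def)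
    ultimately show ?thesis by (simp only: set_lebesgue_integral_def)
   qed
  next
   case empty
   show ?case by (simp add: set_lebesgue_integral_def)
  next
   case (compl A)
   have AM: "A \<in> sets M" using compl(1) GM sets.sigma_sets_subset by auto
   \<comment> \<open>On the whole space this is the unconditional characteristic function of a
     centred Gaussian variable.\<close>
   have "(LINT om:space M|M. ?Y \<theta> om) = 0"
   proof -
    have c: "(\<integral>om. iexp (\<theta> * ll xs om) \<partial>M) = ?e \<theta>"
     by (rule centered_gaussian_char[OF ll_gaussian[OF xs]])
    have i: "integrable M (\<lambda>om. iexp (\<theta> * ll xs om))"
     using integrable_scaleR_iexp[OF ll_measurable[OF xs], of "\<lambda>_. 1" \<theta>] by simp
    have "(\<integral>om. ?Y \<theta> om \<partial>M) = 0"
     by (subst bo_diff[OF i integrable_const]) (simp add: c[simplified] prob_space)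
    then show ?thesis
     unfolding set_lebesgue_integral_def
     by (subst bo_cong[OF refl, of _ _ "?Y \<theta>"]) auto
   qed
   moreover have "space M = A \<union> (space M - A)" using AM sets.sets_into_space by auto
   moreover have "(LINT om:A \<union> (space M - A)|M. ?Y \<theta> om) = (LINT om:A|M. ?Y \<theta> om) + (LINT om:space M - A|M. ?Y \<theta> om)"
    using AM Yi by (intro set_integral_Un) (auto simp: set_integrable_def intro!: integrable_mult_indicator)
   ultimately show ?case using compl by simp
  next
   case (union A)
   have AM: "A i \<in> sets M" for i using union(2) sets.sigma_sets_subset[OF GM] by (meson rangeI subsetD)
   have "(LINT om:(\<Union>i. A i)|M. ?Y \<theta> om) = (\<Sum>i. (LINT om:A i|M. ?Y \<theta> om))"
    using AM Yi union(1) by (intro lebesgue_integral_countable_add)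
     (auto simp: set_integrable_def disjoint_family_on_def intro!: integrable_mult_indicator)
   then show ?case using union by simp
  qed
 qed
 moreover have "(LINT om:A|M. ?Y \<theta> om) = (\<integral>om. indicator A om * ?Y \<theta> om \<partial>M)" for A \<theta>
  unfolding set_lebesgue_integral_def by (intro bo_cong refl) (auto simp: indicator_def)
 ultimately show ?thesis unfolding gauss_indep_def by simp
qed

abbreviation upto_time :: "real => (real \<times> real set) set" where "upto_time t \<equiv> {0..t} \<times> finite_borel"

lemma upto_IX: "upto_time t \<subseteq> IX" by auto

lemma noise_sets_sub: "noise_sets M W t = sets (sub (upto_time t))"
proof -
 have "{W s B -` S \<inter> space M | s B S. 0 \<le> s \<and> s \<le> t \<and> B \<in> finite_borel \<and> S \<in> sets borel}
   = {Wi j -` S \<inter> space M | j S. j \<in> upto_time t \<and> S \<in> sets borel}"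
  by (simp add: split_paired_Ex Wi_def[abs_def] conj_assoc)
 then show ?thesis by (simp only: sub_sets[OF upto_IX] noise_sets_def gens_def)
qed

lemma noise_sets_sigma: "sigma_algebra (space M) (noise_sets M W t)"
 unfolding noise_sets_sub using sets.sigma_algebra_axioms[of "sub (upto_time t)"]
 by (simp add: sub_space[OF upto_IX])

lemma noise_sets_pow: "noise_sets M W t \<subseteq> Pow (space M)"
 unfolding noise_sets_sub using sets.space_closed[of "sub (upto_time t)"]
 by (simp only: sub_space[OF upto_IX])

lemma noise_sets_INF_pow: "(\<Inter>s\<in>{t<..}. noise_sets M W s) \<subseteq> Pow (space M)"
proof -
 have "(\<Inter>s\<in>{t<..}. noise_sets M W s) \<subseteq> noise_sets M W (t + 1)" by (rule INF_lower) simp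
 then show ?thesis using noise_sets_pow by (rule order_trans)
qed

text \<open>An intersection of sigma-algebras is a sigma-algebra, so generating adds nothing to
  it.\<close>

lemma filtration_sets: "sets (noise_filtration M W t) = (\<Inter>s\<in>{t<..}. noise_sets M W s)"
proof -
 let ?I = "\<Inter>s\<in>{t<..}. noise_sets M W s"
 have "sigma_sets (space M) ?I \<subseteq> ?I"
 proof (rule INF_greatest)
  fix s assume "s \<in> {t<..}"
  then have "?I \<subseteq> noise_sets M W s" by (rule INF_lower)
  then show "sigma_sets (space M) ?I \<subseteq> noise_sets M W s"
   by (rule sigma_algebra.sigma_sets_subset[OF noise_sets_sigma])
 qed
 then have "sigma_sets (space M) ?I = ?I" by (intro antisym sigma_sets_superset_generator)
 then show ?thesis
  unfolding noise_filtration_def using noise_sets_INF_pow by (simp only: sets_measure_of)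
qed

lemma filtration_space: "space (noise_filtration M W t) = space M"
 unfolding noise_filtration_def using noise_sets_INF_pow by (rule space_measure_of)

lemma noise_sets_mono: "s \<le> t ==> noise_sets M W s \<subseteq> noise_sets M W t"
 unfolding noise_sets_sub by (rule sub_mono) auto

lemma filtration_subset: "s < t ==> sets (noise_filtration M W s) \<subseteq> noise_sets M W t"
 unfolding filtration_sets by auto

lemma noise_sets_filtration: "noise_sets M W t \<subseteq> sets (noise_filtration M W t)"
 unfolding filtration_sets using noise_sets_mono[OF less_imp_le] by auto

lemma filtration_mono: "s \<le> t ==> sets (noise_filtration M W s) \<subseteq> sets (noise_filtration M W t)"
 unfolding filtration_sets by auto

lemma filtration_subalgebra: "subalgebra M (noise_filtration M W t)"
 unfolding subalgebra_def filtration_space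
 using filtration_subset[of t "t + 1"] sub_subalgebra[OF upto_IX, of "t + 1"]
 by (auto simp: noise_sets_sub subalgebra_def)

lemma measurable_subset_sets:
 "f \<in> bm N ==> space N = space N' ==> sets N \<subseteq> sets N' ==> f \<in> bm N'"
 by (rule measurable_from_subalg) (simp add: subalgebra_def)

lemma filtration_measurable: "f \<in> bm (noise_filtration M W t) ==> f \<in> bm M"
 by (rule measurable_from_subalg[OF filtration_subalgebra])

lemma Wi_filtration:
 assumes "0 \<le> s" "s \<le> t" "B \<in> finite_borel"
 shows "W s B \<in> bm (noise_filtration M W t)"
proof -
 have "Wi (s, B) \<in> bm (sub (upto_time t))" using assms by (intro Wi_sub) auto
 then have "Wi (s, B) \<in> bm (noise_filtration M W t)"
  by (rule measurable_subset_sets)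
   (use noise_sets_filtration in \<open>auto simp: sub_space[OF upto_IX] filtration_space noise_sets_sub\<close>)
 then show ?thesis by (simp add: Wi_def[abs_def])
qed

end

section \<open>Increments of the noise\<close>

context wnoise
begin

lemma gauss_filtration:
 assumes a: "0 \<le> a" "a \<le> b1" "a \<le> b2" and B: "B1 \<in> finite_borel" "B2 \<in> finite_borel"
 shows "\<exists>V. gauss_indep M (noise_filtration M W a)
  (\<lambda>om. c1 * (W b1 B1 om - W a B1 om) + c2 * (W b2 B2 om - W a B2 om)) V"
proof -
 define s where "s n = a + inverse (real (Suc n))" for n
 have s: "a < s n" for n by (simp add: s_def)
 have sl: "s ----> a"
  unfolding s_def[abs_def] using tendsto_add[OF tendsto_const LIMSEQ_inverse_real_of_nat, of a] by simp
 \<comment> \<open>The starting point \<open>min b1 t\<close> gives a zero increment once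
   \<open>t\<close> has passed the end \<open>b1\<close>. The list \<open>d t\<close> represents
   \<open>x t - x a\<close>.\<close>
 define x where "x t = [(c1, (b1, B1)), (- c1, (min b1 t, B1)), (c2, (b2, B2)), (- c2, (min b2 t, B2))]" for t
 define d where "d t = [(- c1, (min b1 t, B1)), (c1, (a, B1)), (- c2, (min b2 t, B2)), (c2, (a, B2))]" for t
 have sn: "0 \<le> s n" for n using s[of n] a by simp
 have x: "0 \<le> t ==> snd ` set (x t) \<subseteq> IX" and d: "0 \<le> t ==> snd ` set (d t) \<subseteq> IX" for t
  using a B by (auto simp: x_def d_def)
 \<comment> \<open>By \<open>ll_prod\<close> the second moments are explicit expressions in minima
   of times, hence continuous in \<open>t\<close>.\<close>
 have sq: "(\<lambda>n. \<integral>om. ll (e (s n)) om * ll (e (s n)) om \<partial>M) ----> (\<integral>om. ll (e a) om * ll (e a) om \<partial>M)"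
  if e: "\<And>t. 0 \<le> t ==> snd ` set (e t) \<subseteq> IX" and "e = x \<or> e = d" for e
 proof -
  have "(\<lambda>n. \<Sum>(c, i)\<leftarrow>e (s n). c * (\<Sum>(d, j)\<leftarrow>e (s n). d * cv i j))
    ----> (\<Sum>(c, i)\<leftarrow>e a. c * (\<Sum>(d, j)\<leftarrow>e a. d * cv i j))"
   using that(2) unfolding x_def[abs_def] d_def[abs_def] cv_def
   by (elim disjE; simp only: list.map sum_list.Cons sum_list.Nil prod.case fst_conv snd_conv)
    (intro tendsto_intros sl)+
  then show ?thesis using e a sn by (simp add: ll_prod)
 qed
 have gi: "gauss_indep M (noise_filtration M W a) (ll (x (s n))) (\<integral>om. ll (x (s n)) om * ll (x (s n)) om \<partial>M)" for n
 proof -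
  have "gauss_indep M (sub (upto_time (s n))) (ll (x (s n))) (\<integral>om. (ll (x (s n)) om)^2 \<partial>M)"
  proof (rule gauss_list[OF x[OF sn] upto_IX])
   fix j assume "j \<in> upto_time (s n)"
   then have "fst j \<le> s n" by auto
   then have "min (min b1 (s n)) (fst j) = min b1 (fst j)" "min (min b2 (s n)) (fst j) = min b2 (fst j)" by linarith+
   then show "(\<Sum>(c, i)\<leftarrow>x (s n). c * cv i j) = 0" by (simp add: cv_def x_def)
  qed
  then show ?thesis
   using filtration_subset[OF s[of n]] unfolding gauss_indep_def noise_sets_sub power2_eq_square by blast
 qed
 have lim: "(\<lambda>n. nn2 M (\<lambda>om. ll (x (s n)) om - ll (x a) om)) ----> 0"
 proof -
  have "nn2 M (\<lambda>om. ll (x (s n)) om - ll (x a) om) = ennreal (\<integral>om. ll (d (s n)) om * ll (d (s n)) om \<partial>M)" for n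
  proof -
   have "ll (x (s n)) om - ll (x a) om = ll (d (s n)) om" for om using a by (simp add: x_def d_def min_absorb2)
   moreover have "integrable M (\<lambda>om. (ll (d (s n)) om)^2)"
    by (rule centered_gaussian_moment[OF ll_gaussian[OF d[OF sn]]])
   ultimately show ?thesis
    by (simp add: power2_eq_square nn_integral_eq_integral)
  qed
  moreover have "ll (d a) om = 0" for om using a by (simp add: d_def min_absorb2)
  ultimately show ?thesis using tendsto_ennrealI[OF sq[of d, OF d]] by simp
 qed
 have "gauss_indep M (noise_filtration M W a) (ll (x a)) (\<integral>om. ll (x a) om * ll (x a) om \<partial>M)"
  by (rule gauss_indep_limit[OF filtration_subalgebra gi ll_measurable[OF x[OF a(1)]] lim sq[of x, OF x]]) simp_all
 moreover have "ll (x a) = (\<lambda>om. c1 * (W b1 B1 om - W a B1 om) + c2 * (W b2 B2 om - W a B2 om))"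
  using a by (intro ext) (simp add: Wi_def x_def min_absorb2 algebra_simps)
 ultimately show ?thesis by auto
qed

lemma inc_gaussian:
 assumes "0 \<le> a" "0 \<le> b" "B \<in> finite_borel"
 shows "centered_gaussian M (\<lambda>om. W b B om - W a B om)"
proof -
 have "ll [(1, (b, B)), (- 1, (a, B))] = (\<lambda>om. W b B om - W a B om)" by (rule ext) (simp add: Wi_def)
 then show ?thesis using ll_gaussian[of "[(1, (b, B)), (- 1, (a, B))]"] assms by auto
qed

lemma inc_prod:
 assumes "0 \<le> a" "a \<le> b1" "a \<le> b2" "B1 \<in> finite_borel" "B2 \<in> finite_borel"
 shows "integrable M (\<lambda>om. (W b1 B1 om - W a B1 om) * (W b2 B2 om - W a B2 om))"
  and "(\<integral>om. (W b1 B1 om - W a B1 om) * (W b2 B2 om - W a B2 om) \<partial>M) = (min b1 b2 - a) * measure lborel (B1 \<inter> B2)"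
proof -
 let ?x = "[(1, (b1, B1)), (- 1, (a, B1))]" and ?y = "[(1, (b2, B2)), (- 1, (a, B2))]"
 have e: "(W b1 B1 om - W a B1 om) * (W b2 B2 om - W a B2 om) = ll ?x om * ll ?y om" for om
  by (simp add: Wi_def)
 have i: "snd ` set ?x \<subseteq> IX" "snd ` set ?y \<subseteq> IX" using assms by auto
 show "(\<integral>om. (W b1 B1 om - W a B1 om) * (W b2 B2 om - W a B2 om) \<partial>M) = (min b1 b2 - a) * measure lborel (B1 \<inter> B2)"
  unfolding e ll_prod[OF i] using assms by (simp add: cv_def min_absorb1 min_absorb2 algebra_simps)
 have m: "ll ?x \<in> bm M" "ll ?y \<in> bm M" using i ll_measurable by auto
 show "integrable M (\<lambda>om. (W b1 B1 om - W a B1 om) * (W b2 B2 om - W a B2 om))"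
  unfolding e
 proof (rule bi_bound)
  show "integrable M (\<lambda>om. (ll ?x om)^2 + (ll ?y om)^2)"
   using i by (intro bi_add centered_gaussian_moment ll_gaussian)
  have "\<bar>p * q\<bar> \<le> \<bar>p^2 + q^2\<bar>" for p q :: real
  proof -
   have "2 * \<bar>p\<bar> * \<bar>q\<bar> \<le> \<bar>p\<bar>^2 + \<bar>q\<bar>^2" by (rule sum_squares_bound)
   moreover have "0 \<le> \<bar>p\<bar> * \<bar>q\<bar>" by simp
   ultimately have "\<bar>p\<bar> * \<bar>q\<bar> \<le> p^2 + q^2" unfolding power2_abs by linarith
   then show ?thesis by (simp add: abs_mult)
  qed
  then show "AE om in M. norm (ll ?x om * ll ?y om) \<le> norm ((ll ?x om)^2 + (ll ?y om)^2)" by simp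
 qed (rule borel_measurable_times[OF m])
qed

text \<open>Polarisation: the product is a quarter of the difference of the squares of
  \<open>p + q\<close> and \<open>p - q\<close>, both Gaussian and independent of the filtration at
  \<open>a\<close>. The factor is identified by the same computation with
  \<open>Z = 1\<close>.\<close>

lemma inc_prod_after:
 assumes a: "0 \<le> a" "a \<le> b1" "a \<le> b2" and B: "B1 \<in> finite_borel" "B2 \<in> finite_borel"
  and Z: "Z \<in> bm (noise_filtration M W a)" "integrable M Z"
 shows "integrable M (\<lambda>om. Z om * ((W b1 B1 om - W a B1 om) * (W b2 B2 om - W a B2 om)))"
  and "(\<integral>om. Z om * ((W b1 B1 om - W a B1 om) * (W b2 B2 om - W a B2 om)) \<partial>M)
   = (\<integral>om. Z om \<partial>M) * ((min b1 b2 - a) * measure lborel (B1 \<inter> B2))"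
proof -
 define p q where "p om = W b1 B1 om - W a B1 om" and "q om = W b2 B2 om - W a B2 om" for om
 obtain V1 where V1: "gauss_indep M (noise_filtration M W a) (\<lambda>om. p om + q om) V1"
  using gauss_filtration[OF a B, of 1 1] by (auto simp: p_def q_def)
 obtain V2 where V2: "gauss_indep M (noise_filtration M W a) (\<lambda>om. p om - q om) V2"
 proof -
  have "(\<lambda>om. p om - q om) = (\<lambda>om. 1 * (W b1 B1 om - W a B1 om) + (- 1) * (W b2 B2 om - W a B2 om))"
   by (simp add: p_def q_def fun_eq_iff)
  then show ?thesis using gauss_filtration[OF a B, of 1 "-1"] that by auto
 qed
 have one: "(\<lambda>_. 1 :: real) \<in> bm (noise_filtration M W a)" "integrable M (\<lambda>_. 1 :: real)" by auto
 note g = gauss_indep_expectation[OF filtration_subalgebra V1 Z, of 2] gauss_indep_expectation[OF filtration_subalgebra V2 Z, of 2]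
 note h = gauss_indep_expectation[OF filtration_subalgebra V1 one, of 2] gauss_indep_expectation[OF filtration_subalgebra V2 one, of 2]
 have e: "z * (p om * q om) = (z * (p om + q om)^2 - z * (p om - q om)^2) / 4" for z om
  by (simp add: power2_eq_square field_simps)
 show "integrable M (\<lambda>om. Z om * ((W b1 B1 om - W a B1 om) * (W b2 B2 om - W a B2 om)))"
  unfolding p_def[symmetric] q_def[symmetric] e using g by auto
 have E: "(\<integral>om. Z om * (p om * q om) \<partial>M) = ((\<integral>om. Z om * (p om + q om)^2 \<partial>M) - (\<integral>om. Z om * (p om - q om)^2 \<partial>M)) / 4"
  unfolding e using g by simp
 have "(\<integral>om. 1 * (p om * q om) \<partial>M) = ((\<integral>om. 1 * (p om + q om)^2 \<partial>M) - (\<integral>om. 1 * (p om - q om)^2 \<partial>M)) / 4"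
  unfolding e[of 1] using h(1,3) by simp
 then have E1: "(min b1 b2 - a) * measure lborel (B1 \<inter> B2)
  = (sqrt V1 ^ 2 * (\<integral>x. x ^ 2 \<partial>std_normal_distribution) - sqrt V2 ^ 2 * (\<integral>x. x ^ 2 \<partial>std_normal_distribution)) / 4"
  using inc_prod(2)[OF a B] h(2,4) by (simp add: p_def q_def prob_space)
 show "(\<integral>om. Z om * ((W b1 B1 om - W a B1 om) * (W b2 B2 om - W a B2 om)) \<partial>M)
   = (\<integral>om. Z om \<partial>M) * ((min b1 b2 - a) * measure lborel (B1 \<inter> B2))"
  unfolding E1 p_def[symmetric] q_def[symmetric] E g(2,4) by (simp add: field_simps)
qed

definition ovl :: "real => real => real => real => real" where
 "ovl a b a' b' = max 0 (min b b' - max a a')"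

text \<open>The first increment is cut at \<open>a'\<close>. Its part before \<open>a'\<close> is
  known at that time, so its product with the second increment has mean zero; the part after
  \<open>a'\<close> contributes over the overlap of the two intervals.\<close>

lemma elementary_prod_le:
 assumes a: "0 \<le> a" "a \<le> b" "a \<le> a'" "a' \<le> b'" and B: "B \<in> finite_borel" "C \<in> finite_borel"
  and X: "X \<in> bm (noise_filtration M W a)" "\<And>om. om \<in> space M ==> \<bar>X om\<bar> \<le> k"
  and Y: "Y \<in> bm (noise_filtration M W a')" "\<And>om. om \<in> space M ==> \<bar>Y om\<bar> \<le> l"
 shows "integrable M (\<lambda>om. (X om * (W b B om - W a B om)) * (Y om * (W b' C om - W a' C om)))" (is ?I)
  and "(\<integral>om. (X om * (W b B om - W a B om)) * (Y om * (W b' C om - W a' C om)) \<partial>M)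
   = (\<integral>om. X om * Y om \<partial>M) * (ovl a b a' b' * measure lborel (B \<inter> C))" (is ?E)
proof -
 let ?F = "noise_filtration M W a'"
 have X'[measurable]: "X \<in> bm ?F"
  using X(1) by (rule measurable_subset_sets) (use filtration_mono[OF a(3)] in \<open>auto simp: filtration_space\<close>)
 note Y(1)[measurable]
 have m1[measurable]: "W (min b a') B \<in> bm ?F" "W a B \<in> bm ?F"
  using a B by (auto intro!: Wi_filtration)
 have XM[measurable]: "X \<in> bm M" "Y \<in> bm M"
  by (rule filtration_measurable[OF X'], rule filtration_measurable[OF Y(1)])
 have k: "\<bar>X om * Y om\<bar> \<le> k * l" if "om \<in> space M" for om
  unfolding abs_mult using X(2)[OF that] Y(2)[OF that] by (intro mult_mono) auto
 have iXY: "integrable M (\<lambda>om. X om * Y om)"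
  by (rule integrable_const_bound[of _ "k * l"]) (use k in auto)
 define D1 where "D1 om = W (min b a') B om - W a B om" for om
 \<comment> \<open>For \<open>b \<le> a'\<close> this is the zero increment from \<open>a'\<close>
   to \<open>a'\<close>, so one formula covers both cases.\<close>
 define D2 where "D2 om = W (max b a') B om - W a' B om" for om
 define D' where "D' om = W b' C om - W a' C om" for om
 have D: "W b B om - W a B om = D1 om + D2 om" for om
  unfolding D1_def D2_def by (cases "b \<le> a'") (auto simp: min_def max_def)
 have D1m[measurable]: "D1 \<in> bm ?F" unfolding D1_def[abs_def] by measurable
 have iD1: "integrable M D1"
  using centered_gaussian_moment[OF inc_gaussian[of a "min b a'" B], of 1] a B by (simp add: D1_def[abs_def])
 have iZ: "integrable M (\<lambda>om. X om * Y om * D1 om)"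
 proof (rule bi_bound)
  show "integrable M (\<lambda>om. (k * l) * D1 om)" using iD1 by simp
  show "AE om in M. norm (X om * Y om * D1 om) \<le> norm ((k * l) * D1 om)"
  proof (rule AE_I2)
   fix om assume "om \<in> space M"
   from k[OF this] have "\<bar>X om * Y om\<bar> \<le> \<bar>k * l\<bar>" by linarith
   then show "norm (X om * Y om * D1 om) \<le> norm ((k * l) * D1 om)"
    by (simp only: real_norm_def abs_mult[of _ "D1 om"] mult_right_mono abs_ge_zero)
  qed
 qed (use iD1 in measurable)
 obtain V where V: "gauss_indep M ?F D' V"
  using gauss_filtration[OF _ a(4) a(4) B(2) B(2), of 1 0] a by (auto simp: D'_def[abs_def])
 have Zm: "(\<lambda>om. X om * Y om * D1 om) \<in> bm ?F" by measurable
 note g = gauss_indep_expectation[OF filtration_subalgebra V Zm iZ, of 1]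
 have m0: "(\<integral>x. x \<partial>std_normal_distribution) = 0" using integral_std_normal_distribution_moment_odd[of 1] by simp
 have a': "0 \<le> a'" "a' \<le> max b a'" using a by auto
 note h = inc_prod_after[OF a' a(4) B _ iXY, folded D2_def D'_def]
 have XYm: "(\<lambda>om. X om * Y om) \<in> bm ?F" by measurable
 have e: "(X om * (W b B om - W a B om)) * (Y om * (W b' C om - W a' C om))
  = X om * Y om * D1 om * D' om ^ 1 + X om * Y om * (D2 om * D' om)" for om
  unfolding D D'_def[symmetric] by (simp add: algebra_simps)
 show ?I unfolding e using g(1) h(1)[OF XYm] by (rule bi_add)
 have "min (max b a') b' - a' = ovl a b a' b'" using a by (auto simp: ovl_def min_def max_def)
 then show ?E unfolding e bo_add[OF g(1) h(1)[OF XYm]] g(2) h(2)[OF XYm] by (simp add: m0)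
qed

lemma elementary_prod:
 assumes a: "0 \<le> a" "a \<le> b" "0 \<le> a'" "a' \<le> b'" and B: "B \<in> finite_borel" "C \<in> finite_borel"
  and X: "X \<in> bm (noise_filtration M W a)" "\<And>om. om \<in> space M ==> \<bar>X om\<bar> \<le> k"
  and Y: "Y \<in> bm (noise_filtration M W a')" "\<And>om. om \<in> space M ==> \<bar>Y om\<bar> \<le> l"
 shows "integrable M (\<lambda>om. (X om * (W b B om - W a B om)) * (Y om * (W b' C om - W a' C om))) \<and>
  (\<integral>om. (X om * (W b B om - W a B om)) * (Y om * (W b' C om - W a' C om)) \<partial>M)
   = (\<integral>om. X om * Y om \<partial>M) * (ovl a b a' b' * measure lborel (B \<inter> C))"
proof (cases "a \<le> a'")
 case True
 then show ?thesis using elementary_prod_le[OF a(1,2) True a(4) B X Y] by simp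
next
 case False
 then have "a' \<le> a" by simp
 from elementary_prod_le[OF a(3,4) this a(2) B(2,1) Y X] show ?thesis
  by (simp add: mult.commute Int_commute ovl_def min.commute max.commute)
qed

end

section \<open>Simple fields and the Walsh isometry\<close>

lemma nn_integral_sq_add_le:
 fixes f g :: "'b => real"
 assumes [measurable]: "f \<in> bm N" "g \<in> bm N"
 shows "nn2 N (\<lambda>z. f z + g z) \<le> 2 * nn2 N (\<lambda>z. f z) + 2 * nn2 N (\<lambda>z. g z)"
proof -
 have "(a + b)^2 \<le> 2 * a^2 + 2 * b^2" for a b :: real
  using sum_squares_bound[of a b] by (simp add: power2_sum)
 then have "nn2 N (\<lambda>z. f z + g z) \<le> (\<integral>\<^sup>+z. 2 * ennreal ((f z)^2) + 2 * ennreal ((g z)^2) \<partial>N)"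
  by (intro nn_integral_mono) (simp add: ennreal_mult'[symmetric] ennreal_plus[symmetric] del: ennreal_plus flip: ennreal_numeral)
 also have "\<dots> = 2 * nn2 N (\<lambda>z. f z) + 2 * nn2 N (\<lambda>z. g z)"
  by (simp add: nn_integral_add nn_integral_cmult)
 finally show ?thesis .
qed

context wnoise
begin

text \<open>Time is not restricted here: integrands carry their time interval as an indicator, so
  that one measure serves all upper limits.\<close>

definition PP :: "('a \<times> real \<times> real) measure" where "PP = M \<Otimes>\<^sub>M lborel"

fun ent :: "('a => real) \<times> real \<times> real \<times> real set => 'a => real" where
 "ent (X, a, b, B) om = X om * (W b B om - W a B om)"

fun ev :: "('a => real) \<times> real \<times> real \<times> real set => 'a \<times> real \<times> real => real" where
 "ev (X, a, b, B) (om, s, y) = X om * indicator {a<..b} s * indicator B y"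

fun valid :: "('a => real) \<times> real \<times> real \<times> real set => bool" where
 "valid (X, a, b, B) \<longleftrightarrow> 0 \<le> a \<and> a \<le> b \<and> B \<in> finite_borel \<and>
   X \<in> bm (noise_filtration M W a) \<and> bounded (X ` space M)"

text \<open>The integral over all times; an upper limit is put into the field by
  \<open>stop\<close>.\<close>

definition sf_int :: "'a simple_field => 'a => real" where
 "sf_int S om = (\<Sum>e\<leftarrow>S. ent e om)"

lemma simple_valid: "is_simple_field M W S \<longleftrightarrow> (\<forall>e\<in>set S. valid e)"
 by (auto simp: is_simple_field_def)

lemma simple_field_eval_ev: "simple_field_eval S z = (\<Sum>e\<leftarrow>S. ev e z)"
proof -
 have "(\<lambda>(X, a, b, B). X (fst z) * indicator {a<..b} (fst (snd z)) * indicator B (snd (snd z))) = (\<lambda>e. ev e z)"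
  by (cases z) (auto simp: fun_eq_iff)
 then show ?thesis by (cases z) (simp add: simple_field_eval_def)
qed

lemma ev_measurable:
 assumes e: "valid e" and [measurable]: "fst \<in> measurable N M" "(\<lambda>z. fst (snd z)) \<in> bm N" "(\<lambda>z. snd (snd z)) \<in> bm N"
 shows "ev e \<in> bm N"
proof (cases e)
 case (fields X a b B)
 have [measurable]: "X \<in> bm M" "B \<in> sets borel"
  using e by (auto simp: fields finite_borel_def intro: filtration_measurable)
 have "(\<lambda>z. X (fst z) * indicator {a<..b} (fst (snd z)) * indicator B (snd (snd z))) \<in> bm N"
  by measurable
 moreover have "(\<lambda>z. X (fst z) * indicator {a<..b} (fst (snd z)) * indicator B (snd (snd z))) = ev e"
  by (auto simp: fields fun_eq_iff)
 ultimately show ?thesis by simp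
qed

lemma PP_measurable [measurable]:
 "fst \<in> measurable PP M" "(\<lambda>z. fst (snd z)) \<in> bm PP" "(\<lambda>z. snd (snd z)) \<in> bm PP"
proof -
 show "fst \<in> measurable PP M" unfolding PP_def by simp
 have "snd \<in> measurable PP (borel :: (real \<times> real) measure)" unfolding PP_def by simp
 then show "(\<lambda>z. fst (snd z)) \<in> bm PP" "(\<lambda>z. snd (snd z)) \<in> bm PP"
  by (auto intro!: measurable_compose[of snd PP borel] simp: borel_prod[symmetric])
qed

lemma sum_list_measurable:
 fixes f :: "'c => 'b => real"
 shows "(\<And>e. e \<in> set S ==> f e \<in> bm N) ==> (\<lambda>z. \<Sum>e\<leftarrow>S. f e z) \<in> bm N"
 by (induction S) auto

lemma eval_measurable:
 assumes "is_simple_field M W S" "fst \<in> measurable N M" "(\<lambda>z. fst (snd z)) \<in> bm N" "(\<lambda>z. snd (snd z)) \<in> bm N"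
 shows "simple_field_eval S \<in> bm N"
 unfolding simple_field_eval_ev[abs_def] using assms ev_measurable by (intro sum_list_measurable) (auto simp: simple_valid)

lemma eval_PP: "is_simple_field M W S ==> simple_field_eval S \<in> bm PP"
 by (intro eval_measurable) auto

lemma ent_measurable: "valid e ==> ent e \<in> bm M"
proof (cases e)
 case (fields X a b B)
 assume "valid e"
 then have [measurable]: "X \<in> bm M" "W a B \<in> bm M" "W b B \<in> bm M"
  using Wi_measurable[of "(a, B)"] Wi_measurable[of "(b, B)"]
  by (auto simp: fields Wi_def[abs_def] intro: filtration_measurable)
 have "ent e = (\<lambda>om. X om * (W b B om - W a B om))" by (auto simp: fields)
 then show ?thesis by simp
qed

lemma sf_int_measurable: "is_simple_field M W S ==> sf_int S \<in> bm M"
 unfolding sf_int_def[abs_def] using ent_measurable by (intro sum_list_measurable) (auto simp: simple_valid)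

lemma product_integral:
 assumes f: "integrable M f" and R: "R \<in> sets borel" "emeasure lborel R < \<infinity>"
 shows "integrable PP (\<lambda>z. f (fst z) * indicator R (snd z))"
  and "(\<integral>z. f (fst z) * indicator R (snd z) \<partial>PP) = (\<integral>om. f om \<partial>M) * measure lborel R"
proof -
 interpret L: pair_sigma_finite M "lborel :: (real \<times> real) measure" ..
 have [measurable]: "f \<in> bm M" using f by simp
 note R(1)[measurable]
 have m: "(\<lambda>z. f (fst z) * indicator R (snd z)) \<in> bm (M \<Otimes>\<^sub>M lborel)" by measurable
 have iR: "integrable lborel (indicator R :: real \<times> real => real)" using R by simp
 have n: "(\<integral>p. norm (f (fst (x, p)) * indicator R (snd (x, p))) \<partial>lborel) = \<bar>f x\<bar> * measure lborel R" for x
 proof -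
  have "(\<integral>p. norm (f (fst (x, p)) * indicator R (snd (x, p))) \<partial>lborel) = (\<integral>p. \<bar>f x\<bar> * indicator R p \<partial>lborel)"
   by (intro bo_cong refl) (auto simp: indicator_def)
  then show ?thesis by simp
 qed
 show I: "integrable PP (\<lambda>z. f (fst z) * indicator R (snd z))"
  unfolding PP_def
 proof (rule L.Fubini_integrable[OF m])
  show "integrable M (\<lambda>x. \<integral>y. norm (f (fst (x, y)) * indicator R (snd (x, y))) \<partial>lborel)"
   unfolding n using f by simp
  show "AE x in M. integrable lborel (\<lambda>y. f (fst (x, y)) * indicator R (snd (x, y)))"
   using iR by simp
 qed
 have "(\<integral>z. f (fst z) * indicator R (snd z) \<partial>PP) = (\<integral>x. \<integral>p. f x * indicator R p \<partial>lborel \<partial>M)"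
  using L.integral_fst'[OF I[unfolded PP_def]] by (simp add: PP_def)
 then show "(\<integral>z. f (fst z) * indicator R (snd z) \<partial>PP) = (\<integral>om. f om \<partial>M) * measure lborel R" by simp
qed

lemma rect_measure:
 assumes "B \<in> sets borel"
 shows "{a<..b} \<times> B \<in> sets (borel :: (real \<times> real) measure)"
  and "emeasure lborel ({a<..b} \<times> B) = ennreal (max 0 (b - a)) * emeasure lborel B"
proof -
 show "{a<..b} \<times> B \<in> sets (borel :: (real \<times> real) measure)"
  using assms unfolding borel_prod[symmetric] by auto
 have "emeasure lborel ({a<..b} \<times> B) = emeasure lborel {a<..b} * emeasure lborel B"
  using assms unfolding lborel_prod[symmetric] by (intro lborel.emeasure_pair_measure_Times) auto
 also have "emeasure lborel {a<..b} = ennreal (max 0 (b - a))"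
  by (cases "a \<le> b") (auto simp: max_def)
 finally show "emeasure lborel ({a<..b} \<times> B) = ennreal (max 0 (b - a)) * emeasure lborel B" .
qed

text \<open>Both integrals equal the mean of the product of the two variables times the area of the
  overlap of the two rectangles.\<close>

lemma pair_isometry:
 assumes "valid e" "valid e'"
 shows "integrable M (\<lambda>om. ent e om * ent e' om) \<and> integrable PP (\<lambda>z. ev e z * ev e' z) \<and>
  (\<integral>om. ent e om * ent e' om \<partial>M) = (\<integral>z. ev e z * ev e' z \<partial>PP)"
proof (cases e; cases e')
 fix X a b B Y a' b' C
 assume e: "e = (X, a, b, B)" "e' = (Y, a', b', C)"
 obtain k where k: "\<And>om. om \<in> space M ==> \<bar>X om\<bar> \<le> k" using assms e by (auto simp: bounded_iff)
 obtain l where l: "\<And>om. om \<in> space M ==> \<bar>Y om\<bar> \<le> l" using assms e by (auto simp: bounded_iff)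
 have B: "B \<in> finite_borel" "C \<in> finite_borel" and ab: "0 \<le> a" "a \<le> b" "0 \<le> a'" "a' \<le> b'"
  and XF: "X \<in> bm (noise_filtration M W a)" "Y \<in> bm (noise_filtration M W a')"
  using assms e by auto
 have [measurable]: "X \<in> bm M" "Y \<in> bm M"
  using XF by (auto intro: filtration_measurable)
 note E = elementary_prod[OF ab B XF(1) k XF(2) l]
 have BC: "B \<inter> C \<in> sets borel" "emeasure lborel (B \<inter> C) < \<infinity>"
  using B emeasure_mono[of "B \<inter> C" B lborel] by (auto simp: finite_borel_def intro: le_less_trans)
 let ?R = "{max a a'<..min b b'} \<times> (B \<inter> C)"
 have R: "?R \<in> sets borel" "emeasure lborel ?R = ennreal (ovl a b a' b') * emeasure lborel (B \<inter> C)"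
  using rect_measure[OF BC(1)] by (auto simp: ovl_def)
 have Rf: "emeasure lborel ?R < \<infinity>" unfolding R(2) using BC(2) by (simp add: ennreal_mult_eq_top_iff less_top[symmetric])
 have Rm: "measure lborel ?R = ovl a b a' b' * measure lborel (B \<inter> C)"
  unfolding measure_def R(2) by (auto simp: enn2real_mult ovl_def max_def ennreal_neg)
 have kl: "\<bar>X om * Y om\<bar> \<le> k * l" if "om \<in> space M" for om
  unfolding abs_mult using k[OF that] l[OF that] by (intro mult_mono) auto
 have iXY: "integrable M (\<lambda>om. X om * Y om)"
  by (rule integrable_const_bound[of _ "k * l"]) (use kl in auto)
 note P = product_integral[OF iXY R(1) Rf]
 have "ev e z * ev e' z = X (fst z) * Y (fst z) * indicator ?R (snd z)" for z
  by (cases z) (auto simp: e indicator_def)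
 then show ?thesis using P E by (simp add: e Rm)
qed

lemma sum_list_square_integral:
 fixes f :: "'c => 'b => real"
 assumes "\<And>e e'. e \<in> set S ==> e' \<in> set S ==> integrable N (\<lambda>z. f e z * f e' z)"
 shows "integrable N (\<lambda>z. (\<Sum>e\<leftarrow>S. f e z)^2)"
  and "(\<integral>z. (\<Sum>e\<leftarrow>S. f e z)^2 \<partial>N) = (\<Sum>i<length S. \<Sum>j<length S. \<integral>z. f (S ! i) z * f (S ! j) z \<partial>N)"
proof -
 have e: "(\<Sum>e\<leftarrow>S. f e z)^2 = (\<Sum>i<length S. \<Sum>j<length S. f (S ! i) z * f (S ! j) z)" for z
  by (simp add: sum_list_sum_nth power2_eq_square sum_product atLeast0LessThan)
 have i: "integrable N (\<lambda>z. f (S ! i) z * f (S ! j) z)" if "i \<in> {..<length S}" "j \<in> {..<length S}" for i j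
  using that assms by simp
 show "integrable N (\<lambda>z. (\<Sum>e\<leftarrow>S. f e z)^2)"
  unfolding e by (intro bi_sum i)
 have "(\<integral>z. (\<Sum>i<length S. \<Sum>j<length S. f (S ! i) z * f (S ! j) z) \<partial>N)
  = (\<Sum>i<length S. \<integral>z. (\<Sum>j<length S. f (S ! i) z * f (S ! j) z) \<partial>N)"
  by (intro bo_sum bi_sum i)
 also have "\<dots> = (\<Sum>i<length S. \<Sum>j<length S. \<integral>z. f (S ! i) z * f (S ! j) z \<partial>N)"
  by (intro sum.cong refl bo_sum i)
 finally show "(\<integral>z. (\<Sum>e\<leftarrow>S. f e z)^2 \<partial>N) = (\<Sum>i<length S. \<Sum>j<length S. \<integral>z. f (S ! i) z * f (S ! j) z \<partial>N)"
  unfolding e .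
qed

lemma simple_isometry:
 assumes S: "is_simple_field M W S"
 shows "integrable M (\<lambda>om. (sf_int S om)^2)" "integrable PP (\<lambda>z. (simple_field_eval S z)^2)"
  and "(\<integral>om. (sf_int S om)^2 \<partial>M) = (\<integral>z. (simple_field_eval S z)^2 \<partial>PP)"
proof -
 have p: "integrable M (\<lambda>om. ent e om * ent e' om)" "integrable PP (\<lambda>z. ev e z * ev e' z)"
  "(\<integral>om. ent e om * ent e' om \<partial>M) = (\<integral>z. ev e z * ev e' z \<partial>PP)" if "e \<in> set S" "e' \<in> set S" for e e'
  using pair_isometry[of e e'] that S by (auto simp: simple_valid)
 note A = sum_list_square_integral[of S M ent, OF p(1)] and B = sum_list_square_integral[of S PP ev, OF p(2)]
 show "integrable M (\<lambda>om. (sf_int S om)^2)" "integrable PP (\<lambda>z. (simple_field_eval S z)^2)"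
  unfolding sf_int_def simple_field_eval_ev using A(1) B(1) by auto
 show "(\<integral>om. (sf_int S om)^2 \<partial>M) = (\<integral>z. (simple_field_eval S z)^2 \<partial>PP)"
 proof -
  have "(\<Sum>i<length S. \<Sum>j<length S. \<integral>om. ent (S ! i) om * ent (S ! j) om \<partial>M)
    = (\<Sum>i<length S. \<Sum>j<length S. \<integral>z. ev (S ! i) z * ev (S ! j) z \<partial>PP)"
   by (intro sum.cong refl p(3)) auto
  then show ?thesis using A(2) B(2) by (simp add: sf_int_def simple_field_eval_ev)
 qed
qed

lemma simple_isometry_nn:
 assumes S: "is_simple_field M W S"
 shows "nn2 M (\<lambda>om. sf_int S om) = nn2 PP (\<lambda>z. simple_field_eval S z)"
 using simple_isometry[OF S] by (simp add: nn_integral_eq_integral)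

text \<open>The counterpart of \<open>has_walsh_integral\<close> over all times, with the horizon
  contained in the integrand. In this form integrals with different horizons can be
  subtracted.\<close>

definition walsh :: "('a \<times> real \<times> real => real) => ('a => real) => bool" where
 "walsh X I \<longleftrightarrow> X \<in> bm PP \<and> I \<in> bm M \<and>
  (\<exists>S. (\<forall>n. is_simple_field M W (S n)) \<and>
   (\<lambda>n::nat. nn2 PP (\<lambda>z. simple_field_eval (S n) z - X z)) ----> 0 \<and>
   (\<lambda>n. nn2 M (\<lambda>om. sf_int (S n) om - I om)) ----> 0)"

lemma walshI:
 assumes "X \<in> bm PP" "I \<in> bm M" "\<And>n. is_simple_field M W (S n)"
  "(\<lambda>n. nn2 PP (\<lambda>z. simple_field_eval (S n) z - X z)) ----> 0"
  "(\<lambda>n. nn2 M (\<lambda>om. sf_int (S n) om - I om)) ----> 0"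
 shows "walsh X I"
 using assms unfolding walsh_def by blast

lemma walsh_simple: "is_simple_field M W S ==> walsh (simple_field_eval S) (sf_int S)"
 by (rule walshI[of _ _ "\<lambda>_. S"]) (simp_all add: eval_PP sf_int_measurable)

definition negs :: "'a simple_field => 'a simple_field" where
 "negs S = map (\<lambda>(X, a, b, B). (\<lambda>om. - X om, a, b, B)) S"

lemma negs:
 assumes "is_simple_field M W S"
 shows "is_simple_field M W (negs S)" and "simple_field_eval (negs S) z = - simple_field_eval S z"
  and "sf_int (negs S) om = - sf_int S om"
proof -
 have "bounded ((\<lambda>om. - X om) ` space M)" if "bounded (X ` space M)" for X :: "'a => real"
  using that by (auto simp: bounded_iff)
 then show "is_simple_field M W (negs S)"
  using assms by (auto simp: is_simple_field_def negs_def)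
 show "simple_field_eval (negs S) z = - simple_field_eval S z"
  unfolding simple_field_eval_ev negs_def by (induction S; cases z) auto
 show "sf_int (negs S) om = - sf_int S om"
  unfolding sf_int_def negs_def by (induction S) auto
qed

lemma simple_append:
 "is_simple_field M W (S @ T) \<longleftrightarrow> is_simple_field M W S \<and> is_simple_field M W T"
 "simple_field_eval (S @ T) z = simple_field_eval S z + simple_field_eval T z"
 "sf_int (S @ T) om = sf_int S om + sf_int T om"
 unfolding simple_valid by (auto simp: simple_field_eval_ev sf_int_def)

lemma tendsto_sum_squares:
 fixes f g :: "nat => 'b => real"
 assumes m: "\<And>n. f n \<in> bm N" "\<And>n. g n \<in> bm N"
  and f: "(\<lambda>n. nn2 N (\<lambda>z. f n z)) ----> 0" and g: "(\<lambda>n. nn2 N (\<lambda>z. g n z)) ----> 0"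
 shows "(\<lambda>n. nn2 N (\<lambda>z. f n z + g n z)) ----> 0"
proof (rule tendsto_sandwich[OF _ _ tendsto_const])
 show "\<forall>\<^sub>F n in sequentially. (nn2 N (\<lambda>z. f n z + g n z))
   \<le> 2 * nn2 N (\<lambda>z. f n z) + 2 * nn2 N (\<lambda>z. g n z)"
  using m by (intro always_eventually allI nn_integral_sq_add_le)
 have "(\<lambda>n. 2 * nn2 N (\<lambda>z. f n z) + 2 * nn2 N (\<lambda>z. g n z)) ----> 2 * 0 + 2 * 0"
  by (intro tendsto_intros ennreal_tendsto_cmult f g) auto
 then show "(\<lambda>n. 2 * nn2 N (\<lambda>z. f n z) + 2 * nn2 N (\<lambda>z. g n z)) ----> 0" by simp
qed simp

lemma walsh_diff:
 assumes "walsh X I" "walsh Y J"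
 shows "walsh (\<lambda>z. X z - Y z) (\<lambda>om. I om - J om)"
proof -
 have [measurable]: "X \<in> bm PP" "I \<in> bm M" "Y \<in> bm PP" "J \<in> bm M"
  using assms by (auto simp: walsh_def)
 obtain S where S: "\<And>n. is_simple_field M W (S n)"
  "(\<lambda>n. nn2 PP (\<lambda>z. simple_field_eval (S n) z - X z)) ----> 0"
  "(\<lambda>n. nn2 M (\<lambda>om. sf_int (S n) om - I om)) ----> 0" using assms by (auto simp: walsh_def)
 obtain T where T: "\<And>n. is_simple_field M W (T n)"
  "(\<lambda>n. nn2 PP (\<lambda>z. simple_field_eval (T n) z - Y z)) ----> 0"
  "(\<lambda>n. nn2 M (\<lambda>om. sf_int (T n) om - J om)) ----> 0" using assms by (auto simp: walsh_def)
 note [measurable] = eval_PP[OF S(1)] eval_PP[OF T(1)] sf_int_measurable[OF S(1)] sf_int_measurable[OF T(1)]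
 have T': "(\<lambda>n. nn2 PP (\<lambda>z. Y z - simple_field_eval (T n) z)) ----> 0"
  "(\<lambda>n. nn2 M (\<lambda>om. J om - sf_int (T n) om)) ----> 0"
  using T(2,3) by (simp_all add: power2_commute)
 show ?thesis
 proof (rule walshI[where S = "\<lambda>n. S n @ negs (T n)"])
  show "is_simple_field M W (S n @ negs (T n))" for n using S T negs by (simp add: simple_append)
  show "(\<lambda>n. nn2 PP (\<lambda>z. simple_field_eval (S n @ negs (T n)) z - (X z - Y z))) ----> 0"
   using tendsto_sum_squares[OF _ _ S(2) T'(1)] by (simp add: simple_append negs[OF T(1)] algebra_simps)
  show "(\<lambda>n. nn2 M (\<lambda>om. sf_int (S n @ negs (T n)) om - (I om - J om))) ----> 0"
   using tendsto_sum_squares[OF _ _ S(3) T'(2)] by (simp add: simple_append negs[OF T(1)] algebra_simps)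
 qed simp_all
qed

text \<open>Simple fields satisfy an isometry; the factor 4 arises from using
  \<open>(a + b)^2 \<le> 2 * a^2 + 2 * b^2\<close> once for the integrals and once for the fields.
  Applied to differences, this yields stability of the integral.\<close>

lemma walsh_bound:
 assumes "walsh X I"
 shows "nn2 M (\<lambda>om. I om) \<le> 4 * nn2 PP (\<lambda>z. X z)"
proof -
 have [measurable]: "X \<in> bm PP" "I \<in> bm M" using assms by (auto simp: walsh_def)
 obtain S where S: "\<And>n. is_simple_field M W (S n)"
  "(\<lambda>n. nn2 PP (\<lambda>z. simple_field_eval (S n) z - X z)) ----> 0"
  "(\<lambda>n. nn2 M (\<lambda>om. sf_int (S n) om - I om)) ----> 0" using assms by (auto simp: walsh_def)
 note [measurable] = eval_PP[OF S(1)] sf_int_measurable[OF S(1)]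
 let ?p = "\<lambda>n. nn2 PP (\<lambda>z. simple_field_eval (S n) z - X z)"
 let ?q = "\<lambda>n. nn2 M (\<lambda>om. sf_int (S n) om - I om)"
 let ?x = "nn2 PP (\<lambda>z. X z)"
 have "nn2 M (\<lambda>om. I om) \<le> 2 * ?q n + 2 * (2 * ?p n + 2 * ?x)" for n
 proof -
  have "nn2 M (\<lambda>om. I om) = nn2 M (\<lambda>om. (I om - sf_int (S n) om) + sf_int (S n) om)" by simp
  also have "\<dots> \<le> 2 * nn2 M (\<lambda>om. I om - sf_int (S n) om) + 2 * nn2 M (\<lambda>om. sf_int (S n) om)"
   by (rule nn_integral_sq_add_le) measurable
  also have "nn2 M (\<lambda>om. I om - sf_int (S n) om) = ?q n" by (simp add: power2_commute)
  also have "nn2 M (\<lambda>om. sf_int (S n) om) = nn2 PP (\<lambda>z. (simple_field_eval (S n) z - X z) + X z)"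
   by (simp add: simple_isometry_nn[OF S(1)])
  also have "\<dots> \<le> 2 * ?p n + 2 * ?x"
   by (rule nn_integral_sq_add_le) measurable
  finally show ?thesis by (simp add: add_left_mono mult_left_mono)
 qed
 moreover have "(\<lambda>n. 2 * ?q n + 2 * (2 * ?p n + 2 * ?x)) ----> 2 * 0 + 2 * (2 * 0 + 2 * ?x)"
  by (intro tendsto_add ennreal_tendsto_cmult S(2,3) tendsto_const) auto
 ultimately have "nn2 M (\<lambda>om. I om) \<le> 2 * 0 + 2 * (2 * 0 + 2 * ?x)"
  by (intro LIMSEQ_le_const) auto
 then show ?thesis by (simp add: mult.assoc[symmetric])
qed

text \<open>\<open>walsh_bound\<close> applies to the difference of \<open>X\<close> and the simple
  field. Hence special approximations, such as grids, may be used for an integral that is already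
  given.\<close>

lemma walsh_approx:
 assumes X: "walsh X I" and S: "\<And>n. is_simple_field M W (S n)"
  and lim: "(\<lambda>n. nn2 PP (\<lambda>z. simple_field_eval (S n) z - X z)) ----> 0"
 shows "(\<lambda>n. nn2 M (\<lambda>om. sf_int (S n) om - I om)) ----> 0"
proof (rule tendsto_sandwich[OF _ _ tendsto_const])
 show "\<forall>\<^sub>F n in sequentially. (nn2 M (\<lambda>om. sf_int (S n) om - I om))
   \<le> 4 * nn2 PP (\<lambda>z. simple_field_eval (S n) z - X z)"
  using walsh_bound[OF walsh_diff[OF walsh_simple[OF S] X]] by simp
 show "(\<lambda>n. 4 * nn2 PP (\<lambda>z. simple_field_eval (S n) z - X z)) ----> 0"
  using ennreal_tendsto_cmult[OF _ lim, of 4] by simp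
qed simp

text \<open>An entry that starts after \<open>t\<close> collapses to the empty interval at
  \<open>t\<close>. Its variable is then replaced by 0, since it is known at time \<open>a\<close>
  and not at \<open>min t a = t\<close>.\<close>

definition stop :: "real => 'a simple_field => 'a simple_field" where
 "stop t S = map (\<lambda>(X, a, b, B). (\<lambda>om. if a \<le> t then X om else 0, min t a, min t b, B)) S"

lemma stop:
 assumes "is_simple_field M W S" "0 \<le> t"
 shows "is_simple_field M W (stop t S)"
  and "simple_field_eval (stop t S) (om, s, y) = simple_field_eval S (om, s, y) * indicator {..t} s"
  and "sf_int (stop t S) om = simple_field_integral W S t om"
proof -
 show "is_simple_field M W (stop t S)"
  unfolding simple_valid
 proof
  fix e assume "e \<in> set (stop t S)"
  then obtain X a b B where e: "e = (\<lambda>om. if a \<le> t then X om else 0, min t a, min t b, B)" and "(X, a, b, B) \<in> set S"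
   by (auto simp: stop_def)
  then have "valid (X, a, b, B)" using assms(1) by (auto simp: simple_valid)
  then show "valid e" using assms(2) by (cases "a \<le> t") (auto simp: e min_absorb2 bounded_iff)
 qed
 show "simple_field_eval (stop t S) (om, s, y) = simple_field_eval S (om, s, y) * indicator {..t} s"
  unfolding simple_field_eval_ev stop_def
  by (induction S) (auto simp: indicator_def min_def)
 show "sf_int (stop t S) om = simple_field_integral W S t om"
  using assms(1) unfolding simple_valid sf_int_def simple_field_integral_def stop_def
  by (induction S) (auto simp: min_def)
qed

text \<open>Tonelli on both sides: for an integrand supported in \<open>{0..t}\<close>, the time
  integral over the whole axis is one over the restricted space.\<close>

lemma field_measure_le:
 assumes f: "f \<in> bm (field_measure M t)" and g: "g \<in> bm PP"
  and le: "\<And>om s y. om \<in> space M ==> g (om, s, y) \<le> f (om, s, y) * indicator {0..t} s"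
 shows "(\<integral>\<^sup>+z. g z \<partial>PP) \<le> (\<integral>\<^sup>+z. f z \<partial>field_measure M t)"
proof -
 let ?R = "restrict_space lborel {0..t} :: real measure"
 interpret R: sigma_finite_measure ?R
  by (rule sigma_finite_measure_restrict_space[OF lborel.sigma_finite_measure_axioms]) simp
 interpret RL: pair_sigma_finite ?R "lborel :: real measure" ..
 have gm: "g \<in> bm (M \<Otimes>\<^sub>M (lborel \<Otimes>\<^sub>M lborel))" using g by (simp add: PP_def lborel_prod)
 have gs: "(\<lambda>p. g (om, p)) \<in> bm (lborel \<Otimes>\<^sub>M lborel)" if "om \<in> space M" for om
  using measurable_compose[OF measurable_Pair1'[OF that] gm] by simp
 have fs: "(\<lambda>p. f (om, p)) \<in> bm (?R \<Otimes>\<^sub>M lborel)" if "om \<in> space M" for om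
  using measurable_compose[OF measurable_Pair1'[OF that] f[unfolded field_measure_def]] by simp
 have "(\<integral>\<^sup>+z. g z \<partial>PP) = (\<integral>\<^sup>+om. \<integral>\<^sup>+p. g (om, p) \<partial>lborel \<partial>M)"
  using g unfolding PP_def by (rule lborel.nn_integral_fst[symmetric])
 also have "\<dots> = (\<integral>\<^sup>+om. \<integral>\<^sup>+s. \<integral>\<^sup>+y. g (om, s, y) \<partial>lborel \<partial>lborel \<partial>M)"
  unfolding lborel_prod[symmetric]
  by (intro nn_integral_cong lborel.nn_integral_fst[symmetric] gs)
 also have "\<dots> \<le> (\<integral>\<^sup>+om. \<integral>\<^sup>+s. (\<integral>\<^sup>+y. f (om, s, y) \<partial>lborel) * indicator {0..t} s \<partial>lborel \<partial>M)"
 proof (intro nn_integral_mono)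
  fix om s assume w: "om \<in> space M"
  show "(\<integral>\<^sup>+y. g (om, s, y) \<partial>lborel) \<le> (\<integral>\<^sup>+y. f (om, s, y) \<partial>lborel) * indicator {0..t} s"
  proof (cases "s \<in> {0..t}")
   case True
   then show ?thesis using le[OF w, of s] by (auto intro!: nn_integral_mono)
  next
   case False
   then have "g (om, s, y) = 0" for y using le[OF w, of s y] by simp
   then show ?thesis by simp
  qed
 qed
 also have "\<dots> = (\<integral>\<^sup>+om. \<integral>\<^sup>+s. (\<integral>\<^sup>+y. f (om, s, y) \<partial>lborel) \<partial>?R \<partial>M)"
  by (intro nn_integral_cong nn_integral_restrict_space[symmetric]) simp
 also have "\<dots> = (\<integral>\<^sup>+om. \<integral>\<^sup>+p. f (om, p) \<partial>(?R \<Otimes>\<^sub>M lborel) \<partial>M)"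
  by (intro nn_integral_cong lborel.nn_integral_fst fs)
 also have "\<dots> = (\<integral>\<^sup>+z. f z \<partial>field_measure M t)"
  unfolding field_measure_def by (rule sigma_finite_measure.nn_integral_fst[OF RL.P.sigma_finite_measure_axioms]) (use f in \<open>simp add: field_measure_def\<close>)
 finally show ?thesis .
qed

text \<open>Stopping at \<open>t\<close> turns an approximating sequence for the given integral into
  one for the extended integrand. Time 0 is excluded because simple fields live on intervals that
  are open on the left.\<close>

lemma has_walsh_integral_walsh:
 assumes X: "has_walsh_integral M W X t I" and t: "0 \<le> t"
  and m: "(\<lambda>(om, s, y). X (om, s, y) * indicator {0<..t} s) \<in> bm PP"
 shows "walsh (\<lambda>(om, s, y). X (om, s, y) * indicator {0<..t} s) I"
proof -
 let ?X = "\<lambda>(om, s, y). X (om, s, y) * indicator {0<..t} s"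
 obtain S where S: "\<And>n. is_simple_field M W (S n)"
  "(\<lambda>n. nn2 (field_measure M t) (\<lambda>z. simple_field_eval (S n) z - X z)) ----> 0"
  "(\<lambda>n. nn2 M (\<lambda>om. simple_field_integral W (S n) t om - I om)) ----> 0"
  using X unfolding has_walsh_integral_def by blast
 have Xm[measurable]: "X \<in> bm (field_measure M t)" and Im: "I \<in> bm M"
  using X unfolding has_walsh_integral_def by blast+
 have fm: "fst \<in> measurable (field_measure M t) M" "(\<lambda>z. fst (snd z)) \<in> bm (field_measure M t)"
  "(\<lambda>z. snd (snd z)) \<in> bm (field_measure M t)"
 proof -
  have "(\<lambda>z. fst (snd z)) \<in> measurable (field_measure M t) (restrict_space lborel {0..t})"
   unfolding field_measure_def by measurable
  moreover have "(\<lambda>x. x) \<in> measurable (restrict_space lborel {0..t}) (borel :: real measure)"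
   by (rule measurable_restrict_space1) simp
  ultimately show "(\<lambda>z. fst (snd z)) \<in> bm (field_measure M t)"
   by (rule measurable_compose)
 qed (unfold field_measure_def, simp_all)
 note [measurable] = eval_measurable[OF S(1) fm] eval_PP[OF S(1)] m
 have ev0: "simple_field_eval (S n) (om, s, y) = 0" if "s \<le> 0" for n om s y
 proof -
  have "ev e (om, s, y) = 0" if "e \<in> set (S n)" for e
   using S(1)[of n] that \<open>s \<le> 0\<close> by (cases e) (auto simp: is_simple_field_def)
  then show ?thesis unfolding simple_field_eval_ev by (intro sum_list_0[THEN trans[rotated]] arg_cong[where f = sum_list]) (auto intro!: map_cong)
 qed
 show ?thesis
 proof (rule walshI[where S = "\<lambda>n. stop t (S n)"])
  show "is_simple_field M W (stop t (S n))" for n by (rule stop[OF S(1) t])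
  note [measurable] = eval_PP[OF this]
  show "(\<lambda>n. nn2 PP (\<lambda>z. simple_field_eval (stop t (S n)) z - ?X z)) ----> 0"
  proof (rule tendsto_sandwich[OF _ _ tendsto_const S(2)])
   have "nn2 PP (\<lambda>z. simple_field_eval (stop t (S n)) z - ?X z)
    \<le> nn2 (field_measure M t) (\<lambda>z. simple_field_eval (S n) z - X z)" for n
   proof (rule field_measure_le)
    show "ennreal ((simple_field_eval (stop t (S n)) (om, s, y) - ?X (om, s, y))^2)
     \<le> ennreal ((simple_field_eval (S n) (om, s, y) - X (om, s, y))^2) * indicator {0..t} s" for om s y
     using ev0[of s n om y] by (auto simp: stop(2)[OF S(1) t] indicator_def)
   qed measurable
   then show "\<forall>\<^sub>F n in sequentially. (nn2 PP (\<lambda>z. simple_field_eval (stop t (S n)) z - ?X z))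
    \<le> nn2 (field_measure M t) (\<lambda>z. simple_field_eval (S n) z - X z)" by simp
  qed simp
  show "(\<lambda>n. nn2 M (\<lambda>om. sf_int (stop t (S n)) om - I om)) ----> 0"
   using S(3) by (simp add: stop(3)[OF S(1) t])
 qed (use m Im in simp_all)
qed

end

section \<open>Fourth moments of simple integrals\<close>

lemma cauchy_schwarz_nonneg:
 fixes f g :: "'b => real"
 assumes [measurable]: "f \<in> bm N" "g \<in> bm N"
  and nn: "\<And>z. 0 \<le> f z" "\<And>z. 0 \<le> g z"
  and i: "integrable N (\<lambda>z. (f z)^2)" "integrable N (\<lambda>z. (g z)^2)"
 shows "integrable N (\<lambda>z. f z * g z)" and "(\<integral>z. f z * g z \<partial>N) \<le> sqrt (\<integral>z. (f z)^2 \<partial>N) * sqrt (\<integral>z. (g z)^2 \<partial>N)"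
proof -
 show I: "integrable N (\<lambda>z. f z * g z)"
 proof (rule bi_bound[OF bi_add[OF i]])
  have "f z * g z \<le> (f z)^2 + (g z)^2" for z
   using sum_squares_bound[of "f z" "g z"] mult_nonneg_nonneg[OF nn[of z]] by linarith
  then show "AE z in N. norm (f z * g z) \<le> norm ((f z)^2 + (g z)^2)" using nn by simp
 qed simp
 have "(\<integral>\<^sup>+z. ennreal (f z) * ennreal (g z) \<partial>N)^2 \<le> (\<integral>\<^sup>+z. ennreal (f z) ^ 2 \<partial>N) * (\<integral>\<^sup>+z. ennreal (g z) ^ 2 \<partial>N)"
  by (rule Cauchy_Schwarz_nn_integral) simp_all
 then have "(ennreal (\<integral>z. f z * g z \<partial>N))^2 \<le> ennreal (\<integral>z. (f z)^2 \<partial>N) * ennreal (\<integral>z. (g z)^2 \<partial>N)"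
  using I i nn by (simp add: ennreal_mult[symmetric] ennreal_power nn_integral_eq_integral)
 then have "(\<integral>z. f z * g z \<partial>N)^2 \<le> (\<integral>z. (f z)^2 \<partial>N) * (\<integral>z. (g z)^2 \<partial>N)"
  using nn by (simp add: ennreal_mult[symmetric] ennreal_power integral_nonneg_AE)
 then show "(\<integral>z. f z * g z \<partial>N) \<le> sqrt (\<integral>z. (f z)^2 \<partial>N) * sqrt (\<integral>z. (g z)^2 \<partial>N)"
  unfolding real_sqrt_mult[symmetric] by (rule real_le_rsqrt)
qed

lemma std_normal_moments:
 "(\<integral>x. x ^ 1 \<partial>std_normal_distribution) = 0" "(\<integral>x. x ^ 2 \<partial>std_normal_distribution) = 1"
 "(\<integral>x. x ^ 3 \<partial>std_normal_distribution) = 0" "(\<integral>x. x ^ 4 \<partial>std_normal_distribution) = 3"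
 "(\<integral>x. x ^ 8 \<partial>std_normal_distribution) = 105"
 using integral_std_normal_distribution_moment_odd[of 1] integral_std_normal_distribution_moment_odd[of 3]
  std_normal_distribution_even_moments(1)[of 1] std_normal_distribution_even_moments(1)[of 2]
  std_normal_distribution_even_moments(1)[of 4]
 by (simp_all add: fact_numeral)

context wnoise
begin

text \<open>The order is chosen so that the noise increment of an entry is independent of the
  variables and increments of all entries before it, including those of the same time
  interval.\<close>

fun after :: "('a => real) \<times> real \<times> real \<times> real set => ('a => real) \<times> real \<times> real \<times> real set => bool" where
 "after (X', a', b', B') (X, a, b, B) \<longleftrightarrow> b' \<le> a \<or> a' = a \<and> b' = b \<and> B' \<inter> B = {}"

text \<open>In contrast to \<open>valid\<close>, the variable is known from the raw past; this past
  is contained in the sigma-algebra \<open>sub J\<close> from which the increment is shown to be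
  independent in \<open>fourth_moment_simple\<close>.\<close>

fun nvalid :: "('a => real) \<times> real \<times> real \<times> real set => bool" where
 "nvalid (X, a, b, B) \<longleftrightarrow> 0 \<le> a \<and> a \<le> b \<and> B \<in> finite_borel \<and>
   X \<in> bm (sub (upto_time a)) \<and> bounded (X ` space M)"

lemma nvalid_valid: "nvalid e ==> valid e"
proof (cases e)
 case (fields X a b B)
 assume e: "nvalid e"
 then have "X \<in> bm (sub (upto_time a))" by (simp add: fields)
 then have "X \<in> bm (noise_filtration M W a)"
  by (rule measurable_subset_sets)
   (use noise_sets_filtration[of a] in \<open>simp_all add: sub_space[OF upto_IX] filtration_space noise_sets_sub\<close>)
 then show ?thesis using e by (simp add: fields)
qed

text \<open>The squared L4 norm of \<open>X\<close> times the area of the rectangle: what an entry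
  contributes to the squared L4 norm of the integral.\<close>

fun weight :: "('a => real) \<times> real \<times> real \<times> real set => real" where
 "weight (X, a, b, B) = sqrt (\<integral>om. X om ^ 4 \<partial>M) * ((b - a) * measure lborel B)"

text \<open>For \<open>I + X D\<close>, with \<open>D\<close> Gaussian of variance \<open>V\<close>
  and independent of \<open>I\<close> and \<open>X\<close>, odd moments of \<open>D\<close> drop out
  and the fourth moment is \<open>E I^4 + 6 V E (I X)^2 + 3 V^2 E X^4\<close>. By Cauchy-Schwarz
  this is at most the square of \<open>sqrt (E I^4) + 3 V sqrt (E X^4)\<close>, so square roots of
  fourth moments add up.\<close>

lemma fourth_moment_simple:
 assumes "\<forall>e\<in>set S. nvalid e" "sorted_wrt after S"
 shows "integrable M (\<lambda>om. sf_int S om ^ 4) \<and> sqrt (\<integral>om. sf_int S om ^ 4 \<partial>M) \<le> 3 * (\<Sum>e\<leftarrow>S. weight e)"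
 using assms
proof (induction S rule: rev_induct)
 case Nil
 then show ?case by (simp add: sf_int_def)
next
 case (snoc e S)
 obtain X a b B where e: "e = (X, a, b, B)" by (cases e)
 have v: "0 \<le> a" "a \<le> b" "B \<in> finite_borel" "X \<in> bm (sub (upto_time a))" "bounded (X ` space M)"
  using snoc.prems(1) by (simp_all add: e)
 define I where "I = sf_int S"
 have IH: "integrable M (\<lambda>om. I om ^ 4)" "sqrt (\<integral>om. I om ^ 4 \<partial>M) \<le> 3 * (\<Sum>e\<leftarrow>S. weight e)"
  using snoc by (auto simp: sorted_wrt_append I_def)
 \<comment> \<open>Besides the noise up to \<open>a\<close>, this contains the noise up to
   \<open>b\<close> on sets disjoint from \<open>B\<close>, on which earlier entries of the same
   time interval depend.\<close>
 define J where "J = {i \<in> IX. fst i \<le> a \<or> fst i \<le> b \<and> snd i \<inter> B = {}}"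
 have JX: "J \<subseteq> IX" by (auto simp: J_def)
 have sp: "space (sub J) = space M" by (rule sub_space[OF JX])
 have XJ: "X \<in> bm (sub J)" if "X \<in> bm (sub (upto_time a'))" "a' \<le> a" for X a'
 proof (rule measurable_subset_sets[OF that(1)])
  have "upto_time a' \<subseteq> J" using that(2) by (auto simp: J_def)
  then show "sets (sub (upto_time a')) \<subseteq> sets (sub J)" by (rule sub_mono[OF _ JX])
 qed (simp add: sp sub_space[OF upto_IX])
 have [measurable]: "X \<in> bm (sub J)" by (rule XJ[OF v(4) order_refl])
 have [measurable]: "I \<in> bm (sub J)"
  unfolding I_def sf_int_def[abs_def]
 proof (rule sum_list_measurable)
  fix e' assume e': "e' \<in> set S"
  obtain X' a' b' B' where f: "e' = (X', a', b', B')" by (cases e')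
  have v': "0 \<le> a'" "a' \<le> b'" "B' \<in> finite_borel" "X' \<in> bm (sub (upto_time a'))"
   using snoc.prems(1) e' by (auto simp: f)
  have "after e' e" using snoc.prems(2) e' by (auto simp: sorted_wrt_append)
  then have af: "b' \<le> a \<or> a' = a \<and> b' = b \<and> B' \<inter> B = {}" by (simp add: e f)
  then have a': "a' \<le> a" using v' by auto
  have [measurable]: "X' \<in> bm (sub J)" by (rule XJ[OF v'(4) a'])
  have "(b', B') \<in> J" "(a', B') \<in> J" using af a' v v' by (auto simp: J_def)
  then have [measurable]: "W b' B' \<in> bm (sub J)" "W a' B' \<in> bm (sub J)"
   using Wi_sub[OF JX] by (auto simp: Wi_def[abs_def] dest: Wi_sub[OF JX])
  have "ent e' = (\<lambda>om. X' om * (W b' B' om - W a' B' om))" by (auto simp: f)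
  then show "ent e' \<in> bm (sub J)" by simp
 qed
 define D where "D = ll [(1, (b, B)), (- 1, (a, B))]"
 have D: "D om = W b B om - W a B om" for om by (simp add: D_def Wi_def)
 define V where "V = (b - a) * measure lborel B"
 have V0: "0 \<le> V" using v by (simp add: V_def)
 have "gauss_indep M (sub J) D (\<integral>om. (D om)^2 \<partial>M)"
  unfolding D_def
 proof (rule gauss_list[OF _ JX])
  show "snd ` set [(1, b, B), (- 1, a, B)] \<subseteq> IX" using v by auto
  fix j assume "j \<in> J"
  then have "fst j \<le> a \<or> B \<inter> snd j = {}" by (auto simp: J_def)
  then show "(\<Sum>(c, i)\<leftarrow>[(1, b, B), (- 1, a, B)]. c * cv i j) = 0"
   using v by (auto simp: cv_def min_absorb2)
 qed
 also have "(\<integral>om. (D om)^2 \<partial>M) = V"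
  using inc_prod(2)[OF v(1,2,2,3,3)] by (simp add: D V_def power2_eq_square)
 finally have gi: "gauss_indep M (sub J) D V" .
 note sa = sub_subalgebra[OF JX]
 obtain k where k: "\<And>om. om \<in> space M ==> \<bar>X om\<bar> \<le> k" using v(5) by (auto simp: bounded_iff)
 have [measurable]: "X \<in> bm M" "I \<in> bm M"
  by (rule measurable_from_subalg[OF sa]; measurable)+
 have ib: "integrable M (\<lambda>om. I om ^ p * X om ^ q)" if "p \<le> 4" for p q
 proof (rule bi_bound)
  show "integrable M (\<lambda>om. (1 + I om ^ 4) * k ^ q)" using IH(1) by simp
  show "AE om in M. norm (I om ^ p * X om ^ q) \<le> norm ((1 + I om ^ 4) * k ^ q)"
  proof (rule AE_I2)
   fix om assume w: "om \<in> space M"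
   have x: "\<bar>X om\<bar> ^ q \<le> \<bar>k ^ q\<bar>" unfolding power_abs using k[OF w] by (intro power_mono) auto
   have "\<bar>I om\<bar> ^ p \<le> 1 + \<bar>I om\<bar> ^ 4"
   proof (cases "\<bar>I om\<bar> \<le> 1")
    case True
    then have "\<bar>I om\<bar> ^ p \<le> 1" by (simp add: power_le_one)
    then show ?thesis using zero_le_power[of "\<bar>I om\<bar>" 4] by linarith
   next
    case False
    then have "\<bar>I om\<bar> ^ p \<le> \<bar>I om\<bar> ^ 4" using that by (intro power_increasing) auto
    then show ?thesis by simp
   qed
   then have "\<bar>I om\<bar> ^ p \<le> \<bar>1 + I om ^ 4\<bar>" by (simp add: power_even_abs)
   then show "norm (I om ^ p * X om ^ q) \<le> norm ((1 + I om ^ 4) * k ^ q)"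
    unfolding real_norm_def abs_mult power_abs[of "I om"] power_abs[of "X om"] using x by (intro mult_mono) auto
  qed
 qed simp
 have Y: "(\<lambda>om. I om ^ p * X om ^ q) \<in> bm (sub J)" for p q by measurable
 have ge: "integrable M (\<lambda>om. I om ^ p * X om ^ q * D om ^ r)"
  "(\<integral>om. I om ^ p * X om ^ q * D om ^ r \<partial>M) = (\<integral>om. I om ^ p * X om ^ q \<partial>M) * (sqrt V ^ r * (\<integral>x. x ^ r \<partial>std_normal_distribution))"
  if "p \<le> 4" for p q r
  by (rule gauss_indep_expectation[OF sa gi Y ib[OF that]])+
 have s: "sf_int (S @ [e]) om ^ 4 = I om ^ 4 * X om ^ 0 * D om ^ 0 + 4 * (I om ^ 3 * X om ^ 1 * D om ^ 1) + 6 * (I om ^ 2 * X om ^ 2 * D om ^ 2)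
   + 4 * (I om ^ 1 * X om ^ 3 * D om ^ 3) + I om ^ 0 * X om ^ 4 * D om ^ 4" for om
 proof -
  have "sf_int (S @ [e]) om = I om + X om * D om" by (simp add: sf_int_def I_def e D)
  moreover have "(i + x * d) ^ 4 = i ^ 4 * x ^ 0 * d ^ 0 + 4 * (i ^ 3 * x ^ 1 * d ^ 1) + 6 * (i ^ 2 * x ^ 2 * d ^ 2)
   + 4 * (i ^ 1 * x ^ 3 * d ^ 3) + i ^ 0 * x ^ 4 * d ^ 4" for i x d :: real
   by (simp add: eval_nat_numeral algebra_simps)
  ultimately show ?thesis by simp
 qed
 have int: "integrable M (\<lambda>om. sf_int (S @ [e]) om ^ 4)"
  unfolding s by (intro bi_add integrable_mult_right ge) simp_all
 have "(\<integral>om. sf_int (S @ [e]) om ^ 4 \<partial>M) = (\<integral>om. I om ^ 4 \<partial>M) + 6 * ((\<integral>om. (I om)^2 * (X om)^2 \<partial>M) * V) + 3 * (\<integral>om. X om ^ 4 \<partial>M) * V^2"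
 proof -
  have "(\<integral>om. sf_int (S @ [e]) om ^ 4 \<partial>M) = (\<integral>om. I om ^ 4 * X om ^ 0 * D om ^ 0 \<partial>M)
    + 4 * (\<integral>om. I om ^ 3 * X om ^ 1 * D om ^ 1 \<partial>M) + 6 * (\<integral>om. I om ^ 2 * X om ^ 2 * D om ^ 2 \<partial>M)
    + 4 * (\<integral>om. I om ^ 1 * X om ^ 3 * D om ^ 3 \<partial>M) + (\<integral>om. I om ^ 0 * X om ^ 4 * D om ^ 4 \<partial>M)"
   unfolding s using ge(1)[of 4 0 0] ge(1)[of 3 1 1] ge(1)[of 2 2 2] ge(1)[of 1 3 3] ge(1)[of 0 4 4]
   by (simp del: power_0 power_one_right)
  also have "\<dots> = (\<integral>om. I om ^ 4 \<partial>M) + 6 * ((\<integral>om. (I om)^2 * (X om)^2 \<partial>M) * (sqrt V)^2) + (\<integral>om. X om ^ 4 \<partial>M) * (sqrt V ^ 4 * 3)"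
   using ge(2)[of 3 1 1] ge(2)[of 2 2 2] ge(2)[of 1 3 3] ge(2)[of 0 4 4]
   by (simp only: std_normal_moments) simp
  also have "(sqrt V)^2 = V" using V0 by simp
  also have "sqrt V ^ 4 = V^2" using V0 by (simp add: eval_nat_numeral)
  finally show ?thesis by simp
 qed
 also have "(\<integral>om. (I om)^2 * (X om)^2 \<partial>M) \<le> sqrt (\<integral>om. ((I om)^2)^2 \<partial>M) * sqrt (\<integral>om. ((X om)^2)^2 \<partial>M)"
  using ib[of 4 0] ib[of 0 4] by (intro cauchy_schwarz_nonneg) simp_all
 finally have "(\<integral>om. sf_int (S @ [e]) om ^ 4 \<partial>M)
   \<le> (\<integral>om. I om ^ 4 \<partial>M) + 6 * (sqrt (\<integral>om. I om ^ 4 \<partial>M) * sqrt (\<integral>om. X om ^ 4 \<partial>M) * V) + 3 * (\<integral>om. X om ^ 4 \<partial>M) * V^2"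
  using V0 by (simp add: mult_right_mono)
 \<comment> \<open>The cross term \<open>2 p (3 q V)\<close> matches the coefficient 6, and
   \<open>3 q^2 V^2\<close> is absorbed by \<open>(3 q V)^2\<close>.\<close>
 also have "\<dots> \<le> (sqrt (\<integral>om. I om ^ 4 \<partial>M) + 3 * (sqrt (\<integral>om. X om ^ 4 \<partial>M) * V))^2"
 proof -
  define p q where "p = sqrt (\<integral>om. I om ^ 4 \<partial>M)" and "q = sqrt (\<integral>om. X om ^ 4 \<partial>M)"
  have "(\<integral>om. I om ^ 4 \<partial>M) = p^2" "(\<integral>om. X om ^ 4 \<partial>M) = q^2" by (simp_all add: p_def q_def)
  moreover have "3 * q^2 * V^2 \<le> 9 * q^2 * V^2" by (intro mult_right_mono) auto
  ultimately show ?thesis by (simp add: power2_eq_square algebra_simps)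
 qed
 finally have "sqrt (\<integral>om. sf_int (S @ [e]) om ^ 4 \<partial>M) \<le> sqrt (\<integral>om. I om ^ 4 \<partial>M) + 3 * (sqrt (\<integral>om. X om ^ 4 \<partial>M) * V)"
  using V0 by (intro real_le_lsqrt) (auto intro!: integral_nonneg_AE)
 then show ?case using IH int by (simp add: e V_def)
qed

text \<open>Fatou's lemma along an almost surely convergent subsequence.\<close>

lemma fourth_moment_limit:
 assumes [measurable]: "\<And>n. Y n \<in> bm M" "I \<in> bm M"
  and lim: "(\<lambda>n. nn2 M (\<lambda>om. Y n om - I om)) ----> 0"
  and c: "\<And>n. (nni M (\<lambda>om. Y n om ^ 4)) \<le> c n" "c ----> c0"
 shows "nni M (\<lambda>om. I om ^ 4) \<le> c0"
proof -
 obtain r where r: "strict_mono r" and ae: "AE om in M. (\<lambda>n. Y (r n) om) ----> I om"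
  by (rule L2_limit_AE_subseq[OF _ _ lim]) simp_all
 have "nni M (\<lambda>om. I om ^ 4) = (\<integral>\<^sup>+om. liminf (\<lambda>n. ennreal (Y (r n) om ^ 4)) \<partial>M)"
 proof (rule nn_integral_cong_AE)
  show "AE om in M. ennreal (I om ^ 4) = liminf (\<lambda>n. ennreal (Y (r n) om ^ 4))"
   using ae
  proof eventually_elim
   case (elim om)
   then have "(\<lambda>n. ennreal (Y (r n) om ^ 4)) ----> ennreal (I om ^ 4)" by (intro tendsto_intros)
   then show ?case by (intro lim_imp_Liminf[symmetric]) auto
  qed
 qed
 also have "\<dots> \<le> liminf (\<lambda>n. nni M (\<lambda>om. Y (r n) om ^ 4))"
  by (rule nn_integral_liminf) simp
 also have "\<dots> \<le> liminf (\<lambda>n. c (r n))" using c(1) by (intro Liminf_mono) simp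
 also have "\<dots> = c0"
  using LIMSEQ_subseq_LIMSEQ[OF c(2) r] by (intro lim_imp_Liminf) (auto simp: comp_def)
 finally show ?thesis .
qed

end

section \<open>Discretisation of random fields\<close>

lemma sorted_wrt_concat:
 assumes "\<And>xs. xs \<in> set xss ==> sorted_wrt R xs"
  and "sorted_wrt (\<lambda>xs ys. \<forall>x\<in>set xs. \<forall>y\<in>set ys. R x y) xss"
 shows "sorted_wrt R (concat xss)"
 using assms by (induction xss) (auto simp: sorted_wrt_append)

lemma sorted_wrt_less_upto: "sorted_wrt (<) [i..j :: int]"
 using strict_sorted_iff[of "[i..j]"] by simp

definition cell :: "nat => int => real set" where
 "cell n k = {real_of_int k / real n<..(real_of_int k + 1) / real n}"

text \<open>Cells are open on the left and closed on the right, so the index is the ceiling minus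
  one, and the left endpoint \<open>gpt n s\<close> is strictly smaller than
  \<open>s\<close>.\<close>

definition gidx :: "nat => real => int" where "gidx n s = \<lceil>real n * s\<rceil> - 1"

definition gpt :: "nat => real => real" where "gpt n s = real_of_int (gidx n s) / real n"

lemma cell_iff: "0 < n ==> s \<in> cell n k \<longleftrightarrow> k = gidx n s"
proof -
 assume n: "0 < n"
 have "s \<in> cell n k \<longleftrightarrow> real_of_int k < real n * s \<and> real n * s \<le> real_of_int k + 1"
  using n by (simp add: cell_def field_simps)
 also have "\<dots> \<longleftrightarrow> \<lceil>real n * s\<rceil> = k + 1" by (simp add: ceiling_eq_iff)
 finally show ?thesis by (auto simp: gidx_def)
qed

lemma gpt_bounds: "0 < n ==> gpt n s < s" "0 < n ==> s \<le> gpt n s + 1 / real n"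
proof -
 assume n: "0 < n"
 then have "s \<in> cell n (gidx n s)" by (simp add: cell_iff)
 then show "gpt n s < s" "s \<le> gpt n s + 1 / real n"
  by (auto simp: cell_def gpt_def add_divide_distrib)
qed

lemma gpt_tendsto: "(\<lambda>n. gpt n s) ----> s"
proof (rule tendsto_sandwich[where f = "\<lambda>n. s - 1 / real n" and h = "\<lambda>_. s"])
 show "\<forall>\<^sub>F n in sequentially. s - 1 / real n \<le> gpt n s"
  using eventually_gt_at_top[of 0] by eventually_elim (use gpt_bounds(2)[of _ s] in \<open>auto simp: algebra_simps\<close>)
 show "\<forall>\<^sub>F n in sequentially. gpt n s \<le> s"
  using eventually_gt_at_top[of 0] by eventually_elim (use gpt_bounds(1)[of _ s] in \<open>auto intro: less_imp_le\<close>)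
 have "(\<lambda>n. s - 1 / real n) ----> s - 0" by (intro tendsto_diff tendsto_const lim_1_over_n)
 then show "(\<lambda>n. s - 1 / real n) ----> s" by simp
qed simp

lemma gpt_measurable [measurable]: "gpt n \<in> bm borel"
 unfolding gpt_def[abs_def] gidx_def by measurable

lemma cell_measure: "0 < n ==> emeasure lborel (cell n k) = ennreal (1 / real n)"
 unfolding cell_def by (subst emeasure_lborel_Ioc) (auto simp: field_simps intro!: arg_cong[where f = ennreal])

lemma cell_finite: "0 < n ==> cell n k \<in> finite_borel"
 using cell_measure[of n k] by (simp add: finite_borel_def) (simp add: cell_def)

definition cut :: "nat => real => real" where "cut m x = max (- real m) (min (real m) x)"

lemma cut: "\<bar>cut m x\<bar> \<le> real m" "\<bar>cut m x\<bar> \<le> \<bar>x\<bar>" "\<bar>cut m x - cut m y\<bar> \<le> \<bar>x - y\<bar>" "\<bar>x - cut m x\<bar> \<le> \<bar>x\<bar>"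
 by (auto simp: cut_def)

lemma cut_tendsto: "(\<lambda>m. cut m x) ----> x"
proof (rule tendsto_eventually)
 obtain N where N: "\<bar>x\<bar> \<le> real N" using real_arch_simple by blast
 show "\<forall>\<^sub>F m in sequentially. cut m x = x"
  using eventually_ge_at_top[of N] by eventually_elim (use N in \<open>auto simp: cut_def\<close>)
qed

lemma cut_measurable [measurable]: "cut m \<in> bm borel"
 unfolding cut_def[abs_def] by measurable

lemma cut_cont: "isCont (cut m) x"
 unfolding cut_def[abs_def] by (intro continuous_intros)

definition bump :: "nat => real => real" where "bump m s = max 0 (min 1 (real m + 1 - \<bar>s\<bar>))"

lemma bump: "0 \<le> bump m s" "bump m s \<le> 1" "bump m s \<noteq> 0 ==> \<bar>s\<bar> \<le> real m + 1" "\<bar>s\<bar> \<le> real m ==> bump m s = 1"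
 by (auto simp: bump_def)

lemma bump_cont: "isCont (bump m) x"
 unfolding bump_def[abs_def] by (intro continuous_intros)

text \<open>Height and support are truncated by continuous functions, so that continuity points of
  \<open>g\<close> remain continuity points; the convergence of values at grid corners depends on
  this.\<close>

definition trunc :: "(real \<times> real => real) => nat => real \<times> real => real" where
 "trunc g m p = cut m (g p) * (bump m (fst p) * bump m (snd p))"

lemma trunc:
 "\<bar>trunc g m p\<bar> \<le> real m" "\<bar>trunc g m p\<bar> \<le> \<bar>g p\<bar>" "\<bar>g p - trunc g m p\<bar> \<le> \<bar>g p\<bar>"
 "trunc g m p \<noteq> 0 ==> g p \<noteq> 0 \<and> \<bar>fst p\<bar> \<le> real m + 1 \<and> \<bar>snd p\<bar> \<le> real m + 1"
proof -
 define b where "b = bump m (fst p) * bump m (snd p)"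
 have b: "0 \<le> b" "b \<le> 1" unfolding b_def using bump by (auto intro: mult_le_one)
 have t: "trunc g m p = cut m (g p) * b" by (simp add: trunc_def b_def)
 have "\<bar>cut m (g p)\<bar> * b \<le> \<bar>cut m (g p)\<bar> * 1" using b by (intro mult_left_mono) auto
 then have le: "\<bar>trunc g m p\<bar> \<le> \<bar>cut m (g p)\<bar>" using b by (simp add: t abs_mult)
 show "\<bar>trunc g m p\<bar> \<le> real m" "\<bar>trunc g m p\<bar> \<le> \<bar>g p\<bar>"
  using le cut(1)[of m "g p"] cut(2)[of m "g p"] by linarith+
 show "\<bar>g p - trunc g m p\<bar> \<le> \<bar>g p\<bar>"
 proof (cases "0 \<le> g p")
  case True
  then have "0 \<le> cut m (g p)" by (simp add: cut_def)
  then have "0 \<le> trunc g m p" using b by (simp add: t)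
  then show ?thesis using True le cut(2)[of m "g p"] by linarith
 next
  case False
  then have "cut m (g p) \<le> 0" by (simp add: cut_def)
  then have "trunc g m p \<le> 0" using b by (simp add: t mult_nonpos_nonneg)
  then show ?thesis using False le cut(2)[of m "g p"] by linarith
 qed
 show "trunc g m p \<noteq> 0 ==> g p \<noteq> 0 \<and> \<bar>fst p\<bar> \<le> real m + 1 \<and> \<bar>snd p\<bar> \<le> real m + 1"
  using bump(3) by (auto simp: trunc_def cut_def)
qed

lemma trunc_cont: "isCont g p ==> isCont (trunc g m) p"
 unfolding trunc_def[abs_def]
 by (intro continuous_intros isCont_o2[OF _ cut_cont] isCont_o2[OF _ bump_cont])

lemma trunc_tendsto: "(\<lambda>m. trunc g m p) ----> g p"
proof -
 obtain N where N: "max \<bar>fst p\<bar> \<bar>snd p\<bar> \<le> real N" using real_arch_simple by blast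
 have "\<forall>\<^sub>F m in sequentially. cut m (g p) = trunc g m p"
  using eventually_ge_at_top[of N]
  by eventually_elim (use N bump(4) in \<open>auto simp: trunc_def\<close>)
 then show ?thesis using cut_tendsto by (rule Lim_transform_eventually[rotated])
qed

lemma trunc_measurable [measurable]:
 assumes [measurable]: "g \<in> bm borel"
 shows "trunc g m \<in> bm borel"
proof -
 have [measurable]: "bump m \<in> bm borel"
  unfolding bump_def[abs_def] by measurable
 have [measurable]: "fst \<in> bm (borel :: (real \<times> real) measure)" "snd \<in> bm (borel :: (real \<times> real) measure)"
  by (auto simp: borel_prod[symmetric])
 show ?thesis unfolding trunc_def[abs_def] by measurable
qed

context wnoise
begin

text \<open>Time is the outer loop, which sorts the list with respect to \<open>after\<close>. Time
  cells start with index 1: the kernels in use vanish at times up to 0, hence at the left endpoint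
  of cell 0, and coefficients can be read one cell earlier.\<close>

definition grid :: "nat => int => (int => int => 'a => real) => 'a simple_field" where
 "grid n N v = concat (map (\<lambda>k. map (\<lambda>l. (v k l, real_of_int k / real n, (real_of_int k + 1) / real n, cell n l)) [-N..N]) [1..N])"

lemma grid_sum: "(\<Sum>e\<leftarrow>grid n N v. (f e :: real))
 = (\<Sum>k\<in>{1..N}. \<Sum>l\<in>{-N..N}. f (v k l, real_of_int k / real n, (real_of_int k + 1) / real n, cell n l))"
proof -
 have c: "sum_list (map f (concat xss)) = (\<Sum>xs\<leftarrow>xss. \<Sum>x\<leftarrow>xs. f x)" for xss
  by (induction xss) auto
 show ?thesis unfolding grid_def c
  by (simp add: comp_def interv_sum_list_conv_sum_set_int)
qed

lemma grid_eval:
 assumes n: "0 < n"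
 shows "simple_field_eval (grid n N v) (om, s, y)
  = (if gidx n s \<in> {1..N} \<and> gidx n y \<in> {-N..N} then v (gidx n s) (gidx n y) om else 0)"
proof -
 have i: "indicator {real_of_int k / real n<..(real_of_int k + 1) / real n} s = (if k = gidx n s then 1 else 0 :: real)" for k s
  using cell_iff[OF n, of s k] by (auto simp: cell_def indicator_def)
 have "simple_field_eval (grid n N v) (om, s, y)
  = (\<Sum>k\<in>{1..N}. \<Sum>l\<in>{-N..N}. v k l om * (if k = gidx n s then 1 else 0) * (if l = gidx n y then 1 else 0))"
  unfolding simple_field_eval_ev grid_sum ev.simps cell_def i ..
 also have "\<dots> = (\<Sum>k\<in>{1..N}. if k = gidx n s then (if gidx n y \<in> {-N..N} then v k (gidx n y) om else 0) else 0)"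
  by (intro sum.cong refl) (auto simp: sum.delta' if_distrib cong: if_cong)
 also have "\<dots> = (if gidx n s \<in> {1..N} \<and> gidx n y \<in> {-N..N} then v (gidx n s) (gidx n y) om else 0)"
  by (auto simp: sum.delta')
 finally show ?thesis .
qed

lemma grid_sorted:
 assumes n: "0 < n"
 shows "sorted_wrt after (grid n N v)"
 unfolding grid_def
proof (rule sorted_wrt_concat)
 have "cell n l \<inter> cell n l' = {}" if "l < l'" for l l' using cell_iff[OF n] that by auto
 then have "sorted_wrt after (map (\<lambda>l. (v k l, real_of_int k / real n, (real_of_int k + 1) / real n, cell n l)) [-N..N])" for k
  unfolding sorted_wrt_map by (intro sorted_wrt_mono_rel[OF _ sorted_wrt_less_upto]) auto
 then show "sorted_wrt after xs"
  if "xs \<in> set (map (\<lambda>k. map (\<lambda>l. (v k l, real_of_int k / real n, (real_of_int k + 1) / real n, cell n l)) [-N..N]) [1..N])" for xs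
  using that by auto
 have "(real_of_int k + 1) / real n \<le> real_of_int k' / real n" if "k < k'" for k k'
  using n that by (intro divide_right_mono) auto
 then show "sorted_wrt (\<lambda>xs ys. \<forall>x\<in>set xs. \<forall>y\<in>set ys. after x y)
  (map (\<lambda>k. map (\<lambda>l. (v k l, real_of_int k / real n, (real_of_int k + 1) / real n, cell n l)) [-N..N]) [1..N])"
  unfolding sorted_wrt_map by (intro sorted_wrt_mono_rel[OF _ sorted_wrt_less_upto]) auto
qed

end

section \<open>Admissible fields, kernels and their grid fields\<close>

context wnoise
begin

lemma PP_swap: "f \<in> bm PP ==> (\<integral>\<^sup>+z. f z \<partial>PP) = (\<integral>\<^sup>+p. \<integral>\<^sup>+om. f (om, p) \<partial>M \<partial>lborel)"
proof -
 interpret L: pair_sigma_finite M "lborel :: (real \<times> real) measure" ..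
 assume "f \<in> bm PP"
 then show ?thesis using L.nn_integral_snd[of f] by (simp add: PP_def)
qed

lemma PP_section: "f \<in> bm PP ==> (\<lambda>p. \<integral>\<^sup>+om. f (om, p) \<partial>M) \<in> bm lborel"
proof -
 interpret L: pair_sigma_finite M "lborel :: (real \<times> real) measure" ..
 assume "f \<in> bm PP"
 then have "(\<lambda>(p, om). f (om, p)) \<in> bm (lborel \<Otimes>\<^sub>M M)"
  unfolding PP_def by (subst (asm) measurable_pair_swap_iff) simp
 then show ?thesis by (rule borel_measurable_nn_integral)
qed

lemma second_of_fourth:
 assumes [measurable]: "X \<in> bm M" and c: "0 \<le> c" and X: "nni M (\<lambda>om. X om ^ 4) \<le> ennreal (c^2)"
 shows "integrable M (\<lambda>om. X om ^ 4)" "(\<integral>om. X om ^ 4 \<partial>M) \<le> c^2" "nn2 M (\<lambda>om. X om) \<le> ennreal c"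
proof -
 show i: "integrable M (\<lambda>om. X om ^ 4)"
  using X le_less_trans[of _ "ennreal (c^2)" \<infinity>] by (intro integrableI_bounded) auto
 have "ennreal (\<integral>om. X om ^ 4 \<partial>M) \<le> ennreal (c^2)" using X i by (subst nn_integral_eq_integral[symmetric]) auto
 then show le: "(\<integral>om. X om ^ 4 \<partial>M) \<le> c^2" by (simp add: ennreal_le_iff)
 have i2: "integrable M (\<lambda>om. ((X om)^2)^2)" using i by simp
 note cs = cauchy_schwarz_nonneg[of "\<lambda>om. (X om)^2" M "\<lambda>_. 1", OF _ _ _ _ i2]
 have "(\<integral>om. (X om)^2 \<partial>M) \<le> sqrt (\<integral>om. X om ^ 4 \<partial>M)" using cs(2) by (simp add: prob_space)
 also have "\<dots> \<le> sqrt (c^2)" using le by (rule real_sqrt_le_mono)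
 finally have "(\<integral>om. (X om)^2 \<partial>M) \<le> c" using c by simp
 moreover have "integrable M (\<lambda>om. (X om)^2)" using cs(1) by simp
 ultimately show "nn2 M (\<lambda>om. X om) \<le> ennreal c"
  by (subst nn_integral_eq_integral) (auto intro: ennreal_leI)
qed

text \<open>\<open>\<phi>\<close> bounds the squared L4 norm of \<open>h\<close>. It is continuous
  because Riemann sums of \<open>\<phi>\<close> times a squared kernel have to converge, whereas
  continuity of the field is asked in L2.\<close>

definition adm :: "real => (real \<times> real => real) => (real => real => 'a => real) => bool" where
 "adm T \<phi> h \<longleftrightarrow> (\<lambda>(om, s, y). h s y om) \<in> bm PP \<and>
  (\<forall>s\<ge>0. \<forall>y. h s y \<in> bm M) \<and>
  continuous_on UNIV \<phi> \<and> (\<forall>p. 0 \<le> \<phi> p) \<and>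
  (\<forall>s\<in>{0..T}. \<forall>y. (nni M (\<lambda>om. h s y om ^ 4)) \<le> ennreal ((\<phi> (s, y))^2)) \<and>
  (\<forall>s\<in>{0..T}. \<forall>y S Y. (\<forall>n::nat. S n \<in> {0..T}) \<and> S ----> s \<and> Y ----> y \<longrightarrow>
   (\<lambda>n. nn2 M (\<lambda>om. h (S n) (Y n) om - h s y om)) ----> 0)"

text \<open>\<open>\<Gamma>\<close> bounds the integral that controls the squared L4 norm of the
  stochastic integral of \<open>h\<close> times \<open>g\<close>.\<close>

definition kern :: "real => (real \<times> real => real) => (real \<times> real => real) => real => bool" where
 "kern T \<phi> g \<Gamma> \<longleftrightarrow> g \<in> bm borel \<and> (AE p in lborel. isCont g p) \<and>
  (\<forall>p. g p \<noteq> 0 \<longrightarrow> 0 < fst p \<and> fst p \<le> T) \<and> 0 \<le> \<Gamma> \<and>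
  nni lborel (\<lambda>p. \<phi> p * (g p)^2) \<le> ennreal \<Gamma>"

text \<open>The kernel is evaluated at the left corner of the cell, the field one mesh width
  earlier: values of the solution at a time strictly before \<open>k / n\<close> are known from the
  raw past at \<open>k / n\<close>. The cut makes the entry bounded.\<close>

definition gval :: "(real => real => 'a => real) => (real \<times> real => real) => nat => nat => int => int => 'a => real" where
 "gval h g m n k l om = cut n (h (max 0 (real_of_int k / real n - 1 / real n)) (real_of_int l / real n) om)
   * trunc g m (real_of_int k / real n, real_of_int l / real n)"

definition gfield :: "(real => real => 'a => real) => (real \<times> real => real) => nat => nat => 'a simple_field" where
 "gfield h g m n = grid n (int ((m + 1) * n)) (gval h g m n)"

lemma gidx_range:
 assumes n: "0 < n" and t: "trunc g m (gpt n s, gpt n y) \<noteq> 0" and g: "\<And>p. g p \<noteq> 0 ==> 0 < fst p"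
 shows "gidx n s \<in> {1..int ((m + 1) * n)} \<and> gidx n y \<in> {- int ((m + 1) * n)..int ((m + 1) * n)}"
proof -
 have b: "g (gpt n s, gpt n y) \<noteq> 0" "\<bar>gpt n s\<bar> \<le> real m + 1" "\<bar>gpt n y\<bar> \<le> real m + 1"
  using trunc(4)[OF t] by auto
 have "0 < gpt n s" using g[OF b(1)] by simp
 then have 1: "0 < gidx n s" using n by (simp add: gpt_def zero_less_divide_iff)
 have "real_of_int \<bar>gidx n s\<bar> \<le> (real m + 1) * real n" "real_of_int \<bar>gidx n y\<bar> \<le> (real m + 1) * real n"
  using b n by (simp_all add: gpt_def abs_divide field_simps)
 then have "real_of_int \<bar>gidx n s\<bar> \<le> real_of_int (int ((m + 1) * n))" "real_of_int \<bar>gidx n y\<bar> \<le> real_of_int (int ((m + 1) * n))"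
  by (simp_all add: algebra_simps)
 then have "\<bar>gidx n s\<bar> \<le> int ((m + 1) * n)" "\<bar>gidx n y\<bar> \<le> int ((m + 1) * n)"
  by (simp_all only: of_int_le_iff)
 then show ?thesis using 1 by auto
qed

lemma gfield_eval:
 assumes n: "0 < n" and g: "\<And>p. g p \<noteq> 0 ==> 0 < fst p"
 shows "simple_field_eval (gfield h g m n) (om, s, y)
  = cut n (h (max 0 (gpt n s - 1 / real n)) (gpt n y) om) * trunc g m (gpt n s, gpt n y)"
proof (cases "trunc g m (gpt n s, gpt n y) = 0")
 case True
 then show ?thesis unfolding gfield_def grid_eval[OF n] by (simp add: gval_def gpt_def)
next
 case False
 from gidx_range[OF n this g] show ?thesis
  unfolding gfield_def grid_eval[OF n] by (simp add: gval_def gpt_def)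
qed

lemma gfield_nvalid:
 assumes n: "0 < n" and h: "adm T \<phi> h" and g: "kern T \<phi> g \<Gamma>"
  and ad: "\<And>s' s y y'. 0 \<le> s' ==> s' < s ==> g (s, y') \<noteq> 0 ==> h s' y \<in> bm (sub (upto_time s))"
  and e: "e \<in> set (gfield h g m n)"
 shows "nvalid e"
proof -
 obtain k l where kl: "k \<in> {1..int ((m + 1) * n)}"
  "e = (gval h g m n k l, real_of_int k / real n, (real_of_int k + 1) / real n, cell n l)"
  using e by (auto simp: gfield_def grid_def)
 let ?t = "trunc g m (real_of_int k / real n, real_of_int l / real n)"
 have k: "1 \<le> real_of_int k" using kl by simp
 have "gval h g m n k l \<in> bm (sub (upto_time (real_of_int k / real n)))"
 proof (cases "?t = 0")
  case True
  then have "gval h g m n k l = (\<lambda>_. 0)" by (simp add: gval_def fun_eq_iff)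
  then show ?thesis by simp
 next
  case False
  have "h (max 0 (real_of_int k / real n - 1 / real n)) (real_of_int l / real n) \<in> bm (sub (upto_time (real_of_int k / real n)))"
  proof (rule ad)
   show "max 0 (real_of_int k / real n - 1 / real n) < real_of_int k / real n" using k n by auto
   show "g (real_of_int k / real n, real_of_int l / real n) \<noteq> 0" using trunc(4)[OF False] by simp
  qed simp
  from measurable_compose[OF this cut_measurable]
  have "(\<lambda>om. cut n (h (max 0 (real_of_int k / real n - 1 / real n)) (real_of_int l / real n) om) * ?t)
   \<in> bm (sub (upto_time (real_of_int k / real n)))" by simp
  then show ?thesis unfolding gval_def[abs_def] .
 qed
 moreover have "bounded (gval h g m n k l ` space M)"
 proof -
  have "\<bar>gval h g m n k l om\<bar> \<le> real n * real m" for om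
   unfolding gval_def abs_mult by (intro mult_mono cut trunc) auto
  then show ?thesis by (auto simp: bounded_iff)
 qed
 ultimately show ?thesis using k n cell_finite[OF n] by (simp add: kl divide_right_mono)
qed

lemma fst_borel [measurable]: "fst \<in> bm (borel :: (real \<times> real) measure)"
 and snd_borel [measurable]: "snd \<in> bm (borel :: (real \<times> real) measure)"
 by (auto simp: borel_prod[symmetric])

text \<open>The weights are dominated by a Riemann sum of \<open>\<phi>\<close> times the squared
  truncated kernel. Written as the integral of a step function, it becomes accessible to dominated
  convergence.\<close>

lemma gfield_weight:
 assumes n: "0 < n" and h: "adm T \<phi> h" and g: "kern T \<phi> g \<Gamma>"
 shows "ennreal (\<Sum>e\<leftarrow>gfield h g m n. weight e)
  \<le> nni lborel (\<lambda>p. \<phi> (max 0 (gpt n (fst p) - 1 / real n), gpt n (snd p)) * (trunc g m (gpt n (fst p), gpt n (snd p)))^2)"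
proof -
 have phi: "0 \<le> \<phi> p" for p using h unfolding adm_def by blast
 let ?N = "int ((m + 1) * n)"
 let ?t = "\<lambda>k l. trunc g m (real_of_int k / real n, real_of_int l / real n)"
 let ?c = "\<lambda>k l. \<phi> (max 0 (real_of_int k / real n - 1 / real n), real_of_int l / real n) * (?t k l)^2"
 have c0: "0 \<le> ?c k l" for k l using phi by simp
 have w: "weight (gval h g m n k l, real_of_int k / real n, (real_of_int k + 1) / real n, cell n l)
  \<le> ?c k l * (1 / real n * (1 / real n))" if "k \<in> {1..?N}" for k l
 proof -
  let ?h = "h (max 0 (real_of_int k / real n - 1 / real n)) (real_of_int l / real n)"
  let ?p = "\<phi> (max 0 (real_of_int k / real n - 1 / real n), real_of_int l / real n)"
  have "sqrt (\<integral>om. gval h g m n k l om ^ 4 \<partial>M) \<le> ?c k l"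
  proof (cases "?t k l = 0")
   case True
   then show ?thesis by (simp add: gval_def)
  next
   case False
   have "real_of_int k / real n \<le> T" using trunc(4)[OF False] g by (auto simp: kern_def)
   moreover have "0 \<le> 1 / real n" "0 \<le> real_of_int k / real n" using that by simp_all
   ultimately have "max 0 (real_of_int k / real n - 1 / real n) \<in> {0..T}"
    unfolding atLeastAtMost_iff by linarith
   then have H: "nni M (\<lambda>om. ?h om ^ 4) \<le> ennreal (?p^2)" and [measurable]: "?h \<in> bm M"
    using h by (auto simp: adm_def)
   note s = second_of_fourth[OF _ phi H]
   have le: "gval h g m n k l om ^ 4 \<le> ?h om ^ 4 * (?t k l) ^ 4" for om
   proof -
    have "\<bar>gval h g m n k l om\<bar> \<le> \<bar>?h om * ?t k l\<bar>"
     unfolding gval_def abs_mult by (intro mult_right_mono cut) auto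
    from power_mono[OF this, of 4] show ?thesis by (simp add: power_mult_distrib[symmetric] power_even_abs)
   qed
   have "(\<integral>om. gval h g m n k l om ^ 4 \<partial>M) \<le> (\<integral>om. ?h om ^ 4 * (?t k l) ^ 4 \<partial>M)"
    by (intro integral_mono' integrable_mult_left s(1)) (auto intro: le)
   also have "\<dots> \<le> ?p^2 * (?t k l) ^ 4"
    using s(2) by (simp add: mult_right_mono)
   also have "\<dots> = (?c k l)^2" by (simp add: power_mult_distrib)
   finally have "sqrt (\<integral>om. gval h g m n k l om ^ 4 \<partial>M) \<le> sqrt ((?c k l)^2)" by (rule real_sqrt_le_mono)
   then show ?thesis using c0[of k l] by simp
  qed
  moreover have "measure lborel (cell n l) = 1 / real n" using cell_measure[OF n, of l] by (simp add: measure_def)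
  moreover have "(real_of_int k + 1) / real n - real_of_int k / real n = 1 / real n" by (simp add: add_divide_distrib)
  moreover have "0 \<le> 1 / real n * (1 / real n)" by simp
  ultimately show ?thesis unfolding weight.simps by (simp only: mult_right_mono)
 qed
 have "(\<Sum>e\<leftarrow>gfield h g m n. weight e) \<le> (\<Sum>k\<in>{1..?N}. \<Sum>l\<in>{-?N..?N}. ?c k l * (1 / real n * (1 / real n)))"
  unfolding gfield_def grid_sum by (intro sum_mono w)
 then have "ennreal (\<Sum>e\<leftarrow>gfield h g m n. weight e) \<le> ennreal (\<Sum>k\<in>{1..?N}. \<Sum>l\<in>{-?N..?N}. ?c k l * (1 / real n * (1 / real n)))"
  by (rule ennreal_leI)
 also have "\<dots> = (\<Sum>k\<in>{1..?N}. \<Sum>l\<in>{-?N..?N}. ennreal (?c k l) * (ennreal (1 / real n) * ennreal (1 / real n)))"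
 proof -
  have n0: "0 \<le> 1 / real n" by simp
  have "ennreal (?c k l) * (ennreal (1 / real n) * ennreal (1 / real n)) = ennreal (?c k l * (1 / real n * (1 / real n)))" for k l
   by (simp only: ennreal_mult[OF c0[of k l] mult_nonneg_nonneg[OF n0 n0]] ennreal_mult[OF n0 n0])
  moreover have "0 \<le> ?c k l * (1 / real n * (1 / real n))" for k l
   by (intro mult_nonneg_nonneg c0 n0)
  ultimately show ?thesis by (simp only: sum_ennreal sum_nonneg)
 qed
 also have "\<dots> = (\<Sum>k\<in>{1..?N}. \<Sum>l\<in>{-?N..?N}. \<integral>\<^sup>+p. ennreal (?c k l) * indicator (cell n k \<times> cell n l) p \<partial>lborel)"
 proof (intro sum.cong refl)
  fix k l
  have b: "cell n k \<in> sets borel" "cell n l \<in> sets borel" by (simp_all add: cell_def)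
  have "emeasure lborel (cell n k \<times> cell n l) = ennreal (1 / real n) * ennreal (1 / real n)"
   unfolding lborel_prod[symmetric] using b cell_measure[OF n]
   by (subst lborel.emeasure_pair_measure_Times) auto
  moreover have "cell n k \<times> cell n l \<in> sets lborel"
   using b unfolding lborel_prod[symmetric] by (intro pair_measureI) auto
  ultimately show "ennreal (?c k l) * (ennreal (1 / real n) * ennreal (1 / real n))
   = (\<integral>\<^sup>+p. ennreal (?c k l) * indicator (cell n k \<times> cell n l) p \<partial>lborel)"
   by (simp add: nn_integral_cmult_indicator)
 qed
 also have "\<dots> = (\<integral>\<^sup>+p. (\<Sum>k\<in>{1..?N}. \<Sum>l\<in>{-?N..?N}. ennreal (?c k l) * indicator (cell n k \<times> cell n l) p) \<partial>lborel)"
 proof -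
  have [measurable]: "cell n k \<times> cell n l \<in> sets borel" for k l
   unfolding cell_def[of n k] by (rule rect_measure(1)) (simp add: cell_def)
  have m: "(\<lambda>p. ennreal (?c k l) * indicator (cell n k \<times> cell n l) p) \<in> bm lborel" for k l
   by (intro borel_measurable_times_ennreal borel_measurable_const borel_measurable_indicator) simp
  have "(\<integral>\<^sup>+p. (\<Sum>k\<in>{1..?N}. \<Sum>l\<in>{-?N..?N}. ennreal (?c k l) * indicator (cell n k \<times> cell n l) p) \<partial>lborel)
   = (\<Sum>k\<in>{1..?N}. \<integral>\<^sup>+p. (\<Sum>l\<in>{-?N..?N}. ennreal (?c k l) * indicator (cell n k \<times> cell n l) p) \<partial>lborel)"
   by (intro nn_integral_sum borel_measurable_sum m)
  also have "\<dots> = (\<Sum>k\<in>{1..?N}. \<Sum>l\<in>{-?N..?N}. \<integral>\<^sup>+p. ennreal (?c k l) * indicator (cell n k \<times> cell n l) p \<partial>lborel)"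
   by (intro sum.cong refl nn_integral_sum m)
  finally show ?thesis ..
 qed
 also have "\<dots> \<le> nni lborel (\<lambda>p. \<phi> (max 0 (gpt n (fst p) - 1 / real n), gpt n (snd p)) * (trunc g m (gpt n (fst p), gpt n (snd p)))^2)"
 proof (intro nn_integral_mono)
  fix p :: "real \<times> real"
  have i: "indicator (cell n k \<times> cell n l) p = (if k = gidx n (fst p) then if l = gidx n (snd p) then 1 else 0 else 0 :: ennreal)" for k l
   using cell_iff[OF n] by (cases p) (auto simp: indicator_def)
  have "(\<Sum>k\<in>{1..?N}. \<Sum>l\<in>{-?N..?N}. ennreal (?c k l) * indicator (cell n k \<times> cell n l) p)
   = (\<Sum>k\<in>{1..?N}. if k = gidx n (fst p) then (if gidx n (snd p) \<in> {-?N..?N} then ennreal (?c k (gidx n (snd p))) else 0) else 0)"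
  proof (intro sum.cong refl)
   fix k
   show "(\<Sum>l\<in>{-?N..?N}. ennreal (?c k l) * indicator (cell n k \<times> cell n l) p)
    = (if k = gidx n (fst p) then (if gidx n (snd p) \<in> {-?N..?N} then ennreal (?c k (gidx n (snd p))) else 0) else 0)"
   proof (cases "k = gidx n (fst p)")
    case True
    then have "(\<Sum>l\<in>{-?N..?N}. ennreal (?c k l) * indicator (cell n k \<times> cell n l) p)
     = (\<Sum>l\<in>{-?N..?N}. if l = gidx n (snd p) then ennreal (?c k l) else 0)"
     unfolding i by (intro sum.cong refl) simp
    then show ?thesis using True by (simp only: sum.delta finite_atLeastAtMost_int simp_thms if_True)
   next
    case False
    then have "ennreal (?c k l) * indicator (cell n k \<times> cell n l) p = 0" for l unfolding i by simp
    then show ?thesis using False by (simp only: sum.neutral_const if_False)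
   qed
  qed
  also have "\<dots> \<le> ennreal (?c (gidx n (fst p)) (gidx n (snd p)))"
   by (auto simp: sum.delta')
  finally show "(\<Sum>k\<in>{1..?N}. \<Sum>l\<in>{-?N..?N}. ennreal (?c k l) * indicator (cell n k \<times> cell n l) p)
   \<le> ennreal (\<phi> (max 0 (gpt n (fst p) - 1 / real n), gpt n (snd p)) * (trunc g m (gpt n (fst p), gpt n (snd p)))^2)"
   by (simp add: gpt_def)
 qed
 finally show ?thesis .
qed

end

section \<open>Convergence of the grid fields\<close>

context wnoise
begin

lemma adm_meas: "adm T \<phi> h ==> 0 \<le> s ==> h s y \<in> bm M"
 unfolding adm_def by blast

lemma adm_cont:
 fixes S Y :: "nat => real"
 shows "adm T \<phi> h ==> s \<in> {0..T} ==> (\<And>n. S n \<in> {0..T}) ==> S ----> s ==> Y ----> y ==>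
  (\<lambda>n. nn2 M (\<lambda>om. h (S n) (Y n) om - h s y om)) ----> 0"
 unfolding adm_def by simp

lemma adm_second:
 assumes h: "adm T \<phi> h" and s: "s \<in> {0..T}"
 shows "nn2 M (\<lambda>om. h s y om) \<le> ennreal (\<phi> (s, y))"
proof (rule second_of_fourth(3))
 show "h s y \<in> bm M" "0 \<le> \<phi> (s, y)" "nni M (\<lambda>om. h s y om ^ 4) \<le> ennreal ((\<phi> (s, y))^2)"
  using h s unfolding adm_def by auto
qed

text \<open>Three errors are separated: moving the arguments of \<open>h\<close> (continuity in L2),
  cutting its values (dominated convergence) and moving the arguments of the kernel (continuity at
  the point).\<close>

lemma gfield_pointwise:
 assumes h: "adm T \<phi> h" and g: "kern T \<phi> g \<Gamma>" and c: "isCont g (s, y)"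
 shows "(\<lambda>j. nn2 M (\<lambda>om. simple_field_eval (gfield h g m (Suc j)) (om, s, y) - h s y om * trunc g m (s, y)))
  ----> 0"
proof -
 have gp: "g p \<noteq> 0 ==> 0 < fst p \<and> fst p \<le> T" for p using g unfolding kern_def by blast
 have gp1: "g p \<noteq> 0 ==> 0 < fst p" for p using gp by blast
 have E: "simple_field_eval (gfield h g m (Suc j)) (om, s, y)
  = cut (Suc j) (h (max 0 (gpt (Suc j) s - 1 / real (Suc j))) (gpt (Suc j) y) om) * trunc g m (gpt (Suc j) s, gpt (Suc j) y)" for j om
  by (rule gfield_eval[OF zero_less_Suc gp1])
 let ?q = "\<lambda>j. (gpt (Suc j) s, gpt (Suc j) y)"
 have ql: "(\<lambda>j. gpt (Suc j) s) ----> s" "(\<lambda>j. gpt (Suc j) y) ----> y"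
  using LIMSEQ_Suc[OF gpt_tendsto] by blast+
 have tz: "trunc g m p = 0" if "g p = 0" for p using trunc(4)[of g m p] that by blast
 consider "s \<le> 0" | "T < s" | "0 < s" "s \<le> T" by linarith
 then show ?thesis
 proof cases
  case 1
  have "g (s, y) = 0" "g (?q j) = 0" for j
   using gp[of "(s, y)"] gp[of "?q j"] 1 gpt_bounds(1)[of "Suc j" s] by auto
  then show ?thesis unfolding E by (simp add: tz)
 next
  \<comment> \<open>Once the mesh is fine enough, the left corner also exceeds \<open>T\<close>, and
    both kernel values vanish.\<close>
  case 2
  have "\<forall>\<^sub>F j in sequentially. T < gpt (Suc j) s" by (rule order_tendstoD(1)[OF ql(1) 2])
  then have "\<forall>\<^sub>F j in sequentially. (nn2 M (\<lambda>om. simple_field_eval (gfield h g m (Suc j)) (om, s, y) - h s y om * trunc g m (s, y))) = 0"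
  proof eventually_elim
   case (elim j)
   have "g (s, y) = 0" "g (?q j) = 0" using gp[of "(s, y)"] gp[of "?q j"] 2 elim by auto
   then show ?case unfolding E by (simp add: tz)
  qed
  then show ?thesis by (rule tendsto_eventually)
 next
  case 3
  define a where "a j = max 0 (gpt (Suc j) s - 1 / real (Suc j))" for j
  define b where "b j = gpt (Suc j) y" for j
  have al: "a ----> s"
  proof -
   have "(\<lambda>j. max 0 (gpt (Suc j) s - 1 / real (Suc j))) ----> max 0 (s - 0)"
    by (intro tendsto_intros ql LIMSEQ_Suc[OF lim_1_over_n])
   then show ?thesis using 3 by (simp add: a_def[abs_def] max_def)
  qed
  have aT: "a j \<in> {0..T}" for j
  proof -
   have "gpt (Suc j) s < s" by (rule gpt_bounds) simp
   moreover have "0 \<le> 1 / real (Suc j)" by simp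
   ultimately show ?thesis using 3 unfolding a_def atLeastAtMost_iff by linarith
  qed
  have sT: "s \<in> {0..T}" using 3 by simp
  have hm[measurable]: "h (a j) (b j) \<in> bm M" "h s y \<in> bm M" for j
   using aT[of j] 3 by (auto intro!: adm_meas[OF h])
  have L1: "(\<lambda>j. nn2 M (\<lambda>om. h (a j) (b j) om - h s y om)) ----> 0"
   by (rule adm_cont[OF h sT aT al]) (simp add: b_def[abs_def] ql(2))
  have H2: "nn2 M (\<lambda>om. h s y om) < \<infinity>"
   using adm_second[OF h sT, of y] by (rule le_less_trans) simp
  have L2: "(\<lambda>j. nn2 M (\<lambda>om. cut (Suc j) (h s y om) - h s y om)) ----> (\<integral>\<^sup>+om. 0 \<partial>M)"
  proof (rule nn_integral_dominated_convergence[where w = "\<lambda>om. ennreal ((h s y om)^2)"])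
   show "AE om in M. ennreal ((cut (Suc j) (h s y om) - h s y om)^2) \<le> ennreal ((h s y om)^2)" for j
   proof -
    have "(cut (Suc j) x - x)^2 \<le> x^2" for x
     using cut(4)[of x "Suc j"] by (simp add: abs_le_square_iff[symmetric] abs_minus_commute)
    then show ?thesis by (simp add: ennreal_leI)
   qed
   have "(\<lambda>j. ennreal ((cut (Suc j) x - x)^2)) ----> ennreal ((x - x)^2)" for x
    by (intro tendsto_intros LIMSEQ_Suc[OF cut_tendsto])
   then show "AE om in M. (\<lambda>j. ennreal ((cut (Suc j) (h s y om) - h s y om)^2)) ----> 0" by simp
  qed (use H2 in simp_all)
  have L1': "(\<lambda>j. nn2 M (\<lambda>om. cut (Suc j) (h (a j) (b j) om) - cut (Suc j) (h s y om))) ----> 0"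
  proof (rule tendsto_sandwich[OF _ _ tendsto_const L1])
   show "\<forall>\<^sub>F j in sequentially. (nn2 M (\<lambda>om. cut (Suc j) (h (a j) (b j) om) - cut (Suc j) (h s y om)))
    \<le> nn2 M (\<lambda>om. h (a j) (b j) om - h s y om)"
    by (intro always_eventually allI nn_integral_mono ennreal_leI) (simp add: abs_le_square_iff[symmetric] cut(3))
  qed simp
  have L3: "(\<lambda>j. nn2 M (\<lambda>om. cut (Suc j) (h (a j) (b j) om) - h s y om)) ----> 0"
   using tendsto_sum_squares[OF _ _ L1' L2[simplified]] by simp
  have L4: "(\<lambda>j. nn2 M (\<lambda>om. (cut (Suc j) (h (a j) (b j) om) - h s y om) * trunc g m (?q j))) ----> 0"
  proof (rule tendsto_sandwich[OF _ _ tendsto_const])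
   have "(\<lambda>j. ennreal ((real m)^2) * nn2 M (\<lambda>om. cut (Suc j) (h (a j) (b j) om) - h s y om)) ----> ennreal ((real m)^2) * 0"
    by (intro ennreal_tendsto_cmult L3) simp
   then show "(\<lambda>j. ennreal ((real m)^2) * nn2 M (\<lambda>om. cut (Suc j) (h (a j) (b j) om) - h s y om)) ----> 0" by simp
   show "\<forall>\<^sub>F j in sequentially. (nn2 M (\<lambda>om. (cut (Suc j) (h (a j) (b j) om) - h s y om) * trunc g m (?q j)))
    \<le> ennreal ((real m)^2) * nn2 M (\<lambda>om. cut (Suc j) (h (a j) (b j) om) - h s y om)"
   proof (intro always_eventually allI)
    fix j
    have "(trunc g m (?q j))^2 \<le> (real m)^2"
     using trunc(1)[of g m "?q j"] by (simp add: abs_le_square_iff[symmetric])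
    then have "(x * trunc g m (?q j))^2 \<le> (real m)^2 * x^2" for x
     using mult_right_mono[of "(trunc g m (?q j))^2" "(real m)^2" "x^2"] by (simp add: power_mult_distrib mult.commute)
    then show "nn2 M (\<lambda>om. (cut (Suc j) (h (a j) (b j) om) - h s y om) * trunc g m (?q j))
    \<le> ennreal ((real m)^2) * nn2 M (\<lambda>om. cut (Suc j) (h (a j) (b j) om) - h s y om)"
     by (subst nn_integral_cmult[symmetric]) (auto simp: ennreal_mult[symmetric] intro!: nn_integral_mono ennreal_leI)
   qed
  qed simp
  have tl: "(\<lambda>j. trunc g m (?q j)) ----> trunc g m (s, y)"
   by (rule isCont_tendsto_compose[OF trunc_cont[OF c]]) (intro tendsto_Pair ql)
  have L5: "(\<lambda>j. nn2 M (\<lambda>om. h s y om * (trunc g m (?q j) - trunc g m (s, y)))) ----> 0"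
  proof -
   have "nn2 M (\<lambda>om. h s y om * (trunc g m (?q j) - trunc g m (s, y)))
    = nn2 M (\<lambda>om. h s y om) * ennreal ((trunc g m (?q j) - trunc g m (s, y))^2)" for j
    by (simp add: power_mult_distrib ennreal_mult nn_integral_multc)
   moreover have "(\<lambda>j. (nn2 M (\<lambda>om. h s y om)) * ennreal ((trunc g m (?q j) - trunc g m (s, y))^2))
    ----> (nn2 M (\<lambda>om. h s y om)) * ennreal ((trunc g m (s, y) - trunc g m (s, y))^2)"
    using H2 by (intro ennreal_tendsto_cmult tendsto_intros tl) (simp add: less_top)
   ultimately show ?thesis by simp
  qed
  have "simple_field_eval (gfield h g m (Suc j)) (om, s, y) - h s y om * trunc g m (s, y)
    = (cut (Suc j) (h (a j) (b j) om) - h s y om) * trunc g m (?q j) + h s y om * (trunc g m (?q j) - trunc g m (s, y))" for j om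
   unfolding E a_def b_def by (simp add: algebra_simps)
  then show ?thesis using tendsto_sum_squares[OF _ _ L4 L5] by simp
 qed
qed

lemma box_bound:
 assumes "continuous_on UNIV \<phi>"
 shows "\<exists>C::real. \<forall>s y. \<bar>s\<bar> \<le> R \<longrightarrow> \<bar>y\<bar> \<le> R \<longrightarrow> \<phi> (s, y :: real) \<le> C"
proof -
 have "compact (({-R..R} :: real set) \<times> ({-R..R} :: real set))" by (intro compact_Times compact_Icc)
 then have "bounded (\<phi> ` ({-R..R} \<times> {-R..R}))"
  using assms by (intro compact_imp_bounded compact_continuous_image continuous_on_subset[OF assms]) auto
 then obtain C where C: "\<forall>x\<in>\<phi> ` ({-R..R} \<times> {-R..R}). norm x \<le> C" unfolding bounded_iff by blast
 have "\<phi> (s, y) \<le> C" if "\<bar>s\<bar> \<le> R" "\<bar>y\<bar> \<le> R" for s y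
 proof -
  have "(s, y) \<in> {-R..R} \<times> {-R..R}" using that by (simp add: abs_le_iff)
  then have "norm (\<phi> (s, y)) \<le> C" using C by blast
  then show ?thesis by simp
 qed
 then show ?thesis by blast
qed

lemma box_finite: "(\<integral>\<^sup>+p. ennreal C * indicator ({-R..R} \<times> {-R..R :: real}) p \<partial>lborel) < \<infinity>"
proof -
 have "emeasure lborel ({-R..R} \<times> {-R..R :: real}) = emeasure lborel {-R..R} * emeasure lborel {-R..R}"
  unfolding lborel_prod[symmetric] by (intro lborel.emeasure_pair_measure_Times) auto
 moreover have "{-R..R} \<times> {-R..R :: real} \<in> sets borel" unfolding borel_prod[symmetric] by (intro pair_measureI) auto
 ultimately show ?thesis
  by (simp add: nn_integral_cmult_indicator ennreal_mult_less_top emeasure_lborel_Icc_eq)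
qed

text \<open>Dominated convergence over the plane, with the pointwise limits of
  \<open>gfield_pointwise\<close>. The truncation supplies the dominating function, a multiple of
  the indicator of a box.\<close>

lemma gfield_limit:
 assumes h: "adm T \<phi> h" and g: "kern T \<phi> g \<Gamma>" 
  and ad: "\<And>s' s y y'. 0 \<le> s' ==> s' < s ==> g (s, y') \<noteq> 0 ==> h s' y \<in> bm (sub (upto_time s))"
 shows "(\<lambda>j. nn2 PP (\<lambda>z. simple_field_eval (gfield h g m (Suc j)) z - (\<lambda>(om, s, y). h s y om * trunc g m (s, y)) z)) ----> 0"
proof -
 let ?X = "\<lambda>(om, s, y). h s y om * trunc g m (s, y)"
 have hm[measurable]: "(\<lambda>(om, s, y). h s y om) \<in> bm PP" and gm[measurable]: "g \<in> bm borel"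
  and gc: "AE p in lborel. isCont g p" and phi: "continuous_on UNIV \<phi>" "\<And>p. 0 \<le> \<phi> p"
  and gp: "\<And>p. g p \<noteq> 0 ==> 0 < fst p \<and> fst p \<le> T"
  using h g unfolding adm_def kern_def by blast+
 have gp1: "g p \<noteq> 0 ==> 0 < fst p" for p using gp by blast
 have Xm[measurable]: "?X \<in> bm PP"
 proof -
  have "snd \<in> measurable PP borel" unfolding PP_def by simp
  then have "(\<lambda>z. (\<lambda>(om, s, y). h s y om) z * trunc g m (snd z)) \<in> bm PP"
   using measurable_compose[OF _ trunc_measurable[OF gm]] by (intro borel_measurable_times hm) simp
  then show ?thesis by (simp add: case_prod_unfold)
 qed
 have Sm: "is_simple_field M W (gfield h g m (Suc j))" for j
  unfolding simple_valid by (intro ballI nvalid_valid) (rule gfield_nvalid[OF zero_less_Suc h g ad])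
 note [measurable] = eval_PP[OF Sm]
 have e: "(\<lambda>z. ennreal ((simple_field_eval (gfield h g m (Suc j)) z - ?X z)^2)) \<in> bm PP" for j
  by measurable
 \<comment> \<open>Where the truncated kernel is nonzero, corners have coordinates of size at most
   \<open>m + 1\<close>. The points of their cells lie within \<open>m + 2\<close>, and the margin 3
   also covers the earlier time at which the field is read.\<close>
 obtain C where C: "\<And>s y. \<bar>s\<bar> \<le> real m + 3 ==> \<bar>y\<bar> \<le> real m + 3 ==> \<phi> (s, y) \<le> C"
  using box_bound[OF phi(1), of "real m + 3"] by blast
 let ?R = "real m + 2"
 let ?w = "\<lambda>p. ennreal (4 * C * (real m)^2) * indicator ({-?R..?R} \<times> {-?R..?R :: real}) p"
 have C0: "0 \<le> C" using C[of 0 0] phi(2)[of "(0, 0)"] by simp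
 have "(\<lambda>j. \<integral>\<^sup>+p. nn2 M (\<lambda>om. simple_field_eval (gfield h g m (Suc j)) (om, p) - ?X (om, p)) \<partial>lborel)
  ----> (\<integral>\<^sup>+p. 0 \<partial>(lborel :: (real \<times> real) measure))"
 proof (rule nn_integral_dominated_convergence[where w = ?w])
  show "(\<lambda>p. nn2 M (\<lambda>om. simple_field_eval (gfield h g m (Suc j)) (om, p) - ?X (om, p))) \<in> bm lborel" for j
   using PP_section[OF e] .
  have "{-?R..?R} \<times> {-?R..?R :: real} \<in> sets borel" unfolding borel_prod[symmetric] by (intro pair_measureI) auto
  then show "?w \<in> bm lborel" by measurable
  show "(\<integral>\<^sup>+p. ?w p \<partial>lborel) < \<infinity>" by (rule box_finite)
  show "AE p in lborel. (\<lambda>j. nn2 M (\<lambda>om. simple_field_eval (gfield h g m (Suc j)) (om, p) - ?X (om, p))) ----> 0"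
   using gc by eventually_elim (use gfield_pointwise[OF h g] in \<open>auto split: prod.split\<close>)
  fix j
  show "AE p in lborel. (nn2 M (\<lambda>om. simple_field_eval (gfield h g m (Suc j)) (om, p) - ?X (om, p))) \<le> ?w p"
  proof (rule AE_I2)
   fix p :: "real \<times> real"
   obtain s y where p: "p = (s, y)" by (cases p)
   let ?q = "(gpt (Suc j) s, gpt (Suc j) y)"
   define a where "a = max 0 (gpt (Suc j) s - 1 / real (Suc j))"
   define b where "b = gpt (Suc j) y"
   have gb: "gpt (Suc j) s < s" "s \<le> gpt (Suc j) s + 1 / real (Suc j)" "gpt (Suc j) y < y" "y \<le> gpt (Suc j) y + 1 / real (Suc j)"
    using gpt_bounds[of "Suc j"] by auto
   have j1: "1 / real (Suc j) \<le> 1" "0 \<le> 1 / real (Suc j)" by simp_all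
   have I: "nn2 M (\<lambda>om. k om * trunc g m q) \<le> ennreal (C * (real m)^2) * indicator ({-?R..?R} \<times> {-?R..?R :: real}) (s, y)"
    if "trunc g m q \<noteq> 0 ==> \<bar>s\<bar> \<le> ?R \<and> \<bar>y\<bar> \<le> ?R \<and> (nn2 M (\<lambda>om. k om)) \<le> ennreal C"
     and [measurable]: "k \<in> bm M" for k q
   proof (cases "trunc g m q = 0")
    case False
    note t = that(1)[OF False]
    from t have "(s, y) \<in> {-?R..?R} \<times> {-?R..?R}" by (auto simp: abs_le_iff)
    then have ind: "indicator ({-?R..?R} \<times> {-?R..?R :: real}) (s, y) = (1 :: ennreal)" by (rule indicator_simps)
    from t have k: "nn2 M (\<lambda>om. k om) \<le> ennreal C" by simp
    have "(trunc g m q)^2 \<le> (real m)^2" using trunc(1)[of g m q] by (simp add: abs_le_square_iff[symmetric])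
    then have "ennreal ((trunc g m q)^2) \<le> ennreal ((real m)^2)" by (rule ennreal_leI)
    then have "nn2 M (\<lambda>om. k om) * ennreal ((trunc g m q)^2) \<le> ennreal C * ennreal ((real m)^2)"
     by (rule mult_mono[OF k]) simp_all
    then show ?thesis
     unfolding ind using C0 by (simp add: power_mult_distrib ennreal_mult nn_integral_multc)
   qed simp
   have hm1: "h a b \<in> bm M" "\<And>s y. 0 \<le> s ==> h s y \<in> bm M" by (auto simp: a_def intro!: adm_meas[OF h])
   have B1: "nn2 M (\<lambda>om. cut (Suc j) (h a b om) * trunc g m ?q) \<le> ennreal (C * (real m)^2) * indicator ({-?R..?R} \<times> {-?R..?R :: real}) (s, y)"
   proof (rule I)
    assume t: "trunc g m ?q \<noteq> 0"
    from trunc(4)[OF t] have q: "\<bar>gpt (Suc j) s\<bar> \<le> real m + 1" "\<bar>gpt (Suc j) y\<bar> \<le> real m + 1" "0 < gpt (Suc j) s" "gpt (Suc j) s \<le> T"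
     using gp[of ?q] by auto
    have aT: "a \<in> {0..T}" using q j1 unfolding a_def atLeastAtMost_iff by linarith
    have ab: "\<bar>a\<bar> \<le> real m + 3" "\<bar>b\<bar> \<le> real m + 3" using q j1 unfolding a_def b_def by linarith+
    have "nn2 M (\<lambda>om. cut (Suc j) (h a b om)) \<le> nn2 M (\<lambda>om. h a b om)"
     by (intro nn_integral_mono ennreal_leI) (simp add: abs_le_square_iff[symmetric] cut(2))
    also have "\<dots> \<le> ennreal (\<phi> (a, b))" by (rule adm_second[OF h aT])
    also have "\<dots> \<le> ennreal C" using C[OF ab] by (rule ennreal_leI)
    finally have "nn2 M (\<lambda>om. cut (Suc j) (h a b om)) \<le> ennreal C" .
    moreover have "\<bar>s\<bar> \<le> ?R" "\<bar>y\<bar> \<le> ?R" using q gb j1 by linarith+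
    ultimately show "\<bar>s\<bar> \<le> ?R \<and> \<bar>y\<bar> \<le> ?R \<and> (nn2 M (\<lambda>om. cut (Suc j) (h a b om))) \<le> ennreal C"
     by blast
   qed (use hm1 in measurable)
   have B2: "nn2 M (\<lambda>om. h s y om * trunc g m (s, y)) \<le> ennreal (C * (real m)^2) * indicator ({-?R..?R} \<times> {-?R..?R :: real}) (s, y)"
   proof (cases "trunc g m (s, y) = 0")
    case False
    then have t: "\<bar>s\<bar> \<le> real m + 1" "\<bar>y\<bar> \<le> real m + 1" "s \<in> {0..T}" using trunc(4)[OF False] gp[of "(s, y)"] by auto
    have "nn2 M (\<lambda>om. h s y om) \<le> ennreal C"
     using adm_second[OF h t(3), of y] C[of s y] t by (auto intro: order_trans ennreal_leI)
    then show ?thesis using t hm1(2)[of s y] by (intro I) auto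
   qed simp
   have sm: "(\<lambda>om. cut (Suc j) (h a b om) * trunc g m ?q) \<in> bm M" using hm1 by measurable
   have sm2: "(\<lambda>om. - (h s y om * trunc g m (s, y))) \<in> bm M"
   proof (cases "trunc g m (s, y) = 0")
    case False
    then have "0 \<le> s" using trunc(4)[OF False] gp[of "(s, y)"] by auto
    then have [measurable]: "h s y \<in> bm M" by (rule hm1)
    show ?thesis by measurable
   qed simp
   have "nn2 M (\<lambda>om. simple_field_eval (gfield h g m (Suc j)) (om, p) - ?X (om, p))
    = nn2 M (\<lambda>om. cut (Suc j) (h a b om) * trunc g m ?q + - (h s y om * trunc g m (s, y)))"
   proof -
    have "simple_field_eval (gfield h g m (Suc j)) (om, s, y) = cut (Suc j) (h a b om) * trunc g m ?q" for om
     unfolding a_def b_def by (rule gfield_eval[OF zero_less_Suc gp1])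
    then show ?thesis by (simp add: p)
   qed
   also have "\<dots> \<le> 2 * nn2 M (\<lambda>om. cut (Suc j) (h a b om) * trunc g m ?q) + 2 * nn2 M (\<lambda>om. - (h s y om * trunc g m (s, y)))"
    by (rule nn_integral_sq_add_le[OF sm sm2])
   also have "\<dots> \<le> 2 * (ennreal (C * (real m)^2) * indicator ({-?R..?R} \<times> {-?R..?R :: real}) (s, y)) + 2 * (ennreal (C * (real m)^2) * indicator ({-?R..?R} \<times> {-?R..?R :: real}) (s, y))"
    using B1 B2 by (intro add_mono mult_left_mono) simp_all
   also have "\<dots> = ?w p"
   proof -
    have "ennreal (4 * C * (real m)^2) = 4 * ennreal (C * (real m)^2)"
     using C0 by (simp add: ennreal_mult'[symmetric] mult.assoc flip: ennreal_numeral)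
    then show ?thesis by (simp add: p indicator_def distrib_right[symmetric])
   qed
   finally show "nn2 M (\<lambda>om. simple_field_eval (gfield h g m (Suc j)) (om, p) - ?X (om, p)) \<le> ?w p" .
  qed
 qed simp
 then show ?thesis by (simp add: PP_swap[OF e])
qed

end

text \<open>From \<open>f^2 - g^2 = (f - g)^2 + 2 * (f - g) * g\<close>, with Cauchy-Schwarz for the
  last term.\<close>

lemma L2_norm_convergence:
 fixes f :: "nat => 'b => real"
 assumes [measurable]: "\<And>n. f n \<in> bm N" "g \<in> bm N"
  and i: "\<And>n. integrable N (\<lambda>z. (f n z)^2)" "integrable N (\<lambda>z. (g z)^2)"
  and lim: "(\<lambda>n. nn2 N (\<lambda>z. f n z - g z)) ----> 0"
 shows "(\<lambda>n. \<integral>z. (f n z)^2 \<partial>N) ----> (\<integral>z. (g z)^2 \<partial>N)"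
proof -
 have id: "integrable N (\<lambda>z. (f n z - g z)^2)" for n
 proof (rule bi_bound)
  show "integrable N (\<lambda>z. 2 * (f n z)^2 + 2 * (g z)^2)" using i by simp
  have "(a - b)^2 \<le> 2 * a^2 + 2 * b^2" for a b :: real
   using sum_squares_bound[of a "- b"] by (simp add: power2_diff)
  then show "AE z in N. norm ((f n z - g z)^2) \<le> norm (2 * (f n z)^2 + 2 * (g z)^2)" by simp
 qed simp
 have "(\<lambda>n. ennreal (\<integral>z. (f n z - g z)^2 \<partial>N)) ----> ennreal 0"
  using lim id by (simp add: nn_integral_eq_integral)
 then have l0: "(\<lambda>n. \<integral>z. (f n z - g z)^2 \<partial>N) ----> 0"
  by (subst (asm) tendsto_ennreal_iff) auto
 have i3: "integrable N (\<lambda>z. \<bar>f n z - g z\<bar> * \<bar>g z\<bar>)"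
  and le: "(\<integral>z. \<bar>f n z - g z\<bar> * \<bar>g z\<bar> \<partial>N) \<le> sqrt (\<integral>z. (f n z - g z)^2 \<partial>N) * sqrt (\<integral>z. (g z)^2 \<partial>N)" for n
  using cauchy_schwarz_nonneg[of "\<lambda>z. \<bar>f n z - g z\<bar>" N "\<lambda>z. \<bar>g z\<bar>"] id i(2) by auto
 have i4: "integrable N (\<lambda>z. (f n z - g z) * g z)" for n
  by (rule bi_bound[OF i3]) (auto simp: abs_mult)
 have e: "(\<integral>z. (f n z)^2 \<partial>N) - (\<integral>z. (g z)^2 \<partial>N) = (\<integral>z. (f n z - g z)^2 \<partial>N) + 2 * (\<integral>z. (f n z - g z) * g z \<partial>N)" for n
 proof -
  have "(\<integral>z. (f n z)^2 \<partial>N) = (\<integral>z. (f n z - g z)^2 + 2 * ((f n z - g z) * g z) + (g z)^2 \<partial>N)"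
   by (intro bo_cong refl) (simp add: power2_eq_square algebra_simps)
  then show ?thesis using id i i4 by simp
 qed
 have a: "\<bar>\<integral>z. (f n z - g z) * g z \<partial>N\<bar> \<le> sqrt (\<integral>z. (f n z - g z)^2 \<partial>N) * sqrt (\<integral>z. (g z)^2 \<partial>N)" for n
 proof -
  have "\<bar>\<integral>z. (f n z - g z) * g z \<partial>N\<bar> \<le> (\<integral>z. \<bar>f n z - g z\<bar> * \<bar>g z\<bar> \<partial>N)"
   using integral_abs_bound[of N "\<lambda>z. (f n z - g z) * g z"] by (simp add: abs_mult)
  then show ?thesis using le by (rule order_trans)
 qed
 have b: "\<bar>(\<integral>z. (f n z)^2 \<partial>N) - (\<integral>z. (g z)^2 \<partial>N)\<bar>
  \<le> (\<integral>z. (f n z - g z)^2 \<partial>N) + 2 * (sqrt (\<integral>z. (f n z - g z)^2 \<partial>N) * sqrt (\<integral>z. (g z)^2 \<partial>N))" for n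
 proof -
  have abs: "\<bar>p + 2 * q\<bar> \<le> p + 2 * r" if "0 \<le> p" "\<bar>q\<bar> \<le> r" for p q r :: real
   using that by linarith
  show ?thesis unfolding e by (rule abs[OF _ a]) simp
 qed
 have "(\<lambda>n. (\<integral>z. (f n z - g z)^2 \<partial>N) + 2 * (sqrt (\<integral>z. (f n z - g z)^2 \<partial>N) * sqrt (\<integral>z. (g z)^2 \<partial>N)))
  ----> 0 + 2 * (sqrt 0 * sqrt (\<integral>z. (g z)^2 \<partial>N))"
  by (intro tendsto_intros l0)
 then have l: "(\<lambda>n. (\<integral>z. (f n z - g z)^2 \<partial>N) + 2 * (sqrt (\<integral>z. (f n z - g z)^2 \<partial>N) * sqrt (\<integral>z. (g z)^2 \<partial>N)))
  ----> 0" by simp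
 have "(\<lambda>n. \<bar>(\<integral>z. (f n z)^2 \<partial>N) - (\<integral>z. (g z)^2 \<partial>N)\<bar>) ----> 0"
  by (rule tendsto_sandwich[OF _ _ tendsto_const l]; intro always_eventually allI abs_ge_zero b)
 then show ?thesis by (simp add: tendsto_rabs_zero_iff LIM_zero_iff)
qed

context wnoise
begin

lemma kern_borel: "kern T \<phi> g \<Gamma> ==> g \<in> bm borel"
 and kern_cont: "kern T \<phi> g \<Gamma> ==> AE p in lborel. isCont g p"
 and kern_supp: "kern T \<phi> g \<Gamma> ==> g p \<noteq> 0 ==> 0 < fst p \<and> fst p \<le> T"
 and kern_bound: "kern T \<phi> g \<Gamma> ==> (nni lborel (\<lambda>p. \<phi> p * (g p)^2)) \<le> ennreal \<Gamma>"
 and kern_nonneg: "kern T \<phi> g \<Gamma> ==> 0 \<le> \<Gamma>"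
 unfolding kern_def by blast+

lemma field_PP:
 assumes "(\<lambda>(om, s, y). h s y om :: real) \<in> bm PP" "g \<in> bm borel"
 shows "(\<lambda>(om, s, y). h s y om * g (s, y)) \<in> bm PP"
proof -
 have "snd \<in> measurable PP borel" unfolding PP_def by simp
 then have "(\<lambda>z. g (snd z)) \<in> bm PP" by (rule measurable_compose[OF _ assms(2)])
 then have "(\<lambda>z. (\<lambda>(om, s, y). h s y om) z * g (snd z)) \<in> bm PP"
  by (intro borel_measurable_times assms(1))
 then show ?thesis by (simp add: case_prod_unfold)
qed

text \<open>Here continuity of \<open>\<phi>\<close> and continuity of \<open>g\<close> almost
  everywhere turn the Riemann sums into the integral; the box of the truncation again
  dominates.\<close>

lemma weight_limit:
 assumes h: "adm T \<phi> h" and g: "kern T \<phi> g \<Gamma>"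
 shows "(\<lambda>j. nni lborel (\<lambda>p. \<phi> (max 0 (gpt (Suc j) (fst p) - 1 / real (Suc j)), gpt (Suc j) (snd p))
   * (trunc g m (gpt (Suc j) (fst p), gpt (Suc j) (snd p)))^2))
  ----> (nni lborel (\<lambda>p. \<phi> p * (trunc g m p)^2))"
proof -
 have phi: "continuous_on UNIV \<phi>" "\<And>p. 0 \<le> \<phi> p" using h unfolding adm_def by blast+
 note [measurable] = kern_borel[OF g]
 have [measurable]: "\<phi> \<in> bm borel" using phi(1) by (rule borel_measurable_continuous_onI)
 let ?R = "real m + 2"
 obtain C where C: "\<And>s y. \<bar>s\<bar> \<le> real m + 3 ==> \<bar>y\<bar> \<le> real m + 3 ==> \<phi> (s, y) \<le> C"
  using box_bound[OF phi(1), of "real m + 3"] by blast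
 have C0: "0 \<le> C" using C[of 0 0] phi(2)[of "(0, 0)"] by simp
 let ?w = "\<lambda>p. ennreal (C * (real m)^2) * indicator ({-?R..?R} \<times> {-?R..?R :: real}) p"
 show ?thesis
 proof (rule nn_integral_dominated_convergence[where w = ?w])
  show "(\<lambda>p. ennreal (\<phi> (max 0 (gpt (Suc j) (fst p) - 1 / real (Suc j)), gpt (Suc j) (snd p))
   * (trunc g m (gpt (Suc j) (fst p), gpt (Suc j) (snd p)))^2)) \<in> bm lborel" for j
  proof -
   have a: "(\<lambda>p. (max 0 (gpt (Suc j) (fst p) - 1 / real (Suc j)), gpt (Suc j) (snd p))) \<in> bm borel"
    "(\<lambda>p. (gpt (Suc j) (fst p), gpt (Suc j) (snd p))) \<in> bm borel"
    by (intro borel_measurable_Pair; measurable)+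
   have [measurable]: "(\<lambda>p. \<phi> (max 0 (gpt (Suc j) (fst p) - 1 / real (Suc j)), gpt (Suc j) (snd p))) \<in> bm borel"
    by (rule measurable_compose[OF a(1)]) measurable
   have [measurable]: "(\<lambda>p. trunc g m (gpt (Suc j) (fst p), gpt (Suc j) (snd p))) \<in> bm borel"
    by (rule measurable_compose[OF a(2)]) measurable
   show ?thesis by simp
  qed
  show "(\<lambda>p. ennreal (\<phi> p * (trunc g m p)^2)) \<in> bm lborel" by measurable
  have "{-?R..?R} \<times> {-?R..?R :: real} \<in> sets borel" unfolding borel_prod[symmetric] by (intro pair_measureI) auto
  then show "?w \<in> bm lborel" by measurable
  show "(\<integral>\<^sup>+p. ?w p \<partial>lborel) < \<infinity>" by (rule box_finite)
  show "AE p in lborel. (\<lambda>j. ennreal (\<phi> (max 0 (gpt (Suc j) (fst p) - 1 / real (Suc j)), gpt (Suc j) (snd p))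
   * (trunc g m (gpt (Suc j) (fst p), gpt (Suc j) (snd p)))^2)) ----> ennreal (\<phi> p * (trunc g m p)^2)"
   using kern_cont[OF g]
  proof eventually_elim
   case (elim p)
   obtain s y where p: "p = (s, y)" by (cases p)
   have ql: "(\<lambda>j. gpt (Suc j) s) ----> s" "(\<lambda>j. gpt (Suc j) y) ----> y"
    using LIMSEQ_Suc[OF gpt_tendsto] by blast+
   have t: "(\<lambda>j. trunc g m (gpt (Suc j) s, gpt (Suc j) y)) ----> trunc g m (s, y)"
    using elim unfolding p by (intro isCont_tendsto_compose[OF trunc_cont] tendsto_Pair ql)
   have ic: "isCont \<phi> (max 0 (s - 0), y)" using phi(1) continuous_on_eq_continuous_at[OF open_UNIV] by blast
   have "(\<lambda>j. (max 0 (gpt (Suc j) s - 1 / real (Suc j)), gpt (Suc j) y)) ----> (max 0 (s - 0), y)"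
    by (intro tendsto_intros ql LIMSEQ_Suc[OF lim_1_over_n])
   from isCont_tendsto_compose[OF ic this]
   have f: "(\<lambda>j. \<phi> (max 0 (gpt (Suc j) s - 1 / real (Suc j)), gpt (Suc j) y)) ----> \<phi> (max 0 s, y)"
    by (simp only: diff_0_right)
   \<comment> \<open>\<open>max 0 s\<close> differs from \<open>s\<close> at negative times only,
     where the kernel vanishes.\<close>
   have e: "\<phi> (s, y) * (trunc g m (s, y))^2 = \<phi> (max 0 s, y) * (trunc g m (s, y))^2"
   proof (cases "0 \<le> s")
    case False
    then have "trunc g m (s, y) = 0" using trunc(4)[of g m "(s, y)"] kern_supp[OF g, of "(s, y)"] by auto
    then show ?thesis by simp
   qed simp
   show ?case unfolding p fst_conv snd_conv e
    by (intro tendsto_ennrealI tendsto_mult tendsto_power f t)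
  qed
  fix j
  show "AE p in lborel. ennreal (\<phi> (max 0 (gpt (Suc j) (fst p) - 1 / real (Suc j)), gpt (Suc j) (snd p))
   * (trunc g m (gpt (Suc j) (fst p), gpt (Suc j) (snd p)))^2) \<le> ?w p"
  proof (rule AE_I2)
   fix p :: "real \<times> real"
   obtain s y where p: "p = (s, y)" by (cases p)
   let ?q = "(gpt (Suc j) s, gpt (Suc j) y)"
   show "ennreal (\<phi> (max 0 (gpt (Suc j) (fst p) - 1 / real (Suc j)), gpt (Suc j) (snd p))
    * (trunc g m (gpt (Suc j) (fst p), gpt (Suc j) (snd p)))^2) \<le> ?w p"
   proof (cases "trunc g m ?q = 0")
    case True
    then show ?thesis by (simp add: p)
   next
    case False
    have gb: "gpt (Suc j) s < s" "s \<le> gpt (Suc j) s + 1 / real (Suc j)" "gpt (Suc j) y < y" "y \<le> gpt (Suc j) y + 1 / real (Suc j)"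
     using gpt_bounds[of "Suc j"] by auto
    have j1: "1 / real (Suc j) \<le> 1" "0 \<le> 1 / real (Suc j)" by simp_all
    from trunc(4)[OF False] have q: "\<bar>gpt (Suc j) s\<bar> \<le> real m + 1" "\<bar>gpt (Suc j) y\<bar> \<le> real m + 1" by auto
    have "\<bar>s\<bar> \<le> ?R" "\<bar>y\<bar> \<le> ?R" using q gb j1 by linarith+
    then have "(s, y) \<in> {-?R..?R} \<times> {-?R..?R}" by (auto simp: abs_le_iff)
    then have ind: "indicator ({-?R..?R} \<times> {-?R..?R :: real}) (s, y) = (1 :: ennreal)" by (rule indicator_simps)
    have "\<phi> (max 0 (gpt (Suc j) s - 1 / real (Suc j)), gpt (Suc j) y) \<le> C"
     by (rule C) (use q j1 in linarith)+
    moreover have "(trunc g m ?q)^2 \<le> (real m)^2" using trunc(1)[of g m ?q] by (simp add: abs_le_square_iff[symmetric])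
    ultimately have "\<phi> (max 0 (gpt (Suc j) s - 1 / real (Suc j)), gpt (Suc j) y) * (trunc g m ?q)^2 \<le> C * (real m)^2"
     using C0 by (intro mult_mono) auto
    then show ?thesis unfolding p fst_conv snd_conv ind by (simp add: ennreal_leI)
   qed
  qed
 qed
qed

text \<open>The truncation error is at most \<open>\<bar>g p\<bar>\<close> at each point, so the
  function bounded by \<open>\<Gamma>\<close> in \<open>kern\<close> dominates.\<close>

lemma trunc_limit:
 assumes h: "adm T \<phi> h" and g: "kern T \<phi> g \<Gamma>"
 shows "(\<lambda>m. nn2 PP (\<lambda>z. (\<lambda>(om, s, y). h s y om * (trunc g m (s, y) - g (s, y))) z)) ----> 0"
proof -
 have hm: "(\<lambda>(om, s, y). h s y om) \<in> bm PP" and phi: "continuous_on UNIV \<phi>" "\<And>p. 0 \<le> \<phi> p"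
  using h unfolding adm_def by blast+
 note [measurable] = kern_borel[OF g]
 have [measurable]: "\<phi> \<in> bm borel" using phi(1) by (rule borel_measurable_continuous_onI)
 have X: "(\<lambda>(om, s, y). h s y om * (trunc g m (s, y) - g (s, y))) \<in> bm PP" for m
  using field_PP[OF hm, of "\<lambda>p. trunc g m p - g p"] by simp
 have e: "(\<lambda>z. ennreal (((\<lambda>(om, s, y). h s y om * (trunc g m (s, y) - g (s, y))) z)^2)) \<in> bm PP" for m
  using X[of m] by measurable
 have tg: "trunc g m p = 0" if "g p = 0" for m p using trunc(4)[of g m p] that by blast
 have prod: "nn2 M (\<lambda>om. h (fst p) (snd p) om * c) = ennreal (c^2) * nn2 M (\<lambda>om. h (fst p) (snd p) om)"
  if "g p \<noteq> 0" for p c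
 proof -
  have [measurable]: "h (fst p) (snd p) \<in> bm M" using adm_meas[OF h] kern_supp[OF g that] by simp
  show ?thesis by (simp add: power_mult_distrib ennreal_mult' nn_integral_cmult mult.commute)
 qed
 have fin: "nn2 M (\<lambda>om. h (fst p) (snd p) om) \<le> ennreal (\<phi> p)" if "g p \<noteq> 0" for p
  using adm_second[OF h, of "fst p" "snd p"] kern_supp[OF g that] by simp
 have "(\<lambda>m. \<integral>\<^sup>+p. nn2 M (\<lambda>om. h (fst p) (snd p) om * (trunc g m p - g p)) \<partial>lborel)
  ----> (\<integral>\<^sup>+p. 0 \<partial>(lborel :: (real \<times> real) measure))"
 proof (rule nn_integral_dominated_convergence[where w = "\<lambda>p. ennreal (\<phi> p * (g p)^2)"])
  show "(\<lambda>p. nn2 M (\<lambda>om. h (fst p) (snd p) om * (trunc g m p - g p))) \<in> bm lborel" for m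
   using PP_section[OF e[of m]] by (simp add: case_prod_unfold)
  show "(\<lambda>p. ennreal (\<phi> p * (g p)^2)) \<in> bm lborel" by measurable
  show "nni lborel (\<lambda>p. \<phi> p * (g p)^2) < \<infinity>"
   using kern_bound[OF g] by (rule le_less_trans) simp
  show "AE p in lborel. (nn2 M (\<lambda>om. h (fst p) (snd p) om * (trunc g m p - g p))) \<le> ennreal (\<phi> p * (g p)^2)" for m
  proof (rule AE_I2)
   fix p :: "real \<times> real"
   show "nn2 M (\<lambda>om. h (fst p) (snd p) om * (trunc g m p - g p)) \<le> ennreal (\<phi> p * (g p)^2)"
   proof (cases "g p = 0")
    case True
    then show ?thesis by (simp add: tg)
   next
    case False
    have "(trunc g m p - g p)^2 \<le> (g p)^2"
     using trunc(3)[of g p m] by (simp add: abs_le_square_iff[symmetric] abs_minus_commute)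
    then have "ennreal ((trunc g m p - g p)^2) * nn2 M (\<lambda>om. h (fst p) (snd p) om) \<le> ennreal ((g p)^2) * ennreal (\<phi> p)"
     by (intro mult_mono fin[OF False] ennreal_leI) auto
    then show ?thesis unfolding prod[OF False] using phi(2) by (simp add: ennreal_mult mult.commute)
   qed
  qed
  show "AE p in lborel. (\<lambda>m. nn2 M (\<lambda>om. h (fst p) (snd p) om * (trunc g m p - g p))) ----> 0"
  proof (rule AE_I2)
   fix p :: "real \<times> real"
   show "(\<lambda>m. nn2 M (\<lambda>om. h (fst p) (snd p) om * (trunc g m p - g p))) ----> 0"
   proof (cases "g p = 0")
    case True
    then show ?thesis by (simp add: tg)
   next
    case False
    have "(\<lambda>m. (nn2 M (\<lambda>om. h (fst p) (snd p) om)) * ennreal ((trunc g m p - g p)^2))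
     ----> (nn2 M (\<lambda>om. h (fst p) (snd p) om)) * ennreal ((g p - g p)^2)"
     using le_less_trans[OF fin[OF False], of top]
     by (intro ennreal_tendsto_cmult tendsto_intros trunc_tendsto) simp
    then show ?thesis unfolding prod[OF False] by (simp add: mult.commute)
   qed
  qed
 qed simp
 then show ?thesis unfolding PP_swap[OF e] by (simp add: case_prod_unfold)
qed

end

section \<open>Fourth moments of Walsh integrals\<close>

context wnoise
begin

text \<open>A diagonal choice: for each truncation level \<open>m\<close>, a mesh so fine that both
  the field error and the excess of the weights over \<open>\<Gamma>\<close> are at most
  \<open>1 / (m + 1)\<close>. The bound \<open>m < n m\<close> later makes the overshoot of the last
  cell beyond the time horizon vanish.\<close>

lemma grid_exists:
 assumes h: "adm T \<phi> h" and g: "kern T \<phi> g \<Gamma>"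
  and ad: "\<And>s' s y y'. 0 \<le> s' ==> s' < s ==> g (s, y') \<noteq> 0 ==> h s' y \<in> bm (sub (upto_time s))"
 shows "\<exists>n :: nat => nat. (\<forall>m. m < n m) \<and> (\<forall>m. is_simple_field M W (gfield h g m (n m))) \<and>
  (\<lambda>m. nn2 PP (\<lambda>z. simple_field_eval (gfield h g m (n m)) z - (\<lambda>(om, s, y). h s y om * g (s, y)) z)) ----> 0 \<and>
  (\<forall>m. (\<Sum>e\<leftarrow>gfield h g m (n m). weight e) \<le> \<Gamma> + 1 / (real m + 1))"
proof -
 have phi: "\<And>p. 0 \<le> \<phi> p" and hm: "(\<lambda>(om, s, y). h s y om) \<in> bm PP" using h unfolding adm_def by blast+
 let ?A = "\<lambda>m j. nn2 PP (\<lambda>z. simple_field_eval (gfield h g m (Suc j)) z - (\<lambda>(om, s, y). h s y om * trunc g m (s, y)) z)"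
 have pos: "0 < 1 / (real m + 1)" for m by simp
 have ex: "\<exists>j. m \<le> j \<and> ?A m j \<le> ennreal (1 / (real m + 1)) \<and> (\<Sum>e\<leftarrow>gfield h g m (Suc j). weight e) \<le> \<Gamma> + 1 / (real m + 1)" for m
 proof -
  have "nni lborel (\<lambda>p. \<phi> p * (trunc g m p)^2) \<le> nni lborel (\<lambda>p. \<phi> p * (g p)^2)"
   using trunc(2) phi by (intro nn_integral_mono ennreal_leI mult_left_mono) (auto simp: abs_le_square_iff[symmetric])
  also have "\<dots> \<le> ennreal \<Gamma>" by (rule kern_bound[OF g])
  \<comment> \<open>The added term makes the inequality strict, so convergence brings the Riemann
    sums below this value eventually.\<close>
  also have "\<dots> < ennreal (\<Gamma> + 1 / (real m + 1))"
   using kern_nonneg[OF g] pos[of m] by (intro ennreal_lessI) linarith+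
  finally have "nni lborel (\<lambda>p. \<phi> p * (trunc g m p)^2) < ennreal (\<Gamma> + 1 / (real m + 1))" .
  note w = order_tendstoD(2)[OF weight_limit[OF h g] this]
  have "0 < ennreal (1 / (real m + 1))" using pos[of m] by simp
  moreover have "(\<lambda>j. ?A m j) ----> 0" by (rule gfield_limit[OF h g ad])
  ultimately have a: "\<forall>\<^sub>F j in sequentially. ?A m j < ennreal (1 / (real m + 1))" by (rule order_tendstoD(2)[rotated])
  have "\<forall>\<^sub>F j in sequentially. m \<le> j \<and> ?A m j \<le> ennreal (1 / (real m + 1)) \<and> (\<Sum>e\<leftarrow>gfield h g m (Suc j). weight e) \<le> \<Gamma> + 1 / (real m + 1)"
   using eventually_ge_at_top[of m] w a
  proof eventually_elim
   case (elim j)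
   from gfield_weight[OF zero_less_Suc h g, of m j] elim(2)
   have "ennreal (\<Sum>e\<leftarrow>gfield h g m (Suc j). weight e) < ennreal (\<Gamma> + 1 / (real m + 1))" by (rule le_less_trans)
   then have "\<not> \<Gamma> + 1 / (real m + 1) \<le> (\<Sum>e\<leftarrow>gfield h g m (Suc j). weight e)"
    using ennreal_leI leD by blast
   then have "(\<Sum>e\<leftarrow>gfield h g m (Suc j). weight e) \<le> \<Gamma> + 1 / (real m + 1)" by linarith
   with elim(1) less_imp_le[OF elim(3)] show ?case by (intro conjI)
  qed
  then show ?thesis unfolding eventually_sequentially by blast
 qed
 define j where "j m = (SOME j. m \<le> j \<and> ?A m j \<le> ennreal (1 / (real m + 1)) \<and> (\<Sum>e\<leftarrow>gfield h g m (Suc j). weight e) \<le> \<Gamma> + 1 / (real m + 1))" for m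
 have j: "m \<le> j m" "?A m (j m) \<le> ennreal (1 / (real m + 1))" "(\<Sum>e\<leftarrow>gfield h g m (Suc (j m)). weight e) \<le> \<Gamma> + 1 / (real m + 1)" for m
  using someI_ex[OF ex[of m]] unfolding j_def by blast+
 have S: "is_simple_field M W (gfield h g m (Suc (j m)))" for m
  unfolding simple_valid by (intro ballI nvalid_valid) (rule gfield_nvalid[OF zero_less_Suc h g ad])
 have "(\<lambda>m. ?A m (j m)) ----> 0"
 proof (rule tendsto_sandwich[OF _ _ tendsto_const])
  show "\<forall>\<^sub>F m in sequentially. ?A m (j m) \<le> ennreal (1 / (real m + 1))" using j(2) by (intro always_eventually allI)
  have "(\<lambda>m. ennreal (1 / real (Suc m))) ----> ennreal 0" by (intro tendsto_ennrealI LIMSEQ_Suc[OF lim_1_over_n])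
  then show "(\<lambda>m. ennreal (1 / (real m + 1))) ----> 0" by (simp add: add.commute)
 qed simp
 moreover note trunc_limit[OF h g]
 ultimately have "(\<lambda>m. nn2 PP (\<lambda>z. (simple_field_eval (gfield h g m (Suc (j m))) z - (\<lambda>(om, s, y). h s y om * trunc g m (s, y)) z)
   + (\<lambda>(om, s, y). h s y om * (trunc g m (s, y) - g (s, y))) z)) ----> 0"
 proof (rule tendsto_sum_squares[rotated 2])
  note gm = kern_borel[OF g]
  show "(\<lambda>z. simple_field_eval (gfield h g m (Suc (j m))) z - (\<lambda>(om, s, y). h s y om * trunc g m (s, y)) z) \<in> bm PP" for m
   by (intro borel_measurable_diff eval_PP S field_PP hm trunc_measurable gm)
  show "(\<lambda>(om, s, y). h s y om * (trunc g m (s, y) - g (s, y))) \<in> bm PP" for m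
   using field_PP[OF hm borel_measurable_diff[OF trunc_measurable[OF gm] gm]] .
 qed
 moreover have "(simple_field_eval (gfield h g m (Suc (j m))) z - (\<lambda>(om, s, y). h s y om * trunc g m (s, y)) z)
   + (\<lambda>(om, s, y). h s y om * (trunc g m (s, y) - g (s, y))) z
  = simple_field_eval (gfield h g m (Suc (j m))) z - (\<lambda>(om, s, y). h s y om * g (s, y)) z" for m z
  by (cases z) (simp add: algebra_simps)
 ultimately have "(\<lambda>m. nn2 PP (\<lambda>z. simple_field_eval (gfield h g m (Suc (j m))) z - (\<lambda>(om, s, y). h s y om * g (s, y)) z)) ----> 0"
  by simp
 with S j show ?thesis by (intro exI[of _ "\<lambda>m. Suc (j m)"] conjI allI) (simp_all add: less_Suc_eq_le)
qed

text \<open>The grid approximations are sorted, so their fourth moments have square roots of at most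
  \<open>3 * (\<Gamma> + 1 / (m + 1))\<close>. They converge to the given \<open>I\<close> by
  \<open>walsh_approx\<close>, and Fatou's lemma carries the bound over.\<close>

lemma walsh_fourth:
 assumes h: "adm T \<phi> h" and g: "kern T \<phi> g \<Gamma>"
  and ad: "\<And>s' s y y'. 0 \<le> s' ==> s' < s ==> g (s, y') \<noteq> 0 ==> h s' y \<in> bm (sub (upto_time s))"
  and I: "walsh (\<lambda>(om, s, y). h s y om * g (s, y)) I"
 shows "nni M (\<lambda>om. I om ^ 4) \<le> ennreal ((3 * \<Gamma>)^2)"
proof -
 have ex: "\<exists>n :: nat => nat. (\<forall>m. m < n m) \<and> (\<forall>m. is_simple_field M W (gfield h g m (n m))) \<and>
  (\<lambda>m. nn2 PP (\<lambda>z. simple_field_eval (gfield h g m (n m)) z - (\<lambda>(om, s, y). h s y om * g (s, y)) z)) ----> 0 \<and>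
  (\<forall>m. (\<Sum>e\<leftarrow>gfield h g m (n m). weight e) \<le> \<Gamma> + 1 / (real m + 1))"
  by (rule grid_exists[OF h g ad])
 obtain n where n: "\<And>m. m < n m" "\<And>m. is_simple_field M W (gfield h g m (n m))"
  "(\<lambda>m. nn2 PP (\<lambda>z. simple_field_eval (gfield h g m (n m)) z - (\<lambda>(om, s, y). h s y om * g (s, y)) z)) ----> 0"
  "\<And>m. (\<Sum>e\<leftarrow>gfield h g m (n m). weight e) \<le> \<Gamma> + 1 / (real m + 1)"
  using ex by blast
 have n0: "0 < n m" for m using n(1)[of m] by simp
 have b: "nni M (\<lambda>om. sf_int (gfield h g m (n m)) om ^ 4) \<le> ennreal ((3 * (\<Gamma> + 1 / (real m + 1)))^2)" for m
 proof -
  have "\<forall>e\<in>set (gfield h g m (n m)). nvalid e" by (intro ballI) (rule gfield_nvalid[OF n0 h g ad])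
  moreover have "sorted_wrt after (gfield h g m (n m))" unfolding gfield_def by (rule grid_sorted[OF n0])
  ultimately have f: "integrable M (\<lambda>om. sf_int (gfield h g m (n m)) om ^ 4)"
   "sqrt (\<integral>om. sf_int (gfield h g m (n m)) om ^ 4 \<partial>M) \<le> 3 * (\<Sum>e\<leftarrow>gfield h g m (n m). weight e)"
   using fourth_moment_simple by blast+
  have le: "sqrt (\<integral>om. sf_int (gfield h g m (n m)) om ^ 4 \<partial>M) \<le> 3 * (\<Gamma> + 1 / (real m + 1))"
   by (rule order_trans[OF f(2) mult_left_mono[OF n(4)]]) simp
  have "(\<integral>om. sf_int (gfield h g m (n m)) om ^ 4 \<partial>M) \<le> (3 * (\<Gamma> + 1 / (real m + 1)))^2"
   using le by (rule sqrt_le_D)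
  then show ?thesis using f(1) by (subst nn_integral_eq_integral) (auto intro: ennreal_leI)
 qed
 have I_m: "I \<in> bm M" using I by (simp add: walsh_def)
 have "(\<lambda>m. ennreal ((3 * (\<Gamma> + 1 / real (Suc m)))^2)) ----> ennreal ((3 * (\<Gamma> + 0))^2)"
  by (intro tendsto_ennrealI tendsto_intros LIMSEQ_Suc[OF lim_1_over_n])
 then have l: "(\<lambda>m. ennreal ((3 * (\<Gamma> + 1 / (real m + 1)))^2)) ----> ennreal ((3 * \<Gamma>)^2)" by (simp add: add.commute)
 show ?thesis
  by (rule fourth_moment_limit[OF sf_int_measurable[OF n(2)] I_m walsh_approx[OF I n(2,3)] b l])
qed

text \<open>The integrals form a Cauchy sequence in L2 by \<open>walsh_bound\<close>; Fatou's lemma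
  in the second index identifies the almost sure limit as the limit in L2.\<close>

lemma walsh_AE:
 assumes X: "X \<in> bm PP" and I: "I \<in> bm M" and S: "\<And>k. is_simple_field M W (S k)"
  and lim: "(\<lambda>k. nn2 PP (\<lambda>z. simple_field_eval (S k) z - X z)) ----> 0"
  and ae: "AE om in M. (\<lambda>k. sf_int (S k) om) ----> I om"
 shows "walsh X I"
proof (rule walshI[OF X I S lim])
 note [measurable] = X I eval_PP[OF S] sf_int_measurable[OF S]
 let ?q = "\<lambda>k. nn2 PP (\<lambda>z. simple_field_eval (S k) z - X z)"
 have d: "nn2 M (\<lambda>om. sf_int (S k) om - sf_int (S l) om) \<le> 4 * (2 * ?q k + 2 * ?q l)" for k l
 proof -
  have "nn2 M (\<lambda>om. sf_int (S k) om - sf_int (S l) om)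
   \<le> 4 * nn2 PP (\<lambda>z. simple_field_eval (S k) z - simple_field_eval (S l) z)"
   by (rule walsh_bound[OF walsh_diff[OF walsh_simple[OF S] walsh_simple[OF S]]])
  also have "nn2 PP (\<lambda>z. simple_field_eval (S k) z - simple_field_eval (S l) z)
   = nn2 PP (\<lambda>z. (simple_field_eval (S k) z - X z) + (X z - simple_field_eval (S l) z))" by simp
  also have "\<dots> \<le> 2 * ?q k + 2 * nn2 PP (\<lambda>z. X z - simple_field_eval (S l) z)"
   by (rule nn_integral_sq_add_le) measurable
  also have "nn2 PP (\<lambda>z. X z - simple_field_eval (S l) z) = ?q l" by (simp add: power2_commute)
  finally show ?thesis by (simp add: mult_left_mono)
 qed
 have b: "nn2 M (\<lambda>om. sf_int (S k) om - I om) \<le> 8 * ?q k" for k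
 proof -
  have "nn2 M (\<lambda>om. sf_int (S k) om - I om) = (\<integral>\<^sup>+om. liminf (\<lambda>l. ennreal ((sf_int (S k) om - sf_int (S l) om)^2)) \<partial>M)"
  proof (rule nn_integral_cong_AE)
   show "AE om in M. ennreal ((sf_int (S k) om - I om)^2) = liminf (\<lambda>l. ennreal ((sf_int (S k) om - sf_int (S l) om)^2))"
    using ae
   proof eventually_elim
    case (elim om)
    then have "(\<lambda>l. ennreal ((sf_int (S k) om - sf_int (S l) om)^2)) ----> ennreal ((sf_int (S k) om - I om)^2)"
     by (intro tendsto_intros)
    then show ?case by (intro lim_imp_Liminf[symmetric]) auto
   qed
  qed
  also have "\<dots> \<le> liminf (\<lambda>l. nn2 M (\<lambda>om. sf_int (S k) om - sf_int (S l) om))"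
   by (rule nn_integral_liminf) simp
  also have "\<dots> \<le> liminf (\<lambda>l. 4 * (2 * ?q k + 2 * ?q l))"
   using d by (intro Liminf_mono) simp
  also have "\<dots> = 4 * (2 * ?q k + 2 * 0)"
   by (intro lim_imp_Liminf ennreal_tendsto_cmult tendsto_add tendsto_const lim) auto
  finally show ?thesis by (simp add: mult.assoc[symmetric])
 qed
 show "(\<lambda>k. nn2 M (\<lambda>om. sf_int (S k) om - I om)) ----> 0"
 proof (rule tendsto_sandwich[OF _ _ tendsto_const])
  show "\<forall>\<^sub>F k in sequentially. (nn2 M (\<lambda>om. sf_int (S k) om - I om)) \<le> 8 * ?q k"
   using b by (intro always_eventually allI)
  show "(\<lambda>k. 8 * ?q k) ----> 0" using ennreal_tendsto_cmult[OF _ lim, of 8] by simp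
 qed simp
qed

end

section \<open>Wiener integrals over a time window\<close>

context wnoise
begin

lemma L1_le_L2:
 assumes [measurable]: "X \<in> bm M" and i: "integrable M (\<lambda>om. (X om)^2)"
 shows "integrable M X" "(\<integral>om. \<bar>X om\<bar> \<partial>M) \<le> sqrt (\<integral>om. (X om)^2 \<partial>M)"
proof -
 have i2: "integrable M (\<lambda>om. \<bar>X om\<bar>\<^sup>2)" using i by simp
 note c = cauchy_schwarz_nonneg[of "\<lambda>om. \<bar>X om\<bar>" M "\<lambda>_. 1", OF _ _ _ _ i2]
 have c1: "integrable M (\<lambda>om. \<bar>X om\<bar> * 1)" by (rule c(1)) simp_all
 show "integrable M X" by (rule bi_bound[OF c1]) simp_all
 show "(\<integral>om. \<bar>X om\<bar> \<partial>M) \<le> sqrt (\<integral>om. (X om)^2 \<partial>M)" using c(2) by (simp add: prob_space)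
qed

text \<open>Holds without convergence, as both sides are the same definite description. It lets a
  limit be computed from late terms, whose noise exceeds the time horizon only slightly.\<close>

lemma lim_shift: "lim (\<lambda>k. f (k + K) :: real) = lim f"
 unfolding lim_def by (rule arg_cong[where f = The]) (auto simp: fun_eq_iff intro: LIMSEQ_ignore_initial_segment LIMSEQ_offset)

text \<open>The variables of the entries are constant, so their values can be read off at
  \<open>undefined\<close>.\<close>

lemma sf_int_ll:
 assumes "\<And>e. e \<in> set S ==> \<exists>c a b B. e = (\<lambda>_. c, a, b, B)"
 shows "sf_int S om = ll (concat (map (\<lambda>(X, a, b, B). [(X undefined, (b, B)), (- X undefined, (a, B))]) S)) om"
 using assms
proof (induction S)
 case (Cons e S)
 have "\<exists>c a b B. e = (\<lambda>_. c, a, b, B)" by (rule Cons.prems) simp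
 then obtain c a b B where e: "e = (\<lambda>_. c, a, b, B)" by blast
 have "ll (xs @ ys) om = ll xs om + ll ys om" for xs ys by (simp add: ll_def)
 then show ?case using Cons by (simp add: e sf_int_def Wi_def algebra_simps)
qed (simp add: sf_int_def)

text \<open>Entries with coefficient 0 are exempt from the time bounds because a grid also lists the
  cells on which the kernel vanishes.\<close>

definition wiener_entry :: "real => real => ('a => real) \<times> real \<times> real \<times> real set => bool" where
 "wiener_entry s0 t e \<longleftrightarrow> (\<exists>c a b B. e = (\<lambda>_. c, a, b, B) \<and> 0 \<le> a \<and> a \<le> b \<and> B \<in> finite_borel \<and> (c \<noteq> 0 \<longrightarrow> s0 < a \<and> b \<le> t))"

lemma wiener_gauss:
 assumes "\<And>e. e \<in> set S ==> wiener_entry s0 t e"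
 shows "gauss_indep M (sub (upto_time s0)) (sf_int S) (\<integral>om. (sf_int S om)^2 \<partial>M)"
proof -
 let ?xs = "concat (map (\<lambda>(X, a, b, B). [(X undefined, (b, B)), (- X undefined, (a, B))]) S)"
 have eq: "sf_int S = ll ?xs"   proof (intro ext sf_int_ll)
  fix e assume "e \<in> set S"
  then show "\<exists>c a b B. e = (\<lambda>_. c, a, b, B)" using assms unfolding wiener_entry_def by blast
 qed
 have "gauss_indep M (sub (upto_time s0)) (ll ?xs) (\<integral>om. (ll ?xs om)^2 \<partial>M)"
 proof (rule gauss_list[OF _ upto_IX])
  show "snd ` set ?xs \<subseteq> IX" using assms by (fastforce simp: wiener_entry_def)
  fix j assume j: "j \<in> upto_time s0"
  have "(\<Sum>(c, i)\<leftarrow>concat (map (\<lambda>(X, a, b, B). [(X undefined, (b, B)), (- X undefined, (a, B))]) T). c * cv i j) = 0"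
   if "set T \<subseteq> set S" for T
   using that
  proof (induction T)
   case (Cons e T)
   then have "wiener_entry s0 t e" using assms by simp
   then obtain c a b B where e: "e = (\<lambda>_. c, a, b, B)" "a \<le> b" "c \<noteq> 0 \<longrightarrow> s0 < a"
    by (auto simp: wiener_entry_def)
   have "c * cv (b, B) j = c * cv (a, B) j" using e j by (auto simp: cv_def)
   then show ?case using Cons by (simp add: e)
  qed simp
  then show "(\<Sum>(c, i)\<leftarrow>?xs. c * cv i j) = 0" by simp
 qed
 then show ?thesis unfolding eq .
qed

lemma wiener_measurable:
 assumes "\<And>e. e \<in> set S ==> wiener_entry s0 t e"
 shows "sf_int S \<in> bm (sub (upto_time t))"
 unfolding sf_int_def[abs_def]
proof (rule sum_list_measurable)
 fix e assume "e \<in> set S"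
 then obtain c a b B where e: "e = (\<lambda>_. c, a, b, B)" "0 \<le> a" "a \<le> b" "B \<in> finite_borel" "c \<noteq> 0 \<longrightarrow> s0 < a \<and> b \<le> t"
  using assms unfolding wiener_entry_def by blast
 have eq: "ent e = (\<lambda>om. c * (W b B om - W a B om))" by (auto simp: e(1))
 show "ent e \<in> bm (sub (upto_time t))"
 proof (cases "c = 0")
  case False
  then have "b \<le> t" using e by simp
  then have "(b, B) \<in> upto_time t" "(a, B) \<in> upto_time t" using e by auto
  from this[THEN Wi_sub[OF upto_IX]]
  have [measurable]: "W b B \<in> bm (sub (upto_time t))" "W a B \<in> bm (sub (upto_time t))"
   by (simp_all add: Wi_def[abs_def])
  show ?thesis unfolding eq by measurable
 qed (simp add: eq)
qed

lemma sub_filtration: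
 assumes "X \<in> bm (sub (upto_time s))" "s \<le> a"
 shows "X \<in> bm (noise_filtration M W a)"
 using assms(1)
proof (rule measurable_subset_sets)
 show "sets (sub (upto_time s)) \<subseteq> sets (noise_filtration M W a)"
  using noise_sets_mono[OF assms(2)] noise_sets_filtration[of a] by (simp add: noise_sets_sub)
qed (simp add: sub_space[OF upto_IX] filtration_space)

text \<open>The integrals are Cauchy in L2, hence in L1, which yields an almost surely convergent
  subsequence. The limit is written with the pointwise \<open>lim\<close>, so that it inherits
  measurability from the terms.\<close>

lemma sf_int_converges:
 assumes S: "\<And>m. is_simple_field M W (S m)" and Xm [measurable]: "X \<in> bm PP"
  and lim: "(\<lambda>m. nn2 PP (\<lambda>z. simple_field_eval (S m) z - X z)) ----> 0"
 shows "\<exists>r. strict_mono r \<and> (AE om in M. (\<lambda>k. sf_int (S (r k)) om) ----> lim (\<lambda>k. sf_int (S (r k)) om))"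
proof -
 note [measurable] = eval_PP[OF S] sf_int_measurable[OF S]
 let ?q = "\<lambda>m. nn2 PP (\<lambda>z. simple_field_eval (S m) z - X z)"
 have d: "nn2 M (\<lambda>om. sf_int (S k) om - sf_int (S l) om) \<le> 4 * (2 * ?q k + 2 * ?q l)" for k l
 proof -
  have "nn2 M (\<lambda>om. sf_int (S k) om - sf_int (S l) om)
   \<le> 4 * nn2 PP (\<lambda>z. simple_field_eval (S k) z - simple_field_eval (S l) z)"
   by (rule walsh_bound[OF walsh_diff[OF walsh_simple[OF S] walsh_simple[OF S]]])
  also have "nn2 PP (\<lambda>z. simple_field_eval (S k) z - simple_field_eval (S l) z)
   = nn2 PP (\<lambda>z. (simple_field_eval (S k) z - X z) + (X z - simple_field_eval (S l) z))" by simp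
  also have "\<dots> \<le> 2 * ?q k + 2 * nn2 PP (\<lambda>z. X z - simple_field_eval (S l) z)"
   by (rule nn_integral_sq_add_le) measurable
  also have "nn2 PP (\<lambda>z. X z - simple_field_eval (S l) z) = ?q l" by (simp add: power2_commute)
  finally show ?thesis by (simp add: mult_left_mono)
 qed
 have ism: "integrable M (sf_int (S m))" for m
  using L1_le_L2(1)[OF _ simple_isometry(1)[OF S]] by simp
 have "\<exists>N. \<forall>i\<ge>N. \<forall>j\<ge>N. (\<integral>om. norm (sf_int (S i) om - sf_int (S j) om) \<partial>M) < e" if e: "0 < e" for e
 proof -
  \<comment> \<open>Chosen since \<open>4 * (2 * e^2 / 32 + 2 * e^2 / 32) = e^2 / 2\<close>.\<close>
  have "0 < ennreal (e^2 / 32)" using e by simp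
  from order_tendstoD(2)[OF lim this] obtain N where N: "\<And>m. N \<le> m ==> ?q m < ennreal (e^2 / 32)"
   by (auto simp: eventually_sequentially)
  have "(\<integral>om. norm (sf_int (S i) om - sf_int (S j) om) \<partial>M) < e" if ij: "N \<le> i" "N \<le> j" for i j
  proof -
   let ?D = "\<lambda>om. sf_int (S i) om - sf_int (S j) om"
   have "nn2 M (\<lambda>om. ?D om) \<le> 4 * (2 * ?q i + 2 * ?q j)" by (rule d)
   also have "\<dots> \<le> 4 * (2 * ennreal (e^2 / 32) + 2 * ennreal (e^2 / 32))"
    using N[OF ij(1)] N[OF ij(2)] by (intro mult_left_mono add_mono) (auto simp: less_imp_le)
   also have "\<dots> = ennreal (e^2 / 2)"
    by (simp add: ennreal_plus[symmetric] ennreal_mult'[symmetric] del: ennreal_plus flip: ennreal_numeral)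
   finally have le: "nn2 M (\<lambda>om. ?D om) \<le> ennreal (e^2 / 2)" .
   have iD: "integrable M (\<lambda>om. (?D om)^2)"
    using le_less_trans[OF le, of \<infinity>] by (intro integrableI_bounded) auto
   have "ennreal (\<integral>om. (?D om)^2 \<partial>M) \<le> ennreal (e^2 / 2)"
    using le iD by (simp add: nn_integral_eq_integral)
   then have "(\<integral>om. (?D om)^2 \<partial>M) \<le> e^2 / 2" by (subst (asm) ennreal_le_iff) auto
   moreover have "e^2 / 2 < e^2" using e by simp
   ultimately have "sqrt (\<integral>om. (?D om)^2 \<partial>M) < sqrt (e^2)" by (intro real_sqrt_less_mono) linarith
   moreover have "(\<integral>om. \<bar>?D om\<bar> \<partial>M) \<le> sqrt (\<integral>om. (?D om)^2 \<partial>M)" by (rule L1_le_L2(2)[OF _ iD]) measurable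
   ultimately show ?thesis using e by simp
  qed
  then show ?thesis by blast
 qed
 then obtain r where r: "strict_mono r" and ca: "AE om in M. Cauchy (\<lambda>i. sf_int (S (r i)) om)"
  by (rule cauchy_L1_AE_cauchy_subseq[OF ism])
 have "AE om in M. (\<lambda>k. sf_int (S (r k)) om) ----> lim (\<lambda>k. sf_int (S (r k)) om)"
  using ca by eventually_elim (simp add: Cauchy_convergent convergent_LIMSEQ_iff[symmetric])
 with r show ?thesis by blast
qed

text \<open>Needed for the part of an increment that comes from the noise before the window, for
  which no integral is given beforehand.\<close>

lemma walsh_exists:
 assumes h: "adm T \<phi> h" and g: "kern T \<phi> g \<Gamma>"
  and ad: "\<And>s' s y y'. 0 \<le> s' ==> s' < s ==> g (s, y') \<noteq> 0 ==> h s' y \<in> bm (sub (upto_time s))"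
 shows "\<exists>I. walsh (\<lambda>(om, s, y). h s y om * g (s, y)) I"
proof -
 let ?X = "\<lambda>(om, s, y). h s y om * g (s, y)"
 have "\<exists>n :: nat => nat. (\<forall>m. m < n m) \<and> (\<forall>m. is_simple_field M W (gfield h g m (n m))) \<and>
  (\<lambda>m. nn2 PP (\<lambda>z. simple_field_eval (gfield h g m (n m)) z - ?X z)) ----> 0 \<and>
  (\<forall>m. (\<Sum>e\<leftarrow>gfield h g m (n m). weight e) \<le> \<Gamma> + 1 / (real m + 1))"
  by (rule grid_exists[OF h g ad])
 then obtain n :: "nat => nat" where n: "\<And>m. is_simple_field M W (gfield h g m (n m))"
  "(\<lambda>m. nn2 PP (\<lambda>z. simple_field_eval (gfield h g m (n m)) z - ?X z)) ----> 0" by blast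
 have X: "?X \<in> bm PP" using field_PP[of h g] kern_borel[OF g] h unfolding adm_def by blast
 from sf_int_converges[OF n(1) X n(2)] obtain r where r: "strict_mono r"
  "AE om in M. (\<lambda>k. sf_int (gfield h g (r k) (n (r k))) om) ----> lim (\<lambda>k. sf_int (gfield h g (r k) (n (r k))) om)" by blast
 have "walsh ?X (\<lambda>om. lim (\<lambda>k. sf_int (gfield h g (r k) (n (r k))) om))"
  using X
 proof (rule walsh_AE)
  show "(\<lambda>om. lim (\<lambda>k. sf_int (gfield h g (r k) (n (r k))) om)) \<in> bm M"
   by (intro borel_measurable_lim_metric sf_int_measurable n)
  show "(\<lambda>k. nn2 PP (\<lambda>z. simple_field_eval (gfield h g (r k) (n (r k))) z - ?X z)) ----> 0"
   using LIMSEQ_subseq_LIMSEQ[OF n(2) r(1)] by (simp add: comp_def)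
 qed (use n r in auto)
 then show ?thesis by blast
qed

text \<open>The Wiener integral of \<open>g\<close> as one variable \<open>N\<close> with three
  properties at once: it is Gaussian and independent of the past at \<open>s0\<close>, it is known
  shortly after \<open>T\<close>, and its product with a variable \<open>z\<close> of the past is
  the integral of \<open>z\<close> times \<open>g\<close>. The \<open>\<epsilon>\<close> is owed to
  the last grid cell, which may reach beyond \<open>T\<close>.\<close>

lemma wiener_exists:
 assumes g: "kern T (\<lambda>_. 1) g \<Gamma>" and s0: "0 \<le> s0" and supp: "\<And>p. g p \<noteq> 0 ==> s0 < fst p"
 shows "\<exists>N. gauss_indep M (sub (upto_time s0)) N (\<integral>p. (g p)^2 \<partial>lborel) \<and>
  (\<forall>\<epsilon>>0. N \<in> bm (sub (upto_time (T + \<epsilon>)))) \<and>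
  (\<forall>z\<in>bm (sub (upto_time s0)). integrable M (\<lambda>om. (z om)^2) \<longrightarrow>
   walsh (\<lambda>(om, s, y). z om * g (s, y)) (\<lambda>om. z om * N om))"
proof -
 let ?h = "\<lambda>(s :: real) (y :: real) (om :: 'a). 1 :: real"
 have h: "adm T (\<lambda>_. 1) ?h" unfolding adm_def by (simp add: prob_space_axioms emeasure_space_1)
 note [measurable] = kern_borel[OF g]
 have "\<exists>n :: nat => nat. (\<forall>m. m < n m) \<and> (\<forall>m. is_simple_field M W (gfield ?h g m (n m))) \<and>
  (\<lambda>m. nn2 PP (\<lambda>z. simple_field_eval (gfield ?h g m (n m)) z - (\<lambda>(om, s, y). ?h s y om * g (s, y)) z)) ----> 0 \<and>
  (\<forall>m. (\<Sum>e\<leftarrow>gfield ?h g m (n m). weight e) \<le> \<Gamma> + 1 / (real m + 1))"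
  by (rule grid_exists[OF h g]) simp
 then obtain n :: "nat => nat" where n: "\<And>m. m < n m" "\<And>m. is_simple_field M W (gfield ?h g m (n m))"
  "(\<lambda>m. nn2 PP (\<lambda>z. simple_field_eval (gfield ?h g m (n m)) z - (\<lambda>(om, s, y). ?h s y om * g (s, y)) z)) ----> 0"
  by blast
 define S where "S m = gfield ?h g m (n m)" for m
 define X where "X = (\<lambda>z :: 'a \<times> real \<times> real. g (snd z))"
 have S: "is_simple_field M W (S m)" for m using n(2) by (simp add: S_def)
 have n0: "0 < n m" for m using n(1)[of m] by simp
 have Xe: "(\<lambda>(om, s, y). ?h s y om * g (s, y)) = X" by (auto simp: X_def)
 have lim: "(\<lambda>m. nn2 PP (\<lambda>z. simple_field_eval (S m) z - X z)) ----> 0"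
  using n(3) unfolding Xe S_def .
 have Xm[measurable]: "X \<in> bm PP"
  using field_PP[of ?h g] kern_borel[OF g] h unfolding Xe adm_def by blast
 note [measurable] = eval_PP[OF S] sf_int_measurable[OF S]
 \<comment> \<open>A cell with nonzero coefficient starts after \<open>s0\<close> and not after
   \<open>T\<close>, so it ends at most one mesh width after \<open>T\<close>.\<close>
 have we: "wiener_entry s0 (T + 1 / real (n m)) e" if "e \<in> set (S m)" for m e
 proof -
  from that obtain k l where kl: "k \<in> {1..int ((m + 1) * n m)}"
   "e = (gval ?h g m (n m) k l, real_of_int k / real (n m), (real_of_int k + 1) / real (n m), cell (n m) l)"
   by (auto simp: S_def gfield_def grid_def)
  let ?t = "trunc g m (real_of_int k / real (n m), real_of_int l / real (n m))"
  have "gval ?h g m (n m) k l = (\<lambda>_. cut (n m) 1 * ?t)" by (simp add: gval_def fun_eq_iff)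
  moreover have "s0 < real_of_int k / real (n m) \<and> (real_of_int k + 1) / real (n m) \<le> T + 1 / real (n m)" if "?t \<noteq> 0"
   using supp[of "(real_of_int k / real (n m), real_of_int l / real (n m))"] trunc(4)[OF that] kern_supp[OF g, of "(real_of_int k / real (n m), real_of_int l / real (n m))"]
   by (auto simp: add_divide_distrib)
  ultimately show ?thesis unfolding wiener_entry_def using kl n0[of m] cell_finite[OF n0[of m], of l]
   by (intro exI[of _ "cut (n m) 1 * ?t"] exI conjI) (auto simp: divide_right_mono)
 qed
 let ?q = "\<lambda>m. nn2 PP (\<lambda>z. simple_field_eval (S m) z - X z)"
 from sf_int_converges[OF S Xm lim] obtain r where r: "strict_mono r"
  and ae0: "AE om in M. (\<lambda>k. sf_int (S (r k)) om) ----> lim (\<lambda>k. sf_int (S (r k)) om)" by blast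
 define N where "N om = lim (\<lambda>k. sf_int (S (r k)) om)" for om
 have ae: "AE om in M. (\<lambda>k. sf_int (S (r k)) om) ----> N om"
  using ae0 by (simp add: N_def)
 have rk: "k \<le> r k" for k using r by (rule strict_mono_imp_increasing)
 \<comment> \<open>From the index \<open>K\<close> on, the mesh width is at most
   \<open>\<epsilon>\<close>, so the limit over late terms is known at time
   \<open>T + \<epsilon>\<close>.\<close>
 have Nm: "N \<in> bm (sub (upto_time (T + \<epsilon>)))" if eps: "0 < \<epsilon>" for \<epsilon>
 proof -
  obtain K :: nat where K: "1 / \<epsilon> < real K" using reals_Archimedean2 by blast
  have "sf_int (S (r (k + K))) \<in> bm (sub (upto_time (T + \<epsilon>)))" for k
  proof (rule wiener_measurable)
   fix e assume "e \<in> set (S (r (k + K)))"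
   from we[OF this] have "wiener_entry s0 (T + 1 / real (n (r (k + K)))) e" .
   moreover have "1 / real (n (r (k + K))) \<le> \<epsilon>"
   proof -
    have "K \<le> n (r (k + K))" using rk[of "k + K"] n(1)[of "r (k + K)"] by linarith
    then have "1 / \<epsilon> < real (n (r (k + K)))" using K by linarith
    then have "1 < real (n (r (k + K))) * \<epsilon>" using eps by (simp add: field_simps)
    then show ?thesis using n0[of "r (k + K)"] by (simp add: field_simps)
   qed
   ultimately show "wiener_entry s0 (T + \<epsilon>) e" unfolding wiener_entry_def by force
  qed
  then have "(\<lambda>om. lim (\<lambda>k. sf_int (S (r (k + K))) om)) \<in> bm (sub (upto_time (T + \<epsilon>)))"
   by (rule borel_measurable_lim_metric)
  moreover have "(\<lambda>om. lim (\<lambda>k. sf_int (S (r (k + K))) om)) = N"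
   by (rule ext) (simp only: lim_shift[of "\<lambda>k. sf_int (S (r k)) _"] N_def)
  ultimately show ?thesis by simp
 qed
 have NM[measurable]: "N \<in> bm M" by (rule measurable_from_subalg[OF sub_subalgebra[OF upto_IX] Nm[OF zero_less_one]])
 have limr: "(\<lambda>k. ?q (r k)) ----> 0" using LIMSEQ_subseq_LIMSEQ[OF lim r] by (simp add: comp_def)
 have wN: "walsh X N" by (rule walsh_AE[OF Xm NM S limr ae])
 have limN: "(\<lambda>k. nn2 M (\<lambda>om. sf_int (S (r k)) om - N om)) ----> 0"
  by (rule walsh_approx[OF wN S limr])
 have gfin: "nn2 lborel (\<lambda>p. g p) \<le> ennreal \<Gamma>" using kern_bound[OF g] by simp
 have ig: "integrable lborel (\<lambda>p. (g p)^2)"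
  using le_less_trans[OF gfin, of \<infinity>] by (intro integrableI_bounded) auto
 have X2: "nn2 PP (\<lambda>z. X z) = nn2 lborel (\<lambda>p. g p)"
 proof -
  have "(\<lambda>z. ennreal ((X z)^2)) \<in> bm PP" by measurable
  from PP_swap[OF this] show ?thesis by (simp add: X_def emeasure_space_1)
 qed
 have iX: "integrable PP (\<lambda>z. (X z)^2)"
  using le_less_trans[OF gfin, of \<infinity>] by (intro integrableI_bounded) (auto simp: X2)
 have "ennreal (\<integral>z. (X z)^2 \<partial>PP) = ennreal (\<integral>p. (g p)^2 \<partial>lborel)"
  using X2 iX ig by (simp add: nn_integral_eq_integral)
 then have iXg: "(\<integral>z. (X z)^2 \<partial>PP) = (\<integral>p. (g p)^2 \<partial>lborel)" by simp
 have "(\<lambda>k. \<integral>z. (simple_field_eval (S (r k)) z)^2 \<partial>PP) ----> (\<integral>z. (X z)^2 \<partial>PP)"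
  by (rule L2_norm_convergence[OF _ _ simple_isometry(2)[OF S] iX limr]) measurable
 then have v: "(\<lambda>k. \<integral>om. (sf_int (S (r k)) om)^2 \<partial>M) ----> (\<integral>p. (g p)^2 \<partial>lborel)"
  by (simp add: simple_isometry(3)[OF S] iXg)
 have gi: "gauss_indep M (sub (upto_time s0)) N (\<integral>p. (g p)^2 \<partial>lborel)"
  by (rule gauss_indep_limit[OF sub_subalgebra[OF upto_IX] wiener_gauss[OF we] NM limN v])
 have "walsh (\<lambda>(om, s, y). z om * g (s, y)) (\<lambda>om. z om * N om)"
  if z: "z \<in> bm (sub (upto_time s0))" and iz: "integrable M (\<lambda>om. (z om)^2)" for z
 proof -
  have [measurable]: "z \<in> bm M" by (rule measurable_from_subalg[OF sub_subalgebra[OF upto_IX] z])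
  \<comment> \<open>An entry with nonzero coefficient starts after \<open>s0\<close>, so multiplying
    it by the cut of \<open>z\<close> leaves an entry of a simple field.\<close>
  define S' where "S' k = map (\<lambda>(X, a, b, B). (\<lambda>om. cut k (z om) * X om, a, b, B)) (S (r k))" for k
  have S': "is_simple_field M W (S' k)" for k
   unfolding simple_valid
  proof
   fix e assume "e \<in> set (S' k)"
   then obtain X a b B where f: "(X, a, b, B) \<in> set (S (r k))" "e = (\<lambda>om. cut k (z om) * X om, a, b, B)"
    by (auto simp: S'_def)
   from we[OF f(1)] obtain c where c: "X = (\<lambda>_. c)" "0 \<le> a" "a \<le> b" "B \<in> finite_borel" "c \<noteq> 0 \<longrightarrow> s0 < a"
    by (auto simp: wiener_entry_def)
   have "(\<lambda>om. cut k (z om) * c) \<in> bm (noise_filtration M W a)"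
   proof (cases "c = 0")
    case False
    then have [measurable]: "z \<in> bm (noise_filtration M W a)" using c by (intro sub_filtration[OF z]) simp
    show ?thesis by measurable
   qed simp
   moreover have "\<bar>cut k (z om) * c\<bar> \<le> real k * \<bar>c\<bar>" for om
    unfolding abs_mult by (intro mult_right_mono cut) simp
   ultimately show "valid e" using c by (auto simp: f bounded_iff)
  qed
  have evS': "simple_field_eval (S' k) z' = cut k (z (fst z')) * simple_field_eval (S (r k)) z'" for k z'
   unfolding simple_field_eval_ev S'_def sum_list_const_mult[symmetric] map_map comp_def
   by (rule arg_cong[where f = sum_list], rule map_cong[OF refl], cases z') (auto simp: mult_ac)
  have sfS': "sf_int (S' k) om = cut k (z om) * sf_int (S (r k)) om" for k om
   unfolding sf_int_def S'_def sum_list_const_mult[symmetric] map_map comp_def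
   by (rule arg_cong[where f = sum_list], rule map_cong[OF refl]) (auto simp: mult_ac)
  define Z where "Z = nn2 M (\<lambda>om. z om)"
  have Z: "Z < \<infinity>" using iz by (simp add: Z_def nn_integral_eq_integral)
  have Ym: "(\<lambda>(om, s, y). z om * g (s, y)) \<in> bm PP"
  proof -
   have "(\<lambda>w. z (fst w) * X w) \<in> bm PP" by measurable
   then show ?thesis by (simp add: X_def case_prod_unfold)
  qed
  have limS': "(\<lambda>k. nn2 PP (\<lambda>w. simple_field_eval (S' k) w - (\<lambda>(om, s, y). z om * g (s, y)) w)) ----> 0"
  proof -
   have A: "(\<lambda>k. nn2 PP (\<lambda>w. cut k (z (fst w)) * (simple_field_eval (S (r k)) w - X w))) ----> 0"
   proof (rule tendsto_sandwich[OF _ _ tendsto_const])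
    show "(\<lambda>k. Z * ?q (r k)) ----> 0" using ennreal_tendsto_cmult[OF _ limr, of Z] Z by simp
    have "nn2 PP (\<lambda>w. cut k (z (fst w)) * (simple_field_eval (S (r k)) w - X w)) \<le> Z * ?q (r k)" for k
    proof -
     \<comment> \<open>The simple field and \<open>X\<close> do not depend on \<open>om\<close>, so
       the double integral factors into a second moment of the cut of \<open>z\<close> and the
       deterministic error \<open>\<rho>\<close>.\<close>
     define \<rho> where "\<rho> p = (cut (n (r k)) 1 * trunc g (r k) (gpt (n (r k)) (fst p), gpt (n (r k)) (snd p)) - g p)^2" for p
     have ev: "simple_field_eval (S (r k)) (om, p) = cut (n (r k)) 1 * trunc g (r k) (gpt (n (r k)) (fst p), gpt (n (r k)) (snd p))" for om p
      unfolding S_def using gfield_eval[OF n0[of "r k"], of g ?h "r k" om "fst p" "snd p"] kern_supp[OF g] by simp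
     have \<rho>: "(\<lambda>p. ennreal (\<rho> p)) \<in> bm lborel"
     proof -
      have "(\<lambda>w. ennreal ((simple_field_eval (S (r k)) w - X w)^2)) \<in> bm PP" by measurable
      from PP_section[OF this] show ?thesis by (simp add: ev X_def \<rho>_def emeasure_space_1)
     qed
     have "?q (r k) = nni lborel (\<lambda>p. \<rho> p)"
     proof -
      have "(\<lambda>w. ennreal ((simple_field_eval (S (r k)) w - X w)^2)) \<in> bm PP" by measurable
      from PP_swap[OF this] show ?thesis by (simp add: ev X_def \<rho>_def emeasure_space_1)
     qed
     moreover have "nn2 PP (\<lambda>w. cut k (z (fst w)) * (simple_field_eval (S (r k)) w - X w))
      = (\<integral>\<^sup>+p. \<integral>\<^sup>+om. ennreal ((cut k (z om))^2) * ennreal (\<rho> p) \<partial>M \<partial>lborel)"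
     proof -
      have "(\<lambda>w. ennreal ((cut k (z (fst w)) * (simple_field_eval (S (r k)) w - X w))^2)) \<in> bm PP" by measurable
      from PP_swap[OF this] show ?thesis by (simp add: ev X_def \<rho>_def power_mult_distrib ennreal_mult)
     qed
     moreover have "\<dots> \<le> (\<integral>\<^sup>+p. Z * ennreal (\<rho> p) \<partial>lborel)"
      unfolding Z_def
      by (subst nn_integral_multc) (auto intro!: nn_integral_mono mult_right_mono ennreal_leI simp: abs_le_square_iff[symmetric] cut(2))
     ultimately show ?thesis using \<rho> by (simp add: nn_integral_cmult)
    qed
    then show "\<forall>\<^sub>F k in sequentially. (nn2 PP (\<lambda>w. cut k (z (fst w)) * (simple_field_eval (S (r k)) w - X w))) \<le> Z * ?q (r k)"
     by (intro always_eventually allI)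
   qed simp
   have B: "(\<lambda>k. nn2 PP (\<lambda>w. (cut k (z (fst w)) - z (fst w)) * X w)) ----> 0"
   proof -
    have "(\<lambda>k. nn2 M (\<lambda>om. cut k (z om) - z om)) ----> (\<integral>\<^sup>+om. 0 \<partial>M)"
    proof (rule nn_integral_dominated_convergence[where w = "\<lambda>om. ennreal ((z om)^2)"])
     show "AE om in M. ennreal ((cut j (z om) - z om)^2) \<le> ennreal ((z om)^2)" for j
     proof -
      have "(cut j x - x)^2 \<le> x^2" for x
       using cut(4)[of x j] by (simp add: abs_le_square_iff[symmetric] abs_minus_commute)
      then show ?thesis by (simp add: ennreal_leI)
     qed
     have "(\<lambda>j. ennreal ((cut j x - x)^2)) ----> ennreal ((x - x)^2)" for x
      by (intro tendsto_intros cut_tendsto)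
     then show "AE om in M. (\<lambda>j. ennreal ((cut j (z om) - z om)^2)) ----> 0" by simp
    qed (use Z in \<open>simp_all add: Z_def\<close>)
    then have c0: "(\<lambda>k. nn2 M (\<lambda>om. cut k (z om) - z om)) ----> 0" by simp
    have "nn2 PP (\<lambda>w. (cut k (z (fst w)) - z (fst w)) * X w)
     = nn2 lborel (\<lambda>p. g p) * nn2 M (\<lambda>om. cut k (z om) - z om)" for k
    proof -
     have "(\<lambda>w. ennreal (((cut k (z (fst w)) - z (fst w)) * X w)^2)) \<in> bm PP" by measurable
     from PP_swap[OF this] show ?thesis
      by (simp add: X_def power_mult_distrib ennreal_mult nn_integral_multc nn_integral_cmult mult.commute)
    qed
    moreover have "(\<lambda>k. (nn2 lborel (\<lambda>p. g p)) * nn2 M (\<lambda>om. cut k (z om) - z om)) ----> (nn2 lborel (\<lambda>p. g p)) * 0"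
     using le_less_trans[OF gfin, of top] by (intro ennreal_tendsto_cmult c0) simp
    ultimately show ?thesis by simp
   qed
   have "(\<lambda>k. nn2 PP (\<lambda>w. cut k (z (fst w)) * (simple_field_eval (S (r k)) w - X w) + (cut k (z (fst w)) - z (fst w)) * X w)) ----> 0"
    by (rule tendsto_sum_squares[OF _ _ A B]) measurable
   moreover have "cut k (z (fst w)) * (simple_field_eval (S (r k)) w - X w) + (cut k (z (fst w)) - z (fst w)) * X w
    = simple_field_eval (S' k) w - (\<lambda>(om, s, y). z om * g (s, y)) w" for k w
    by (cases w) (simp add: evS' X_def algebra_simps)
   ultimately show ?thesis by simp
  qed
  show ?thesis
  proof (rule walsh_AE[OF Ym _ S' limS'])
   show "AE om in M. (\<lambda>k. sf_int (S' k) om) ----> z om * N om"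
    using ae unfolding sfS' by eventually_elim (intro tendsto_mult cut_tendsto)
  qed measurable
 qed
 then show ?thesis using gi Nm by blast
qed

end

section \<open>The Gaussian heat kernel\<close>

definition gk :: "real => real => real" where "gk t z = exp (- (z^2 / (2 * t))) / sqrt (2 * pi * t)"

lemma gk_normal: "0 < t ==> gk t z = normal_density 0 (sqrt t) z"
 by (simp add: gk_def normal_density_def)

lemma gk_measurable [measurable]: "gk t \<in> bm borel"
 unfolding gk_def[abs_def] by measurable

lemma gk_nonneg: "0 < t ==> 0 \<le> gk t z" by (simp add: gk_def)

lemma gk_minus: "gk t (- z) = gk t z" "gk t (a - b) = gk t (b - a)" "gk t \<bar>z\<bar> = gk t z"
 by (simp_all add: gk_def power2_commute)

lemma gk_zero: "gk t 0 = 1 / sqrt (2 * pi * t)" by (simp add: gk_def)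

lemma gk_mono: "0 < t ==> \<bar>w\<bar> \<le> \<bar>z\<bar> ==> gk t z \<le> gk t w"
proof -
 assume t: "0 < t" and "\<bar>w\<bar> \<le> \<bar>z\<bar>"
 then have "w^2 \<le> z^2" by (simp add: abs_le_square_iff)
 then show ?thesis unfolding gk_def using t by (intro divide_right_mono) (auto simp: divide_right_mono)
qed

text \<open>With \<open>v = z^2 / (2 * t)\<close> the product is
  \<open>sqrt v * exp (- v) / sqrt pi\<close>. The bound does not depend on \<open>t\<close>, so a
  kernel evaluated at a positive distance is harmless near the time singularity.\<close>

lemma gk_le_inverse: "0 < t ==> \<bar>z\<bar> * gk t z \<le> 1"
proof -
 assume t: "0 < t"
 define v where "v = z^2 / (2 * t)"
 have v: "0 \<le> v" using t by (simp add: v_def)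
 have "\<bar>z\<bar> = sqrt (2 * t) * sqrt v" using t by (simp add: v_def real_sqrt_mult[symmetric])
 moreover have "sqrt (2 * pi * t) = sqrt (2 * t) * sqrt pi" by (simp add: real_sqrt_mult[symmetric] mult_ac)
 ultimately have e: "\<bar>z\<bar> * gk t z = sqrt v * exp (- v) / sqrt pi" using t by (simp add: gk_def v_def)
 have "sqrt v \<le> 1 + v"
 proof (cases "v \<le> 1")
  case True
  then have "sqrt v \<le> sqrt 1" by (rule real_sqrt_le_mono)
  then have "sqrt v \<le> 1" by (simp only: real_sqrt_one)
  then show ?thesis using v by linarith
 next
  case False
  then have "sqrt v \<le> sqrt (v^2)" by (intro real_sqrt_le_mono) (simp add: power2_eq_square)
  then show ?thesis using v by simp
 qed
 also have "\<dots> \<le> exp v" by (rule exp_ge_add_one_self)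
 finally have "sqrt v * exp (- v) \<le> exp v * exp (- v)" by (intro mult_right_mono) auto
 then have 1: "sqrt v * exp (- v) \<le> 1" by (simp add: exp_minus)
 have "1 \<le> sqrt pi" using pi_ge_two by simp
 with 1 have "sqrt v * exp (- v) \<le> sqrt pi" by linarith
 then have "sqrt v * exp (- v) / sqrt pi \<le> 1" by (simp add: divide_le_eq)
 then show ?thesis unfolding e .
qed

lemma gk_integral: "0 < t ==> (nni lborel (\<lambda>z. gk t (X - z))) = 1"
proof -
 assume t: "0 < t"
 have "nni lborel (\<lambda>z. gk t (X - z)) = nni lborel (\<lambda>z. gk t z)"
  using nn_integral_real_affine[of "\<lambda>z. ennreal (gk t z)" "- 1" X] by simp
 also have "\<dots> = nni lborel (\<lambda>z. normal_density 0 (sqrt t) z)" by (simp add: gk_normal[OF t])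
 also have "nni lborel (\<lambda>z. normal_density 0 (sqrt t) z) = ennreal (\<integral>z. normal_density 0 (sqrt t) z \<partial>lborel)"
  using t by (intro nn_integral_eq_integral) auto
 also have "\<dots> = 1" using t by simp
 finally show ?thesis .
qed

lemma gk_product:
 assumes t: "0 < t" "0 < s"
 shows "nni lborel (\<lambda>z. gk t (X - z) * gk s (Y - z)) = ennreal (gk (t + s) (X - Y))"
  and "integrable lborel (\<lambda>z. gk t (X - z) * gk s (Y - z))"
  and "(\<integral>z. gk t (X - z) * gk s (Y - z) \<partial>lborel) = gk (t + s) (X - Y)"
proof -
 have "nni lborel (\<lambda>z. gk t (X - z) * gk s (Y - z))
  = nni lborel (\<lambda>z. gk t ((X - Y) - z) * gk s z)"
  using nn_integral_real_affine[of "\<lambda>z. ennreal (gk t (X - z) * gk s (Y - z))" 1 Y]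
  by (simp add: gk_minus(1) algebra_simps)
 also have "\<dots> = ennreal (gk (t + s) (X - Y))"
  using fun_cong[OF conv_normal_density_zero_mean[of "sqrt t" "sqrt s"], of "X - Y"] t
  by (simp add: gk_normal)
 finally show n: "nni lborel (\<lambda>z. gk t (X - z) * gk s (Y - z)) = ennreal (gk (t + s) (X - Y))" .
 have nn: "0 \<le> gk t (X - z) * gk s (Y - z)" for z using t by (intro mult_nonneg_nonneg gk_nonneg)
 show "integrable lborel (\<lambda>z. gk t (X - z) * gk s (Y - z))"
  using nn n by (intro integrableI_nonneg) auto
 show "(\<integral>z. gk t (X - z) * gk s (Y - z) \<partial>lborel) = gk (t + s) (X - Y)"
  using nn n gk_nonneg[of "t + s"] t by (intro integral_eq_nn_integral[THEN trans]) auto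
qed

text \<open>By \<open>gk_sq_diff\<close>, the squared L2 distance of two Gaussian densities with
  variances \<open>t\<close> and \<open>s\<close> whose centres are \<open>d\<close> apart.\<close>

definition gdiff :: "real => real => real => real" where
 "gdiff t s d = gk (2 * t) 0 + gk (2 * s) 0 - 2 * gk (t + s) d"

lemma gk_sq_diff:
 assumes t: "0 < t" "0 < s"
 shows "nn2 lborel (\<lambda>z. gk t (X - z) - gk s (Y - z)) = ennreal (gdiff t s (X - Y))"
  and "0 \<le> gdiff t s d"
proof -
 have i: "integrable lborel (\<lambda>z. (gk t (X - z) - gk s (Y - z))^2)"
  and e: "(\<integral>z. (gk t (X - z) - gk s (Y - z))^2 \<partial>lborel) = gdiff t s (X - Y)" for X Y
 proof -
  have sq: "(gk t (X - z) - gk s (Y - z))^2 = gk t (X - z) * gk t (X - z) + gk s (Y - z) * gk s (Y - z) - 2 * (gk t (X - z) * gk s (Y - z))" for z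
   by (simp add: power2_eq_square algebra_simps)
  note gi = gk_product(2)[OF t(1,1), of X X] gk_product(2)[OF t(2,2), of Y Y] integrable_mult_right[OF gk_product(2)[OF t, of X Y], of 2]
  note ge = gk_product(3)[OF t(1,1), of X X] gk_product(3)[OF t(2,2), of Y Y] gk_product(3)[OF t, of X Y]
  show "integrable lborel (\<lambda>z. (gk t (X - z) - gk s (Y - z))^2)"
   unfolding sq by (rule bi_diff[OF bi_add[OF gi(1,2)] gi(3)])
  show "(\<integral>z. (gk t (X - z) - gk s (Y - z))^2 \<partial>lborel) = gdiff t s (X - Y)"
   unfolding sq
   by (subst bo_diff[OF bi_add[OF gi(1,2)] gi(3)],
     subst bo_add[OF gi(1,2)], subst integral_mult_right_zero)
    (simp only: ge gdiff_def mult_2 diff_self)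
 qed
 show "nn2 lborel (\<lambda>z. gk t (X - z) - gk s (Y - z)) = ennreal (gdiff t s (X - Y))"
  using i by (simp add: nn_integral_eq_integral e)
 have "0 \<le> (\<integral>z. (gk t (d - z) - gk s (0 - z))^2 \<partial>lborel)" by simp
 then show "0 \<le> gdiff t s d" unfolding e by simp
qed

lemma gdiff_mono: "0 < t ==> 0 < s ==> \<bar>d\<bar> \<le> \<bar>d'\<bar> ==> gdiff t s d \<le> gdiff t s d'"
 using gk_mono[of "t + s" d d'] by (simp add: gdiff_def)

text \<open>Derivatives are required in the interior because the integrands below may blow up like
  an inverse square root at an endpoint, where the primitive is still continuous.\<close>

lemma nn_integral_FTC_interior:
 fixes F f :: "real => real"
 assumes ab: "a \<le> b" and F: "continuous_on {a..b} F"
  and d: "\<And>x. a < x ==> x < b ==> (F has_real_derivative f x) (at x)"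
  and f: "f \<in> bm borel" "\<And>x. a < x ==> x < b ==> 0 \<le> f x"
 shows "(\<integral>\<^sup>+x. ennreal (f x) * indicator {a<..<b} x \<partial>lborel) = ennreal (F b - F a)"
proof -
 define f' where "f' x = (if x \<in> {a<..<b} then f x else 0)" for x
 have "(f has_integral (F b - F a)) {a..b}"
  using d by (intro fundamental_theorem_of_calculus_interior ab F)
   (auto simp: has_real_derivative_iff_has_vector_derivative)
 then have "(f' has_integral (F b - F a)) {a..b}"
  by (rule has_integral_spike_finite[rotated 2, where S = "{a, b}"]) (auto simp: f'_def)
 then have "(\<integral>\<^sup>+x. ennreal (f' x) * indicator {a..b} x \<partial>lborel) = ennreal (F b - F a)"
  by (rule nn_integral_has_integral_lebesgue'[rotated]) (use f in \<open>auto simp: f'_def\<close>)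
 moreover have "ennreal (f' x) * indicator {a..b} x = ennreal (f x) * indicator {a<..<b} x" for x
  by (auto simp: f'_def indicator_def)
 ultimately show ?thesis by simp
qed

text \<open>Relative to the midpoint \<open>m = w + h / 2\<close> it suffices to bound
  \<open>2 - sqrt (1 - x) - sqrt (1 + x)\<close> by \<open>x^2\<close>, where
  \<open>x = h / (2 * m)\<close>. This is the decay in \<open>w\<close> of the kernel difference
  before a window.\<close>

lemma second_difference_sqrt:
 assumes "0 < w" "0 \<le> h"
 shows "0 \<le> 2 * sqrt (w + h / 2) - sqrt w - sqrt (w + h)"
  and "2 * sqrt (w + h / 2) - sqrt w - sqrt (w + h) \<le> h^2 / (w * sqrt w)"
proof -
 define m where "m = w + h / 2"
 define x where "x = (h / 2) / m"
 have m: "0 < m" using assms by (simp add: m_def)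
 have x: "0 \<le> x" "x \<le> 1" using assms m by (auto simp: x_def m_def field_simps)
 have w: "w = m * (1 - x)" and wh: "w + h = m * (1 + x)" using m by (auto simp: x_def m_def field_simps)
 have p: "0 \<le> sqrt (1 - x)" "0 \<le> sqrt (1 + x)" "(sqrt (1 - x))^2 = 1 - x" "(sqrt (1 + x))^2 = 1 + x" using x by auto
 have e: "2 * sqrt (w + h / 2) - sqrt w - sqrt (w + h) = sqrt m * (2 - sqrt (1 - x) - sqrt (1 + x))"
 proof -
  have "sqrt w = sqrt m * sqrt (1 - x)" "sqrt (w + h) = sqrt m * sqrt (1 + x)"
   unfolding real_sqrt_mult[symmetric] w[symmetric] wh[symmetric] by simp_all
  then show ?thesis unfolding m_def[symmetric] by (simp add: algebra_simps)
 qed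
 have "(sqrt (1 - x) + sqrt (1 + x))^2 \<le> 2^2"
  using p sum_squares_bound[of "sqrt (1 - x)" "sqrt (1 + x)"] by (simp add: power2_sum)
 then have "sqrt (1 - x) + sqrt (1 + x) \<le> 2" by (rule power2_le_imp_le) simp
 then show "0 \<le> 2 * sqrt (w + h / 2) - sqrt w - sqrt (w + h)" unfolding e using m by simp
 have "1 - x^2 \<le> sqrt (1 - x) * sqrt (1 + x)"
 proof -
  have "sqrt (1 - x) * sqrt (1 + x) = sqrt (1 - x^2)"
   by (simp add: real_sqrt_mult[symmetric] power2_eq_square algebra_simps)
  moreover have "0 \<le> 1 - x^2" "1 - x^2 \<le> 1" using x by (auto simp: power_le_one)
  then have "(1 - x^2)^2 \<le> 1 - x^2" by (simp add: power2_eq_square[of "1 - x^2"] mult_left_le)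
  then have "1 - x^2 \<le> sqrt (1 - x^2)" by (rule real_le_rsqrt)
  ultimately show ?thesis by simp
 qed
 \<comment> \<open>Squares are compared: the left side is \<open>4 - 4 * x^2 + x^4\<close>, the
   right side at least \<open>4 - 2 * x^2\<close>.\<close>
 then have "(2 - x^2)^2 \<le> (sqrt (1 - x) + sqrt (1 + x))^2"
 proof -
  assume a: "1 - x^2 \<le> sqrt (1 - x) * sqrt (1 + x)"
  have "x ^ 4 \<le> x^2" using x by (intro power_decreasing) auto
  moreover have "(2 - x^2)^2 = 4 - 4 * x^2 + x ^ 4" by (simp add: power2_eq_square power4_eq_xxxx algebra_simps)
  moreover have "0 \<le> x^2" by simp
  moreover have "(sqrt (1 - x) + sqrt (1 + x))^2 = 2 + 2 * (sqrt (1 - x) * sqrt (1 + x))"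
   unfolding power2_sum p(3,4) by simp
  ultimately show ?thesis using a by linarith
 qed
 then have "2 - x^2 \<le> sqrt (1 - x) + sqrt (1 + x)" by (rule power2_le_imp_le) (use p in simp)
 then have "sqrt m * (2 - sqrt (1 - x) - sqrt (1 + x)) \<le> sqrt m * x^2" using m by (intro mult_left_mono) auto
 also have "\<dots> = (h / 2)^2 / (m * sqrt m)"
  using m by (simp add: x_def power2_eq_square field_simps)
 also have "\<dots> \<le> h^2 / (w * sqrt w)"
 proof (rule frac_le)
  show "(h / 2)^2 \<le> h^2" by (simp add: power_divide)
  show "w * sqrt w \<le> m * sqrt m" using assms by (intro mult_mono) (auto simp: m_def)
 qed (use assms in auto)
 finally show "2 * sqrt (w + h / 2) - sqrt w - sqrt (w + h) \<le> h^2 / (w * sqrt w)" unfolding e .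
qed

section \<open>The fundamental solution\<close>

locale coeffs =
 fixes a1 a2 \<rho>1 \<rho>2 :: real
 assumes pos: "0 < a1" "0 < a2" "0 < \<rho>1" "0 < \<rho>2"
begin

abbreviation f where "f \<equiv> f_scale a1 a2"
abbreviation \<beta> where "\<beta> \<equiv> beta_const a1 a2 \<rho>1 \<rho>2"
abbreviation G where "G \<equiv> heat_kernel a1 a2 \<rho>1 \<rho>2"

definition hw :: "real => real" where "hw y = (if y \<le> 0 then 1 / sqrt a1 else 1 / sqrt a2)"
text \<open>Lipschitz constants: \<open>hm\<close> for \<open>f\<close> and \<open>cf\<close> for
  its inverse.\<close>

definition hm :: real where "hm = max (1 / sqrt a1) (1 / sqrt a2)"
definition cf :: real where "cf = max (sqrt a1) (sqrt a2)"

lemma f_eq: "f y = y * hw y"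
 by (auto simp: f_scale_def hw_def indicator_def)

lemma hw: "0 < hw y" "hw y \<le> hm" and hm_pos: "0 < hm"
 using pos by (auto simp: hw_def hm_def less_max_iff_disj)

lemma hw_measurable [measurable]: "hw \<in> bm borel"
 unfolding hw_def[abs_def] by measurable

lemma f_measurable [measurable]: "f \<in> bm borel"
 unfolding f_eq[abs_def] by measurable

lemma G_pos: "0 < t ==> G t x y = hw y * (gk t (f x - f y) + \<beta> * sgn y * gk t (\<bar>f x\<bar> + \<bar>f y\<bar>))"
 by (auto simp: heat_kernel_def Let_def hw_def gk_def indicator_def field_simps)

lemma G_nonpos: "t \<le> 0 ==> G t x y = 0" by (simp add: heat_kernel_def)

lemma G_measurable [measurable]: "(\<lambda>p. G (fst p) x (snd p)) \<in> bm (borel \<Otimes>\<^sub>M borel)"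
proof -
 have "(\<lambda>p. G (fst p) x (snd p)) = (\<lambda>p. if 0 < fst p then hw (snd p) * (gk (fst p) (f x - f (snd p)) + \<beta> * sgn (snd p) * gk (fst p) (\<bar>f x\<bar> + \<bar>f (snd p)\<bar>)) else 0)"
  by (auto simp: fun_eq_iff G_pos G_nonpos)
 moreover have "(\<lambda>p. if 0 < fst p then hw (snd p) * (gk (fst p) (f x - f (snd p)) + \<beta> * sgn (snd p) * gk (fst p) (\<bar>f x\<bar> + \<bar>f (snd p)\<bar>)) else 0)
  \<in> bm (borel \<Otimes>\<^sub>M borel)"
  unfolding gk_def by measurable
 ultimately show ?thesis by simp
qed

lemma G_comp_measurable [measurable]:
 assumes [measurable]: "T \<in> bm N" "Y \<in> bm N"
 shows "(\<lambda>z. G (T z) x (Y z)) \<in> bm N"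
proof -
 have "(\<lambda>z. (T z, Y z)) \<in> measurable N (borel \<Otimes>\<^sub>M borel)" by measurable
 from measurable_compose[OF this G_measurable] show ?thesis by simp
qed

text \<open>The weight \<open>hw\<close> is the derivative of \<open>f\<close>.\<close>

lemma f_substitution:
 assumes [measurable]: "F \<in> bm borel"
 shows "(\<integral>\<^sup>+y. ennreal (hw y) * F (f y) \<partial>lborel) = (\<integral>\<^sup>+z. F z \<partial>lborel)"
proof -
 have s: "sqrt a1 > 0" "sqrt a2 > 0" using pos by auto
 have m: "(\<integral>\<^sup>+z. F z * indicator {..0} z \<partial>lborel) = ennreal (1 / sqrt a1) * (\<integral>\<^sup>+y. F (f y) * indicator {..0} y \<partial>lborel)"
 proof -
  have "(\<integral>\<^sup>+z. F z * indicator {..0} z \<partial>lborel) = ennreal (1 / sqrt a1) * (\<integral>\<^sup>+y. F (y / sqrt a1) * indicator {..0} (y / sqrt a1) \<partial>lborel)"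
   using s by (subst nn_integral_real_affine[of _ "1 / sqrt a1" 0]) auto
  also have "(\<lambda>y. F (y / sqrt a1) * indicator {..0} (y / sqrt a1)) = (\<lambda>y. F (f y) * indicator {..0} y)"
   using s by (auto simp: fun_eq_iff f_eq hw_def indicator_def divide_le_0_iff)
  finally show ?thesis .
 qed
 have p: "(\<integral>\<^sup>+z. F z * indicator {0<..} z \<partial>lborel) = ennreal (1 / sqrt a2) * (\<integral>\<^sup>+y. F (f y) * indicator {0<..} y \<partial>lborel)"
 proof -
  have "(\<integral>\<^sup>+z. F z * indicator {0<..} z \<partial>lborel) = ennreal (1 / sqrt a2) * (\<integral>\<^sup>+y. F (y / sqrt a2) * indicator {0<..} (y / sqrt a2) \<partial>lborel)"
   using s by (subst nn_integral_real_affine[of _ "1 / sqrt a2" 0]) auto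
  also have "(\<lambda>y. F (y / sqrt a2) * indicator {0<..} (y / sqrt a2)) = (\<lambda>y. F (f y) * indicator {0<..} y)"
   using s by (auto simp: fun_eq_iff f_eq hw_def indicator_def zero_less_divide_iff)
  finally show ?thesis .
 qed
 have "(\<integral>\<^sup>+z. F z \<partial>lborel) = (\<integral>\<^sup>+z. F z * indicator {..0} z + F z * indicator {0<..} z \<partial>lborel)"
  by (intro nn_integral_cong) (auto simp: indicator_def)
 also have "\<dots> = (\<integral>\<^sup>+z. F z * indicator {..0} z \<partial>lborel) + (\<integral>\<^sup>+z. F z * indicator {0<..} z \<partial>lborel)"
  by (rule nn_integral_add) measurable
 also have "\<dots> = (\<integral>\<^sup>+y. ennreal (1 / sqrt a1) * (F (f y) * indicator {..0} y) + ennreal (1 / sqrt a2) * (F (f y) * indicator {0<..} y) \<partial>lborel)"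
  unfolding m p by (subst nn_integral_add) (auto simp: nn_integral_cmult)
 also have "\<dots> = (\<integral>\<^sup>+y. ennreal (hw y) * F (f y) \<partial>lborel)"
  by (intro nn_integral_cong) (auto simp: indicator_def hw_def)
 finally show ?thesis ..
qed

text \<open>On each half-line \<open>f\<close> is linear. For points on different sides of 0 both
  distances are sums of distances to 0, so the bounds at 0 add up.\<close>

lemma f_abs_diff: "\<bar>y - x\<bar> \<le> cf * \<bar>f x - f y\<bar>" and f_lipschitz: "\<bar>f x - f y\<bar> \<le> hm * \<bar>x - y\<bar>"
proof -
 have cf: "0 < cf" "sqrt a1 \<le> cf" "sqrt a2 \<le> cf" using pos by (auto simp: cf_def less_max_iff_disj)
 have inv: "\<bar>z\<bar> \<le> cf * \<bar>f z\<bar>" for z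
 proof -
  have "1 \<le> cf * hw z" using pos cf by (auto simp: hw_def field_simps)
  then have "1 * \<bar>z\<bar> \<le> (cf * hw z) * \<bar>z\<bar>" by (intro mult_right_mono) auto
  then show ?thesis using hw(1)[of z] by (simp add: f_eq abs_mult mult_ac)
 qed
 have up: "\<bar>f z\<bar> \<le> hm * \<bar>z\<bar>" for z
  using mult_right_mono[OF hw(2)[of z] abs_ge_zero[of z]] hw(1)[of z] by (simp add: f_eq abs_mult mult_ac)
 have sg: "(0 < z \<longrightarrow> 0 < f z) \<and> (z \<le> 0 \<longrightarrow> f z \<le> 0)" for z
  using hw(1)[of z] by (auto simp: f_eq mult_nonpos_nonneg)
 consider (pp) "0 < x" "0 < y" | (nn) "x \<le> 0" "y \<le> 0" | (pn) "0 < x" "y \<le> 0" | (np) "x \<le> 0" "0 < y" by linarith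
 then have "\<bar>y - x\<bar> \<le> cf * \<bar>f x - f y\<bar> \<and> \<bar>f x - f y\<bar> \<le> hm * \<bar>x - y\<bar>"
 proof cases
  case pp
  then have e: "\<bar>f x - f y\<bar> = hw x * \<bar>x - y\<bar>" using pos by (simp add: f_eq hw_def abs_mult left_diff_distrib[symmetric] diff_divide_distrib[symmetric])
  have "1 \<le> cf * hw x" using pos cf by (auto simp: hw_def field_simps)
  then have "1 * \<bar>x - y\<bar> \<le> (cf * hw x) * \<bar>x - y\<bar>" by (intro mult_right_mono) auto
  then show ?thesis unfolding e using mult_right_mono[OF hw(2)[of x] abs_ge_zero[of "x - y"]] by (simp add: mult_ac abs_minus_commute)
 next
  case nn
  then have e: "\<bar>f x - f y\<bar> = hw x * \<bar>x - y\<bar>" using pos by (simp add: f_eq hw_def abs_mult left_diff_distrib[symmetric] diff_divide_distrib[symmetric])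
  have "1 \<le> cf * hw x" using pos cf by (auto simp: hw_def field_simps)
  then have "1 * \<bar>x - y\<bar> \<le> (cf * hw x) * \<bar>x - y\<bar>" by (intro mult_right_mono) auto
  then show ?thesis unfolding e using mult_right_mono[OF hw(2)[of x] abs_ge_zero[of "x - y"]] by (simp add: mult_ac abs_minus_commute)
 next
  case pn
  then have "\<bar>f x - f y\<bar> = \<bar>f x\<bar> + \<bar>f y\<bar>" "\<bar>y - x\<bar> = \<bar>x\<bar> + \<bar>y\<bar>" "\<bar>x - y\<bar> = \<bar>x\<bar> + \<bar>y\<bar>" using sg[of x] sg[of y] by auto
  then show ?thesis using inv[of x] inv[of y] up[of x] up[of y] by (simp add: distrib_left)
 next
  case np
  then have "\<bar>f x - f y\<bar> = \<bar>f x\<bar> + \<bar>f y\<bar>" "\<bar>y - x\<bar> = \<bar>x\<bar> + \<bar>y\<bar>" "\<bar>x - y\<bar> = \<bar>x\<bar> + \<bar>y\<bar>" using sg[of x] sg[of y] by auto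
  then show ?thesis using inv[of x] inv[of y] up[of x] up[of y] by (simp add: distrib_left)
 qed
 then show "\<bar>y - x\<bar> \<le> cf * \<bar>f x - f y\<bar>" "\<bar>f x - f y\<bar> \<le> hm * \<bar>x - y\<bar>" by auto
qed

lemma gk_reflected_le: "0 < t ==> gk t (\<bar>X\<bar> + \<bar>Z\<bar>) \<le> gk t (X - Z)"
 by (rule gk_mono) auto

definition c1 :: real where "c1 = 1 + \<bar>\<beta>\<bar>"

lemma G_bound: "0 < t ==> \<bar>G t x y\<bar> \<le> hw y * (c1 * gk t (f x - f y))"
proof -
 assume t: "0 < t"
 have "\<bar>\<beta> * sgn y * gk t (\<bar>f x\<bar> + \<bar>f y\<bar>)\<bar> \<le> \<bar>\<beta>\<bar> * 1 * gk t (f x - f y)"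
  unfolding abs_mult using gk_reflected_le[OF t] gk_nonneg[OF t] by (intro mult_mono) (auto simp: abs_sgn_eq)
 then have "\<bar>gk t (f x - f y) + \<beta> * sgn y * gk t (\<bar>f x\<bar> + \<bar>f y\<bar>)\<bar> \<le> c1 * gk t (f x - f y)"
  using gk_nonneg[OF t, of "f x - f y"] by (simp add: c1_def distrib_right)
 then show ?thesis using hw(1)[of y] by (simp add: G_pos[OF t] abs_mult mult_left_mono)
qed

text \<open>Of the two factors \<open>hw y\<close> one is bounded by \<open>hm\<close>, the other is
  kept as the Jacobian for \<open>f_substitution\<close>.\<close>

lemma G_sq_bound: "0 < t ==> (G t x y)\<^sup>2 \<le> hm * c1^2 * (hw y * (gk t (f x - f y))^2)"
proof -
 assume t: "0 < t"
 have "\<bar>G t x y\<bar>\<^sup>2 \<le> (hw y * (c1 * gk t (f x - f y)))^2" using G_bound[OF t] by (intro power_mono) auto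
 also have "\<dots> = hw y * (hw y * (c1 * gk t (f x - f y))^2)" by (simp add: power2_eq_square)
 also have "\<dots> \<le> hm * (hw y * (c1 * gk t (f x - f y))^2)"
  using hw(1)[of y] hw(2)[of y] by (intro mult_right_mono mult_nonneg_nonneg) auto
 finally show ?thesis by (simp add: power_mult_distrib mult_ac)
qed

lemma G_sq_integral:
 assumes t: "0 < t"
 shows "nn2 lborel (\<lambda>y. G t x y) \<le> ennreal (hm * c1^2 * gk (2 * t) 0)"
proof -
 have k: "0 \<le> hm * c1^2" using hm_pos by simp
 have "nn2 lborel (\<lambda>y. G t x y) \<le> (\<integral>\<^sup>+y. ennreal (hm * c1^2) * (ennreal (hw y) * ennreal ((gk t (f x - f y))^2)) \<partial>lborel)"
  using G_sq_bound[OF t] k hw(1)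
  by (intro nn_integral_mono) (simp add: ennreal_mult'[symmetric] ennreal_mult''[symmetric] less_imp_le ennreal_leI)
 also have "\<dots> = ennreal (hm * c1^2) * (\<integral>\<^sup>+y. ennreal (hw y) * ennreal ((gk t (f x - f y))^2) \<partial>lborel)"
  by (rule nn_integral_cmult) measurable
 also have "(\<integral>\<^sup>+y. ennreal (hw y) * ennreal ((gk t (f x - f y))^2) \<partial>lborel) = nn2 lborel (\<lambda>z. gk t (f x - z))"
  by (rule f_substitution) measurable
 also have "\<dots> = ennreal (gk (2 * t) 0)"
  unfolding power2_eq_square gk_product(1)[OF t t] mult_2 diff_self ..
 also have "ennreal (hm * c1^2) * ennreal (gk (2 * t) 0) = ennreal (hm * c1^2 * gk (2 * t) 0)"
  using k gk_nonneg[of "2 * t" 0] t by (simp only: ennreal_mult)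
 finally show ?thesis .
qed

text \<open>One Gaussian factor absorbs the distance by \<open>gk_le_inverse\<close>, the other has
  mass one. The weight thus removes the singularity at small \<open>t\<close>, and a time window
  will contribute its full length.\<close>

lemma G_weighted_integral:
 assumes t: "0 < t"
 shows "nni lborel (\<lambda>y. \<bar>y - x\<bar> * (G t x y)^2) \<le> ennreal (cf * hm * c1^2)"
proof -
 have cf: "0 < cf" using pos by (auto simp: cf_def less_max_iff_disj)
 have k: "0 \<le> cf * hm * c1^2" using hm_pos cf by simp
 have "\<bar>y - x\<bar> * (G t x y)^2 \<le> cf * hm * c1^2 * (hw y * gk t (f x - f y))" for y
 proof -
  have "\<bar>y - x\<bar> * (G t x y)^2 \<le> (cf * \<bar>f x - f y\<bar>) * (hm * c1^2 * (hw y * (gk t (f x - f y))^2))"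
   using f_abs_diff[of y x] G_sq_bound[OF t, of x y] cf by (intro mult_mono) auto
  also have "\<dots> = cf * hm * c1^2 * (hw y * gk t (f x - f y)) * (\<bar>f x - f y\<bar> * gk t (f x - f y))"
   by (simp add: power2_eq_square mult_ac)
  also have "\<dots> \<le> cf * hm * c1^2 * (hw y * gk t (f x - f y)) * 1"
   using gk_le_inverse[OF t, of "f x - f y"] hw(1)[of y] gk_nonneg[OF t] cf hm_pos
   by (intro mult_left_mono mult_nonneg_nonneg) (auto simp: less_imp_le)
  finally show ?thesis by simp
 qed
 then have "nni lborel (\<lambda>y. \<bar>y - x\<bar> * (G t x y)^2) \<le> (\<integral>\<^sup>+y. ennreal (cf * hm * c1^2) * (ennreal (hw y) * ennreal (gk t (f x - f y))) \<partial>lborel)"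
  using k hw(1) by (intro nn_integral_mono) (simp add: ennreal_mult'[symmetric] ennreal_mult''[symmetric] less_imp_le ennreal_leI)
 also have "\<dots> = ennreal (cf * hm * c1^2) * (\<integral>\<^sup>+y. ennreal (hw y) * ennreal (gk t (f x - f y)) \<partial>lborel)"
  by (rule nn_integral_cmult) measurable
 also have "(\<integral>\<^sup>+y. ennreal (hw y) * ennreal (gk t (f x - f y)) \<partial>lborel) = nni lborel (\<lambda>z. gk t (f x - z))"
  by (rule f_substitution) measurable
 also have "\<dots> = 1" by (rule gk_integral[OF t])
 finally show ?thesis by simp
qed

definition c2 :: real where "c2 = 2 * hm * (1 + 2 * \<beta>^2)"

text \<open>After substitution, the reflected kernels are Gaussians centred at
  \<open>- \<bar>f x\<bar>\<close> and \<open>- \<bar>f x'\<bar>\<close> on one half-line and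
  mirrored on the other. These centres are at most as far apart as \<open>f x\<close> and
  \<open>f x'\<close>; the two half-lines give the factor 2 before \<open>\<beta>^2\<close> in
  \<open>c2\<close>.\<close>

lemma G_diff_integral:
 assumes t: "0 < t" "0 < s"
 shows "nn2 lborel (\<lambda>y. G t x y - G s x' y) \<le> ennreal (c2 * gdiff t s (f x - f x'))"
proof -
 define A where "A z = (gk t (f x - z) - gk s (f x' - z))^2" for z
 define b where "b r = (gk t (\<bar>f x\<bar> + r) - gk s (\<bar>f x'\<bar> + r))^2" for r
 have [measurable]: "A \<in> bm borel" "b \<in> bm borel"
  unfolding A_def[abs_def] b_def[abs_def] by measurable
 have nn: "0 \<le> A z" "0 \<le> b z" for z by (simp_all add: A_def b_def)
 have le: "(G t x y - G s x' y)^2 \<le> 2 * hm * (hw y * (A (f y) + \<beta>^2 * b \<bar>f y\<bar>))" for y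
 proof -
  define p q where "p = gk t (f x - f y) - gk s (f x' - f y)" and "q = gk t (\<bar>f x\<bar> + \<bar>f y\<bar>) - gk s (\<bar>f x'\<bar> + \<bar>f y\<bar>)"
  have "G t x y - G s x' y = hw y * (p + \<beta> * sgn y * q)"
   unfolding G_pos[OF t(1)] G_pos[OF t(2)] p_def q_def by (simp add: algebra_simps)
  then have "(G t x y - G s x' y)^2 = hw y * (hw y * (p + \<beta> * sgn y * q)^2)" by (simp add: power2_eq_square)
  also have "\<dots> \<le> hm * (hw y * (p + \<beta> * sgn y * q)^2)"
   using hw[of y] by (intro mult_right_mono mult_nonneg_nonneg) auto
  also have "(p + \<beta> * sgn y * q)^2 \<le> 2 * p^2 + 2 * (\<beta> * sgn y * q)^2"
   using sum_squares_bound[of p "\<beta> * sgn y * q"] by (simp add: power2_sum)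
  also have "(\<beta> * sgn y * q)^2 \<le> \<beta>^2 * q^2"
  proof -
   have "(sgn y)^2 \<le> 1" by (simp add: sgn_if)
   then have "(\<beta>^2 * q^2) * (sgn y)^2 \<le> (\<beta>^2 * q^2) * 1" by (intro mult_left_mono) auto
   then show ?thesis by (simp add: power_mult_distrib mult_ac)
  qed
  finally show ?thesis
   using hw(1)[of y] hm_pos by (simp add: A_def b_def p_def[symmetric] q_def[symmetric] mult_left_mono algebra_simps)
 qed
 have k: "0 \<le> 2 * hm" using hm_pos by simp
 have "nn2 lborel (\<lambda>y. G t x y - G s x' y) \<le> (\<integral>\<^sup>+y. ennreal (2 * hm) * (ennreal (hw y) * ennreal (A (f y) + \<beta>^2 * b \<bar>f y\<bar>)) \<partial>lborel)"
 proof (intro nn_integral_mono)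
  fix y
  have "0 \<le> A (f y) + \<beta>^2 * b \<bar>f y\<bar>" using nn by simp
  then have "ennreal (2 * hm) * (ennreal (hw y) * ennreal (A (f y) + \<beta>^2 * b \<bar>f y\<bar>)) = ennreal (2 * hm * (hw y * (A (f y) + \<beta>^2 * b \<bar>f y\<bar>)))"
   using k hw(1)[of y] by (simp only: ennreal_mult mult_nonneg_nonneg less_imp_le)
  then show "ennreal ((G t x y - G s x' y)^2) \<le> ennreal (2 * hm) * (ennreal (hw y) * ennreal (A (f y) + \<beta>^2 * b \<bar>f y\<bar>))"
   using le[of y] by (simp only: ennreal_leI)
 qed
 also have "\<dots> = ennreal (2 * hm) * (\<integral>\<^sup>+y. ennreal (hw y) * ennreal (A (f y) + \<beta>^2 * b \<bar>f y\<bar>) \<partial>lborel)"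
  by (rule nn_integral_cmult) measurable
 also have "(\<integral>\<^sup>+y. ennreal (hw y) * ennreal (A (f y) + \<beta>^2 * b \<bar>f y\<bar>) \<partial>lborel) = nni lborel (\<lambda>z. A z + \<beta>^2 * b \<bar>z\<bar>)"
  by (rule f_substitution) measurable
 also have "\<dots> = (\<integral>\<^sup>+z. ennreal (A z) + ennreal (\<beta>^2) * ennreal (b \<bar>z\<bar>) \<partial>lborel)"
  using nn by (intro nn_integral_cong) (simp add: ennreal_mult')
 also have "\<dots> = nni lborel (\<lambda>z. A z) + ennreal (\<beta>^2) * nni lborel (\<lambda>z. b \<bar>z\<bar>)"
  by (simp add: nn_integral_add nn_integral_cmult)
 also have "nni lborel (\<lambda>z. A z) = ennreal (gdiff t s (f x - f x'))"
  unfolding A_def by (rule gk_sq_diff(1)[OF t])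
 also have "nni lborel (\<lambda>z. b \<bar>z\<bar>) \<le> ennreal (2 * gdiff t s (f x - f x'))"
 proof -
  have B: "nni lborel (\<lambda>z. b z) \<le> ennreal (gdiff t s (f x - f x'))"
  proof -
   have "b z = (gk t (- \<bar>f x\<bar> - z) - gk s (- \<bar>f x'\<bar> - z))^2" for z
    unfolding b_def using gk_minus(1)[of t "\<bar>f x\<bar> + z"] gk_minus(1)[of s "\<bar>f x'\<bar> + z"] by simp
   then have "nni lborel (\<lambda>z. b z) = ennreal (gdiff t s (- \<bar>f x\<bar> - - \<bar>f x'\<bar>))"
    by (simp only: gk_sq_diff(1)[OF t])
   also have "\<dots> \<le> ennreal (gdiff t s (f x - f x'))"
    by (intro ennreal_leI gdiff_mono t) auto
   finally show ?thesis .
  qed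
  have "nni lborel (\<lambda>z. b \<bar>z\<bar>) \<le> (\<integral>\<^sup>+z. ennreal (b z) + ennreal (b (- z)) \<partial>lborel)"
   by (intro nn_integral_mono) (auto simp: abs_if)
  also have "\<dots> = nni lborel (\<lambda>z. b z) + nni lborel (\<lambda>z. b (- z))"
   by (rule nn_integral_add) measurable
  also have "nni lborel (\<lambda>z. b (- z)) = nni lborel (\<lambda>z. b z)"
   using nn_integral_real_affine[of "\<lambda>z. ennreal (b z)" "- 1" 0] by simp
  also have "nni lborel (\<lambda>z. b z) + nni lborel (\<lambda>z. b z) \<le> ennreal (gdiff t s (f x - f x')) + ennreal (gdiff t s (f x - f x'))"
   by (intro add_mono B)
  finally show ?thesis using gk_sq_diff(2)[OF t] by (simp add: ennreal_plus[symmetric] del: ennreal_plus)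
 qed
 finally have "nn2 lborel (\<lambda>y. G t x y - G s x' y)
  \<le> ennreal (2 * hm) * (ennreal (gdiff t s (f x - f x')) + ennreal (\<beta>^2) * ennreal (2 * gdiff t s (f x - f x')))"
  by (simp add: mult_left_mono add_left_mono)
 also have "\<dots> = ennreal (c2 * gdiff t s (f x - f x'))"
 proof -
  define D where "D = gdiff t s (f x - f x')"
  have D: "0 \<le> D" "0 \<le> 2 * D" "0 \<le> \<beta>^2" using gk_sq_diff(2)[OF t] by (simp_all add: D_def)
  have "c2 * D = 2 * hm * (D + \<beta>^2 * (2 * D))" by (simp add: c2_def algebra_simps)
  then show ?thesis unfolding D_def[symmetric]
   using D k by (simp only: ennreal_mult ennreal_plus mult_nonneg_nonneg add_nonneg_nonneg)
 qed
 finally show ?thesis .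
qed

end

section \<open>Gaussian kernels integrated over time\<close>

lemma nn_integral_plane:
 fixes F :: "real \<times> real => ennreal"
 assumes "F \<in> bm borel"
 shows "(\<integral>\<^sup>+p. F p \<partial>lborel) = (\<integral>\<^sup>+s. \<integral>\<^sup>+y. F (s, y) \<partial>lborel \<partial>lborel)"
 using lborel.nn_integral_fst[of F lborel] assms by (simp add: lborel_prod)

text \<open>As a function of \<open>s\<close>, \<open>sdiff h (\<tau> - s) / sqrt pi\<close> is a
  primitive of \<open>gdiff (\<tau> + h - s) (\<tau> - s) 0\<close>.\<close>

definition sdiff :: "real => real => real" where
 "sdiff h m = 2 * sqrt (m + h / 2) - sqrt m - sqrt (m + h)"

lemma gk_double: "0 < r ==> gk (2 * r) 0 = 1 / (2 * (sqrt pi * sqrt r))"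
proof -
 assume "0 < r"
 have "sqrt (2 * pi * (2 * r)) = sqrt (2^2 * (pi * r))" by (simp add: power2_eq_square mult_ac)
 also have "\<dots> = 2 * (sqrt pi * sqrt r)" by (simp only: real_sqrt_mult real_sqrt_power) simp
 finally show ?thesis by (simp add: gk_zero)
qed

lemma gk_time_integral:
 assumes "\<alpha> \<le> \<gamma>" "\<gamma> \<le> \<tau>"
 shows "(\<integral>\<^sup>+s. ennreal (gk (2 * (\<tau> - s)) 0) * indicator {\<alpha><..<\<gamma>} s \<partial>lborel) = ennreal ((sqrt (\<tau> - \<alpha>) - sqrt (\<tau> - \<gamma>)) / sqrt pi)"
proof -
 have "(\<integral>\<^sup>+s. ennreal (gk (2 * (\<tau> - s)) 0) * indicator {\<alpha><..<\<gamma>} s \<partial>lborel) = ennreal (- sqrt (\<tau> - \<gamma>) / sqrt pi - (- sqrt (\<tau> - \<alpha>) / sqrt pi))"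
 proof (rule nn_integral_FTC_interior[OF assms(1)])
  show "continuous_on {\<alpha>..\<gamma>} (\<lambda>s. - sqrt (\<tau> - s) / sqrt pi)" by (intro continuous_intros) auto
  fix s assume s: "\<alpha> < s" "s < \<gamma>"
  then have r: "0 < \<tau> - s" using assms by simp
  show "((\<lambda>s. - sqrt (\<tau> - s) / sqrt pi) has_real_derivative gk (2 * (\<tau> - s)) 0) (at s)"
   unfolding gk_double[OF r] using r
   by (auto intro!: derivative_eq_intros simp: divide_simps)
  show "0 \<le> gk (2 * (\<tau> - s)) 0" using r by (intro gk_nonneg) simp
 qed (unfold gk_def, measurable)
 also have "- sqrt (\<tau> - \<gamma>) / sqrt pi - (- sqrt (\<tau> - \<alpha>) / sqrt pi) = (sqrt (\<tau> - \<alpha>) - sqrt (\<tau> - \<gamma>)) / sqrt pi"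
  by (simp add: diff_divide_distrib)
 finally show ?thesis .
qed

lemma gdiff_time_integral:
 assumes h: "0 < h" and "\<alpha> \<le> \<gamma>" "\<gamma> \<le> \<tau>"
 shows "(\<integral>\<^sup>+s. ennreal (gdiff (\<tau> + h - s) (\<tau> - s) 0) * indicator {\<alpha><..<\<gamma>} s \<partial>lborel)
  = ennreal ((sdiff h (\<tau> - \<gamma>) - sdiff h (\<tau> - \<alpha>)) / sqrt pi)"
proof -
 have "(\<integral>\<^sup>+s. ennreal (gdiff (\<tau> + h - s) (\<tau> - s) 0) * indicator {\<alpha><..<\<gamma>} s \<partial>lborel)
  = ennreal (sdiff h (\<tau> - \<gamma>) / sqrt pi - sdiff h (\<tau> - \<alpha>) / sqrt pi)"
 proof (rule nn_integral_FTC_interior[OF assms(2)])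
  show "continuous_on {\<alpha>..\<gamma>} (\<lambda>s. sdiff h (\<tau> - s) / sqrt pi)"
   unfolding sdiff_def by (intro continuous_intros) auto
  fix s assume s: "\<alpha> < s" "s < \<gamma>"
  then have r: "0 < \<tau> - s" "0 < \<tau> + h - s" "0 < \<tau> + h / 2 - s" using assms by simp_all
  have e: "gdiff (\<tau> + h - s) (\<tau> - s) 0 = 1 / (2 * (sqrt pi * sqrt (\<tau> + h - s))) + 1 / (2 * (sqrt pi * sqrt (\<tau> - s))) - 2 * (1 / (2 * (sqrt pi * sqrt (\<tau> + h / 2 - s))))"
  proof -
   have "\<tau> + h - s + (\<tau> - s) = 2 * (\<tau> + h / 2 - s)" by simp
   then show ?thesis unfolding gdiff_def by (simp only: gk_double r)
  qed
  have "((\<lambda>s. sqrt (m - s)) has_real_derivative - (1 / (2 * sqrt (m - s)))) (at s)" if "0 < m - s" for m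
   using that by (auto intro!: derivative_eq_intros simp: divide_simps)
  note d = this[OF r(1)] this[OF r(2)] this[OF r(3)]
  have "((\<lambda>s. (2 * sqrt (\<tau> + h / 2 - s) - sqrt (\<tau> - s) - sqrt (\<tau> + h - s)) / sqrt pi) has_real_derivative
   (2 * (- (1 / (2 * sqrt (\<tau> + h / 2 - s)))) - (- (1 / (2 * sqrt (\<tau> - s)))) - (- (1 / (2 * sqrt (\<tau> + h - s))))) / sqrt pi) (at s)"
   by (intro DERIV_cdivide DERIV_diff DERIV_cmult d)
  moreover have "(\<lambda>s. (2 * sqrt (\<tau> + h / 2 - s) - sqrt (\<tau> - s) - sqrt (\<tau> + h - s)) / sqrt pi) = (\<lambda>s. sdiff h (\<tau> - s) / sqrt pi)"
   by (simp add: sdiff_def fun_eq_iff algebra_simps)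
  moreover have "(2 * (- (1 / (2 * sqrt (\<tau> + h / 2 - s)))) - (- (1 / (2 * sqrt (\<tau> - s)))) - (- (1 / (2 * sqrt (\<tau> + h - s))))) / sqrt pi = gdiff (\<tau> + h - s) (\<tau> - s) 0"
  proof -
   have "(2 * (- (1 / (2 * A))) - (- (1 / (2 * B))) - (- (1 / (2 * C)))) / P
    = 1 / (2 * (P * C)) + 1 / (2 * (P * B)) - 2 * (1 / (2 * (P * A)))" for A B C P :: real
    by (simp add: diff_divide_distrib add_divide_distrib mult_ac)
   then show ?thesis unfolding e .
  qed
  ultimately show "((\<lambda>s. sdiff h (\<tau> - s) / sqrt pi) has_real_derivative gdiff (\<tau> + h - s) (\<tau> - s) 0) (at s)" by simp
  show "0 \<le> gdiff (\<tau> + h - s) (\<tau> - s) 0" by (rule gk_sq_diff(2)[OF r(2,1)])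
 qed (unfold gdiff_def gk_def, measurable)
 then show ?thesis by (simp only: diff_divide_distrib)
qed

text \<open>With \<open>u = d^2 / (4 * r)\<close>, the estimate
  \<open>1 - exp (- u) \<le> 2 * u / (1 + u)\<close> replaces the exponential by a rational function
  whose product with \<open>1 / sqrt r\<close> has an arctangent as primitive. Its bound
  \<open>pi / 2\<close> makes the result linear in the distance, uniformly in
  \<open>t\<close>.\<close>

lemma gdiff_space_integral:
 assumes t: "0 \<le> t"
 shows "(\<integral>\<^sup>+s. ennreal (gdiff (t - s) (t - s) d) * indicator {0<..<t} s \<partial>lborel) \<le> ennreal (sqrt pi * \<bar>d\<bar>)"
proof (cases "d = 0")
 case True
 have "r + r = 2 * r" for r :: real by simp
 then have "gdiff r r 0 = 0" for r by (simp only: gdiff_def)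
 then show ?thesis using True by simp
next
 case False
 define \<psi> where "\<psi> s = 2 * d^2 / (sqrt pi * sqrt (t - s) * (4 * (t - s) + d^2))" for s
 have le: "gdiff (t - s) (t - s) d \<le> \<psi> s" if s: "s < t" for s
 proof -
  define r where "r = t - s"
  have r: "0 < r" using s by (simp add: r_def)
  define u where "u = d^2 / (4 * r)"
  have u: "0 \<le> u" using r by (simp add: u_def)
  have "1 - exp (- u) \<le> 2 * u / (1 + u)"
  proof (cases "u \<le> 1")
   case True
   have "1 - u \<le> exp (- u)" using exp_ge_add_one_self[of "- u"] by simp
   then have "1 - exp (- u) \<le> u" by simp
   also have "u * (1 + u) \<le> 2 * u" using u True mult_right_mono[of u 1 u] by (simp add: distrib_left)
   then have "u \<le> 2 * u / (1 + u)" using u by (simp add: le_divide_eq)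
   finally show ?thesis .
  next
   case False
   then have "1 \<le> 2 * u / (1 + u)" by (simp add: le_divide_eq)
   moreover have "0 < exp (- u)" by simp
   ultimately show ?thesis by linarith
  qed
  also have "2 * u / (1 + u) = 2 * d^2 / (4 * r + d^2)"
   using r by (simp add: u_def field_simps)
  finally have E: "1 - exp (- u) \<le> 2 * d^2 / (4 * r + d^2)" .
  have "gdiff r r d = 2 * gk (2 * r) 0 * (1 - exp (- u))"
  proof -
   have "r + r = 2 * r" by simp
   then have "gdiff r r d = 2 * gk (2 * r) 0 - 2 * gk (2 * r) d" by (simp only: gdiff_def)
   moreover have "gk (2 * r) d = gk (2 * r) 0 * exp (- u)" by (simp add: gk_def u_def)
   ultimately show ?thesis by (simp add: right_diff_distrib)
  qed
  also have "\<dots> \<le> 2 * gk (2 * r) 0 * (2 * d^2 / (4 * r + d^2))"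
   using E r by (intro mult_left_mono) (auto intro!: gk_nonneg)
  also have "\<dots> = \<psi> s" unfolding gk_double[OF r] \<psi>_def r_def[symmetric] by simp
  finally show ?thesis by (simp add: r_def)
 qed
 have "(\<integral>\<^sup>+s. ennreal (gdiff (t - s) (t - s) d) * indicator {0<..<t} s \<partial>lborel) \<le> (\<integral>\<^sup>+s. ennreal (\<psi> s) * indicator {0<..<t} s \<partial>lborel)"
  using le by (intro nn_integral_mono) (auto simp: indicator_def intro!: ennreal_leI)
 also have "\<dots> = ennreal (- (2 * \<bar>d\<bar> / sqrt pi) * arctan (2 * sqrt (t - t) / \<bar>d\<bar>) - (- (2 * \<bar>d\<bar> / sqrt pi) * arctan (2 * sqrt (t - 0) / \<bar>d\<bar>)))"
 proof (rule nn_integral_FTC_interior[OF t])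
  show "continuous_on {0..t} (\<lambda>s. - (2 * \<bar>d\<bar> / sqrt pi) * arctan (2 * sqrt (t - s) / \<bar>d\<bar>))"
   using False by (intro continuous_intros) auto
  fix s assume s: "0 < s" "s < t"
  define r where "r = t - s"
  have r: "0 < r" using s by (simp add: r_def)
  have "((\<lambda>s. sqrt (t - s)) has_real_derivative - (1 / (2 * sqrt (t - s)))) (at s)"
   using r by (auto intro!: derivative_eq_intros simp: divide_simps r_def)
  then have "((\<lambda>s. 2 * sqrt (t - s) / \<bar>d\<bar>) has_real_derivative 2 * (- (1 / (2 * sqrt (t - s)))) / \<bar>d\<bar>) (at s)"
   by (intro DERIV_cdivide DERIV_cmult)
  then have "((\<lambda>s. arctan (2 * sqrt (t - s) / \<bar>d\<bar>)) has_real_derivative inverse (1 + (2 * sqrt (t - s) / \<bar>d\<bar>)^2) * (2 * (- (1 / (2 * sqrt (t - s)))) / \<bar>d\<bar>)) (at s)"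
   by (rule DERIV_chain2[OF DERIV_arctan])
  then have D: "((\<lambda>s. - (2 * \<bar>d\<bar> / sqrt pi) * arctan (2 * sqrt (t - s) / \<bar>d\<bar>)) has_real_derivative
    - (2 * \<bar>d\<bar> / sqrt pi) * (inverse (1 + (2 * sqrt (t - s) / \<bar>d\<bar>)^2) * (2 * (- (1 / (2 * sqrt (t - s)))) / \<bar>d\<bar>))) (at s)"
   by (rule DERIV_cmult)
  have "1 + (2 * sqrt r / \<bar>d\<bar>)^2 = (4 * r + d^2) / d^2"
   using r False by (simp add: power_divide power_mult_distrib field_simps)
  then have "- (2 * \<bar>d\<bar> / sqrt pi) * (inverse (1 + (2 * sqrt r / \<bar>d\<bar>)^2) * (2 * (- (1 / (2 * sqrt r))) / \<bar>d\<bar>)) = \<psi> s"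
   using False by (simp add: \<psi>_def r_def[symmetric])
  then show "((\<lambda>s. - (2 * \<bar>d\<bar> / sqrt pi) * arctan (2 * sqrt (t - s) / \<bar>d\<bar>)) has_real_derivative \<psi> s) (at s)"
   using D by (simp add: r_def)
  show "0 \<le> \<psi> s" using r by (auto simp: \<psi>_def r_def[symmetric] intro!: divide_nonneg_nonneg mult_nonneg_nonneg)
 qed (unfold \<psi>_def, measurable)
 also have "\<dots> \<le> ennreal (sqrt pi * \<bar>d\<bar>)"
 proof (rule ennreal_leI)
  have "(2 * \<bar>d\<bar> / sqrt pi) * arctan (2 * sqrt t / \<bar>d\<bar>) \<le> (2 * \<bar>d\<bar> / sqrt pi) * (pi / 2)"
   using arctan_ubound[of "2 * sqrt t / \<bar>d\<bar>"] by (intro mult_left_mono) auto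
  also have "\<dots> = \<bar>d\<bar> * (pi / sqrt pi)" by simp
  also have "pi / sqrt pi = sqrt pi" by (simp add: real_div_sqrt)
  finally show "- (2 * \<bar>d\<bar> / sqrt pi) * arctan (2 * sqrt (t - t) / \<bar>d\<bar>) - (- (2 * \<bar>d\<bar> / sqrt pi) * arctan (2 * sqrt (t - 0) / \<bar>d\<bar>)) \<le> sqrt pi * \<bar>d\<bar>"
   by (simp add: mult.commute)
 qed
 finally show ?thesis .
qed

lemma AE_plane_lines:
 "AE p in (lborel :: (real \<times> real) measure). fst p \<noteq> c" "AE p in (lborel :: (real \<times> real) measure). snd p \<noteq> c"
proof -
 have "emeasure lborel ({c} \<times> (UNIV :: real set)) = 0"
  unfolding lborel_prod[symmetric] by (subst lborel.emeasure_pair_measure_Times) auto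
 then have "{c} \<times> UNIV \<in> null_sets (lborel :: (real \<times> real) measure)"
  by (intro null_setsI) (auto simp: borel_prod[symmetric])
 from AE_not_in[OF this] show "AE p in (lborel :: (real \<times> real) measure). fst p \<noteq> c"
  by eventually_elim auto
 have "emeasure lborel ((UNIV :: real set) \<times> {c}) = 0"
  unfolding lborel_prod[symmetric] by (subst lborel.emeasure_pair_measure_Times) auto
 then have "UNIV \<times> {c} \<in> null_sets (lborel :: (real \<times> real) measure)"
  by (intro null_setsI) (auto simp: borel_prod[symmetric])
 from AE_not_in[OF this] show "AE p in (lborel :: (real \<times> real) measure). snd p \<noteq> c"
  by eventually_elim auto
qed

section \<open>Kernels as functions on the plane\<close>

context coeffs
begin

definition Gf :: "real => real => real \<times> real => real" where "Gf t x p = G (t - fst p) x (snd p)"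

lemma Gf_measurable [measurable]: "Gf t x \<in> bm borel"
proof -
 have [measurable]: "fst \<in> bm (borel :: (real \<times> real) measure)" "snd \<in> bm (borel :: (real \<times> real) measure)"
  by (auto simp: borel_prod[symmetric])
 show ?thesis unfolding Gf_def[abs_def] by measurable
qed

text \<open>Away from time \<open>t\<close>, where the kernel is singular, and from the interface,
  where its formula changes, it is locally given by one continuous expression.\<close>

lemma Gf_cont:
 assumes "fst p \<noteq> t" "snd p \<noteq> 0"
 shows "isCont (Gf t x) p"
proof (cases "t < fst p")
 case True
 have "open {q :: real \<times> real. t < fst q}" by (intro open_Collect_less continuous_intros)
 then have "eventually (\<lambda>q. q \<in> {q. t < fst q}) (nhds p)" using True by (intro eventually_nhds_in_open) auto
 then have "eventually (\<lambda>q. Gf t x q = 0) (nhds p)" by eventually_elim (simp add: Gf_def G_nonpos)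
 then show ?thesis by (subst isCont_cong) auto
next
 case False
 then have lt: "fst p < t" using assms by simp
 have G: "isCont (\<lambda>q. w * (gk (t - fst q) (f x - w * snd q) + e * gk (t - fst q) (\<bar>f x\<bar> + \<bar>w * snd q\<bar>))) p" for w e
  unfolding gk_def using lt by (intro continuous_intros) auto
 show ?thesis
 proof (cases "0 < snd p")
  case True
  have "open {q :: real \<times> real. fst q < t \<and> 0 < snd q}" by (intro open_Collect_conj open_Collect_less continuous_intros)
  then have "eventually (\<lambda>q. q \<in> {q. fst q < t \<and> 0 < snd q}) (nhds p)" using True lt by (intro eventually_nhds_in_open) auto
  then have "eventually (\<lambda>q. Gf t x q = (1 / sqrt a2) * (gk (t - fst q) (f x - (1 / sqrt a2) * snd q) + \<beta> * gk (t - fst q) (\<bar>f x\<bar> + \<bar>(1 / sqrt a2) * snd q\<bar>))) (nhds p)"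
   by eventually_elim (simp add: Gf_def G_pos hw_def f_eq[of "snd _"])
  then show ?thesis by (rule isCont_cong[THEN iffD2, OF _ G])
 next
  case False
  have "open {q :: real \<times> real. fst q < t \<and> snd q < 0}" by (intro open_Collect_conj open_Collect_less continuous_intros)
  then have "eventually (\<lambda>q. q \<in> {q. fst q < t \<and> snd q < 0}) (nhds p)" using False assms lt by (intro eventually_nhds_in_open) auto
  then have "eventually (\<lambda>q. Gf t x q = (1 / sqrt a1) * (gk (t - fst q) (f x - (1 / sqrt a1) * snd q) + (- \<beta>) * gk (t - fst q) (\<bar>f x\<bar> + \<bar>(1 / sqrt a1) * snd q\<bar>))) (nhds p)"
   by eventually_elim (simp add: Gf_def G_pos hw_def f_eq[of "snd _"])
  then show ?thesis by (rule isCont_cong[THEN iffD2, OF _ G])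
 qed
qed

text \<open>The kernel of the increment of the solution between \<open>(t', x')\<close> and
  \<open>(t, x)\<close>, reduced to the noise of the times in \<open>I\<close>.\<close>

definition gker :: "real => real => real => real => real set => real \<times> real => real" where
 "gker t t' x x' I p = (Gf t x p - Gf t' x' p) * indicator I (fst p)"

lemma gker_measurable [measurable]:
 assumes [measurable]: "I \<in> sets borel"
 shows "gker t t' x x' I \<in> bm borel"
proof -
 have [measurable]: "fst \<in> bm (borel :: (real \<times> real) measure)" by (auto simp: borel_prod[symmetric])
 show ?thesis unfolding gker_def[abs_def] by measurable
qed

text \<open>Discontinuities can lie only at the times \<open>t\<close>, \<open>t'\<close>,
  \<open>a\<close>, \<open>b\<close> and on the interface, that is on five null sets.\<close>

lemma gker_cont:
 assumes "I = {a<..<b} \<or> I = {a<..b}"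
 shows "AE p in lborel. isCont (gker t t' x x' I) p"
proof -
 have i: "isCont (\<lambda>p. indicator I (fst p) :: real) p" if p: "fst p \<noteq> a" "fst p \<noteq> b" for p :: "real \<times> real"
 proof -
  define U where "U = (if a < fst p \<and> fst p < b then {q :: real \<times> real. a < fst q \<and> fst q < b} else if fst p < a then {q. fst q < a} else if b < fst p then {q. b < fst q} else {q. a < fst q \<and> fst q < b})"
  have "open U" unfolding U_def
   by (auto intro!: open_Collect_conj open_Collect_less continuous_intros)
  moreover have "p \<in> U" using p unfolding U_def by auto
  ultimately have "eventually (\<lambda>q. q \<in> U) (nhds p)" by (rule eventually_nhds_in_open)
  then have "eventually (\<lambda>q. indicator I (fst q) = (indicator I (fst p) :: real)) (nhds p)"
   by eventually_elim (use assms p in \<open>auto simp: U_def indicator_def split: if_splits\<close>)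
  then show ?thesis by (subst isCont_cong) auto
 qed
 show ?thesis
  using AE_plane_lines(1)[of t] AE_plane_lines(1)[of t'] AE_plane_lines(1)[of a] AE_plane_lines(1)[of b] AE_plane_lines(2)[of 0]
  by eventually_elim (unfold gker_def[abs_def], intro continuous_intros Gf_cont i)
qed

end

lemma sdiff_nonneg: "0 \<le> h ==> 0 \<le> m ==> 0 \<le> sdiff h m"
proof (cases "m = 0")
 case True
 assume "0 \<le> h"
 have "sqrt h \<le> sqrt (2^2 * (h / 2))" using \<open>0 \<le> h\<close> by (intro real_sqrt_le_mono) simp
 also have "\<dots> = 2 * sqrt (h / 2)" by (simp only: real_sqrt_mult real_sqrt_power) simp
 finally show ?thesis using True by (simp add: sdiff_def)
next
 case False
 assume "0 \<le> h" "0 \<le> m"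
 with False second_difference_sqrt(1)[of m h] show ?thesis by (simp add: sdiff_def)
qed

text \<open>Up to a factor \<open>1 / sqrt pi\<close>, \<open>sdiff h 0\<close> stands for the times
  before \<open>\<tau>\<close> and \<open>sqrt h\<close> for those between \<open>\<tau>\<close> and
  \<open>\<tau> + h\<close>. Their sum is the origin of \<open>sqrt (2 * h)\<close> in the variance
  of an increment.\<close>

lemma sdiff_zero: "0 \<le> h ==> sdiff h 0 + sqrt h = sqrt (2 * h)"
proof -
 assume "0 \<le> h"
 have "2 * sqrt (h / 2) = sqrt (2^2 * (h / 2))" by (simp only: real_sqrt_mult real_sqrt_power) simp
 then show ?thesis by (simp add: sdiff_def)
qed

lemma sdiff_zero_le: "0 \<le> h ==> sdiff h 0 \<le> sqrt h"
proof -
 assume h: "0 \<le> h"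
 have "sqrt (2 * h) \<le> sqrt (2^2 * h)" using h by (intro real_sqrt_le_mono) simp
 also have "\<dots> = 2 * sqrt h" by (simp only: real_sqrt_mult real_sqrt_power) simp
 finally show ?thesis using sdiff_zero[OF h] by simp
qed

lemma sqrt_pi_ge_1: "1 \<le> sqrt pi" using pi_ge_two by simp

section \<open>L2 bounds for kernel differences\<close>

context coeffs
begin

lemma c_nonneg: "0 \<le> c2" "0 \<le> hm * c1^2" "0 \<le> cf" "0 \<le> cf * hm * c1^2"
 using hm_pos pos by (auto simp: c2_def cf_def le_max_iff_disj)

lemma gker_slice:
 assumes [measurable]: "I \<in> sets borel" "w \<in> bm borel"
 shows "nni lborel (\<lambda>p. w (snd p) * (gker t t' x x' I p)^2)
  = (\<integral>\<^sup>+s. (nni lborel (\<lambda>y. w y * (G (t - s) x y - G (t' - s) x' y)^2)) * indicator I s \<partial>lborel)"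
proof -
 have "snd \<in> bm (borel :: (real \<times> real) measure)" by (auto simp: borel_prod[symmetric])
 then have [measurable]: "(\<lambda>p :: real \<times> real. w (snd p)) \<in> bm borel" by (rule measurable_compose) fact
 have "nni lborel (\<lambda>p. w (snd p) * (gker t t' x x' I p)^2)
  = (\<integral>\<^sup>+s. nni lborel (\<lambda>y. w (snd (s, y)) * (gker t t' x x' I (s, y))^2) \<partial>lborel)"
  by (rule nn_integral_plane) measurable
 also have "\<dots> = (\<integral>\<^sup>+s. (nni lborel (\<lambda>y. w y * (G (t - s) x y - G (t' - s) x' y)^2)) * indicator I s \<partial>lborel)"
 proof (intro nn_integral_cong)
  fix s
  show "nni lborel (\<lambda>y. w (snd (s, y)) * (gker t t' x x' I (s, y))^2)
   = nni lborel (\<lambda>y. w y * (G (t - s) x y - G (t' - s) x' y)^2) * indicator I s"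
   by (cases "s \<in> I") (simp_all add: gker_def Gf_def)
 qed
 finally show ?thesis .
qed

lemmas gker_slice1 = gker_slice[where w = "\<lambda>_. 1", simplified]

lemma nn_integral_open_mono:
 assumes "\<And>s. a < s ==> s < b ==> F s \<le> H s"
 shows "(\<integral>\<^sup>+s. F s * indicator {a<..b} s \<partial>lborel) \<le> (\<integral>\<^sup>+s. H s * indicator {a<..<b} s \<partial>(lborel :: real measure))"
proof (rule nn_integral_mono_AE)
 show "AE s in lborel. F s * indicator {a<..b} s \<le> H s * indicator {a<..<b} s"
  using AE_lborel_singleton[of b] by eventually_elim (use assms in \<open>auto simp: indicator_def\<close>)
qed

lemma scaled_nn_integral:
 fixes a b :: real
 assumes "0 \<le> c" "\<And>s. a < s ==> s < b ==> 0 \<le> H s" and [measurable]: "H \<in> bm borel"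
 shows "(\<integral>\<^sup>+s. ennreal (c * H s) * indicator {a<..<b} s \<partial>lborel) = ennreal c * (\<integral>\<^sup>+s. ennreal (H s) * indicator {a<..<b} s \<partial>lborel)"
proof -
 have "(\<integral>\<^sup>+s. ennreal (c * H s) * indicator {a<..<b} s \<partial>lborel) = (\<integral>\<^sup>+s. ennreal c * (ennreal (H s) * indicator {a<..<b} s) \<partial>lborel)"
  using assms by (intro nn_integral_cong) (auto simp: indicator_def ennreal_mult)
 also have "\<dots> = ennreal c * (\<integral>\<^sup>+s. ennreal (H s) * indicator {a<..<b} s \<partial>lborel)"
  by (rule nn_integral_cmult) measurable
 finally show ?thesis .
qed

text \<open>With \<open>\<gamma> = \<tau> - w\<close> this is the mass lost by cutting off the noise
  before the window; with \<open>\<gamma> = \<tau>\<close> it is part of the regularity in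
  time.\<close>

lemma outer_integral:
 assumes h: "0 < h" and g: "0 \<le> \<gamma>" "\<gamma> \<le> \<tau>"
 shows "nn2 lborel (\<lambda>p. gker (\<tau> + h) \<tau> x x {0<..\<gamma>} p) \<le> ennreal (c2 * sdiff h (\<tau> - \<gamma>))"
proof -
 have "nn2 lborel (\<lambda>p. gker (\<tau> + h) \<tau> x x {0<..\<gamma>} p)
  = (\<integral>\<^sup>+s. (nn2 lborel (\<lambda>y. G (\<tau> + h - s) x y - G (\<tau> - s) x y)) * indicator {0<..\<gamma>} s \<partial>lborel)"
  by (rule gker_slice1) simp
 also have "\<dots> \<le> (\<integral>\<^sup>+s. ennreal (c2 * gdiff (\<tau> + h - s) (\<tau> - s) 0) * indicator {0<..<\<gamma>} s \<partial>lborel)"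
 proof (rule nn_integral_open_mono)
  fix s assume "0 < s" "s < \<gamma>"
  then show "nn2 lborel (\<lambda>y. G (\<tau> + h - s) x y - G (\<tau> - s) x y) \<le> ennreal (c2 * gdiff (\<tau> + h - s) (\<tau> - s) 0)"
   using G_diff_integral[of "\<tau> + h - s" "\<tau> - s" x x] h g by simp
 qed
 also have "\<dots> = ennreal c2 * (\<integral>\<^sup>+s. ennreal (gdiff (\<tau> + h - s) (\<tau> - s) 0) * indicator {0<..<\<gamma>} s \<partial>lborel)"
 proof (rule scaled_nn_integral[OF c_nonneg(1)])
  show "0 \<le> gdiff (\<tau> + h - s) (\<tau> - s) 0" if "0 < s" "s < \<gamma>" for s
   using that h g by (intro gk_sq_diff(2)) auto
 qed (unfold gdiff_def gk_def, measurable)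
 also have "\<dots> = ennreal c2 * ennreal ((sdiff h (\<tau> - \<gamma>) - sdiff h (\<tau> - 0)) / sqrt pi)"
  by (simp only: gdiff_time_integral[OF h g])
 also have "\<dots> \<le> ennreal c2 * ennreal (sdiff h (\<tau> - \<gamma>))"
 proof (intro mult_left_mono ennreal_leI)
  have "(sdiff h (\<tau> - \<gamma>) - sdiff h (\<tau> - 0)) / sqrt pi \<le> sdiff h (\<tau> - \<gamma>) / sqrt pi"
   using sdiff_nonneg[of h "\<tau> - 0"] h g by (intro divide_right_mono) auto
  also have "\<dots> \<le> sdiff h (\<tau> - \<gamma>) / 1"
   using sdiff_nonneg[of h "\<tau> - \<gamma>"] sqrt_pi_ge_1 h g by (intro divide_left_mono) auto
  finally show "(sdiff h (\<tau> - \<gamma>) - sdiff h (\<tau> - 0)) / sqrt pi \<le> sdiff h (\<tau> - \<gamma>)" by simp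
 qed simp
 also have "\<dots> = ennreal (c2 * sdiff h (\<tau> - \<gamma>))"
  using c_nonneg(1) sdiff_nonneg[of h "\<tau> - \<gamma>"] h g by (simp add: ennreal_mult)
 finally show ?thesis .
qed

definition c3 :: real where "c3 = 2 * (c2 + hm * c1^2) + 2 * (c2 * (sqrt pi * hm))"

lemma c3_nonneg: "0 \<le> c3"
 using c_nonneg hm_pos unfolding c3_def by (intro add_nonneg_nonneg mult_nonneg_nonneg) auto

text \<open>The increment passes through \<open>(t', x)\<close>. In time, the part before
  \<open>t'\<close> is \<open>outer_integral\<close> and after \<open>t'\<close> a single kernel
  remains, both of order \<open>sqrt h\<close>; in space, \<open>gdiff_space_integral\<close> is
  linear in the distance.\<close>

lemma holder_kernel:
 assumes t: "0 \<le> t'" "t' \<le> t"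
 shows "nn2 lborel (\<lambda>p. gker t t' x x' {0<..t} p) \<le> ennreal (c3 * (sqrt (t - t') + \<bar>x - x'\<bar>))"
proof -
 define h where "h = t - t'"
 have h: "0 \<le> h" "t = t' + h" using t by (auto simp: h_def)
 have T: "nn2 lborel (\<lambda>p. gker t t' x x {0<..t} p) \<le> ennreal ((c2 + hm * c1^2) * sqrt h)"
 proof (cases "h = 0")
  case True
  then show ?thesis using h by (simp add: gker_def)
 next
  case False
  then have hp: "0 < h" using h by simp
  have i: "(gker t t' x x {0<..t} p)^2 = (gker (t' + h) t' x x {0<..t'} p)^2 + (gker t t' x x {t'<..t} p)^2" for p
   using t by (auto simp: gker_def h(2) indicator_def)
  have "nn2 lborel (\<lambda>p. gker t t' x x {0<..t} p)
   = (\<integral>\<^sup>+p. ennreal ((gker (t' + h) t' x x {0<..t'} p)^2) + ennreal ((gker t t' x x {t'<..t} p)^2) \<partial>lborel)"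
   unfolding i by (simp add: ennreal_plus)
  also have "\<dots> = nn2 lborel (\<lambda>p. gker (t' + h) t' x x {0<..t'} p) + nn2 lborel (\<lambda>p. gker t t' x x {t'<..t} p)"
   by (rule nn_integral_add) measurable
  also have "nn2 lborel (\<lambda>p. gker (t' + h) t' x x {0<..t'} p) \<le> ennreal (c2 * sqrt h)"
  proof -
   have "nn2 lborel (\<lambda>p. gker (t' + h) t' x x {0<..t'} p) \<le> ennreal (c2 * sdiff h (t' - t'))"
    by (rule outer_integral[OF hp t(1) order_refl])
   also have "\<dots> \<le> ennreal (c2 * sqrt h)"
    using sdiff_zero_le[OF h(1)] c_nonneg(1) by (intro ennreal_leI mult_left_mono) auto
   finally show ?thesis .
  qed
  also have "nn2 lborel (\<lambda>p. gker t t' x x {t'<..t} p) \<le> ennreal (hm * c1^2 * sqrt h)"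
  proof -
   have "nn2 lborel (\<lambda>p. gker t t' x x {t'<..t} p)
    = (\<integral>\<^sup>+s. (nn2 lborel (\<lambda>y. G (t - s) x y - G (t' - s) x y)) * indicator {t'<..t} s \<partial>lborel)"
    by (rule gker_slice1) simp
   also have "\<dots> \<le> (\<integral>\<^sup>+s. ennreal (hm * c1^2 * gk (2 * (t - s)) 0) * indicator {t'<..<t} s \<partial>lborel)"
   proof (rule nn_integral_open_mono)
    fix s assume "t' < s" "s < t"
    then show "nn2 lborel (\<lambda>y. G (t - s) x y - G (t' - s) x y) \<le> ennreal (hm * c1^2 * gk (2 * (t - s)) 0)"
     using G_sq_integral[of "t - s" x] by (simp add: G_nonpos[of "t' - s"])
   qed
   also have "\<dots> = ennreal (hm * c1^2) * (\<integral>\<^sup>+s. ennreal (gk (2 * (t - s)) 0) * indicator {t'<..<t} s \<partial>lborel)"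
   proof (rule scaled_nn_integral[OF c_nonneg(2)])
    show "0 \<le> gk (2 * (t - s)) 0" if "t' < s" "s < t" for s
     using that by (intro gk_nonneg) auto
   qed (unfold gk_def, measurable)
   also have "\<dots> = ennreal (hm * c1^2) * ennreal ((sqrt (t - t') - sqrt (t - t)) / sqrt pi)"
    by (simp only: gk_time_integral[OF t(2) order_refl])
   also have "\<dots> \<le> ennreal (hm * c1^2) * ennreal (sqrt h)"
   proof (intro mult_left_mono ennreal_leI)
    have "sqrt h / sqrt pi \<le> sqrt h / 1" using sqrt_pi_ge_1 h by (intro divide_left_mono) auto
    then show "(sqrt (t - t') - sqrt (t - t)) / sqrt pi \<le> sqrt h" by (simp add: h_def)
   qed simp
   also have "\<dots> = ennreal (hm * c1^2 * sqrt h)" using c_nonneg(2) h by (simp only: ennreal_mult real_sqrt_ge_zero)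
   finally show ?thesis .
  qed
  finally have "nn2 lborel (\<lambda>p. gker t t' x x {0<..t} p) \<le> ennreal (c2 * sqrt h) + ennreal (hm * c1^2 * sqrt h)"
   by (simp add: add_mono)
  also have "\<dots> = ennreal ((c2 + hm * c1^2) * sqrt h)"
   using c_nonneg(1,2) h(1) by (subst ennreal_plus[symmetric]) (auto simp: distrib_right)
  finally show ?thesis .
 qed
 have X: "nn2 lborel (\<lambda>p. gker t' t' x x' {0<..t} p) \<le> ennreal (c2 * (sqrt pi * hm) * \<bar>x - x'\<bar>)"
 proof -
  \<comment> \<open>Both kernels belong to time \<open>t'\<close> and vanish afterwards.\<close>
  have i: "gker t' t' x x' {0<..t} p = gker t' t' x x' {0<..t'} p" for p
   using t by (auto simp: gker_def Gf_def G_nonpos indicator_def)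
  have "nn2 lborel (\<lambda>p. gker t' t' x x' {0<..t} p)
   = (\<integral>\<^sup>+s. (nn2 lborel (\<lambda>y. G (t' - s) x y - G (t' - s) x' y)) * indicator {0<..t'} s \<partial>lborel)"
   unfolding i by (rule gker_slice1) simp
  also have "\<dots> \<le> (\<integral>\<^sup>+s. ennreal (c2 * gdiff (t' - s) (t' - s) (f x - f x')) * indicator {0<..<t'} s \<partial>lborel)"
  proof (rule nn_integral_open_mono)
   fix s assume "0 < s" "s < t'"
   then show "nn2 lborel (\<lambda>y. G (t' - s) x y - G (t' - s) x' y) \<le> ennreal (c2 * gdiff (t' - s) (t' - s) (f x - f x'))"
    by (intro G_diff_integral) auto
  qed
  also have "\<dots> = ennreal c2 * (\<integral>\<^sup>+s. ennreal (gdiff (t' - s) (t' - s) (f x - f x')) * indicator {0<..<t'} s \<partial>lborel)"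
  proof (rule scaled_nn_integral[OF c_nonneg(1)])
   show "0 \<le> gdiff (t' - s) (t' - s) (f x - f x')" if "0 < s" "s < t'" for s
    using that by (intro gk_sq_diff(2)) auto
  qed (unfold gdiff_def gk_def, measurable)
  also have "\<dots> \<le> ennreal c2 * ennreal (sqrt pi * \<bar>f x - f x'\<bar>)"
   by (intro mult_left_mono gdiff_space_integral t) simp
  also have "\<dots> \<le> ennreal c2 * ennreal (sqrt pi * (hm * \<bar>x - x'\<bar>))"
   by (intro mult_left_mono ennreal_leI f_lipschitz) auto
  also have "\<dots> = ennreal (c2 * (sqrt pi * hm) * \<bar>x - x'\<bar>)"
   using c_nonneg(1) hm_pos by (subst ennreal_mult[symmetric]) (auto simp: mult_ac)
  finally show ?thesis .
 qed
 have "gker t t' x x' {0<..t} p = gker t t' x x {0<..t} p + gker t' t' x x' {0<..t} p" for p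
  by (simp add: gker_def algebra_simps)
 then have "nn2 lborel (\<lambda>p. gker t t' x x' {0<..t} p)
  \<le> 2 * nn2 lborel (\<lambda>p. gker t t' x x {0<..t} p) + 2 * nn2 lborel (\<lambda>p. gker t' t' x x' {0<..t} p)"
  using nn_integral_sq_add_le[of "gker t t' x x {0<..t}" lborel "gker t' t' x x' {0<..t}"] by simp
 also have "\<dots> \<le> 2 * ennreal ((c2 + hm * c1^2) * sqrt h) + 2 * ennreal (c2 * (sqrt pi * hm) * \<bar>x - x'\<bar>)"
  by (intro add_mono mult_left_mono T X) auto
 also have "\<dots> = ennreal (2 * ((c2 + hm * c1^2) * sqrt h) + 2 * (c2 * (sqrt pi * hm) * \<bar>x - x'\<bar>))"
 proof -
  have "0 \<le> (c2 + hm * c1^2) * sqrt h" "0 \<le> c2 * (sqrt pi * hm) * \<bar>x - x'\<bar>"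
   using c_nonneg hm_pos h by (intro mult_nonneg_nonneg add_nonneg_nonneg; simp)+
  then show ?thesis by (simp add: ennreal_plus ennreal_mult' del: ennreal_plus[symmetric])
 qed
 also have "\<dots> \<le> ennreal (c3 * (sqrt h + \<bar>x - x'\<bar>))"
 proof (rule ennreal_leI)
  have "0 \<le> 2 * (c2 * (sqrt pi * hm)) * sqrt h" "0 \<le> 2 * (c2 + hm * c1^2) * \<bar>x - x'\<bar>"
   using c_nonneg hm_pos h by (intro mult_nonneg_nonneg add_nonneg_nonneg; simp)+
  then show "2 * ((c2 + hm * c1^2) * sqrt h) + 2 * (c2 * (sqrt pi * hm) * \<bar>x - x'\<bar>) \<le> c3 * (sqrt h + \<bar>x - x'\<bar>)"
   by (simp add: c3_def algebra_simps)
 qed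
 finally show ?thesis by (simp add: h_def)
qed

text \<open>By \<open>G_weighted_integral\<close> each time slice is bounded by a constant, so the
  window contributes its length.\<close>

lemma weighted_window:
 assumes "a \<le> t" "t' \<le> t"
 shows "nni lborel (\<lambda>p. \<bar>snd p - x\<bar> * (gker t t' x x {a<..t} p)^2) \<le> ennreal (4 * (cf * hm * c1^2) * (t - a))"
proof -
 let ?K = "cf * hm * c1^2"
 have "nni lborel (\<lambda>p. \<bar>snd p - x\<bar> * (gker t t' x x {a<..t} p)^2)
  = (\<integral>\<^sup>+s. (nni lborel (\<lambda>y. \<bar>y - x\<bar> * (G (t - s) x y - G (t' - s) x y)^2)) * indicator {a<..t} s \<partial>lborel)"
  by (rule gker_slice) auto
 also have "\<dots> \<le> (\<integral>\<^sup>+s. ennreal (4 * ?K) * indicator {a<..t} s \<partial>lborel)"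
 proof (intro nn_integral_mono mult_right_mono)
  fix s
  have W: "nni lborel (\<lambda>y. \<bar>y - x\<bar> * (G r x y)^2) \<le> ennreal ?K" for r
   by (cases "0 < r") (simp_all add: G_weighted_integral G_nonpos)
  have "nni lborel (\<lambda>y. \<bar>y - x\<bar> * (G (t - s) x y - G (t' - s) x y)^2)
   \<le> (\<integral>\<^sup>+y. 2 * ennreal (\<bar>y - x\<bar> * (G (t - s) x y)^2) + 2 * ennreal (\<bar>y - x\<bar> * (G (t' - s) x y)^2) \<partial>lborel)"
  proof (intro nn_integral_mono)
   fix y
   have "(p - q)^2 \<le> 2 * p^2 + 2 * q^2" for p q :: real using sum_squares_bound[of p "- q"] by (simp add: power2_diff)
   then have "\<bar>y - x\<bar> * (G (t - s) x y - G (t' - s) x y)^2 \<le> \<bar>y - x\<bar> * (2 * (G (t - s) x y)^2 + 2 * (G (t' - s) x y)^2)"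
    by (intro mult_left_mono) auto
   also have "\<dots> = 2 * (\<bar>y - x\<bar> * (G (t - s) x y)^2) + 2 * (\<bar>y - x\<bar> * (G (t' - s) x y)^2)" by (simp add: algebra_simps)
   finally have "ennreal (\<bar>y - x\<bar> * (G (t - s) x y - G (t' - s) x y)^2) \<le> ennreal (2 * (\<bar>y - x\<bar> * (G (t - s) x y)^2) + 2 * (\<bar>y - x\<bar> * (G (t' - s) x y)^2))"
    by (rule ennreal_leI)
   also have "\<dots> = 2 * ennreal (\<bar>y - x\<bar> * (G (t - s) x y)^2) + 2 * ennreal (\<bar>y - x\<bar> * (G (t' - s) x y)^2)"
    by (subst ennreal_plus) (auto simp: ennreal_mult')
   finally show "ennreal (\<bar>y - x\<bar> * (G (t - s) x y - G (t' - s) x y)^2) \<le> \<dots>" .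
  qed
  also have "\<dots> = 2 * nni lborel (\<lambda>y. \<bar>y - x\<bar> * (G (t - s) x y)^2) + 2 * nni lborel (\<lambda>y. \<bar>y - x\<bar> * (G (t' - s) x y)^2)"
   by (subst nn_integral_add) (simp_all add: nn_integral_cmult)
  also have "\<dots> \<le> 2 * ennreal ?K + 2 * ennreal ?K" by (intro add_mono mult_left_mono W) auto
  also have "\<dots> = ennreal (2 * ?K + 2 * ?K)" using c_nonneg(4) by (subst ennreal_plus) (auto simp: ennreal_mult')
  also have "2 * ?K + 2 * ?K = 4 * ?K" by simp
  finally show "nni lborel (\<lambda>y. \<bar>y - x\<bar> * (G (t - s) x y - G (t' - s) x y)^2) \<le> ennreal (4 * ?K)" .
 qed simp
 also have "\<dots> = ennreal (4 * ?K * (t - a))"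
  using assms c_nonneg(4) by (simp add: nn_integral_cmult_indicator ennreal_mult)
 finally show ?thesis .
qed

end

section \<open>Variance of the local increments\<close>

context coeffs
begin

text \<open>The leading factor of the local variance. Away from the interface the direct kernel
  dominates, with Jacobian \<open>hw x\<close>; at 0 the direct and the reflected kernel merge, and
  \<open>eta_const\<close> averages over the two half-lines.\<close>

definition kap :: "real => real" where
 "kap x = (if x = 0 then eta_const a1 a2 \<rho>1 \<rho>2 / sqrt a1 else hw x)"

lemma kap_nonneg: "0 \<le> kap x"
 using hw(1)[of x] pos by (auto simp: kap_def eta_const_def Let_def)

text \<open>At 0 both sides involve \<open>a1\<close>, since \<open>coeffA\<close> assigns the
  interface to the left half-line.\<close>

lemma kap_sq: "(kap x)^2 = tau_fun a1 a2 \<rho>1 \<rho>2 x / coeffA a1 a2 x"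
 using pos by (auto simp: kap_def tau_fun_def coeffA_def hw_def indicator_def power_divide)

lemma f_substitution_real:
 assumes F: "F \<in> bm borel" "\<And>z. 0 \<le> F z" and I: "nni lborel (\<lambda>z. F z) = ennreal c" "0 \<le> c"
 shows "integrable lborel (\<lambda>y. hw y * F (f y))" "(\<integral>y. hw y * F (f y) \<partial>lborel) = c"
proof -
 note [measurable] = F(1)
 have nn: "0 \<le> hw y * F (f y)" for y using hw(1)[of y] F(2) by simp
 have "nni lborel (\<lambda>y. hw y * F (f y)) = (\<integral>\<^sup>+y. ennreal (hw y) * ennreal (F (f y)) \<partial>lborel)"
  using hw(1) F(2) by (intro nn_integral_cong ennreal_mult) (auto intro: less_imp_le)
 also have "\<dots> = ennreal c" unfolding I(1)[symmetric] by (rule f_substitution) measurable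
 finally have e: "nni lborel (\<lambda>y. hw y * F (f y)) = ennreal c" .
 show "integrable lborel (\<lambda>y. hw y * F (f y))" using nn e by (intro integrableI_nonneg) auto
 show "(\<integral>y. hw y * F (f y) \<partial>lborel) = c"
  using nn e I(2) by (subst integral_eq_nn_integral) auto
qed

lemma hw_gk_product:
 assumes t: "0 < t" "0 < s"
 shows "integrable lborel (\<lambda>y. hw y * (gk t (f x - f y) * gk s (f x - f y)))"
  and "(\<integral>y. hw y * (gk t (f x - f y) * gk s (f x - f y)) \<partial>lborel) = gk (t + s) 0"
proof -
 have m: "(\<lambda>z. gk t (f x - z) * gk s (f x - z)) \<in> bm borel" by measurable
 have n: "0 \<le> gk t (f x - z) * gk s (f x - z)" for z using t by (intro mult_nonneg_nonneg gk_nonneg)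
 have i: "nni lborel (\<lambda>z. gk t (f x - z) * gk s (f x - z)) = ennreal (gk (t + s) 0)"
  using gk_product(1)[OF t, of "f x" "f x"] by simp
 have c: "0 \<le> gk (t + s) 0" using t by (intro gk_nonneg) simp
 show "integrable lborel (\<lambda>y. hw y * (gk t (f x - f y) * gk s (f x - f y)))"
  and "(\<integral>y. hw y * (gk t (f x - f y) * gk s (f x - f y)) \<partial>lborel) = gk (t + s) 0"
  using f_substitution_real[OF m n i c] by auto
qed

lemma hw_gk:
 assumes t: "0 < t"
 shows "integrable lborel (\<lambda>y. hw y * gk t (f x - f y))" "(\<integral>y. hw y * gk t (f x - f y) \<partial>lborel) = 1"
proof -
 have m: "(\<lambda>z. gk t (f x - z)) \<in> bm borel" by measurable
 have i: "nni lborel (\<lambda>z. gk t (f x - z)) = ennreal 1" using gk_integral[OF t] by simp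
 show "integrable lborel (\<lambda>y. hw y * gk t (f x - f y))" "(\<integral>y. hw y * gk t (f x - f y) \<partial>lborel) = 1"
  using f_substitution_real[OF m gk_nonneg[OF t] i] by auto
qed

lemma G_prod_integrable:
 assumes t: "0 < t" "0 < s"
 shows "integrable lborel (\<lambda>y. G t x y * G s x y)"
proof (rule bi_bound)
 show "integrable lborel (\<lambda>y. hm * c1^2 * (hw y * (gk t (f x - f y) * gk s (f x - f y))))"
  by (intro integrable_mult_right hw_gk_product t)
 have "\<bar>G t x y * G s x y\<bar> \<le> hm * c1^2 * (hw y * (gk t (f x - f y) * gk s (f x - f y)))" for y
 proof -
  have "0 \<le> hw y * (c1 * gk t (f x - f y))" using hw(1)[of y] gk_nonneg[OF t(1)] by (simp add: c1_def)
  then have "\<bar>G t x y\<bar> * \<bar>G s x y\<bar> \<le> (hw y * (c1 * gk t (f x - f y))) * (hw y * (c1 * gk s (f x - f y)))"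
   by (intro mult_mono G_bound t) auto
  also have "\<dots> = hw y * (hw y * (c1^2 * (gk t (f x - f y) * gk s (f x - f y))))" by (simp add: power2_eq_square mult_ac)
  also have "\<dots> \<le> hm * (hw y * (c1^2 * (gk t (f x - f y) * gk s (f x - f y))))"
   using hw[of y] gk_nonneg[OF t(1)] gk_nonneg[OF t(2)] by (intro mult_right_mono mult_nonneg_nonneg) auto
  finally show ?thesis by (simp add: abs_mult mult_ac)
 qed
 then show "AE y in lborel. norm (G t x y * G s x y) \<le> norm (hm * c1^2 * (hw y * (gk t (f x - f y) * gk s (f x - f y))))"
  by (intro AE_I2) (simp add: order_trans[OF _ abs_ge_self])
qed measurable

text \<open>Since \<open>f 0 = 0\<close>, the direct and the reflected kernel coincide and combine
  to the factors \<open>1 + \<beta>\<close> on the right and \<open>1 - \<beta>\<close> on the left.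
  Each half-line carries half of the Gaussian product integral, so the identity is exact.\<close>

lemma corr_zero:
 assumes t: "0 < t" "0 < s"
 shows "(\<integral>y. G t 0 y * G s 0 y \<partial>lborel) = kap 0 * gk (t + s) 0"
proof -
 define D where "D z = gk t z * gk s z" for z
 have [measurable]: "D \<in> bm borel" unfolding D_def[abs_def] by measurable
 have Dn: "0 \<le> D z" for z using t by (simp add: D_def gk_nonneg)
 have Di: "integrable lborel D" and DI: "(\<integral>z. D z \<partial>lborel) = gk (t + s) 0"
  using gk_product(2,3)[OF t, of 0 0] by (simp_all add: D_def[abs_def] gk_minus(1))
 have ip: "integrable lborel (\<lambda>z. D z * indicator {0<..} z)" and "integrable lborel (\<lambda>z. D z * indicator {..0} z)"
  by (rule bi_bound[OF Di]; auto simp: indicator_def Dn)+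
 have "(\<integral>z. D z * indicator {0<..} z \<partial>lborel) = (\<integral>z. D (- z) * indicator {0<..} (- z) \<partial>lborel)"
  using lborel_integral_real_affine[of "- 1" "\<lambda>z. D z * indicator {0<..} z" 0] by simp
 also have "\<dots> = (\<integral>z. D z * indicator {..0} z \<partial>lborel)"
 proof (rule integral_cong_AE)
  show "AE z in lborel. D (- z) * indicator {0<..} (- z) = D z * indicator {..0} z"
   using AE_lborel_singleton[of 0] by eventually_elim (auto simp: D_def gk_minus indicator_def)
 qed measurable
 finally have eq: "(\<integral>z. D z * indicator {0<..} z \<partial>lborel) = (\<integral>z. D z * indicator {..0} z \<partial>lborel)" .
 have "(\<integral>z. D z \<partial>lborel) = (\<integral>z. D z * indicator {0<..} z + D z * indicator {..0} z \<partial>lborel)"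
  by (intro bo_cong refl) (auto simp: indicator_def)
 also have "\<dots> = (\<integral>z. D z * indicator {0<..} z \<partial>lborel) + (\<integral>z. D z * indicator {..0} z \<partial>lborel)"
  by (rule bo_add) fact+
 finally have half: "(\<integral>z. D z * indicator {0<..} z \<partial>lborel) = gk (t + s) 0 / 2" "(\<integral>z. D z * indicator {..0} z \<partial>lborel) = gk (t + s) 0 / 2"
  using eq DI by simp_all
 define p q where "p = (1 + \<beta>)^2 / sqrt a2" and "q = (1 - \<beta>)^2 / sqrt a1"
 have pq: "0 \<le> p" "0 \<le> q" using pos by (simp_all add: p_def q_def)
 define F where "F z = p * (D z * indicator {0<..} z) + q * (D z * indicator {..0} z)" for z
 have Fm: "F \<in> bm borel" unfolding F_def[abs_def] by measurable
 have Fn: "0 \<le> F z" for z using pq Dn by (simp add: F_def indicator_def)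
 have Fi: "integrable lborel F" and FI: "(\<integral>z. F z \<partial>lborel) = (p + q) / 2 * gk (t + s) 0"
  unfolding F_def[abs_def] using half \<open>integrable lborel (\<lambda>z. D z * indicator {..0} z)\<close> ip
  by (simp_all add: field_simps)
 have k: "kap 0 = (p + q) / 2"
 proof -
  have "1 / 2 * (u + A / B * v) / A = (v / B + u / A) / 2" if "A \<noteq> 0" for u v A B :: real
   using that by (simp add: add_divide_distrib distrib_left)
  from this[of "sqrt a1" "(1 - \<beta>)^2" "sqrt a2" "(1 + \<beta>)^2"] show ?thesis
   using pos unfolding kap_def eta_const_def Let_def p_def q_def by (simp only: real_sqrt_divide real_sqrt_eq_zero_cancel_iff) simp
 qed
 have "nni lborel (\<lambda>z. F z) = ennreal (kap 0 * gk (t + s) 0)"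
  unfolding k FI[symmetric] by (rule nn_integral_eq_integral[OF Fi]) (simp add: Fn)
 moreover have "0 \<le> kap 0 * gk (t + s) 0" using kap_nonneg t by (simp add: gk_nonneg)
 ultimately have "(\<integral>y. hw y * F (f y) \<partial>lborel) = kap 0 * gk (t + s) 0"
  by (rule f_substitution_real(2)[OF Fm Fn])
 moreover have "(\<integral>y. G t 0 y * G s 0 y \<partial>lborel) = (\<integral>y. hw y * F (f y) \<partial>lborel)"
 proof (rule integral_cong_AE)
  show "AE y in lborel. G t 0 y * G s 0 y = hw y * F (f y)"
   using AE_lborel_singleton[of 0]
  proof eventually_elim
   case (elim y)
   have f0: "f 0 = 0" by (simp add: f_eq)
   have sg: "sgn (f y) = sgn y" using hw(1)[of y] by (simp add: f_eq sgn_mult)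
   show ?case
   proof (cases "0 < y")
    case True
    then have fy: "0 < f y" using hw(1)[of y] by (simp add: f_eq)
    have g: "G r 0 y = hw y * ((1 + \<beta>) * gk r (f y))" if "0 < r" for r
     using True fy that by (simp add: G_pos f0 gk_minus(1) distrib_right)
    have "F (f y) = ((1 + \<beta>)^2 * hw y) * (gk t (f y) * gk s (f y))"
     using True fy by (simp add: F_def D_def p_def hw_def)
    then show ?thesis unfolding g[OF t(1)] g[OF t(2)] by (simp only: power2_eq_square mult_ac)
   next
    case False
    then have y: "y < 0" "f y < 0" using elim hw(1)[of y] by (auto simp: f_eq mult_neg_pos)
    have g: "G r 0 y = hw y * ((1 - \<beta>) * gk r (f y))" if "0 < r" for r
     using y that by (simp add: G_pos f0 gk_minus(1) left_diff_distrib)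
    have "F (f y) = ((1 - \<beta>)^2 * hw y) * (gk t (f y) * gk s (f y))"
     using y by (simp add: F_def D_def q_def hw_def)
    then show ?thesis unfolding g[OF t(1)] g[OF t(2)] by (simp only: power2_eq_square mult_ac)
   qed
  qed
  have [measurable]: "F \<in> bm borel" by fact
  show "(\<lambda>y. hw y * F (f y)) \<in> bm lborel" by measurable
 qed measurable
 ultimately show ?thesis by simp
qed

text \<open>Every deviation from the leading product contains a Gaussian at distance at least
  \<open>X\<close> from its centre: a reflected kernel, or a direct one at a point across the
  interface. By \<open>gk_le_inverse\<close> it is at most \<open>1 / X\<close> for all times, while
  the other kernel has mass one.\<close>

lemma corr_nonzero:
 assumes x: "x \<noteq> 0"
 shows "\<exists>C\<ge>0. \<forall>t>0. \<forall>s>0. \<bar>(\<integral>y. G t x y * G s x y \<partial>lborel) - kap x * gk (t + s) 0\<bar> \<le> C"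
proof -
 define X where "X = \<bar>f x\<bar>"
 have X: "0 < X" using x hw(1)[of x] by (simp add: X_def f_eq)
 define C where "C = hm * (2 + \<bar>\<beta>\<bar> + \<beta>^2) / X"
 have C0: "0 \<le> C" using X hm_pos unfolding C_def by (intro divide_nonneg_pos mult_nonneg_nonneg) auto
 have kx: "kap x = hw x" using x by (simp add: kap_def)
 have "\<bar>(\<integral>y. G t x y * G s x y \<partial>lborel) - kap x * gk (t + s) 0\<bar> \<le> 2 * C" if t: "0 < t" "0 < s" for t s
 proof -
  define A B where "A r y = gk r (f x - f y)" and "B r y = gk r (\<bar>f x\<bar> + \<bar>f y\<bar>)" for r y
  have small: "gk r z \<le> 1 / X" if "0 < r" "X \<le> \<bar>z\<bar>" for r z
  proof -
   have "X * gk r z \<le> \<bar>z\<bar> * gk r z" using that by (intro mult_right_mono gk_nonneg) auto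
   also have "\<dots> \<le> 1" by (rule gk_le_inverse) fact
   finally show ?thesis using X by (simp add: field_simps)
  qed
  have A0: "0 \<le> A r y" "0 \<le> B r y" "B r y \<le> A r y" "B r y \<le> 1 / X" if "0 < r" for r y
  proof -
   show "0 \<le> A r y" "0 \<le> B r y" using that by (simp_all add: A_def B_def gk_nonneg)
   show "B r y \<le> A r y" unfolding A_def B_def by (rule gk_reflected_le[OF that])
   show "B r y \<le> 1 / X" unfolding B_def by (rule small[OF that]) (simp add: X_def)
  qed
  have pt: "\<bar>G t x y * G s x y - hw x * (hw y * (A t y * A s y))\<bar> \<le> C * (hw y * A t y + hw y * A s y)" for y
  proof -
   define e where "e = \<beta> * sgn y"
   have e: "\<bar>e\<bar> \<le> \<bar>\<beta>\<bar>" "e^2 \<le> \<beta>^2"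
   proof -
    show a: "\<bar>e\<bar> \<le> \<bar>\<beta>\<bar>" by (simp add: e_def abs_mult abs_sgn_eq)
    show "e^2 \<le> \<beta>^2" using a by (simp add: abs_le_square_iff)
   qed
   \<comment> \<open>\<open>E\<close> collects the change of the Jacobian from \<open>hw x\<close>
     to \<open>hw y\<close> and the terms with a reflected kernel.\<close>
   define E where "E = (hw y - hw x) * (A t y * A s y) + hw y * (e * (A t y * B s y + B t y * A s y) + e^2 * (B t y * B s y))"
   have eq: "G t x y * G s x y - hw x * (hw y * (A t y * A s y)) = hw y * E"
    unfolding G_pos[OF t(1)] G_pos[OF t(2)] A_def[symmetric] B_def[symmetric] e_def[symmetric] E_def
    by (simp add: power2_eq_square algebra_simps)
   have "\<bar>G t x y * G s x y - hw x * (hw y * (A t y * A s y))\<bar> = hw y * \<bar>E\<bar>"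
    unfolding eq abs_mult[of "hw y"] using hw(1)[of y] by (simp only: abs_of_pos)
   also have "\<dots> \<le> hw y * (2 * hm * (1 / X * A s y) + hm * (\<bar>\<beta>\<bar> * (1 / X * (A t y + A s y)) + \<beta>^2 * (1 / X * A t y)))"
   proof (intro mult_left_mono)
    have 1: "\<bar>(hw y - hw x) * (A t y * A s y)\<bar> \<le> 2 * hm * (1 / X * A s y)"
    proof (cases "(x \<le> 0) = (y \<le> 0)")
     case True
     then have "hw y = hw x" by (simp add: hw_def)
     then show ?thesis using hm_pos X A0[OF t(2)] by simp
    next
     \<comment> \<open>Here \<open>y\<close> lies across the interface, so \<open>f y\<close> is at
       least as far from \<open>f x\<close> as 0 is.\<close>
     case False
     have sg: "(0 < z \<longrightarrow> 0 < f z) \<and> (z \<le> 0 \<longrightarrow> f z \<le> 0)" for z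
      using hw(1)[of z] by (auto simp: f_eq mult_nonpos_nonneg)
     have "X \<le> \<bar>f x - f y\<bar>"
      using False sg[of x] sg[of y] unfolding X_def by (cases "x \<le> 0") auto
     then have "A t y \<le> 1 / X" unfolding A_def by (intro small t)
     then have "A t y * A s y \<le> 1 / X * A s y" using A0[OF t(2)] by (intro mult_right_mono)
     moreover have "\<bar>hw y - hw x\<bar> \<le> 2 * hm" using hw[of x] hw[of y] hm_pos by auto
     ultimately have "\<bar>hw y - hw x\<bar> * (A t y * A s y) \<le> 2 * hm * (1 / X * A s y)"
      using A0(1)[OF t(1), of y] A0(1)[OF t(2), of y] hm_pos
      by (rule_tac mult_mono) (auto intro: mult_nonneg_nonneg)
     then show ?thesis unfolding abs_mult[of "hw y - hw x"] using A0(1)[OF t(1), of y] A0(1)[OF t(2), of y] by simp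
    qed
    have 2: "\<bar>e * (A t y * B s y + B t y * A s y)\<bar> \<le> \<bar>\<beta>\<bar> * (1 / X * (A t y + A s y))"
    proof -
     have "A t y * B s y \<le> A t y * (1 / X)" "B t y * A s y \<le> (1 / X) * A s y"
      using A0[OF t(1), of y] A0[OF t(2), of y] by (auto intro!: mult_left_mono mult_right_mono simp del: times_divide_eq_right times_divide_eq_left)
     then have "A t y * B s y + B t y * A s y \<le> 1 / X * (A t y + A s y)" by (simp add: distrib_left mult.commute)
     moreover have n: "0 \<le> A t y * B s y + B t y * A s y" using A0[OF t(1), of y] A0[OF t(2), of y] by simp
     ultimately have "\<bar>e\<bar> * (A t y * B s y + B t y * A s y) \<le> \<bar>\<beta>\<bar> * (1 / X * (A t y + A s y))"
      using e(1) by (rule_tac mult_mono) auto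
     then show ?thesis unfolding abs_mult[of e] abs_of_nonneg[OF n] .
    qed
    have 3: "\<bar>e^2 * (B t y * B s y)\<bar> \<le> \<beta>^2 * (1 / X * A t y)"
    proof -
     have "B t y * B s y \<le> A t y * (1 / X)" using A0[OF t(1), of y] A0[OF t(2), of y] by (rule_tac mult_mono) auto
     then have "e^2 * (B t y * B s y) \<le> \<beta>^2 * (1 / X * A t y)"
      using e(2) A0[OF t(1), of y] A0[OF t(2), of y] by (rule_tac mult_mono) (auto simp: mult.commute)
     then show ?thesis using A0[OF t(1), of y] A0[OF t(2), of y] by simp
    qed
    have "\<bar>hw y * (e * (A t y * B s y + B t y * A s y) + e^2 * (B t y * B s y))\<bar> \<le> hm * (\<bar>\<beta>\<bar> * (1 / X * (A t y + A s y)) + \<beta>^2 * (1 / X * A t y))"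
     unfolding abs_mult[of "hw y"] using 2 3 hw[of y] by (rule_tac mult_mono) auto
    with 1 show "\<bar>E\<bar> \<le> 2 * hm * (1 / X * A s y) + hm * (\<bar>\<beta>\<bar> * (1 / X * (A t y + A s y)) + \<beta>^2 * (1 / X * A t y))"
     unfolding E_def by linarith
    show "0 \<le> hw y" using hw(1)[of y] by simp
   qed
   also have "\<dots> \<le> hw y * (C * (A t y + A s y))"
   proof (intro mult_left_mono)
    define c where "c = hm / X"
    have c: "0 \<le> c" using hm_pos X by (simp add: c_def)
    have "2 * hm * (1 / X * A s y) + hm * (\<bar>\<beta>\<bar> * (1 / X * (A t y + A s y)) + \<beta>^2 * (1 / X * A t y))
     = c * (2 * A s y + \<bar>\<beta>\<bar> * (A t y + A s y) + \<beta>^2 * A t y)" by (simp add: c_def divide_inverse algebra_simps)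
    also have "\<dots> \<le> c * ((2 + \<bar>\<beta>\<bar> + \<beta>^2) * (A t y + A s y))"
    proof (intro mult_left_mono c)
     have "0 \<le> \<beta>^2 * A s y" "0 \<le> A t y" using A0[OF t(1)] A0[OF t(2)] by auto
     then show "2 * A s y + \<bar>\<beta>\<bar> * (A t y + A s y) + \<beta>^2 * A t y \<le> (2 + \<bar>\<beta>\<bar> + \<beta>^2) * (A t y + A s y)"
      by (simp add: distrib_right distrib_left)
    qed
    also have "\<dots> = C * (A t y + A s y)" by (simp add: c_def C_def)
    finally show "2 * hm * (1 / X * A s y) + hm * (\<bar>\<beta>\<bar> * (1 / X * (A t y + A s y)) + \<beta>^2 * (1 / X * A t y)) \<le> C * (A t y + A s y)" .
    show "0 \<le> hw y" using hw(1)[of y] by simp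
   qed
   finally show ?thesis by (simp add: algebra_simps)
  qed
  have iA: "integrable lborel (\<lambda>y. hw x * (hw y * (A t y * A s y)))" unfolding A_def by (intro integrable_mult_right hw_gk_product t)
  have iB: "integrable lborel (\<lambda>y. C * (hw y * A t y + hw y * A s y))"
   unfolding A_def by (intro integrable_mult_right bi_add hw_gk t)
  have iD: "integrable lborel (\<lambda>y. G t x y * G s x y - hw x * (hw y * (A t y * A s y)))"
   by (intro bi_diff G_prod_integrable t iA)
  have "(\<integral>y. G t x y * G s x y - hw x * (hw y * (A t y * A s y)) \<partial>lborel) = (\<integral>y. G t x y * G s x y \<partial>lborel) - kap x * gk (t + s) 0"
   using hw_gk_product(2)[OF t, of x]
   by (subst bo_diff[OF G_prod_integrable[OF t] iA]) (simp_all add: A_def kx)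
  then have "\<bar>(\<integral>y. G t x y * G s x y \<partial>lborel) - kap x * gk (t + s) 0\<bar> \<le> (\<integral>y. \<bar>G t x y * G s x y - hw x * (hw y * (A t y * A s y))\<bar> \<partial>lborel)"
   using integral_abs_bound[of lborel "\<lambda>y. G t x y * G s x y - hw x * (hw y * (A t y * A s y))"] by (simp only:)
  also have "\<dots> \<le> (\<integral>y. C * (hw y * A t y + hw y * A s y) \<partial>lborel)"
   by (rule integral_mono[OF integrable_abs[OF iD] iB pt])
  also have "\<dots> = C * (1 + 1)"
   using hw_gk[OF t(1), of x] hw_gk[OF t(2), of x]
   by (subst integral_mult_right_zero, subst bo_add) (simp_all add: A_def)
  finally show ?thesis by simp
 qed
 then show ?thesis using C0 by (intro exI[of _ "2 * C"]) auto
qed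

lemma corr: "\<exists>C\<ge>0. \<forall>t>0. \<forall>s>0. \<bar>(\<integral>y. G t x y * G s x y \<partial>lborel) - kap x * gk (t + s) 0\<bar> \<le> C"
proof (cases "x = 0")
 case True
 then show ?thesis using corr_zero by (intro exI[of _ 0]) auto
qed (rule corr_nonzero)

end

lemma ennreal_le_add_iff:
 assumes "0 \<le> b" "0 \<le> c"
 shows "ennreal a \<le> ennreal b + ennreal c \<longleftrightarrow> a \<le> b + c"
 using assms by (simp add: ennreal_plus[symmetric] ennreal_le_iff del: ennreal_plus)

text \<open>Multiplication by conjugates removes the cancellation; monotonicity in \<open>m\<close>
  can then be read off the denominator, as \<open>sdiff_le_zero\<close> does.\<close>

lemma sdiff_eq:
 assumes "0 < h" "0 \<le> m"
 shows "sdiff h m = h^2 / 2 / ((sqrt (m + h / 2) + sqrt m) * (sqrt (m + h) + sqrt (m + h / 2)) * (sqrt (m + h) + sqrt m))"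
proof -
 define a b c where "a = sqrt m" and "b = sqrt (m + h / 2)" and "c = sqrt (m + h)"
 have n: "0 \<le> a" "0 < b" "0 < c" using assms by (simp_all add: a_def b_def c_def)
 have sq: "a^2 = m" "b^2 = m + h / 2" "c^2 = m + h" using assms by (simp_all add: a_def b_def c_def)
 have "(2 * b - a - c) * ((b + a) * (c + b) * (c + a)) = ((b^2 - a^2) * (c + b) - (c^2 - b^2) * (b + a)) * (c + a)"
  by (simp add: power2_eq_square algebra_simps)
 also have "\<dots> = h / 2 * (c^2 - a^2)" 
 proof -
  have "b^2 - a^2 = h / 2" "c^2 - b^2 = h / 2" unfolding sq by auto
  then have "((b^2 - a^2) * (c + b) - (c^2 - b^2) * (b + a)) * (c + a) = h / 2 * ((c + b) - (b + a)) * (c + a)"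
   by (simp only: right_diff_distrib)
  also have "\<dots> = h / 2 * (c^2 - a^2)"
   unfolding power2_eq_square square_diff_square_factored by (simp add: mult_ac)
  finally show ?thesis .
 qed
 also have "\<dots> = h^2 / 2" unfolding sq by (simp add: power2_eq_square)
 finally have "(2 * b - a - c) * ((b + a) * (c + b) * (c + a)) = h^2 / 2" .
 moreover have "0 < b + a" "0 < c + b" "0 < c + a" using n by simp_all
 then have "(b + a) * (c + b) * (c + a) \<noteq> 0" by simp
 ultimately show ?thesis unfolding sdiff_def a_def[symmetric] b_def[symmetric] c_def[symmetric] by (rule_tac eq_divide_imp)
qed

lemma sdiff_le_zero:
 assumes "0 < h" "0 \<le> m"
 shows "sdiff h m \<le> sdiff h 0"
 unfolding sdiff_eq[OF assms] sdiff_eq[OF assms(1) order_refl]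
 using assms by (intro divide_left_mono mult_mono add_mono mult_pos_pos add_pos_nonneg) auto

context coeffs
begin

text \<open>Expanding the square leaves correlations with coefficients 1, 1 and 2, each known up to
  \<open>C\<close>, hence \<open>4 * C\<close>. For \<open>s \<le> 0\<close> the second kernel
  vanishes and one correlation remains.\<close>

lemma G_diff_sq:
 assumes C: "\<And>t s. 0 < t ==> 0 < s ==> \<bar>(\<integral>y. G t x y * G s x y \<partial>lborel) - kap x * gk (t + s) 0\<bar> \<le> C"
  and h: "0 < t"
 obtains r where "nn2 lborel (\<lambda>y. G t x y - G s x y) = ennreal r" "0 \<le> r"
  "\<bar>r - (if 0 < s then kap x * gdiff t s 0 else kap x * gk (2 * t) 0)\<bar> \<le> 4 * C"
proof -
 define R where "R t s = (\<integral>y. G t x y * G s x y \<partial>lborel)" for t s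
 define r where "r = (\<integral>y. (G t x y - G s x y)^2 \<partial>lborel)"
 have R: "\<bar>R t s - kap x * gk (t + s) 0\<bar> \<le> C" if "0 < t" "0 < s" for t s using C[OF that] by (simp add: R_def)
 have I: "integrable lborel (\<lambda>y. (G t x y - G s x y)^2)"
  and e: "r = (if 0 < s then R t t + R s s - 2 * R t s else R t t)"
 proof -
  have eq: "(G t x y - G s x y)^2 = G t x y * G t x y + G s x y * G s x y - 2 * (G t x y * G s x y)" for y
   by (simp add: power2_eq_square algebra_simps)
  have "integrable lborel (\<lambda>y. (G t x y - G s x y)^2) \<and> r = (if 0 < s then R t t + R s s - 2 * R t s else R t t)"
  proof (cases "0 < s")
   case True
   note i = G_prod_integrable[OF h h, of x] G_prod_integrable[OF True True, of x] G_prod_integrable[OF h True, of x]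
   show ?thesis using True i by (simp add: eq r_def R_def)
  next
   case False
   then have z: "G s x y = 0" for y by (simp add: G_nonpos)
   show ?thesis using False G_prod_integrable[OF h h, of x] by (simp add: z r_def R_def power2_eq_square)
  qed
  then show "integrable lborel (\<lambda>y. (G t x y - G s x y)^2)" "r = (if 0 < s then R t t + R s s - 2 * R t s else R t t)" by auto
 qed
 show thesis
 proof (rule that)
  show "nn2 lborel (\<lambda>y. G t x y - G s x y) = ennreal r"
   unfolding r_def by (rule nn_integral_eq_integral[OF I]) simp
  show "0 \<le> r" unfolding r_def by simp
  show "\<bar>r - (if 0 < s then kap x * gdiff t s 0 else kap x * gk (2 * t) 0)\<bar> \<le> 4 * C"
  proof (cases "0 < s")
   case True
   have "kap x * gdiff t s 0 = kap x * gk (t + t) 0 + kap x * gk (s + s) 0 - 2 * (kap x * gk (t + s) 0)"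
    by (simp add: gdiff_def mult_2[symmetric] algebra_simps)
   then show ?thesis using R[OF h h] R[OF True True] R[OF h True] unfolding e if_P[OF True] by linarith
  next
   case False
   have "kap x * gk (2 * t) 0 = kap x * gk (t + t) 0" by (simp only: mult_2)
   then show ?thesis using R[OF h h] unfolding e if_not_P[OF False] by linarith
  qed
 qed
qed

text \<open>In each time slice the squared kernel difference is within \<open>4 * C\<close> of an
  explicit Gaussian expression. Apart from constants, the latter integrates to
  \<open>sdiff h 0 - sdiff h w\<close> before \<open>\<tau>\<close> and to \<open>sqrt h\<close>
  after it, together \<open>sqrt (2 * h) - sdiff h w\<close>.\<close>

lemma window_variance:
 "\<exists>C\<ge>0. \<forall>\<tau> h w. 0 < h \<longrightarrow> 0 \<le> w \<longrightarrow>
  \<bar>(\<integral>p. (gker (\<tau> + h) \<tau> x x {\<tau> - w<..\<tau> + h} p)^2 \<partial>lborel) - kap x * (sqrt (2 * h) - sdiff h w) / sqrt pi\<bar> \<le> C * (w + h)"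
proof -
 from corr[of x] obtain C where C: "0 \<le> C"
  "\<And>t s. 0 < t ==> 0 < s ==> \<bar>(\<integral>y. G t x y * G s x y \<partial>lborel) - kap x * gk (t + s) 0\<bar> \<le> C" by blast
 have "\<bar>(\<integral>p. (gker (\<tau> + h) \<tau> x x {\<tau> - w<..\<tau> + h} p)^2 \<partial>lborel) - kap x * (sqrt (2 * h) - sdiff h w) / sqrt pi\<bar> \<le> 4 * C * (w + h)"
  if h: "0 < h" "0 \<le> w" for \<tau> h w
 proof -
  define J where "J = {\<tau> - w<..<\<tau> + h}"
  \<comment> \<open>After \<open>\<tau>\<close> only the kernel of the later time is
    present.\<close>
  define H where "H s = (if s < \<tau> then kap x * gdiff (\<tau> + h - s) (\<tau> - s) 0 else kap x * gk (2 * (\<tau> + h - s)) 0)" for s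
  have Jm [measurable]: "J \<in> sets borel" by (simp add: J_def)
  define F where "F s = nn2 lborel (\<lambda>y. G (\<tau> + h - s) x y - G (\<tau> - s) x y)" for s
  define c where "c = kap x * (sqrt (2 * h) - sdiff h w) / sqrt pi"
  have Hm [measurable]: "H \<in> bm borel" unfolding H_def[abs_def] gdiff_def gk_def by measurable
  have Fm [measurable]: "F \<in> bm borel" unfolding F_def[abs_def] by measurable
  have Hn: "0 \<le> H s" if "s \<in> J" for s
   using that h kap_nonneg[of x] by (auto simp: H_def J_def intro!: mult_nonneg_nonneg gk_sq_diff(2) gk_nonneg)
  have FH: "F s \<le> ennreal (H s) + ennreal (4 * C)" "ennreal (H s) \<le> F s + ennreal (4 * C)" if s: "s \<in> J" for s
  proof -
   have p: "0 < \<tau> + h - s" using s by (simp add: J_def)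
   have H: "H s = (if 0 < \<tau> - s then kap x * gdiff (\<tau> + h - s) (\<tau> - s) 0 else kap x * gk (2 * (\<tau> + h - s)) 0)"
    by (simp add: H_def)
   obtain r where r: "F s = ennreal r" "0 \<le> r" "\<bar>r - H s\<bar> \<le> 4 * C"
    unfolding F_def H by (rule G_diff_sq[OF C(2) p, of "\<tau> - s"])
   show "F s \<le> ennreal (H s) + ennreal (4 * C)" unfolding r(1)
    using r(2,3) Hn[OF s] C(1) by (subst ennreal_le_add_iff) auto
   show "ennreal (H s) \<le> F s + ennreal (4 * C)" unfolding r(1)
    using r(2,3) Hn[OF s] C(1) by (subst ennreal_le_add_iff) auto
  qed
  have IH: "(\<integral>\<^sup>+s. ennreal (H s) * indicator J s \<partial>lborel) = ennreal c"
  proof -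
   have "(\<integral>\<^sup>+s. ennreal (H s) * indicator J s \<partial>lborel)
    = (\<integral>\<^sup>+s. ennreal (kap x * gdiff (\<tau> + h - s) (\<tau> - s) 0) * indicator {\<tau> - w<..<\<tau>} s
      + ennreal (kap x * gk (2 * (\<tau> + h - s)) 0) * indicator {\<tau><..<\<tau> + h} s \<partial>lborel)"
   proof (rule nn_integral_cong_AE)
    show "AE s in lborel. ennreal (H s) * indicator J s = ennreal (kap x * gdiff (\<tau> + h - s) (\<tau> - s) 0) * indicator {\<tau> - w<..<\<tau>} s
      + ennreal (kap x * gk (2 * (\<tau> + h - s)) 0) * indicator {\<tau><..<\<tau> + h} s"
     using AE_lborel_singleton[of \<tau>] by eventually_elim (use h in \<open>auto simp: H_def J_def indicator_def\<close>)
   qed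
   also have "\<dots> = (\<integral>\<^sup>+s. ennreal (kap x * gdiff (\<tau> + h - s) (\<tau> - s) 0) * indicator {\<tau> - w<..<\<tau>} s \<partial>lborel)
     + (\<integral>\<^sup>+s. ennreal (kap x * gk (2 * (\<tau> + h - s)) 0) * indicator {\<tau><..<\<tau> + h} s \<partial>lborel)"
    by (rule nn_integral_add) (unfold gdiff_def gk_def, measurable)
   also have "(\<integral>\<^sup>+s. ennreal (kap x * gdiff (\<tau> + h - s) (\<tau> - s) 0) * indicator {\<tau> - w<..<\<tau>} s \<partial>lborel)
    = ennreal (kap x) * (\<integral>\<^sup>+s. ennreal (gdiff (\<tau> + h - s) (\<tau> - s) 0) * indicator {\<tau> - w<..<\<tau>} s \<partial>lborel)"
   proof (rule scaled_nn_integral[OF kap_nonneg])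
    show "0 \<le> gdiff (\<tau> + h - s) (\<tau> - s) 0" if "s < \<tau>" for s using that h by (intro gk_sq_diff(2)) auto
   qed (unfold gdiff_def gk_def, measurable)
   also have "\<dots> = ennreal (kap x * ((sdiff h 0 - sdiff h w) / sqrt pi))"
    using h unfolding ennreal_mult'[OF kap_nonneg[of x]] by (subst gdiff_time_integral[OF h(1)]) simp_all
   also have "(\<integral>\<^sup>+s. ennreal (kap x * gk (2 * (\<tau> + h - s)) 0) * indicator {\<tau><..<\<tau> + h} s \<partial>lborel)
    = ennreal (kap x) * (\<integral>\<^sup>+s. ennreal (gk (2 * (\<tau> + h - s)) 0) * indicator {\<tau><..<\<tau> + h} s \<partial>lborel)"
   proof (rule scaled_nn_integral[OF kap_nonneg])
    show "0 \<le> gk (2 * (\<tau> + h - s)) 0" if "s < \<tau> + h" for s using that by (intro gk_nonneg) auto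
   qed (unfold gk_def, measurable)
   also have "\<dots> = ennreal (kap x * (sqrt h / sqrt pi))"
    using h unfolding ennreal_mult'[OF kap_nonneg[of x]] by (subst gk_time_integral) simp_all
   also have "ennreal (kap x * ((sdiff h 0 - sdiff h w) / sqrt pi)) + ennreal (kap x * (sqrt h / sqrt pi)) = ennreal c"
   proof -
    have "0 \<le> sdiff h 0 - sdiff h w" using sdiff_le_zero[OF h] by simp
    then have "ennreal (kap x * ((sdiff h 0 - sdiff h w) / sqrt pi)) + ennreal (kap x * (sqrt h / sqrt pi))
     = ennreal (kap x * ((sdiff h 0 - sdiff h w) / sqrt pi) + kap x * (sqrt h / sqrt pi))"
     using kap_nonneg[of x] h by (intro ennreal_plus[symmetric] mult_nonneg_nonneg divide_nonneg_nonneg) auto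
    also have "kap x * ((sdiff h 0 - sdiff h w) / sqrt pi) + kap x * (sqrt h / sqrt pi) = c"
    proof -
     have "sqrt (2 * h) - sdiff h w = (sdiff h 0 - sdiff h w) + sqrt h" using sdiff_zero[of h] h by simp
     then show ?thesis unfolding c_def by (simp only: distrib_left add_divide_distrib times_divide_eq_right)
    qed
    finally show ?thesis .
   qed
   finally show ?thesis .
  qed
  have IC: "(\<integral>\<^sup>+s. ennreal (4 * C) * indicator J s \<partial>lborel) = ennreal (4 * C * (w + h))"
  proof -
   have "(\<integral>\<^sup>+s. ennreal (4 * C) * indicator J s \<partial>lborel) = ennreal (4 * C) * emeasure lborel J"
    by (rule nn_integral_cmult_indicator) (simp add: J_def)
   also have "emeasure lborel J = ennreal (w + h)" using h by (simp add: J_def add.commute del: ennreal_plus)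
   finally show ?thesis using h C(1) by (simp only: ennreal_mult mult_nonneg_nonneg add_nonneg_nonneg zero_le_numeral less_imp_le)
  qed
  define V where "V = nn2 lborel (\<lambda>p. gker (\<tau> + h) \<tau> x x {\<tau> - w<..\<tau> + h} p)"
  have V: "V = (\<integral>\<^sup>+s. F s * indicator J s \<partial>lborel)"
  proof -
   have "V = (\<integral>\<^sup>+s. F s * indicator {\<tau> - w<..\<tau> + h} s \<partial>lborel)" unfolding V_def F_def by (rule gker_slice1) simp
   also have "\<dots> = (\<integral>\<^sup>+s. F s * indicator J s \<partial>lborel)"
   proof (rule nn_integral_cong_AE)
    show "AE s in lborel. F s * indicator {\<tau> - w<..\<tau> + h} s = F s * indicator J s"
     using AE_lborel_singleton[of "\<tau> + h"] by eventually_elim (auto simp: J_def indicator_def)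
   qed
   finally show ?thesis .
  qed
  have "0 \<le> sqrt h" using h by simp
  then have "sdiff h w \<le> sqrt (2 * h)" using sdiff_le_zero[OF h] sdiff_zero[of h] h by linarith
  then have c: "0 \<le> c" using kap_nonneg[of x] unfolding c_def by (intro divide_nonneg_nonneg mult_nonneg_nonneg) auto
  have "V \<le> (\<integral>\<^sup>+s. ennreal (H s) * indicator J s + ennreal (4 * C) * indicator J s \<partial>lborel)"
   unfolding V using FH(1) by (intro nn_integral_mono) (auto simp: indicator_def)
  also have "\<dots> = ennreal c + ennreal (4 * C * (w + h))"
   by (subst nn_integral_add) (simp_all only: IH IC, auto)
  finally have up: "V \<le> ennreal c + ennreal (4 * C * (w + h))" .
  have "ennreal c \<le> (\<integral>\<^sup>+s. F s * indicator J s + ennreal (4 * C) * indicator J s \<partial>lborel)"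
   unfolding IH[symmetric] using FH(2) by (intro nn_integral_mono) (auto simp: indicator_def)
  also have "\<dots> = V + ennreal (4 * C * (w + h))"
   by (subst nn_integral_add) (simp_all only: V IC, auto)
  finally have lo: "ennreal c \<le> V + ennreal (4 * C * (w + h))" .
  have fin: "V < \<infinity>" using up by (rule le_less_trans) simp
  define v where "v = enn2real V"
  have Vv: "V = ennreal v" and v0: "0 \<le> v" using fin by (simp_all add: v_def)
  have vi: "(\<integral>p. (gker (\<tau> + h) \<tau> x x {\<tau> - w<..\<tau> + h} p)^2 \<partial>lborel) = v"
   unfolding v_def V_def by (rule integral_eq_nn_integral) auto
  have e: "0 \<le> 4 * C * (w + h)" using C h by simp
  have "v \<le> c + 4 * C * (w + h)" using up c e by (simp add: Vv ennreal_le_add_iff)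
  moreover have "c \<le> v + 4 * C * (w + h)" using lo v0 e by (simp add: Vv ennreal_le_add_iff)
  ultimately show ?thesis unfolding vi c_def[symmetric] by linarith
 qed
 then show ?thesis using C(1) by (intro exI[of _ "4 * C"]) auto
qed

end

section \<open>Moments and regularity of the mild solution\<close>

lemma add_power_le:
 assumes "0 \<le> (a :: real)" "0 \<le> b"
 shows "(a + b) ^ n \<le> 2 ^ n * (a ^ n + b ^ n)"
proof (cases "a \<le> b")
 case True
 then have "(a + b) ^ n \<le> (2 * b) ^ n" using assms by (intro power_mono) auto
 also have "\<dots> \<le> 2 ^ n * (a ^ n + b ^ n)" using assms unfolding power_mult_distrib by (intro mult_left_mono) auto
 finally show ?thesis .
next
 case False
 then have "(a + b) ^ n \<le> (2 * a) ^ n" using assms by (intro power_mono) auto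
 also have "\<dots> \<le> 2 ^ n * (a ^ n + b ^ n)" using assms unfolding power_mult_distrib by (intro mult_left_mono) auto
 finally show ?thesis .
qed

locale mild = wnoise M W + coeffs a1 a2 \<rho>1 \<rho>2
 for M :: "'a measure" and W and a1 a2 \<rho>1 \<rho>2 :: real +
 fixes \<sigma> :: "real => real" and K :: real and u :: "real => real => 'a => real" and T :: real
 assumes K: "0 < K" "K-lipschitz_on UNIV \<sigma>"
  and sol: "mild_solution a1 a2 \<rho>1 \<rho>2 \<sigma> M W u"
  and T: "0 < T"
begin

text \<open>Extended to negative times by its value at 0, because joint measurability of
  \<open>u\<close> is given for nonnegative times.\<close>

definition v :: "real => real => 'a => real" where "v s y om = \<sigma> (u (max 0 s) y om)"

lemma sigma_lipschitz: "\<bar>\<sigma> a - \<sigma> b\<bar> \<le> K * \<bar>a - b\<bar>"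
 using lipschitz_onD[OF K(2), of a b] by (simp add: dist_real_def)

lemma sigma_measurable [measurable]: "\<sigma> \<in> bm borel"
 by (intro borel_measurable_continuous_onI lipschitz_on_continuous_on[OF K(2)])

lemma u_measurable: "0 \<le> t ==> u t x \<in> bm M"
 using sol filtration_measurable unfolding mild_solution_def by blast

lemma v_measurable: "v s y \<in> bm M"
 unfolding v_def[abs_def] by (intro measurable_compose[OF u_measurable sigma_measurable]) simp

text \<open>The solution is adapted to the right-continuous filtration, which is contained in the
  raw past of every strictly later time; hence the gap \<open>s' < s\<close>.\<close>

lemma v_adapted:
 assumes "0 \<le> s'" "s' < s"
 shows "v s' y \<in> bm (sub (upto_time s))"
proof -
 have "u s' y \<in> bm (noise_filtration M W s')" using sol assms unfolding mild_solution_def by blast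
 then have "u s' y \<in> bm (sub (upto_time s))"
  using filtration_subset[OF assms(2)]
  by (rule_tac measurable_subset_sets) (auto simp: filtration_space sub_space[OF upto_IX] noise_sets_sub)
 from measurable_compose[OF this sigma_measurable] show ?thesis using assms by (simp add: v_def[abs_def])
qed

lemma u_joint: "(\<lambda>(om, s, y). u (max 0 s) y om) \<in> bm (M \<Otimes>\<^sub>M borel \<Otimes>\<^sub>M borel)"
proof -
 let ?U = "\<lambda>(om, t, x). u t x om"
 have U: "?U \<in> bm (M \<Otimes>\<^sub>M (restrict_space borel {0..} \<Otimes>\<^sub>M borel))"
  using sol unfolding mild_solution_def by blast
 have "(\<lambda>s :: real. max 0 s) \<in> borel \<rightarrow>\<^sub>M restrict_space borel {0..}" by (rule measurable_restrict_space2) auto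
 then have "(\<lambda>z. (fst z, max 0 (fst (snd z)), snd (snd z)))
   \<in> measurable (M \<Otimes>\<^sub>M (borel :: real measure) \<Otimes>\<^sub>M (borel :: real measure)) (M \<Otimes>\<^sub>M (restrict_space borel {0..} \<Otimes>\<^sub>M borel))"
  by measurable
 from measurable_compose[OF this U] show ?thesis by (simp add: case_prod_beta')
qed

lemma v_PP: "(\<lambda>(om, s, y). v s y om) \<in> bm PP"
proof -
 have e: "sets (M \<Otimes>\<^sub>M (lborel :: (real \<times> real) measure)) = sets (M \<Otimes>\<^sub>M (borel \<Otimes>\<^sub>M borel))"
  by (intro sets_pair_measure_cong) (simp_all add: borel_prod[symmetric])
 have "(\<lambda>z. \<sigma> ((\<lambda>(om, s, y). u (max 0 s) y om) z)) \<in> bm (M \<Otimes>\<^sub>M borel \<Otimes>\<^sub>M borel)"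
  by (rule measurable_compose[OF u_joint sigma_measurable])
 then show ?thesis unfolding PP_def measurable_cong_sets[OF e refl] by (simp add: case_prod_beta' v_def)
qed

lemma walsh_u:
 assumes t: "0 \<le> t"
 shows "walsh (\<lambda>(om, s, y). v s y om * (Gf t x (s, y) * indicator {0<..t} s)) (u t x)"
proof -
 have h: "has_walsh_integral M W (\<lambda>(om, s, y). \<sigma> (u s y om) * G (t - s) x y) t (u t x)"
  using sol t unfolding mild_solution_def by blast
 have eq: "(\<lambda>(om, s, y). (\<lambda>(om, s, y). \<sigma> (u s y om) * G (t - s) x y) (om, s, y) * indicator {0<..t} s)
  = (\<lambda>(om, s, y). v s y om * (Gf t x (s, y) * indicator {0<..t} s))"
  by (auto simp: fun_eq_iff v_def Gf_def indicator_def)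
 have gm: "(\<lambda>p. Gf t x p * indicator {0<..t} (fst p)) \<in> bm borel" by measurable
 have "(\<lambda>(om, s, y). v s y om * (Gf t x (s, y) * indicator {0<..t} s)) \<in> bm PP"
  using field_PP[OF v_PP gm] by simp
 then show ?thesis using has_walsh_integral_walsh[OF h t] unfolding eq by blast
qed

text \<open>The kernel of the earlier time vanishes after \<open>t'\<close>, so both integrals can
  be taken up to \<open>t\<close>.\<close>

lemma walsh_u_diff:
 assumes t: "0 \<le> t'" "t' \<le> t"
 shows "walsh (\<lambda>(om, s, y). v s y om * gker t t' x x' {0<..t} (s, y)) (\<lambda>om. u t x om - u t' x' om)"
proof -
 have t0: "0 \<le> t" using t by simp
 have "(\<lambda>z. (\<lambda>(om, s, y). v s y om * (Gf t x (s, y) * indicator {0<..t} s)) z - (\<lambda>(om, s, y). v s y om * (Gf t' x' (s, y) * indicator {0<..t'} s)) z)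
  = (\<lambda>(om, s, y). v s y om * gker t t' x x' {0<..t} (s, y))"
  using t by (auto simp: fun_eq_iff gker_def Gf_def indicator_def G_nonpos algebra_simps)
 then show ?thesis using walsh_diff[OF walsh_u[OF t0, of x] walsh_u[OF t(1), of x']] by simp
qed

text \<open>Lipschitz continuity gives linear growth of \<open>\<sigma>\<close>, and the moments of
  \<open>u\<close> are bounded uniformly up to time \<open>T\<close>.\<close>

lemma v_moments:
 fixes p :: nat
 assumes p: "even p" "2 \<le> p"
 shows "\<exists>B\<ge>0. \<forall>s\<in>{0..T}. \<forall>y. (nni M (\<lambda>om. v s y om ^ p)) \<le> ennreal B"
proof -
 define S where "S = (SUP (t, x) \<in> {0..T} \<times> UNIV. nni M (\<lambda>om. \<bar>u t x om\<bar> powr (real p)))"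
 have "S < \<infinity>" unfolding S_def using sol T p(2) unfolding mild_solution_def by auto
 then obtain B where B: "0 \<le> B" "S = ennreal B" by (cases S) auto
 define D where "D = 2 ^ p * (\<bar>\<sigma> 0\<bar> ^ p + K ^ p * B)"
 have pt: "v s y om ^ p \<le> 2 ^ p * \<bar>\<sigma> 0\<bar> ^ p + 2 ^ p * K ^ p * (\<bar>u s y om\<bar> powr real p)" if "0 \<le> s" for s y om
 proof -
  have "v s y om ^ p = \<bar>v s y om\<bar> ^ p" using p(1) by (simp add: power_even_abs)
  also have "\<dots> \<le> (\<bar>\<sigma> 0\<bar> + K * \<bar>u s y om\<bar>) ^ p"
   using sigma_lipschitz[of "u s y om" 0] that by (intro power_mono) (auto simp: v_def)
  also have "\<dots> \<le> 2 ^ p * (\<bar>\<sigma> 0\<bar> ^ p + (K * \<bar>u s y om\<bar>) ^ p)" using K(1) by (intro add_power_le) auto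
  also have "(K * \<bar>u s y om\<bar>) ^ p = K ^ p * (\<bar>u s y om\<bar> powr real p)"
   using p by (cases "u s y om = 0") (auto simp: power_mult_distrib powr_realpow)
  finally show ?thesis by (simp add: distrib_left mult_ac)
 qed
 have "nni M (\<lambda>om. v s y om ^ p) \<le> ennreal D" if s: "s \<in> {0..T}" for s y
 proof -
  have um [measurable]: "u s y \<in> bm M" using s by (intro u_measurable) simp
  have "nni M (\<lambda>om. v s y om ^ p) \<le> (\<integral>\<^sup>+om. ennreal (2 ^ p * \<bar>\<sigma> 0\<bar> ^ p) + ennreal (2 ^ p * K ^ p) * ennreal (\<bar>u s y om\<bar> powr real p) \<partial>M)"
  proof (rule nn_integral_mono)
   fix om
   have "ennreal (v s y om ^ p) \<le> ennreal (2 ^ p * \<bar>\<sigma> 0\<bar> ^ p + 2 ^ p * K ^ p * (\<bar>u s y om\<bar> powr real p))"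
    using pt[of s y om] s by (intro ennreal_leI) simp
   also have "\<dots> = ennreal (2 ^ p * \<bar>\<sigma> 0\<bar> ^ p) + ennreal (2 ^ p * K ^ p * (\<bar>u s y om\<bar> powr real p))"
    using K(1) by (intro ennreal_plus) auto
   also have "ennreal (2 ^ p * K ^ p * (\<bar>u s y om\<bar> powr real p)) = ennreal (2 ^ p * K ^ p) * ennreal (\<bar>u s y om\<bar> powr real p)"
    using K(1) by (intro ennreal_mult) auto
   finally show "ennreal (v s y om ^ p) \<le> ennreal (2 ^ p * \<bar>\<sigma> 0\<bar> ^ p) + ennreal (2 ^ p * K ^ p) * ennreal (\<bar>u s y om\<bar> powr real p)" .
  qed
  also have "\<dots> = ennreal (2 ^ p * \<bar>\<sigma> 0\<bar> ^ p) + ennreal (2 ^ p * K ^ p) * nni M (\<lambda>om. \<bar>u s y om\<bar> powr real p)"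
   by (subst nn_integral_add) (simp_all add: nn_integral_cmult emeasure_space_1)
  also have "\<dots> \<le> ennreal (2 ^ p * \<bar>\<sigma> 0\<bar> ^ p) + ennreal (2 ^ p * K ^ p) * S"
  proof (intro add_left_mono mult_left_mono)
   have "(case (s, y) of (t, x) => nni M (\<lambda>om. \<bar>u t x om\<bar> powr real p)) \<le> S"
    unfolding S_def by (rule SUP_upper) (use s in simp)
   then show "nni M (\<lambda>om. \<bar>u s y om\<bar> powr real p) \<le> S" by simp
  qed simp
  also have "\<dots> = ennreal (2 ^ p * \<bar>\<sigma> 0\<bar> ^ p + 2 ^ p * K ^ p * B)"
   unfolding B(2) using K(1) B(1) by (simp only: ennreal_mult ennreal_plus mult_nonneg_nonneg zero_le_power zero_le_numeral less_imp_le abs_ge_zero)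
  also have "\<dots> = ennreal D" by (simp add: D_def distrib_left mult_ac)
  finally show ?thesis .
 qed
 moreover have "0 \<le> D" using K(1) B(1) by (simp add: D_def)
 ultimately show ?thesis by blast
qed

definition b4 :: real where
 "b4 = (SOME b. 0 \<le> b \<and> (\<forall>s\<in>{0..T}. \<forall>y. (nni M (\<lambda>om. v s y om ^ 4)) \<le> ennreal (b^2)))"

lemma b4: "0 \<le> b4" "s \<in> {0..T} ==> (nni M (\<lambda>om. v s y om ^ 4)) \<le> ennreal (b4^2)"
proof -
 obtain B where B: "0 \<le> B" "\<forall>s\<in>{0..T}. \<forall>y. (nni M (\<lambda>om. v s y om ^ 4)) \<le> ennreal B"
  using v_moments[of 4] by auto
 \<comment> \<open>Puts the bound into the form of a square, which \<open>adm\<close>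
   expects.\<close>
 have "B \<le> (B + 1)^2" using B(1) by (simp add: power2_eq_square algebra_simps)
 then have "ennreal B \<le> ennreal ((B + 1)^2)" by (rule ennreal_leI)
 with B have "\<forall>s\<in>{0..T}. \<forall>y. (nni M (\<lambda>om. v s y om ^ 4)) \<le> ennreal ((B + 1)^2)"
  by (meson order_trans)
 with B(1) have "\<exists>b. 0 \<le> b \<and> (\<forall>s\<in>{0..T}. \<forall>y. (nni M (\<lambda>om. v s y om ^ 4)) \<le> ennreal (b^2))"
  by (rule_tac exI[of _ "B + 1"]) simp
 from someI_ex[OF this] show "0 \<le> b4" "s \<in> {0..T} ==> (nni M (\<lambda>om. v s y om ^ 4)) \<le> ennreal (b4^2)"
  unfolding b4_def[symmetric] by blast+
qed

lemma gker_kern: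
 assumes ab: "0 \<le> a" "b \<le> T'" and \<Gamma>: "0 \<le> \<Gamma>"
  "nni lborel (\<lambda>p. \<phi> p * (gker t t' x x' {a<..b} p)^2) \<le> ennreal \<Gamma>"
 shows "kern T' \<phi> (gker t t' x x' {a<..b}) \<Gamma>"
 unfolding kern_def using ab \<Gamma> gker_cont[of "{a<..b}" a b t t' x x'] by (auto simp: gker_def indicator_def)

lemma gker_support: "gker t t' x x' {a<..b} p \<noteq> 0 ==> a < fst p \<and> fst p \<le> b"
 by (auto simp: gker_def indicator_def)

lemma const_mult_bound:
 assumes "0 \<le> c" "0 \<le> \<Gamma>" "nn2 lborel (\<lambda>p. g p) \<le> ennreal \<Gamma>" and [measurable]: "g \<in> bm borel"
 shows "nni (lborel :: (real \<times> real) measure) (\<lambda>p. c * (g p)^2) \<le> ennreal (c * \<Gamma>)"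
proof -
 have "nni lborel (\<lambda>p. c * (g p)^2) = ennreal c * nn2 (lborel :: (real \<times> real) measure) (\<lambda>p. g p)"
  using assms(1) by (simp add: ennreal_mult nn_integral_cmult)
 also have "\<dots> \<le> ennreal c * ennreal \<Gamma>" by (intro mult_left_mono assms) simp
 finally show ?thesis using assms by (simp add: ennreal_mult)
qed

text \<open>A modulus for squared norms: up to constant factors it bounds the second moment of an
  increment of \<open>u\<close> as well as the square root of its fourth moment.\<close>

definition mod_u :: "real => real => real => real => real" where
 "mod_u t x t' x' = b4 * (c3 * (sqrt \<bar>t - t'\<bar> + \<bar>x - x'\<bar>))"

lemma mod_u_nonneg: "0 \<le> mod_u t x t' x'"
 using b4(1) c3_nonneg by (simp add: mod_u_def)

lemma mod_kern:
 assumes t: "0 \<le> t'" "t' \<le> t" "t \<le> T"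
 shows "kern T (\<lambda>_. b4) (gker t t' x x' {0<..t}) (mod_u t x t' x')"
proof (rule gker_kern[OF order_refl t(3) mod_u_nonneg])
 have "nni lborel (\<lambda>p. b4 * (gker t t' x x' {0<..t} p)^2) \<le> ennreal (b4 * (c3 * (sqrt (t - t') + \<bar>x - x'\<bar>)))"
  using holder_kernel[OF t(1,2), of x x'] c3_nonneg t by (intro const_mult_bound b4(1)) auto
 then show "nni lborel (\<lambda>p. b4 * (gker t t' x x' {0<..t} p)^2) \<le> ennreal (mod_u t x t' x')"
  using t by (simp add: mod_u_def)
qed

lemma v_second: "s \<in> {0..T} ==> (nn2 M (\<lambda>om. v s y om)) \<le> ennreal b4"
 by (rule second_of_fourth(3)[OF v_measurable b4])

text \<open>Second moments come first, since they follow from \<open>walsh_bound\<close> alone. They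
  give the continuity of \<open>v\<close> in L2 that \<open>adm\<close> demands, on which the fourth
  moment bounds rest.\<close>

lemma u_holder2_aux:
 assumes t: "0 \<le> t'" "t' \<le> t" "t \<le> T"
 shows "nn2 M (\<lambda>om. u t x om - u t' x' om) \<le> ennreal (4 * mod_u t x t' x')"
proof -
 let ?g = "gker t t' x x' {0<..t}"
 note k = mod_kern[OF t, of x x']
 let ?X = "\<lambda>(om, s, y). v s y om * ?g (s, y)"
 have "?X \<in> bm PP" using walsh_u_diff[OF t(1,2)] by (simp add: walsh_def)
 then have m: "(\<lambda>z. ennreal ((?X z)^2)) \<in> bm PP" by measurable
 have "nn2 PP (\<lambda>z. ?X z) = (\<integral>\<^sup>+p. nn2 M (\<lambda>om. ?X (om, p)) \<partial>lborel)" by (rule PP_swap[OF m])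
 also have "\<dots> \<le> nni lborel (\<lambda>p. b4 * (?g p)^2)"
 proof (rule nn_integral_mono)
  fix p :: "real \<times> real"
  obtain s y where p: "p = (s, y)" by (cases p)
  show "nn2 M (\<lambda>om. ?X (om, p)) \<le> ennreal (b4 * (?g p)^2)"
  proof (cases "?g p = 0")
   case False
   then have s: "s \<in> {0..T}" using gker_support[OF False] t by (auto simp: p)
   note [measurable] = v_measurable
   have "nn2 M (\<lambda>om. ?X (om, p)) = (\<integral>\<^sup>+om. ennreal ((v s y om)^2) * ennreal ((?g p)^2) \<partial>M)"
    by (simp add: p power_mult_distrib ennreal_mult)
   also have "\<dots> = nn2 M (\<lambda>om. v s y om) * ennreal ((?g p)^2)" by (rule nn_integral_multc) measurable
   also have "\<dots> \<le> ennreal b4 * ennreal ((?g p)^2)" by (intro mult_right_mono v_second s) simp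
   finally show ?thesis using b4(1) by (simp add: ennreal_mult)
  qed (simp add: p)
 qed
 also have "\<dots> \<le> ennreal (mod_u t x t' x')" by (rule kern_bound[OF k])
 finally have le: "nn2 PP (\<lambda>z. ?X z) \<le> ennreal (mod_u t x t' x')" .
 have "nn2 M (\<lambda>om. u t x om - u t' x' om) \<le> 4 * nn2 PP (\<lambda>z. ?X z)"
  by (rule walsh_bound[OF walsh_u_diff[OF t(1,2)]])
 also have "\<dots> \<le> 4 * ennreal (mod_u t x t' x')" by (intro mult_left_mono le) simp
 finally show ?thesis using mod_u_nonneg by (simp add: ennreal_mult'')
qed

lemma mod_u_commute: "mod_u t x t' x' = mod_u t' x' t x"
 by (simp add: mod_u_def abs_minus_commute)

lemma u_holder2:
 assumes "t \<in> {0..T}" "t' \<in> {0..T}"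
 shows "nn2 M (\<lambda>om. u t x om - u t' x' om) \<le> ennreal (4 * mod_u t x t' x')"
proof (cases "t' \<le> t")
 case True
 then show ?thesis using assms by (intro u_holder2_aux) auto
next
 case False
 then show ?thesis using assms u_holder2_aux[of t t' x' x] by (simp add: power2_commute mod_u_commute[of t' x'])
qed

lemma v_cont:
 fixes S Y :: "nat => real"
 assumes s: "s \<in> {0..T}" "\<And>n. S n \<in> {0..T}" and lim: "S ----> s" "Y ----> y"
 shows "(\<lambda>n. nn2 M (\<lambda>om. v (S n) (Y n) om - v s y om)) ----> 0"
proof (rule tendsto_sandwich[OF _ _ tendsto_const])
 have "nn2 M (\<lambda>om. v (S n) (Y n) om - v s y om) \<le> ennreal (K^2 * (4 * mod_u (S n) (Y n) s y))" for n
 proof -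
  have [measurable]: "u (S n) (Y n) \<in> bm M" "u s y \<in> bm M" using s by (auto intro!: u_measurable)
  have "(v (S n) (Y n) om - v s y om)^2 \<le> K^2 * (u (S n) (Y n) om - u s y om)^2" for om
   using power_mono[OF sigma_lipschitz[of "u (S n) (Y n) om" "u s y om"], of 2] s
   by (simp add: v_def power_mult_distrib)
  then have "nn2 M (\<lambda>om. v (S n) (Y n) om - v s y om) \<le> (\<integral>\<^sup>+om. ennreal (K^2) * ennreal ((u (S n) (Y n) om - u s y om)^2) \<partial>M)"
   by (intro nn_integral_mono) (simp add: ennreal_mult[symmetric] ennreal_leI)
  also have "\<dots> = ennreal (K^2) * nn2 M (\<lambda>om. u (S n) (Y n) om - u s y om)" by (rule nn_integral_cmult) measurable
  also have "\<dots> \<le> ennreal (K^2) * ennreal (4 * mod_u (S n) (Y n) s y)" by (intro mult_left_mono u_holder2 s) simp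
  finally show ?thesis using mod_u_nonneg by (simp add: ennreal_mult)
 qed
 then show "\<forall>\<^sub>F n in sequentially. (nn2 M (\<lambda>om. v (S n) (Y n) om - v s y om)) \<le> ennreal (K^2 * (4 * mod_u (S n) (Y n) s y))"
  by simp
 have "(\<lambda>n. K^2 * (4 * mod_u (S n) (Y n) s y)) ----> K\<^sup>2 * (4 * (b4 * (c3 * (sqrt \<bar>s - s\<bar> + \<bar>y - y\<bar>))))"
  unfolding mod_u_def by (intro tendsto_intros lim)
 then have "(\<lambda>n. ennreal (K^2 * (4 * mod_u (S n) (Y n) s y))) ----> ennreal 0" by (intro tendsto_ennrealI) simp
 then show "(\<lambda>n. ennreal (K^2 * (4 * mod_u (S n) (Y n) s y))) ----> 0" by simp
qed simp

text \<open>With \<open>z = 0\<close> this covers the coefficient itself, with a frozen value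
  \<open>z\<close> the freezing error.\<close>

lemma v_adm:
 assumes z: "z \<in> bm M" and \<phi>: "continuous_on UNIV \<phi>" "\<And>p. 0 \<le> \<phi> p"
  and b: "\<And>s y. s \<in> {0..T} ==> (nni M (\<lambda>om. (v s y om - z om) ^ 4)) \<le> ennreal ((\<phi> (s, y))^2)"
 shows "adm T \<phi> (\<lambda>s y om. v s y om - z om)"
proof -
 have "fst \<in> measurable PP M" unfolding PP_def by simp
 from measurable_compose[OF this z] have "(\<lambda>w. z (fst w)) \<in> bm PP" .
 then have "(\<lambda>w. (\<lambda>(om, s, y). v s y om) w - z (fst w)) \<in> bm PP" by (intro borel_measurable_diff v_PP)
 then have "(\<lambda>(om, s, y). v s y om - z om) \<in> bm PP" by (simp add: case_prod_beta')
 moreover have "(\<lambda>om. v s y om - z om) \<in> bm M" for s y by (intro borel_measurable_diff v_measurable z)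
 ultimately show ?thesis unfolding adm_def using \<phi> b v_cont by simp
qed

lemma u_holder4_aux:
 assumes t: "0 \<le> t'" "t' \<le> t" "t \<le> T"
 shows "nni M (\<lambda>om. (u t x om - u t' x' om) ^ 4) \<le> ennreal ((3 * mod_u t x t' x')^2)"
proof (rule walsh_fourth)
 have "adm T (\<lambda>_. b4) (\<lambda>s y om. v s y om - 0)" by (rule v_adm) (simp_all add: b4)
 then show "adm T (\<lambda>_. b4) v" by simp
 show "kern T (\<lambda>_. b4) (gker t t' x x' {0<..t}) (mod_u t x t' x')" by (rule mod_kern[OF t])
 show "walsh (\<lambda>(om, s, y). v s y om * gker t t' x x' {0<..t} (s, y)) (\<lambda>om. u t x om - u t' x' om)"
  by (rule walsh_u_diff[OF t(1,2)])
qed (rule v_adapted)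

lemma u_holder4:
 assumes "t \<in> {0..T}" "t' \<in> {0..T}"
 shows "nni M (\<lambda>om. (u t x om - u t' x' om) ^ 4) \<le> ennreal ((3 * mod_u t x t' x')^2)"
proof (cases "t' \<le> t")
 case True
 then show ?thesis using assms by (intro u_holder4_aux) auto
next
 case False
 have "(u t x om - u t' x' om) ^ 4 = (u t' x' om - u t x om) ^ 4" for om
  using power_minus_even[of 4 "u t x om - u t' x' om"] by simp
 then show ?thesis using assms False u_holder4_aux[of t t' x' x] by (simp add: mod_u_commute[of t' x'])
qed

definition mod_v :: "real => real => real => real => real" where
 "mod_v t x t' x' = K^2 * (3 * mod_u t x t' x')"

lemma v_holder4:
 assumes s: "s \<in> {0..T}" "s' \<in> {0..T}"
 shows "nni M (\<lambda>om. (v s y om - v s' y' om) ^ 4) \<le> ennreal ((mod_v s y s' y')^2)"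
proof -
 have [measurable]: "u s y \<in> bm M" "u s' y' \<in> bm M" using s by (auto intro!: u_measurable)
 have "(v s y om - v s' y' om) ^ 4 \<le> K ^ 4 * (u s y om - u s' y' om) ^ 4" for om
  using power_mono[OF sigma_lipschitz[of "u s y om" "u s' y' om"], of 4] s
  by (simp add: v_def power_mult_distrib)
 then have "nni M (\<lambda>om. (v s y om - v s' y' om) ^ 4) \<le> (\<integral>\<^sup>+om. ennreal (K ^ 4) * ennreal ((u s y om - u s' y' om) ^ 4) \<partial>M)"
  using K(1) by (intro nn_integral_mono) (simp add: ennreal_mult[symmetric] ennreal_leI)
 also have "\<dots> = ennreal (K ^ 4) * nni M (\<lambda>om. (u s y om - u s' y' om) ^ 4)" by (rule nn_integral_cmult) measurable
 also have "\<dots> \<le> ennreal (K ^ 4) * ennreal ((3 * mod_u s y s' y')^2)" by (intro mult_left_mono u_holder4 s) simp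
 also have "\<dots> = ennreal ((mod_v s y s' y')^2)"
 proof -
  have "K ^ 4 * (3 * mod_u s y s' y')^2 = (mod_v s y s' y')^2" 
   unfolding mod_v_def power_mult_distrib[of "K^2"] power_mult[symmetric] by simp
  then show ?thesis using K(1) by (subst ennreal_mult[symmetric]) simp_all
 qed
 finally show ?thesis .
qed

lemma mod_v_eq: "mod_v t x t' x' = 3 * K^2 * b4 * c3 * (sqrt \<bar>t - t'\<bar> + \<bar>x - x'\<bar>)"
 by (simp only: mod_v_def mod_u_def mult_ac)

end

section \<open>Approximation of the increments\<close>

text \<open>Fourth moments are bounded by squares \<open>a^2\<close>, so \<open>a\<close> plays the
  role of a squared L4 norm; the factor 4 is the square root of \<open>2 ^ 4\<close>.\<close>

lemma fourth_power_add:
 fixes f g :: "'b => real"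
 assumes [measurable]: "f \<in> bm N" "g \<in> bm N"
  and le: "nni N (\<lambda>z. f z ^ 4) \<le> ennreal (a^2)" "nni N (\<lambda>z. g z ^ 4) \<le> ennreal (b^2)"
  and ab: "0 \<le> a" "0 \<le> b"
 shows "nni N (\<lambda>z. (f z + g z) ^ 4) \<le> ennreal ((4 * (a + b))^2)"
proof -
 have pt: "(p + q) ^ 4 \<le> 16 * p ^ 4 + 16 * q ^ 4" for p q :: real
 proof -
  have "(p + q) ^ 4 = \<bar>p + q\<bar> ^ 4" by simp
  also have "\<dots> \<le> (\<bar>p\<bar> + \<bar>q\<bar>) ^ 4" by (intro power_mono abs_triangle_ineq) simp
  also have "\<dots> \<le> 2 ^ 4 * (\<bar>p\<bar> ^ 4 + \<bar>q\<bar> ^ 4)" by (rule add_power_le) auto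
  finally show ?thesis by simp
 qed
 have "nni N (\<lambda>z. (f z + g z) ^ 4) \<le> (\<integral>\<^sup>+z. 16 * ennreal (f z ^ 4) + 16 * ennreal (g z ^ 4) \<partial>N)"
 proof (rule nn_integral_mono)
  fix z
  have "ennreal ((f z + g z) ^ 4) \<le> ennreal (16 * f z ^ 4 + 16 * g z ^ 4)" by (rule ennreal_leI) (rule pt)
  also have "\<dots> = 16 * ennreal (f z ^ 4) + 16 * ennreal (g z ^ 4)" by (simp add: ennreal_mult)
  finally show "ennreal ((f z + g z) ^ 4) \<le> 16 * ennreal (f z ^ 4) + 16 * ennreal (g z ^ 4)" .
 qed
 also have "\<dots> = 16 * nni N (\<lambda>z. f z ^ 4) + 16 * nni N (\<lambda>z. g z ^ 4)"
  by (subst nn_integral_add) (simp_all add: nn_integral_cmult)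
 also have "\<dots> \<le> 16 * ennreal (a^2) + 16 * ennreal (b^2)" by (intro add_mono mult_left_mono le) auto
 also have "\<dots> = ennreal (16 * a^2 + 16 * b^2)" by (simp add: ennreal_mult)
 also have "\<dots> \<le> ennreal ((4 * (a + b))^2)"
  using ab by (intro ennreal_leI) (simp add: power2_eq_square algebra_simps)
 finally show ?thesis .
qed

context mild
begin

definition win :: "real => real => real => real => real \<times> real => real" where
 "win x \<tau> h w = gker (\<tau> + h) \<tau> x x {\<tau> - w<..\<tau> + h}"

lemma win_L2:
 assumes "0 < h" "0 \<le> w" "w \<le> \<tau>"
 shows "nn2 lborel (\<lambda>p. win x \<tau> h w p) \<le> ennreal (c3 * sqrt h)"
proof -
 have "nn2 lborel (\<lambda>p. win x \<tau> h w p) \<le> nn2 lborel (\<lambda>p. gker (\<tau> + h) \<tau> x x {0<..\<tau> + h} p)"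
  using assms by (intro nn_integral_mono ennreal_leI) (auto simp: win_def gker_def indicator_def)
 also have "\<dots> \<le> ennreal (c3 * (sqrt (\<tau> + h - \<tau>) + \<bar>x - x\<bar>))" using assms by (intro holder_kernel) auto
 finally show ?thesis by simp
qed

text \<open>On the window, \<open>mod_v\<close> is of order \<open>sqrt w\<close> plus the distance
  to \<open>x\<close>. The first term meets the squared kernel norm, of order \<open>sqrt h\<close>,
  and the second is treated by \<open>weighted_window\<close>; both contributions are of order
  \<open>w\<close>.\<close>

lemma win_weighted:
 assumes h: "0 < h" "h \<le> w" "2 * w \<le> \<tau>" "\<tau> + h \<le> T"
 shows "kern T (\<lambda>p. mod_v (fst p) (snd p) (\<tau> - 2 * w) x) (win x \<tau> h w) (3 * K^2 * b4 * c3 * (2 * c3 + 8 * (cf * hm * c1^2)) * w)"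
proof -
 define L where "L = 3 * K^2 * b4 * c3"
 have L: "0 \<le> L" using b4(1) c3_nonneg by (simp add: L_def)
 let ?g = "win x \<tau> h w"
 have [measurable]: "?g \<in> bm borel" unfolding win_def by measurable
 have w: "0 < w" using h by simp
 have pt: "mod_v (fst p) (snd p) (\<tau> - 2 * w) x * (?g p)^2 \<le> L * (2 * sqrt w) * (?g p)^2 + L * (\<bar>snd p - x\<bar> * (?g p)^2)" for p
 proof (cases "?g p = 0")
  case False
  then have "\<tau> - w < fst p \<and> fst p \<le> \<tau> + h" unfolding win_def by (rule gker_support)
  \<comment> \<open>The distance is at most \<open>2 * w + h\<close>; the cruder bound
    \<open>4 * w\<close> has the square root \<open>2 * sqrt w\<close>.\<close>
  then have "\<bar>fst p - (\<tau> - 2 * w)\<bar> \<le> 4 * w" using h by linarith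
  then have "sqrt \<bar>fst p - (\<tau> - 2 * w)\<bar> \<le> sqrt (4 * w)" by (rule real_sqrt_le_mono)
  also have "\<dots> = 2 * sqrt w" by (simp add: real_sqrt_mult)
  finally have "L * (sqrt \<bar>fst p - (\<tau> - 2 * w)\<bar> + \<bar>snd p - x\<bar>) * (?g p)^2 \<le> L * (2 * sqrt w + \<bar>snd p - x\<bar>) * (?g p)^2"
   using L by (intro mult_right_mono mult_left_mono add_mono) auto
  then show ?thesis unfolding mod_v_eq L_def[symmetric] by (simp only: distrib_left distrib_right mult.assoc)
 qed simp
 have "nni lborel (\<lambda>p. mod_v (fst p) (snd p) (\<tau> - 2 * w) x * (?g p)^2)
  \<le> (\<integral>\<^sup>+p. ennreal (L * (2 * sqrt w) * (?g p)^2) + ennreal L * ennreal (\<bar>snd p - x\<bar> * (?g p)^2) \<partial>lborel)"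
 proof (rule nn_integral_mono)
  fix p
  have "ennreal (mod_v (fst p) (snd p) (\<tau> - 2 * w) x * (?g p)^2) \<le> ennreal (L * (2 * sqrt w) * (?g p)^2 + L * (\<bar>snd p - x\<bar> * (?g p)^2))"
   by (rule ennreal_leI) (rule pt)
  also have "\<dots> = ennreal (L * (2 * sqrt w) * (?g p)^2) + ennreal (L * (\<bar>snd p - x\<bar> * (?g p)^2))"
   using L w by (intro ennreal_plus mult_nonneg_nonneg) auto
  also have "ennreal (L * (\<bar>snd p - x\<bar> * (?g p)^2)) = ennreal L * ennreal (\<bar>snd p - x\<bar> * (?g p)^2)"
   using L by (intro ennreal_mult) auto
  finally show "ennreal (mod_v (fst p) (snd p) (\<tau> - 2 * w) x * (?g p)^2) \<le> ennreal (L * (2 * sqrt w) * (?g p)^2) + ennreal L * ennreal (\<bar>snd p - x\<bar> * (?g p)^2)" .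
 qed
 also have "\<dots> = nni lborel (\<lambda>p. L * (2 * sqrt w) * (?g p)^2) + ennreal L * nni lborel (\<lambda>p. \<bar>snd p - x\<bar> * (?g p)^2)"
  by (subst nn_integral_add) (simp_all add: nn_integral_cmult)
 also have "\<dots> \<le> ennreal (L * (2 * sqrt w) * (c3 * sqrt h)) + ennreal L * ennreal (4 * (cf * hm * c1^2) * (\<tau> + h - (\<tau> - w)))"
 proof (intro add_mono mult_left_mono)
  show "nni lborel (\<lambda>p. L * (2 * sqrt w) * (?g p)^2) \<le> ennreal (L * (2 * sqrt w) * (c3 * sqrt h))"
   using L w h c3_nonneg by (intro const_mult_bound win_L2) auto
  show "nni lborel (\<lambda>p. \<bar>snd p - x\<bar> * (?g p)^2) \<le> ennreal (4 * (cf * hm * c1^2) * (\<tau> + h - (\<tau> - w)))"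
   unfolding win_def using h w by (intro weighted_window) auto
 qed simp
 also have "\<dots> = ennreal (L * (2 * sqrt w) * (c3 * sqrt h) + L * (4 * (cf * hm * c1^2) * (\<tau> + h - (\<tau> - w))))"
  using L w h c3_nonneg c_nonneg(4) by (subst ennreal_mult[symmetric]) (auto intro!: ennreal_plus[symmetric])
 also have "\<dots> \<le> ennreal (L * (2 * c3 + 8 * (cf * hm * c1^2)) * w)"
 proof (rule ennreal_leI)
  have "sqrt w * sqrt h \<le> sqrt w * sqrt w" using h by (intro mult_left_mono) auto
  then have "sqrt w * sqrt h \<le> w" using w by simp
  then have a: "L * (2 * c3) * (sqrt w * sqrt h) \<le> L * (2 * c3) * w" using L c3_nonneg by (intro mult_left_mono) auto
  have "4 * (cf * hm * c1^2) * (\<tau> + h - (\<tau> - w)) \<le> 4 * (cf * hm * c1^2) * (2 * w)"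
   using c_nonneg(4) h by (intro mult_left_mono) auto
  then have b: "L * (4 * (cf * hm * c1^2) * (\<tau> + h - (\<tau> - w))) \<le> L * (4 * (cf * hm * c1^2) * (2 * w))"
   using L by (rule mult_left_mono)
  have "L * (2 * sqrt w) * (c3 * sqrt h) = L * (2 * c3) * (sqrt w * sqrt h)" by (simp only: mult_ac)
  moreover have "L * (4 * (cf * hm * c1^2) * (2 * w)) = L * (8 * (cf * hm * c1^2)) * w" by simp
  ultimately show "L * (2 * sqrt w) * (c3 * sqrt h) + L * (4 * (cf * hm * c1^2) * (\<tau> + h - (\<tau> - w))) \<le> L * (2 * c3 + 8 * (cf * hm * c1^2)) * w"
   using a b by (simp only: distrib_left distrib_right)
 qed
 finally have "nni lborel (\<lambda>p. mod_v (fst p) (snd p) (\<tau> - 2 * w) x * (?g p)^2) \<le> ennreal (L * (2 * c3 + 8 * (cf * hm * c1^2)) * w)" .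
 moreover have "0 \<le> L * (2 * c3 + 8 * (cf * hm * c1^2)) * w"
  using L c3_nonneg c_nonneg(3) hm_pos w by (intro mult_nonneg_nonneg add_nonneg_nonneg) auto
 ultimately show ?thesis unfolding win_def L_def[symmetric] using h by (intro gker_kern) auto
qed

text \<open>The factor 12 is 3 from \<open>walsh_fourth\<close> times 4 from
  \<open>fourth_power_add\<close>.\<close>

definition c4 :: real where
 "c4 = 12 * (b4 * c2 + 3 * K^2 * b4 * c3 * (2 * c3 + 8 * (cf * hm * c1^2)))"

lemma c4_nonneg: "0 \<le> c4"
 using b4(1) c3_nonneg c_nonneg hm_pos unfolding c4_def by (intro mult_nonneg_nonneg add_nonneg_nonneg) auto

text \<open>The increment is the sum of three integrals: \<open>I\<close> over the noise before the
  window, \<open>J\<close> with the freezing error of the coefficient over the window, and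
  \<open>z\<close> times the Wiener integral \<open>N\<close>. The condition on \<open>h^2\<close>
  yields \<open>sdiff h w \<le> w\<close>, so that \<open>I\<close> is as small as
  \<open>J\<close>.\<close>

lemma increment:
 assumes h: "0 < h" "h \<le> w" "2 * w \<le> \<tau>" "\<tau> + h \<le> T" and hw: "h^2 \<le> w^2 * sqrt w"
 shows "\<exists>N. gauss_indep M (sub (upto_time (\<tau> - w))) N (\<integral>p. (win x \<tau> h w p)^2 \<partial>lborel) \<and>
  (\<forall>\<epsilon>>0. N \<in> bm (sub (upto_time (\<tau> + h + \<epsilon>)))) \<and>
  nni M (\<lambda>om. (u (\<tau> + h) x om - u \<tau> x om - v (\<tau> - 2 * w) x om * N om) ^ 4) \<le> ennreal ((c4 * w)^2)"
proof -
 have w: "0 < w" "0 \<le> \<tau> - w" using h by auto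
 define z where "z = v (\<tau> - 2 * w) x"
 have zm [measurable]: "z \<in> bm M" unfolding z_def by (rule v_measurable)
 have za: "z \<in> bm (sub (upto_time s))" if "\<tau> - w \<le> s" for s
  unfolding z_def using h w that by (intro v_adapted) auto
 have zi: "integrable M (\<lambda>om. (z om)^2)"
  using v_second[of "\<tau> - 2 * w" x] h le_less_trans[of _ "ennreal b4" \<infinity>]
  by (intro integrableI_bounded) (measurable, simp add: z_def)
 let ?g = "win x \<tau> h w" and ?o = "gker (\<tau> + h) \<tau> x x {0<..\<tau> - w}"
 have ws: "\<tau> - w < fst p" "fst p \<le> \<tau> + h" if "?g p \<noteq> 0" for p
  using gker_support that unfolding win_def by blast+
 \<comment> \<open>The horizon is \<open>\<tau> + h\<close> instead of \<open>T\<close>, so that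
   \<open>N\<close> is known shortly after the end of the increment.\<close>
 have "kern (\<tau> + h) (\<lambda>_. 1) ?g (c3 * sqrt h)"
  unfolding win_def using win_L2[of h w \<tau> x] h w c3_nonneg by (intro gker_kern) (auto simp: win_def)
 from wiener_exists[OF this w(2) ws(1)]
 obtain N where N: "gauss_indep M (sub (upto_time (\<tau> - w))) N (\<integral>p. (?g p)^2 \<partial>lborel)"
  "\<forall>\<epsilon>>0. N \<in> bm (sub (upto_time (\<tau> + h + \<epsilon>)))"
  "\<forall>z\<in>bm (sub (upto_time (\<tau> - w))). integrable M (\<lambda>om. (z om)^2) \<longrightarrow>
   walsh (\<lambda>(om, s, y). z om * ?g (s, y)) (\<lambda>om. z om * N om)" by blast
 have wz: "walsh (\<lambda>(om, s, y). z om * ?g (s, y)) (\<lambda>om. z om * N om)" using N(3) za[OF order_refl] zi by blast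
 have ko: "kern T (\<lambda>_. b4) ?o (b4 * (c2 * sdiff h w))"
 proof (rule gker_kern)
  show "0 \<le> b4 * (c2 * sdiff h w)" using b4(1) c_nonneg(1) sdiff_nonneg[of h w] h w by simp
  show "nni lborel (\<lambda>p. b4 * (?o p)^2) \<le> ennreal (b4 * (c2 * sdiff h w))"
   using outer_integral[of h "\<tau> - w" \<tau> x] h w c_nonneg(1) sdiff_nonneg[of h w] by (intro const_mult_bound b4(1)) auto
 qed (use h w in auto)
 have "adm T (\<lambda>_. b4) (\<lambda>s y om. v s y om - 0)" by (rule v_adm) (simp_all add: b4)
 then have av: "adm T (\<lambda>_. b4) v" by simp
 have "\<exists>I. walsh (\<lambda>(om, s, y). v s y om * ?o (s, y)) I" by (rule walsh_exists[OF av ko v_adapted])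
 then obtain I where I: "walsh (\<lambda>(om, s, y). v s y om * ?o (s, y)) I" by blast
 have I4: "nni M (\<lambda>om. I om ^ 4) \<le> ennreal ((3 * (b4 * (c2 * sdiff h w)))^2)"
  by (rule walsh_fourth[OF av ko v_adapted I])
 define \<phi> where "\<phi> p = mod_v (fst p) (snd p) (\<tau> - 2 * w) x" for p
 have az: "adm T \<phi> (\<lambda>s y om. v s y om - z om)"
 proof (rule v_adm[OF zm])
  show "continuous_on UNIV \<phi>" unfolding \<phi>_def mod_v_eq by (intro continuous_intros)
  show "0 \<le> \<phi> p" for p using mod_u_nonneg by (simp add: \<phi>_def mod_v_def)
  show "nni M (\<lambda>om. (v s y om - z om) ^ 4) \<le> ennreal ((\<phi> (s, y))^2)" if "s \<in> {0..T}" for s y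
   unfolding z_def \<phi>_def fst_conv snd_conv using that h by (intro v_holder4) auto
 qed
 let ?R = "3 * K^2 * b4 * c3 * (2 * c3 + 8 * (cf * hm * c1^2)) * w"
 have kz: "kern T \<phi> ?g ?R" unfolding \<phi>_def using win_weighted[OF h, of x] .
 define J where "J om = u (\<tau> + h) x om - u \<tau> x om - I om - z om * N om" for om
 have "walsh (\<lambda>(om, s, y). (v s y om - z om) * ?g (s, y)) J"
 proof -
  have t: "0 \<le> \<tau>" "\<tau> \<le> \<tau> + h" using h w by auto
  let ?F = "\<lambda>(om, s, y). v s y om * gker (\<tau> + h) \<tau> x x {0<..\<tau> + h} (s, y)"
  have "(\<lambda>q. ?F q - (\<lambda>(om, s, y). v s y om * ?o (s, y)) q - (\<lambda>(om, s, y). z om * ?g (s, y)) q)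
   = (\<lambda>(om, s, y). (v s y om - z om) * ?g (s, y))"
  proof
   fix q :: "'a \<times> real \<times> real"
   obtain om s y where q: "q = (om, s, y)" by (cases q) auto
   have "gker (\<tau> + h) \<tau> x x {0<..\<tau> + h} (s, y) = ?o (s, y) + ?g (s, y)"
    using h w by (simp add: gker_def win_def indicator_def)
   then show "?F q - (\<lambda>(om, s, y). v s y om * ?o (s, y)) q - (\<lambda>(om, s, y). z om * ?g (s, y)) q
     = (\<lambda>(om, s, y). (v s y om - z om) * ?g (s, y)) q"
    by (simp add: q algebra_simps)
  qed
  then show ?thesis using walsh_diff[OF walsh_diff[OF walsh_u_diff[OF t, of x x] I] wz] unfolding J_def by simp
 qed
 then have J4: "nni M (\<lambda>om. J om ^ 4) \<le> ennreal ((3 * ?R)^2)"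
 proof (rule walsh_fourth[OF az kz, rotated])
  fix s' s y y' assume "0 \<le> s'" "s' < s" "?g (s, y') \<noteq> 0"
  then show "(\<lambda>om. v s' y om - z om) \<in> bm (sub (upto_time s))"
   using ws(1)[of "(s, y')"] by (intro borel_measurable_diff v_adapted za) auto
 qed
 have [measurable]: "I \<in> bm M" "J \<in> bm M"
  using I \<open>walsh _ J\<close> by (simp_all add: walsh_def)
 have R0: "0 \<le> ?R" using kern_nonneg[OF kz] .
 have o0: "0 \<le> b4 * (c2 * sdiff h w)" using kern_nonneg[OF ko] .
 have "nni M (\<lambda>om. (I om + J om) ^ 4) \<le> ennreal ((4 * (3 * (b4 * (c2 * sdiff h w)) + 3 * ?R))^2)"
  using R0 o0 by (intro fourth_power_add I4 J4) auto
 also have "\<dots> \<le> ennreal ((c4 * w)^2)"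
 proof (intro ennreal_leI power_mono)
  have "sdiff h w \<le> h^2 / (w * sqrt w)" unfolding sdiff_def using second_difference_sqrt(2)[of w h] h w by simp
  also have "\<dots> \<le> w" using w hw by (simp add: divide_le_eq power2_eq_square mult_ac)
  finally have "b4 * (c2 * sdiff h w) \<le> b4 * (c2 * w)" using b4(1) c_nonneg(1) by (rule_tac mult_left_mono, rule_tac mult_left_mono)
  then have "4 * (3 * (b4 * (c2 * sdiff h w)) + 3 * ?R) \<le> 12 * (b4 * (c2 * w)) + 12 * ?R" by simp
  also have "\<dots> = c4 * w" unfolding c4_def by (simp only: distrib_left distrib_right mult.assoc)
  finally show "4 * (3 * (b4 * (c2 * sdiff h w)) + 3 * ?R) \<le> c4 * w" .
 qed (use R0 o0 in simp)
 finally have "nni M (\<lambda>om. (I om + J om) ^ 4) \<le> ennreal ((c4 * w)^2)" .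
 moreover have "I om + J om = u (\<tau> + h) x om - u \<tau> x om - v (\<tau> - 2 * w) x om * N om" for om
  by (simp add: J_def z_def)
 ultimately show ?thesis using N(1,2) by auto
qed

end

text \<open>Young's inequality with scale \<open>P\<close> for the difference and \<open>Q\<close>
  for the variables. If the fourth moments are at most \<open>P ^ 4\<close> and
  \<open>Q ^ 4\<close>, the mean of the right side is at most \<open>4 * P * Q ^ 3\<close>.\<close>

lemma fourth_power_diff_le:
 assumes "0 < P" "0 < (Q :: real)"
 shows "\<bar>x ^ 4 - y ^ 4\<bar> \<le> P * Q ^ 3 * ((x - y) ^ 4 / P ^ 4 + (3 / 2) * (x ^ 4 / Q ^ 4) + (3 / 2) * (y ^ 4 / Q ^ 4))"
proof -
 define a b where "a = \<bar>x\<bar>" and "b = \<bar>y\<bar>"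
 have ab: "0 \<le> a" "0 \<le> b" by (simp_all add: a_def b_def)
 have young: "p * r ^ 3 \<le> P * Q ^ 3 * (p ^ 4 / P ^ 4 / 4 + 3 * (r ^ 4 / Q ^ 4) / 4)" if "0 \<le> p" "0 \<le> r" for p r
 proof -
  define s t where "s = p / P" and "t = r / Q"
  have st: "0 \<le> s" "0 \<le> t" using assms that by (simp_all add: s_def t_def)
  \<comment> \<open>The inequality of arithmetic and geometric means for \<open>s^4\<close>,
    \<open>t^4\<close>, \<open>t^4\<close>, \<open>t^4\<close>, as a polynomial identity.\<close>
  have "s ^ 4 + 3 * t ^ 4 - 4 * (s * t ^ 3) = (s - t)^2 * (s^2 + 2 * s * t + 3 * t^2)"
   by (simp add: power2_eq_square power3_eq_cube power4_eq_xxxx algebra_simps)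
  also have "\<dots> \<ge> 0" using st by (intro mult_nonneg_nonneg add_nonneg_nonneg) auto
  finally have "s * t ^ 3 \<le> s ^ 4 / 4 + 3 * t ^ 4 / 4" by simp
  then have "P * Q ^ 3 * (s * t ^ 3) \<le> P * Q ^ 3 * (s ^ 4 / 4 + 3 * t ^ 4 / 4)" using assms by (intro mult_left_mono) auto
  moreover have "P * Q ^ 3 * (s * t ^ 3) = p * r ^ 3" using assms by (simp add: s_def t_def power_divide)
  ultimately show ?thesis by (simp add: s_def t_def power_divide)
 qed
 have "(a + b) * (a^2 + b^2) \<le> 2 * (a ^ 3 + b ^ 3)"
 proof -
  have "2 * (a ^ 3 + b ^ 3) - (a + b) * (a^2 + b^2) = (a - b)^2 * (a + b)"
   by (simp add: power2_eq_square power3_eq_cube algebra_simps)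
  also have "\<dots> \<ge> 0" using ab by simp
  finally show ?thesis by simp
 qed
 moreover have "\<bar>(x + y) * (x^2 + y^2)\<bar> \<le> (a + b) * (a^2 + b^2)"
  unfolding abs_mult a_def b_def by (simp add: mult_right_mono)
 ultimately have "\<bar>x - y\<bar> * \<bar>(x + y) * (x^2 + y^2)\<bar> \<le> \<bar>x - y\<bar> * (2 * (a ^ 3 + b ^ 3))" by (intro mult_left_mono) auto
 moreover have "\<bar>x ^ 4 - y ^ 4\<bar> = \<bar>x - y\<bar> * \<bar>(x + y) * (x^2 + y^2)\<bar>"
 proof -
  have "x ^ 4 - y ^ 4 = (x - y) * ((x + y) * (x^2 + y^2))"
   by (simp add: power2_eq_square power4_eq_xxxx algebra_simps)
  then show ?thesis by (simp only: abs_mult)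
 qed
 moreover have "\<bar>x - y\<bar> * (2 * (a ^ 3 + b ^ 3)) = 2 * (\<bar>x - y\<bar> * a ^ 3) + 2 * (\<bar>x - y\<bar> * b ^ 3)"
  by (simp only: distrib_left mult.left_commute)
 ultimately have "\<bar>x ^ 4 - y ^ 4\<bar> \<le> 2 * (\<bar>x - y\<bar> * a ^ 3) + 2 * (\<bar>x - y\<bar> * b ^ 3)" by linarith
 also have "\<dots> \<le> 2 * (P * Q ^ 3 * (\<bar>x - y\<bar> ^ 4 / P ^ 4 / 4 + 3 * (a ^ 4 / Q ^ 4) / 4))
   + 2 * (P * Q ^ 3 * (\<bar>x - y\<bar> ^ 4 / P ^ 4 / 4 + 3 * (b ^ 4 / Q ^ 4) / 4))"
  by (intro add_mono mult_left_mono young ab) auto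
 also have "\<dots> = P * Q ^ 3 * ((x - y) ^ 4 / P ^ 4 + (3 / 2) * (x ^ 4 / Q ^ 4) + (3 / 2) * (y ^ 4 / Q ^ 4))"
  by (simp add: a_def b_def distrib_left)
 finally show ?thesis .
qed

section \<open>Moments of sums and of Gaussian fourth powers\<close>

context prob_space
begin

lemma fourth_power_L1:
 fixes X Y :: "'a => real"
 assumes [measurable]: "X \<in> bm M" "Y \<in> bm M" and PQ: "0 < P" "0 < Q"
  and i: "integrable M (\<lambda>om. (X om - Y om) ^ 4)" "integrable M (\<lambda>om. X om ^ 4)" "integrable M (\<lambda>om. Y om ^ 4)"
  and b: "(\<integral>om. (X om - Y om) ^ 4 \<partial>M) \<le> P ^ 4" "(\<integral>om. X om ^ 4 \<partial>M) \<le> Q ^ 4" "(\<integral>om. Y om ^ 4 \<partial>M) \<le> Q ^ 4"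
 shows "(\<integral>om. \<bar>X om ^ 4 - Y om ^ 4\<bar> \<partial>M) \<le> 4 * (P * Q ^ 3)"
proof -
 let ?R = "\<lambda>om. P * Q ^ 3 * ((X om - Y om) ^ 4 / P ^ 4 + (3 / 2) * (X om ^ 4 / Q ^ 4) + (3 / 2) * (Y om ^ 4 / Q ^ 4))"
 have "(\<integral>om. \<bar>X om ^ 4 - Y om ^ 4\<bar> \<partial>M) \<le> (\<integral>om. ?R om \<partial>M)"
  by (intro integral_mono integrable_abs bi_diff bi_add
    integrable_mult_right integrable_divide i fourth_power_diff_le PQ)
 also have "\<dots> = P * Q ^ 3 * ((\<integral>om. (X om - Y om) ^ 4 \<partial>M) / P ^ 4 + (3 / 2) * ((\<integral>om. X om ^ 4 \<partial>M) / Q ^ 4) + (3 / 2) * ((\<integral>om. Y om ^ 4 \<partial>M) / Q ^ 4))"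
  using i by simp
 also have "\<dots> \<le> P * Q ^ 3 * (1 + (3 / 2) * 1 + (3 / 2) * 1)"
  using PQ b by (intro mult_left_mono add_mono) auto
 finally show ?thesis by simp
qed

text \<open>Each row of the double sum has at most \<open>2 * m + 1\<close> terms near the diagonal
  that need not vanish, each of them at most \<open>S\<close>.\<close>

lemma sum_second_moment:
 fixes X :: "nat => 'a => real"
 assumes [measurable]: "\<And>i. i \<in> {1..n} ==> X i \<in> bm M"
  and i: "\<And>i. i \<in> {1..n} ==> integrable M (\<lambda>om. (X i om)^2)" and S: "\<And>i. i \<in> {1..n} ==> (\<integral>om. (X i om)^2 \<partial>M) \<le> S"
  and orth: "\<And>i j. i \<in> {1..n} ==> j \<in> {1..n} ==> i + m < j ==> (\<integral>om. X i om * X j om \<partial>M) = 0" and S0: "0 \<le> S"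
 shows "integrable M (\<lambda>om. (\<Sum>i=1..n. X i om)^2)" "(\<integral>om. (\<Sum>i=1..n. X i om)^2 \<partial>M) \<le> real n * (2 * real m + 1) * S"
proof -
 have pr: "integrable M (\<lambda>om. X i om * X j om)" "(\<integral>om. X i om * X j om \<partial>M) \<le> S" if ij: "i \<in> {1..n}" "j \<in> {1..n}" for i j
 proof -
  note [measurable] = assms(1)[OF ij(1)] assms(1)[OF ij(2)]
  have le: "\<bar>p * q\<bar> \<le> (p^2 + q^2) / 2" for p q :: real
   using sum_squares_bound[of "\<bar>p\<bar>" "\<bar>q\<bar>"] by (simp add: abs_mult)
  have s: "integrable M (\<lambda>om. ((X i om)^2 + (X j om)^2) / 2)" using i ij by simp
  show ip: "integrable M (\<lambda>om. X i om * X j om)"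
   by (rule bi_bound[OF s]) (use le in simp_all)
  have "(\<integral>om. X i om * X j om \<partial>M) \<le> (\<integral>om. ((X i om)^2 + (X j om)^2) / 2 \<partial>M)"
   by (rule integral_mono[OF ip s]) (rule order_trans[OF abs_ge_self le])
  also have "\<dots> = ((\<integral>om. (X i om)^2 \<partial>M) + (\<integral>om. (X j om)^2 \<partial>M)) / 2" using i[OF ij(1)] i[OF ij(2)] by simp
  also have "\<dots> \<le> S" using S[OF ij(1)] S[OF ij(2)] by simp
  finally show "(\<integral>om. X i om * X j om \<partial>M) \<le> S" .
 qed
 have e: "(\<Sum>i=1..n. X i om)^2 = (\<Sum>i=1..n. \<Sum>j=1..n. X i om * X j om)" for om
  by (simp add: power2_eq_square sum_product)
 show "integrable M (\<lambda>om. (\<Sum>i=1..n. X i om)^2)" unfolding e by (intro bi_sum pr)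
 have "(\<integral>om. (\<Sum>i=1..n. X i om)^2 \<partial>M) = (\<Sum>i=1..n. \<Sum>j=1..n. \<integral>om. X i om * X j om \<partial>M)"
 proof -
  have "(\<integral>om. (\<Sum>i=1..n. X i om)^2 \<partial>M) = (\<Sum>i=1..n. \<integral>om. (\<Sum>j=1..n. X i om * X j om) \<partial>M)"
   unfolding e by (intro bo_sum bi_sum pr)
  also have "\<dots> = (\<Sum>i=1..n. \<Sum>j=1..n. \<integral>om. X i om * X j om \<partial>M)"
   by (intro sum.cong refl bo_sum pr)
  finally show ?thesis .
 qed
 also have "\<dots> \<le> (\<Sum>i=1..n. (2 * real m + 1) * S)"
 proof (rule sum_mono)
  fix i assume i: "i \<in> {1..n}"
  have "(\<Sum>j=1..n. \<integral>om. X i om * X j om \<partial>M) \<le> (\<Sum>j=1..n. if j \<in> {i - m..i + m} then S else 0)"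
  proof (rule sum_mono)
   fix j assume j: "j \<in> {1..n}"
   consider "j \<in> {i - m..i + m}" | "i + m < j" | "j + m < i" by (cases "j \<le> i") force+
   then show "(\<integral>om. X i om * X j om \<partial>M) \<le> (if j \<in> {i - m..i + m} then S else 0)"
   proof cases
    case 2 then show ?thesis using orth[OF i j] by simp
   next
    case 3 then show ?thesis using orth[OF j i] by (simp add: mult.commute)
   qed (use pr(2)[OF i j] in auto)
  qed
  also have "\<dots> = real (card ({1..n} \<inter> {i - m..i + m})) * S"
   unfolding sum.inter_restrict[OF finite_atLeastAtMost, symmetric] sum_constant ..
  also have "\<dots> \<le> (2 * real m + 1) * S"
  proof (rule mult_right_mono[OF _ S0])
   have "card ({1..n} \<inter> {i - m..i + m}) \<le> card {i - m..i + m}" by (intro card_mono) auto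
   also have "\<dots> \<le> 2 * m + 1" by simp
   finally show "real (card ({1..n} \<inter> {i - m..i + m})) \<le> 2 * real m + 1" by linarith
  qed
  finally show "(\<Sum>j=1..n. \<integral>om. X i om * X j om \<partial>M) \<le> (2 * real m + 1) * S" .
 qed
 also have "\<dots> = real n * (2 * real m + 1) * S" by simp
 finally show "(\<integral>om. (\<Sum>i=1..n. X i om)^2 \<partial>M) \<le> real n * (2 * real m + 1) * S" .
qed

text \<open>The constant 96 is \<open>105 - 2 * 3 * 3 + 3^2\<close>, from the eighth and fourth
  moments 105 and 3 of a standard normal variable.\<close>

lemma gauss_indep_moments:
 assumes F: "subalgebra M F" and N: "gauss_indep M F N V" and X: "X \<in> bm F" "integrable M X"
 shows "integrable M (\<lambda>om. X om * N om ^ 4)" "(\<integral>om. X om * N om ^ 4 \<partial>M) = 3 * V^2 * (\<integral>om. X om \<partial>M)"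
  and "(\<integral>om. X om * (N om ^ 4 - 3 * V^2) \<partial>M) = 0"
  and "integrable M (\<lambda>om. X om * (N om ^ 4 - 3 * V^2)^2)" "(\<integral>om. X om * (N om ^ 4 - 3 * V^2)^2 \<partial>M) = 96 * V ^ 4 * (\<integral>om. X om \<partial>M)"
proof -
 note e = gauss_indep_expectation[OF F N X]
 have V: "0 \<le> V" using N by (simp add: gauss_indep_def)
 then have s: "sqrt V ^ 4 = V^2" "sqrt V ^ 8 = V ^ 4"
  using power_mult[of "sqrt V" 2 2] power_mult[of "sqrt V" 2 4] by simp_all
 show i4: "integrable M (\<lambda>om. X om * N om ^ 4)" by (rule e(1))
 show m4: "(\<integral>om. X om * N om ^ 4 \<partial>M) = 3 * V^2 * (\<integral>om. X om \<partial>M)"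
  using e(2)[of 4] by (simp add: s std_normal_moments)
 have i8: "integrable M (\<lambda>om. X om * N om ^ 8)" by (rule e(1))
 have m8: "(\<integral>om. X om * N om ^ 8 \<partial>M) = 105 * V ^ 4 * (\<integral>om. X om \<partial>M)"
  using e(2)[of 8] by (simp add: s std_normal_moments)
 have "(\<integral>om. X om * N om ^ 4 - 3 * V^2 * X om \<partial>M) = 0"
  using i4 X(2) m4 by (subst bo_diff) simp_all
 then show "(\<integral>om. X om * (N om ^ 4 - 3 * V^2) \<partial>M) = 0" by (simp add: right_diff_distrib mult_ac)
 have eq: "X om * (N om ^ 4 - 3 * V^2)^2 = X om * N om ^ 8 - 6 * V^2 * (X om * N om ^ 4) + 9 * V ^ 4 * X om" for om
 proof -
  have "N om ^ 8 = (N om ^ 4)^2" "V ^ 4 = (V^2)^2" by (simp_all flip: power_mult)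
  then show ?thesis by (simp add: power2_eq_square algebra_simps)
 qed
 show "integrable M (\<lambda>om. X om * (N om ^ 4 - 3 * V^2)^2)" unfolding eq using i4 i8 X(2) by simp
 have "(\<integral>om. X om * (N om ^ 4 - 3 * V^2)^2 \<partial>M) = 105 * V ^ 4 * (\<integral>om. X om \<partial>M) - 6 * V^2 * (3 * V^2 * (\<integral>om. X om \<partial>M)) + 9 * V ^ 4 * (\<integral>om. X om \<partial>M)"
  unfolding eq using i4 i8 X(2) m4 m8 by simp
 also have "\<dots> = 96 * V ^ 4 * (\<integral>om. X om \<partial>M)"
  by (simp add: power2_eq_square power4_eq_xxxx algebra_simps)
 finally show "(\<integral>om. X om * (N om ^ 4 - 3 * V^2)^2 \<partial>M) = 96 * V ^ 4 * (\<integral>om. X om \<partial>M)" .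
qed

end

text \<open>Brings bounds with a constant factor into the form of a fourth power that
  \<open>fourth_power_L1\<close> expects. For this purpose the constants below are 1 plus the
  coefficients that they have to dominate.\<close>

lemma le_fourth_power:
 assumes "1 \<le> (a :: real)" "0 \<le> c" "c \<le> a" "0 \<le> b"
 shows "c * b ^ 4 \<le> (a * b) ^ 4"
proof -
 have "c \<le> a ^ 4" using assms self_le_power[of a 4] by simp
 then show ?thesis using assms unfolding power_mult_distrib by (intro mult_right_mono) auto
qed

lemma sqrt_even_power: "0 \<le> q ==> sqrt (q ^ 20) = q ^ 10" "0 \<le> q ==> sqrt (q ^ 16) = q ^ 8"
 using real_sqrt_unique[of "q ^ 10" "q ^ 20"] real_sqrt_unique[of "q ^ 8" "q ^ 16"] by (simp_all flip: power_mult)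

context mild
begin

lemma v_fourth: "s \<in> {0..T} ==> integrable M (\<lambda>om. v s y om ^ 4)" "s \<in> {0..T} ==> (\<integral>om. v s y om ^ 4 \<partial>M) \<le> b4^2"
 by (rule second_of_fourth(1)[OF v_measurable b4], assumption) (rule second_of_fourth(2)[OF v_measurable b4], assumption)

lemma v_fourth_L1:
 "\<exists>C\<ge>0. \<forall>q s r. 0 < q \<longrightarrow> s \<in> {0..T} \<longrightarrow> r \<in> {0..T} \<longrightarrow> \<bar>r - s\<bar> \<le> 4 * q ^ 16 \<longrightarrow>
  (\<integral>om. \<bar>v s x om ^ 4 - v r x om ^ 4\<bar> \<partial>M) \<le> C * q ^ 4"
proof -
 define L where "L = 3 * K^2 * b4 * c3"
 have L: "0 \<le> L" using b4(1) c3_nonneg by (simp add: L_def)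
 define p Q where "p = 1 + 4 * L^2" and "Q = 1 + b4^2"
 have pQ: "1 \<le> p" "1 \<le> Q" by (simp_all add: p_def Q_def)
 have "(\<integral>om. \<bar>v s x om ^ 4 - v r x om ^ 4\<bar> \<partial>M) \<le> 4 * (p * q ^ 4 * Q ^ 3)"
  if q: "0 < q" and sr: "s \<in> {0..T}" "r \<in> {0..T}" "\<bar>r - s\<bar> \<le> 4 * q ^ 16" for q s r
 proof (rule fourth_power_L1[OF v_measurable v_measurable])
  have "sqrt \<bar>s - r\<bar> \<le> sqrt (4 * q ^ 16)" using sr(3) by (intro real_sqrt_le_mono) (simp add: abs_minus_commute)
  also have "\<dots> = 2 * q ^ 8" using q by (simp add: real_sqrt_mult sqrt_even_power)
  finally have m: "mod_v s x r x \<le> L * (2 * q ^ 8)" unfolding mod_v_eq L_def[symmetric] using L by (intro mult_left_mono) auto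
  have n: "0 \<le> mod_v s x r x" using mod_u_nonneg by (simp add: mod_v_def)
  have d: "(\<lambda>om. v s x om - v r x om) \<in> bm M" by (intro borel_measurable_diff v_measurable)
  note f = second_of_fourth[OF d n v_holder4[OF sr(1,2)]]
  show "integrable M (\<lambda>om. (v s x om - v r x om) ^ 4)" by (rule f(1))
  have "(\<integral>om. (v s x om - v r x om) ^ 4 \<partial>M) \<le> (L * (2 * q ^ 8))^2" using f(2) power_mono[OF m n, of 2] by linarith
  also have "\<dots> = 4 * L^2 * (q ^ 4) ^ 4" by (simp add: power_mult_distrib flip: power_mult)
  also have "\<dots> \<le> (p * q ^ 4) ^ 4" using pQ q by (intro le_fourth_power) (auto simp: p_def)
  finally show "(\<integral>om. (v s x om - v r x om) ^ 4 \<partial>M) \<le> (p * q ^ 4) ^ 4" .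
  have "b4^2 \<le> Q ^ 4" using le_fourth_power[of Q "b4^2" 1] by (simp add: Q_def)
  then show "(\<integral>om. v s x om ^ 4 \<partial>M) \<le> Q ^ 4" "(\<integral>om. v r x om ^ 4 \<partial>M) \<le> Q ^ 4"
   using v_fourth(2)[OF sr(1), of x] v_fourth(2)[OF sr(2), of x] by linarith+
 qed (use q pQ sr v_fourth in auto)
 then show ?thesis using pQ by (intro exI[of _ "4 * p * Q ^ 3"]) (auto simp: mult_ac)
qed

text \<open>The case \<open>h = q ^ 20\<close>, \<open>w = q ^ 16\<close> of
  \<open>increment\<close>. The error has L4 norm of order \<open>q^8\<close>, the increment and its
  approximation have order \<open>q^5\<close>, and \<open>8 + 3 * 5 = 23\<close>.\<close>

lemma increment_L1:
 "\<exists>C\<ge>0. \<forall>q \<tau>. 0 < q \<longrightarrow> q \<le> 1 \<longrightarrow> 2 * q ^ 16 \<le> \<tau> \<longrightarrow> \<tau> + q ^ 20 \<le> T \<longrightarrow>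
  (\<exists>N V. gauss_indep M (sub (upto_time (\<tau> - q ^ 16))) N V \<and>
   (\<forall>\<epsilon>>0. N \<in> bm (sub (upto_time (\<tau> + q ^ 20 + \<epsilon>)))) \<and>
   \<bar>V - kap x * sqrt (2 * q ^ 20) / sqrt pi\<bar> \<le> C * q ^ 16 \<and> V \<le> C * q ^ 10 \<and>
   integrable M (\<lambda>om. (u (\<tau> + q ^ 20) x om - u \<tau> x om) ^ 4) \<and>
   (\<integral>om. \<bar>(u (\<tau> + q ^ 20) x om - u \<tau> x om) ^ 4 - (v (\<tau> - 2 * q ^ 16) x om * N om) ^ 4\<bar> \<partial>M) \<le> C * q ^ 23)"
proof -
 from window_variance[of x] obtain C0 where C0: "0 \<le> C0" "\<And>\<tau> h w. 0 < h ==> 0 \<le> w ==>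
  \<bar>(\<integral>p. (win x \<tau> h w p)^2 \<partial>lborel) - kap x * (sqrt (2 * h) - sdiff h w) / sqrt pi\<bar> \<le> C0 * (w + h)"
  unfolding win_def by blast
 define c where "c = 2 * C0 + 3 * kap x"
 define p a where "p = 1 + c4^2" and "a = 1 + 9 * (b4 * c3)^2 + 3 * b4^2 * c^2"
 have c: "0 \<le> c" using C0 kap_nonneg[of x] by (simp add: c_def)
 have pa: "1 \<le> p" "1 \<le> a" by (simp_all add: p_def a_def)
 have main: "\<exists>N V. gauss_indep M (sub (upto_time (\<tau> - q ^ 16))) N V \<and>
   (\<forall>\<epsilon>>0. N \<in> bm (sub (upto_time (\<tau> + q ^ 20 + \<epsilon>)))) \<and>
   \<bar>V - kap x * sqrt (2 * q ^ 20) / sqrt pi\<bar> \<le> c * q ^ 16 \<and> V \<le> c * q ^ 10 \<and>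
   integrable M (\<lambda>om. (u (\<tau> + q ^ 20) x om - u \<tau> x om) ^ 4) \<and>
   (\<integral>om. \<bar>(u (\<tau> + q ^ 20) x om - u \<tau> x om) ^ 4 - (v (\<tau> - 2 * q ^ 16) x om * N om) ^ 4\<bar> \<partial>M) \<le> 4 * (p * q ^ 8 * (a * q ^ 5) ^ 3)"
  if q: "0 < q" "q \<le> 1" "2 * q ^ 16 \<le> \<tau>" "\<tau> + q ^ 20 \<le> T" for q \<tau>
 proof -
  define h w where "h = q ^ 20" and "w = q ^ 16"
  have h: "0 < h" "h \<le> w" "2 * w \<le> \<tau>" "\<tau> + h \<le> T"
   using q power_decreasing[of 16 20 q] by (auto simp: h_def w_def)
  \<comment> \<open>Both sides are equal to \<open>q ^ 40\<close>.\<close>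
  have hw: "h^2 \<le> w^2 * sqrt w"
   using q by (simp add: h_def w_def sqrt_even_power flip: power_mult power_add)
  have w: "0 < w" using h by simp
  from increment[OF h hw, of x] obtain N where N: "gauss_indep M (sub (upto_time (\<tau> - w))) N (\<integral>p. (win x \<tau> h w p)^2 \<partial>lborel)"
   "\<forall>\<epsilon>>0. N \<in> bm (sub (upto_time (\<tau> + h + \<epsilon>)))"
   "nni M (\<lambda>om. (u (\<tau> + h) x om - u \<tau> x om - v (\<tau> - 2 * w) x om * N om) ^ 4) \<le> ennreal ((c4 * w)^2)" by blast
  define V where "V = (\<integral>p. (win x \<tau> h w p)^2 \<partial>lborel)"
  have V0: "0 \<le> V" unfolding V_def by simp
  have sd: "0 \<le> sdiff h w" "sdiff h w \<le> w"
  proof -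
   show "0 \<le> sdiff h w" using h w by (intro sdiff_nonneg) auto
   have "sdiff h w \<le> h^2 / (w * sqrt w)" unfolding sdiff_def using second_difference_sqrt(2)[of w h] h w by simp
   also have "\<dots> \<le> w" using w hw by (simp add: divide_le_eq power2_eq_square mult_ac)
   finally show "sdiff h w \<le> w" .
  qed
  have V1: "\<bar>V - kap x * sqrt (2 * h) / sqrt pi\<bar> \<le> C0 * (2 * w) + kap x * w"
  proof -
   have "\<bar>V - kap x * (sqrt (2 * h) - sdiff h w) / sqrt pi\<bar> \<le> C0 * (w + h)" unfolding V_def using h w by (intro C0(2)) auto
   also have "\<dots> \<le> C0 * (2 * w)" using C0(1) h by (intro mult_left_mono) auto
   finally have 1: "\<bar>V - kap x * (sqrt (2 * h) - sdiff h w) / sqrt pi\<bar> \<le> C0 * (2 * w)" .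
   have "kap x * sdiff h w / sqrt pi \<le> kap x * sdiff h w / 1"
    using kap_nonneg[of x] sd(1) sqrt_pi_ge_1 by (intro divide_left_mono) auto
   also have "\<dots> \<le> kap x * w" using kap_nonneg[of x] sd by (simp add: mult_left_mono)
   finally have 2: "kap x * sdiff h w / sqrt pi \<le> kap x * w" .
   have 3: "0 \<le> kap x * sdiff h w / sqrt pi" using kap_nonneg[of x] sd by (intro divide_nonneg_nonneg mult_nonneg_nonneg) auto
   have 4: "kap x * (sqrt (2 * h) - sdiff h w) / sqrt pi = kap x * sqrt (2 * h) / sqrt pi - kap x * sdiff h w / sqrt pi"
    by (simp only: right_diff_distrib diff_divide_distrib)
   show ?thesis using 1 2 3 unfolding 4 by linarith
  qed
  have Vd: "\<bar>V - kap x * sqrt (2 * h) / sqrt pi\<bar> \<le> c * w"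
  proof -
   have "c * w = C0 * (2 * w) + 3 * (kap x * w)" by (simp add: c_def distrib_right)
   moreover have "0 \<le> kap x * w" using kap_nonneg[of x] w by simp
   ultimately show ?thesis using V1 by linarith
  qed
  have sh: "sqrt (2 * h) = sqrt 2 * q ^ 10" using q by (simp add: h_def real_sqrt_mult sqrt_even_power)
  have Vb: "V \<le> c * q ^ 10"
  proof -
   have "w \<le> q ^ 10" unfolding w_def using q by (intro power_decreasing) auto
   then have "C0 * (2 * w) + kap x * w \<le> C0 * (2 * q ^ 10) + kap x * q ^ 10"
    using C0(1) kap_nonneg[of x] by (intro add_mono mult_left_mono) auto
   moreover have "kap x * sqrt (2 * h) / sqrt pi \<le> kap x * (2 * q ^ 10)"
   proof -
    have "sqrt 2 \<le> (2 :: real)" by (rule real_le_lsqrt) auto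
    then have "sqrt (2 * h) \<le> 2 * q ^ 10" unfolding sh using q by (intro mult_right_mono) auto
    then have "kap x * sqrt (2 * h) \<le> kap x * (2 * q ^ 10)" using kap_nonneg[of x] by (intro mult_left_mono)
    moreover have "kap x * sqrt (2 * h) / sqrt pi \<le> kap x * sqrt (2 * h) / 1"
     using kap_nonneg[of x] sqrt_pi_ge_1 h by (intro divide_left_mono mult_nonneg_nonneg) auto
    ultimately show ?thesis by simp
   qed
   moreover have "c * q ^ 10 = C0 * (2 * q ^ 10) + kap x * q ^ 10 + kap x * (2 * q ^ 10)" by (simp add: c_def distrib_right)
   ultimately show ?thesis using V1 by linarith
  qed
  define \<Delta> where "\<Delta> om = u (\<tau> + h) x om - u \<tau> x om" for om
  define Z where "Z = v (\<tau> - 2 * w) x"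
  have Zm: "Z \<in> bm M" unfolding Z_def by (rule v_measurable)
  have Za: "Z \<in> bm (sub (upto_time (\<tau> - w)))" unfolding Z_def using h w by (intro v_adapted) auto
  have Nm: "N \<in> bm M" using N(1) by (simp add: gauss_indep_def)
  have Dm: "\<Delta> \<in> bm M" unfolding \<Delta>_def[abs_def] using h w by (intro borel_measurable_diff u_measurable) auto
  have Em: "(\<lambda>om. \<Delta> om - Z om * N om) \<in> bm M" by (intro borel_measurable_diff borel_measurable_times Dm Zm Nm)
  have e0: "0 \<le> c4 * w" using c4_nonneg w by simp
  have "nni M (\<lambda>om. (\<Delta> om - Z om * N om) ^ 4) \<le> ennreal ((c4 * w)^2)" using N(3) by (simp add: \<Delta>_def Z_def)
  note E = second_of_fourth[OF Em e0 this]
  have d0: "0 \<le> 3 * mod_u (\<tau> + h) x \<tau> x" using mod_u_nonneg by simp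
  have "nni M (\<lambda>om. \<Delta> om ^ 4) \<le> ennreal ((3 * mod_u (\<tau> + h) x \<tau> x)^2)"
   unfolding \<Delta>_def using h w by (intro u_holder4) auto
  note D = second_of_fourth[OF Dm d0 this]
  have sz: "\<tau> - 2 * w \<in> {0..T}" using h w by auto
  have Z4: "(\<lambda>om. Z om ^ 4) \<in> bm (sub (upto_time (\<tau> - w)))" using Za by (rule borel_measurable_power)
  note g = gauss_indep_moments[OF sub_subalgebra[OF upto_IX] N(1)[folded V_def] Z4 v_fourth(1)[OF sz, of x, folded Z_def]]
  have "(\<integral>om. \<bar>\<Delta> om ^ 4 - (Z om * N om) ^ 4\<bar> \<partial>M) \<le> 4 * (p * q ^ 8 * (a * q ^ 5) ^ 3)"
  proof (rule fourth_power_L1[OF Dm borel_measurable_times[OF Zm Nm]])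
   show "integrable M (\<lambda>om. (Z om * N om) ^ 4)" unfolding power_mult_distrib by (rule g(1))
   have "(\<integral>om. (Z om * N om) ^ 4 \<partial>M) = 3 * V^2 * (\<integral>om. Z om ^ 4 \<partial>M)" unfolding power_mult_distrib by (rule g(2))
   also have "\<dots> \<le> 3 * (c * q ^ 10)^2 * b4^2"
    using v_fourth(2)[OF sz, of x, folded Z_def] V0 Vb by (intro mult_mono power_mono) auto
   also have "\<dots> = 3 * b4^2 * c^2 * (q ^ 5) ^ 4" by (simp add: power_mult_distrib flip: power_mult)
   also have "\<dots> \<le> (a * q ^ 5) ^ 4" using pa q by (intro le_fourth_power) (auto simp: a_def)
   finally show "(\<integral>om. (Z om * N om) ^ 4 \<partial>M) \<le> (a * q ^ 5) ^ 4" .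
   have "(\<integral>om. \<Delta> om ^ 4 \<partial>M) \<le> (3 * mod_u (\<tau> + h) x \<tau> x)^2" by (rule D(2))
   also have "\<dots> = (3 * (b4 * c3) * q ^ 10)^2" using h q sqrt_even_power(1)[of q] by (simp add: mod_u_def h_def mult_ac)
   also have "\<dots> = 9 * (b4 * c3)^2 * (q ^ 5) ^ 4" by (simp add: power_mult_distrib flip: power_mult)
   also have "\<dots> \<le> (a * q ^ 5) ^ 4" using pa q by (intro le_fourth_power) (auto simp: a_def)
   finally show "(\<integral>om. \<Delta> om ^ 4 \<partial>M) \<le> (a * q ^ 5) ^ 4" .
   have "(\<integral>om. (\<Delta> om - Z om * N om) ^ 4 \<partial>M) \<le> (c4 * w)^2" by (rule E(2))
   also have "\<dots> = c4^2 * (q ^ 8) ^ 4" by (simp add: w_def power_mult_distrib flip: power_mult)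
   also have "\<dots> \<le> (p * q ^ 8) ^ 4" using pa q by (intro le_fourth_power) (auto simp: p_def)
   finally show "(\<integral>om. (\<Delta> om - Z om * N om) ^ 4 \<partial>M) \<le> (p * q ^ 8) ^ 4" .
  qed (use pa q in \<open>auto intro: E(1) D(1)\<close>)
  then show ?thesis using N(1)[folded V_def] N(2) Vd Vb D(1) unfolding \<Delta>_def Z_def h_def w_def by blast
 qed
 define C where "C = c + 4 * p * a ^ 3"
 have C: "0 \<le> C" "c \<le> C" "4 * (p * q ^ 8 * (a * q ^ 5) ^ 3) \<le> C * q ^ 23" if "0 \<le> q" for q
 proof -
  show "0 \<le> C" "c \<le> C" using c pa by (simp_all add: C_def)
  have "4 * (p * q ^ 8 * (a * q ^ 5) ^ 3) = 4 * p * a ^ 3 * q ^ 23" by (simp add: power_mult_distrib flip: power_mult power_add)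
  also have "\<dots> \<le> C * q ^ 23" using c that by (intro mult_right_mono) (auto simp: C_def)
  finally show "4 * (p * q ^ 8 * (a * q ^ 5) ^ 3) \<le> C * q ^ 23" .
 qed
 show ?thesis
 proof (intro exI[of _ C] conjI allI impI)
  show "0 \<le> C" using C(1)[of 0] by simp
  fix q \<tau> assume q: "0 < q" "q \<le> 1" "2 * q ^ 16 \<le> \<tau>" "\<tau> + q ^ 20 \<le> T"
  have "c * q ^ 16 \<le> C * q ^ 16" "c * q ^ 10 \<le> C * q ^ 10" using C(2)[of 0] q by (auto intro!: mult_right_mono)
  with main[OF q] C(3)[OF less_imp_le[OF q(1)]]
  show "\<exists>N V. gauss_indep M (sub (upto_time (\<tau> - q ^ 16))) N V \<and>
   (\<forall>\<epsilon>>0. N \<in> bm (sub (upto_time (\<tau> + q ^ 20 + \<epsilon>)))) \<and>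
   \<bar>V - kap x * sqrt (2 * q ^ 20) / sqrt pi\<bar> \<le> C * q ^ 16 \<and> V \<le> C * q ^ 10 \<and>
   integrable M (\<lambda>om. (u (\<tau> + q ^ 20) x om - u \<tau> x om) ^ 4) \<and>
   (\<integral>om. \<bar>(u (\<tau> + q ^ 20) x om - u \<tau> x om) ^ 4 - (v (\<tau> - 2 * q ^ 16) x om * N om) ^ 4\<bar> \<partial>M) \<le> C * q ^ 23"
   by (meson order_trans)
 qed
qed

end

section \<open>Riemann sums of the fourth power of the coefficient\<close>

context mild
begin

lemma v_path_measurable: "(\<lambda>(om, r). v r x om) \<in> bm (M \<Otimes>\<^sub>M lborel)"
proof -
 have "(\<lambda>(om, r). (om, r, x)) \<in> M \<Otimes>\<^sub>M lborel \<rightarrow>\<^sub>M M \<Otimes>\<^sub>M borel \<Otimes>\<^sub>M borel" by measurable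
 from measurable_compose[OF measurable_compose[OF this u_joint] sigma_measurable]
 show ?thesis by (simp add: v_def case_prod_beta')
qed

text \<open>Sum and integral are the time integrals of \<open>Sf\<close> and \<open>Vf\<close>, so
  Fubini's theorem reduces the claim to the bound \<open>le\<close> at each single time.\<close>

lemma riemann_sum:
 fixes s :: "nat => real"
 assumes a: "0 \<le> a" "a + real n * h = T" and h: "0 < h" and s: "\<And>i. i \<in> {1..n} ==> s i \<in> {0..T}" and e: "0 \<le> e"
  and le: "\<And>i r. i \<in> {1..n} ==> a + (real i - 1) * h < r ==> r \<le> a + real i * h ==> (\<integral>om. \<bar>v (s i) x om ^ 4 - v r x om ^ 4\<bar> \<partial>M) \<le> e"
 shows "integrable M (\<lambda>om. LBINT r:{a..T}. \<sigma> (u r x om) ^ 4)"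
  and "(\<integral>om. \<bar>h * (\<Sum>i=1..n. v (s i) x om ^ 4) - (LBINT r:{a..T}. \<sigma> (u r x om) ^ 4)\<bar> \<partial>M) \<le> (T - a) * e"
proof -
 interpret L: pair_sigma_finite M "lborel :: real measure" ..
 let ?P = "M \<Otimes>\<^sub>M (lborel :: real measure)"
 have aT: "a \<le> T" using a h by (metis le_add_same_cancel1 less_imp_le mult_nonneg_nonneg of_nat_0_le_iff)
 define I where "I i = {a + (real i - 1) * h<..a + real i * h}" for i
 define J where "J om = (LBINT r:{a..T}. \<sigma> (u r x om) ^ 4)" for om
 define Vf where "Vf = (\<lambda>(om, r). indicator {a..T} r * v r x om ^ 4)"
 define Sf where "Sf = (\<lambda>(om, r). \<Sum>i=1..n. indicator (I i) r * v (s i) x om ^ 4)"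
 have "(\<lambda>z. v (snd z) x (fst z)) \<in> bm ?P" using v_path_measurable by (simp add: case_prod_beta')
 note [measurable] = this v_measurable
 have [measurable]: "I i \<in> sets borel" for i by (simp add: I_def)
 have Vm [measurable]: "Vf \<in> bm ?P" unfolding Vf_def case_prod_beta' by measurable
 have Sm [measurable]: "Sf \<in> bm ?P" unfolding Sf_def case_prod_beta' by measurable
 have JV: "J om = (\<integral>r. Vf (om, r) \<partial>lborel)" for om
  unfolding J_def set_lebesgue_integral_def Vf_def using a(1)
  by (intro bo_cong) (auto simp: v_def indicator_def)
 have iV: "integrable ?P Vf"
 proof (rule integrableI_bounded)
  have "nni ?P (\<lambda>z. norm (Vf z)) = (\<integral>\<^sup>+r. nni M (\<lambda>om. norm (Vf (om, r))) \<partial>lborel)"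
   by (rule L.nn_integral_snd[symmetric]) measurable
  also have "\<dots> \<le> (\<integral>\<^sup>+r. ennreal (b4^2) * indicator {a..T} r \<partial>lborel)"
  proof (rule nn_integral_mono)
   fix r
   show "nni M (\<lambda>om. norm (Vf (om, r))) \<le> ennreal (b4^2) * indicator {a..T} r"
    using b4(2)[of r x] a(1) by (cases "r \<in> {a..T}") (simp_all add: Vf_def)
  qed
  also have "\<dots> < \<infinity>" using aT by (simp add: nn_integral_cmult_indicator ennreal_mult_less_top)
  finally show "nni ?P (\<lambda>z. norm (Vf z)) < \<infinity>" .
 qed measurable
 show iJ: "integrable M (\<lambda>om. LBINT r:{a..T}. \<sigma> (u r x om) ^ 4)"
  using L.integrable_fst'[OF iV] unfolding JV[symmetric] J_def .
 have pt: "\<exists>i\<in>{1..n}. r \<in> I i \<and> (\<forall>om. Sf (om, r) = v (s i) x om ^ 4)" if r: "a < r" "r \<le> T" for r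
 proof -
  \<comment> \<open>The intervals are closed on the right, so the one that contains \<open>r\<close>
    has the rounded up quotient as its index.\<close>
  define k where "k = nat \<lceil>(r - a) / h\<rceil>"
  have pos: "0 < (r - a) / h" using r h by simp
  have kn: "int k = \<lceil>(r - a) / h\<rceil>" using pos by (simp add: k_def)
  have ind: "r \<in> I i \<longleftrightarrow> i = k" for i
  proof -
   have "r \<in> I i \<longleftrightarrow> of_int (int i) - 1 < (r - a) / h \<and> (r - a) / h \<le> of_int (int i)"
    using h by (simp add: I_def less_divide_eq divide_le_eq) linarith
   also have "\<dots> \<longleftrightarrow> \<lceil>(r - a) / h\<rceil> = int i" by (rule ceiling_eq_iff[symmetric])
   finally show ?thesis using kn by auto
  qed
  have "(r - a) / h \<le> real n" using r a h by (simp add: divide_le_eq) 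
  then have "\<lceil>(r - a) / h\<rceil> \<le> int n" by (simp add: ceiling_le_iff)
  moreover have "0 < \<lceil>(r - a) / h\<rceil>" using pos by simp
  ultimately have "k \<le> n" "1 \<le> k" using kn by linarith+
  then have k: "k \<in> {1..n}" by simp
  have "Sf (om, r) = v (s k) x om ^ 4" for om
  proof -
   have "Sf (om, r) = (\<Sum>i=1..n. if i = k then v (s i) x om ^ 4 else 0)"
    unfolding Sf_def by (simp add: indicator_def ind if_distrib cong: if_cong)
   also have "\<dots> = v (s k) x om ^ 4" using k by simp
   finally show ?thesis .
  qed
  then show ?thesis using ind k by blast
 qed
 have out: "Sf (om, r) = 0" if "r \<notin> {a..T}" for om r
 proof -
  have "r \<notin> I i" if i: "i \<in> {1..n}" for i
  proof
   assume r: "r \<in> I i"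
   have "real i * h \<le> real n * h" "0 \<le> (real i - 1) * h" using i h by auto
   then show False using r \<open>r \<notin> {a..T}\<close> a by (auto simp: I_def)
  qed
  then show ?thesis unfolding Sf_def prod.case by (intro sum.neutral) simp
 qed
 let ?F = "\<lambda>z. Sf z - Vf z"
 have nF: "nni ?P (\<lambda>z. norm (?F z)) \<le> ennreal ((T - a) * e)"
 proof -
  have "nni ?P (\<lambda>z. norm (?F z)) = (\<integral>\<^sup>+r. nni M (\<lambda>om. norm (?F (om, r))) \<partial>lborel)"
   by (rule L.nn_integral_snd[symmetric]) measurable
  also have "\<dots> \<le> (\<integral>\<^sup>+r. ennreal e * indicator {a..T} r \<partial>lborel)"
  proof (rule nn_integral_mono_AE)
   show "AE r in lborel. (nni M (\<lambda>om. norm (?F (om, r)))) \<le> ennreal e * indicator {a..T} r"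
    using AE_lborel_singleton[of a]
   proof eventually_elim
    case (elim r)
    show ?case
    proof (cases "r \<in> {a..T}")
     case True
     then have "a < r" "r \<le> T" using elim by auto
     from pt[OF this] obtain i where i: "i \<in> {1..n}" "r \<in> I i" "\<And>om. Sf (om, r) = v (s i) x om ^ 4" by blast
     have r: "r \<in> {0..T}" using True a by auto
     have int: "integrable M (\<lambda>om. \<bar>v (s i) x om ^ 4 - v r x om ^ 4\<bar>)"
      by (intro integrable_abs bi_diff v_fourth s i r)
     have "nni M (\<lambda>om. norm (?F (om, r))) = (\<integral>\<^sup>+om. ennreal \<bar>v (s i) x om ^ 4 - v r x om ^ 4\<bar> \<partial>M)"
      using True by (simp add: i(3) Vf_def)
     also have "\<dots> = ennreal (\<integral>om. \<bar>v (s i) x om ^ 4 - v r x om ^ 4\<bar> \<partial>M)" by (rule nn_integral_eq_integral[OF int]) simp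
     also have "\<dots> \<le> ennreal e" using i(2) by (intro ennreal_leI le i(1)) (auto simp: I_def)
     finally show ?thesis using True by simp
    qed (simp add: out Vf_def)
   qed
  qed
  also have "\<dots> = ennreal ((T - a) * e)" using aT e by (simp add: nn_integral_cmult_indicator ennreal_mult' mult.commute)
  finally show ?thesis .
 qed
 have iF: "integrable ?P ?F" by (rule integrableI_bounded) (measurable, use le_less_trans[OF nF] in simp)
 \<comment> \<open>Splitting the time integral requires a path that is integrable, which almost
   every path is.\<close>
 have Fe: "AE om in M. h * (\<Sum>i=1..n. v (s i) x om ^ 4) - J om = (\<integral>r. ?F (om, r) \<partial>lborel)"
  using L.AE_integrable_fst'[OF iV]
 proof eventually_elim
  case (elim om)
  have ii: "integrable lborel (\<lambda>r. indicator (I i) r * v (s i) x om ^ 4)" for i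
  proof (intro integrable_mult_left integrable_real_indicator)
   show "emeasure lborel (I i) < \<infinity>" using h by (simp add: I_def)
  qed simp
  have m: "(\<integral>r. indicator (I i) r * v (s i) x om ^ 4 \<partial>lborel) = h * v (s i) x om ^ 4" for i
   using h by (simp add: I_def algebra_simps)
  have "(\<integral>r. ?F (om, r) \<partial>lborel) = (\<integral>r. Sf (om, r) \<partial>lborel) - J om"
   unfolding JV
  proof (rule bo_diff[OF _ elim])
   show "integrable lborel (\<lambda>r. Sf (om, r))" unfolding Sf_def prod.case by (intro bi_sum ii)
  qed
  also have "(\<integral>r. Sf (om, r) \<partial>lborel) = (\<Sum>i=1..n. h * v (s i) x om ^ 4)"
   unfolding Sf_def prod.case m[symmetric] by (intro bo_sum ii)
  finally show ?case by (simp add: sum_distrib_left)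
 qed
 have "(\<integral>\<^sup>+om. ennreal \<bar>h * (\<Sum>i=1..n. v (s i) x om ^ 4) - J om\<bar> \<partial>M) \<le> (\<integral>\<^sup>+om. nni lborel (\<lambda>r. norm (?F (om, r))) \<partial>M)"
 proof (rule nn_integral_mono_AE)
  show "AE om in M. ennreal \<bar>h * (\<Sum>i=1..n. v (s i) x om ^ 4) - J om\<bar> \<le> nni lborel (\<lambda>r. norm (?F (om, r)))"
   using Fe L.AE_integrable_fst'[OF iF]
  proof eventually_elim
   case (elim om)
   show ?case using integral_norm_bound_ennreal[OF elim(2)] unfolding elim(1) by simp
  qed
 qed
 also have "\<dots> = nni ?P (\<lambda>z. norm (?F z))"
  by (rule lborel.nn_integral_fst) measurable
 also have "\<dots> \<le> ennreal ((T - a) * e)" by (rule nF)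
 finally show "(\<integral>om. \<bar>h * (\<Sum>i=1..n. v (s i) x om ^ 4) - (LBINT r:{a..T}. \<sigma> (u r x om) ^ 4)\<bar> \<partial>M) \<le> (T - a) * e"
  unfolding J_def using aT e by (intro integral_real_bounded) auto
qed

end

section \<open>Quartic variation\<close>

context mild
begin

text \<open>Windows are disjoint once the indices differ by more than about
  \<open>w / h = q^(-4)\<close>, so \<open>sum_second_moment\<close> applies with \<open>m\<close>
  of that order. With \<open>n\<close> of order \<open>q^(-20)\<close> and second moments of order
  \<open>q^40\<close>, the sum has a second moment of order \<open>q^16\<close>.\<close>

lemma martingale_part:
 fixes s :: "nat => real" and N :: "nat => 'a => real" and V \<tau> :: "nat => real"
 assumes q: "0 < q" "q \<le> 1" and nq: "real n * q ^ 20 = L" and \<tau>: "\<And>i. \<tau> i = a + (real i - 1) * q ^ 20"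
  and s: "\<And>i. s i = \<tau> i - 2 * q ^ 16" "\<And>i. i \<in> {1..n} ==> s i \<in> {0..T}"
  and N: "\<And>i. i \<in> {1..n} ==> gauss_indep M (sub (upto_time (\<tau> i - q ^ 16))) (N i) (V i)"
   "\<And>i \<epsilon>. i \<in> {1..n} ==> 0 < \<epsilon> ==> N i \<in> bm (sub (upto_time (\<tau> i + q ^ 20 + \<epsilon>)))"
  and V: "\<And>i. i \<in> {1..n} ==> V i \<le> C * q ^ 10"
  and B: "\<And>i. i \<in> {1..n} ==> (nni M (\<lambda>om. v (s i) x om ^ 8)) \<le> ennreal B" "0 \<le> B"
 shows "integrable M (\<lambda>om. \<Sum>i=1..n. v (s i) x om ^ 4 * (N i om ^ 4 - 3 * (V i)^2))" (is "integrable M ?S")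
  and "(\<integral>om. \<bar>\<Sum>i=1..n. v (s i) x om ^ 4 * (N i om ^ 4 - 3 * (V i)^2)\<bar> \<partial>M) \<le> sqrt (7 * L * (96 * C ^ 4 * B)) * q ^ 8"
proof -
 define X where "X i om = v (s i) x om ^ 4 * (N i om ^ 4 - 3 * (V i)^2)" for i om
 define S where "S = 96 * (C * q ^ 10) ^ 4 * B"
 \<comment> \<open>The additional 1 ensures that an index distance beyond \<open>m\<close> leaves
   room for a window, one mesh and a positive gap.\<close>
 define m where "m = nat \<lceil>1 / q ^ 4\<rceil> + 1"
 have S0: "0 \<le> S" using B(2) by (simp add: S_def)
 have sub: "subalgebra M (sub (upto_time t))" for t by (rule sub_subalgebra[OF upto_IX])
 have sa: "v (s i) x \<in> bm (sub (upto_time t))" if "i \<in> {1..n}" "\<tau> i - q ^ 16 \<le> t" for i t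
 proof (rule v_adapted)
  show "0 \<le> s i" using s(2)[OF that(1)] by simp
  have "0 < q ^ 16" using q by simp
  then show "s i < t" using that(2) unfolding s(1) by linarith
 qed
 have B8: "integrable M (\<lambda>om. v (s i) x om ^ 8)" "(\<integral>om. v (s i) x om ^ 8 \<partial>M) \<le> B" if i: "i \<in> {1..n}" for i
 proof -
  have [measurable]: "v (s i) x \<in> bm M" by (rule v_measurable)
  show I: "integrable M (\<lambda>om. v (s i) x om ^ 8)"
  proof (rule integrableI_bounded)
   show "nni M (\<lambda>om. norm (v (s i) x om ^ 8)) < \<infinity>" using le_less_trans[OF B(1)[OF i], of \<infinity>] by simp
  qed measurable
  have "ennreal (\<integral>om. v (s i) x om ^ 8 \<partial>M) \<le> ennreal B" using B(1)[OF i] I by (simp add: nn_integral_eq_integral)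
  then show "(\<integral>om. v (s i) x om ^ 8 \<partial>M) \<le> B" using B(2) by (simp add: ennreal_le_iff)
 qed
 have Nm: "N i \<in> bm M" if "i \<in> {1..n}" for i using N(1)[OF that] by (simp add: gauss_indep_def)
 have Xm: "X i \<in> bm M" if "i \<in> {1..n}" for i
  unfolding X_def[abs_def] using Nm[OF that] v_measurable[of "s i" x] by measurable
 have X2e: "(X i om)^2 = v (s i) x om ^ 8 * (N i om ^ 4 - 3 * (V i)^2)^2" for i om
  by (simp add: X_def power_mult_distrib flip: power_mult)
 have X2: "integrable M (\<lambda>om. (X i om)^2)" "(\<integral>om. (X i om)^2 \<partial>M) \<le> S" if i: "i \<in> {1..n}" for i
 proof -
  have "(\<lambda>om. v (s i) x om ^ 8) \<in> bm (sub (upto_time (\<tau> i - q ^ 16)))"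
   by (intro borel_measurable_power sa i order_refl)
  note g = gauss_indep_moments[OF sub N(1)[OF i] this B8(1)[OF i]]
  show "integrable M (\<lambda>om. (X i om)^2)" unfolding X2e by (rule g(4))
  have V0: "0 \<le> V i" using N(1)[OF i] by (simp add: gauss_indep_def)
  have "(\<integral>om. (X i om)^2 \<partial>M) = 96 * V i ^ 4 * (\<integral>om. v (s i) x om ^ 8 \<partial>M)" unfolding X2e by (rule g(5))
  also have "\<dots> \<le> 96 * (C * q ^ 10) ^ 4 * B" using B8(2)[OF i] V[OF i] V0 by (intro mult_mono power_mono) auto
  finally show "(\<integral>om. (X i om)^2 \<partial>M) \<le> S" by (simp add: S_def)
 qed
 have orth: "(\<integral>om. X i om * X j om \<partial>M) = 0" if ij: "i \<in> {1..n}" "j \<in> {1..n}" "i + m < j" for i j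
 proof -
  \<comment> \<open>The gap between the end of increment \<open>i\<close> and the beginning of
    window \<open>j\<close>; after it, \<open>N i\<close> is known.\<close>
  define \<epsilon> where "\<epsilon> = \<tau> j - q ^ 16 - \<tau> i - q ^ 20"
  have eps: "0 < \<epsilon>"
  proof -
   have "real m \<le> real j - real i - 1" using ij(3) by linarith
   moreover have "1 / q ^ 4 + 1 \<le> real m" unfolding m_def by linarith
   ultimately have "(1 / q ^ 4 + 1) * q ^ 20 \<le> (real j - real i - 1) * q ^ 20" using q by (intro mult_right_mono) auto
   moreover have "(1 / q ^ 4 + 1) * q ^ 20 = q ^ 16 + q ^ 20"
   proof -
    have e: "q ^ 20 = q ^ 4 * q ^ 16" by (simp flip: power_add)
    have c: "1 / c * (c * d) = d" if "c \<noteq> 0" for c d :: real using that by simp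
    have "1 / q ^ 4 * q ^ 20 = q ^ 16" unfolding e by (rule c) (use q in simp)
    then show ?thesis by (simp only: distrib_right mult_1_left)
   qed
   moreover have "\<epsilon> = (real j - real i - 1) * q ^ 20 - q ^ 16" by (simp add: \<epsilon>_def \<tau> algebra_simps)
   moreover have "0 < q ^ 20" using q by simp
   ultimately show ?thesis by linarith
  qed
  let ?F = "sub (upto_time (\<tau> j - q ^ 16))"
  have te: "\<tau> i + q ^ 20 + \<epsilon> = \<tau> j - q ^ 16" by (simp add: \<epsilon>_def)
  have [measurable]: "N i \<in> bm ?F" using N(2)[OF ij(1) eps] unfolding te .
  have "\<tau> i - q ^ 16 \<le> \<tau> j - q ^ 16" using eps zero_le_power[OF less_imp_le[OF q(1)], of 20] zero_le_power[OF less_imp_le[OF q(1)], of 16]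
   unfolding \<epsilon>_def by linarith
  from sa[OF ij(1) this] sa[OF ij(2) order_refl]
  have [measurable]: "v (s i) x \<in> bm ?F" "v (s j) x \<in> bm ?F" .
  have YF: "(\<lambda>om. X i om * v (s j) x om ^ 4) \<in> bm ?F" unfolding X_def by measurable
  have Yi: "integrable M (\<lambda>om. X i om * v (s j) x om ^ 4)"
  proof (rule bi_bound)
   show "integrable M (\<lambda>om. ((X i om)^2 + v (s j) x om ^ 8) / 2)" using X2(1)[OF ij(1)] B8(1)[OF ij(2)] by simp
   show "(\<lambda>om. X i om * v (s j) x om ^ 4) \<in> bm M" by (rule measurable_from_subalg[OF sub YF])
   have "\<bar>p * r ^ 4\<bar> \<le> (p^2 + r ^ 8) / 2" for p r :: real
    using sum_squares_bound[of "\<bar>p\<bar>" "r ^ 4"] by (simp add: abs_mult flip: power_mult)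
   then show "AE om in M. norm (X i om * v (s j) x om ^ 4) \<le> norm (((X i om)^2 + v (s j) x om ^ 8) / 2)"
    by (intro AE_I2) (simp add: order_trans[OF _ abs_ge_self])
  qed
  \<comment> \<open>All factors except the centred fourth power of \<open>N j\<close> are known at
    the beginning of window \<open>j\<close>.\<close>
  have "(\<integral>om. X i om * X j om \<partial>M) = (\<integral>om. X i om * v (s j) x om ^ 4 * (N j om ^ 4 - 3 * (V j)^2) \<partial>M)"
   by (simp add: X_def mult.assoc)
  also have "\<dots> = 0" by (rule gauss_indep_moments(3)[OF sub N(1)[OF ij(2)] YF Yi])
  finally show ?thesis .
 qed
 note sm = sum_second_moment[OF Xm X2 orth S0]
 have Sm: "(\<lambda>om. \<Sum>i=1..n. X i om) \<in> bm M" by (intro borel_measurable_sum Xm)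
 note l = L1_le_L2[OF Sm sm(1)]
 show "integrable M ?S" using l(1) unfolding X_def .
 have "(\<integral>om. \<bar>\<Sum>i=1..n. X i om\<bar> \<partial>M) \<le> sqrt (\<integral>om. (\<Sum>i=1..n. X i om)^2 \<partial>M)" by (rule l(2))
 also have "\<dots> \<le> sqrt ((7 * L * (96 * C ^ 4 * B)) * q ^ 16)"
 proof (rule real_sqrt_le_mono)
  have "(\<integral>om. (\<Sum>i=1..n. X i om)^2 \<partial>M) \<le> real n * (2 * real m + 1) * S" by (rule sm(2))
  also have "\<dots> = L * ((2 * real m + 1) * q ^ 4) * (96 * C ^ 4 * B) * q ^ 16"
  proof -
   have "(C * q ^ 10) ^ 4 = C ^ 4 * (q ^ 20 * q ^ 4 * q ^ 16)" by (simp add: power_mult_distrib flip: power_mult power_add)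
   then show ?thesis by (simp add: S_def nq[symmetric] mult_ac)
  qed
  also have "\<dots> \<le> L * 7 * (96 * C ^ 4 * B) * q ^ 16"
  proof (intro mult_right_mono mult_left_mono)
   \<comment> \<open>Hence \<open>2 * m + 1\<close> is at most \<open>2 / q ^ 4 + 5\<close>, which
     gives the factor 7.\<close>
   have "real m \<le> 1 / q ^ 4 + 2" using q unfolding m_def by (simp add: of_nat_nat) linarith
   then have "(2 * real m + 1) * q ^ 4 \<le> (2 / q ^ 4 + 5) * q ^ 4" using q by (intro mult_right_mono) auto
   also have "\<dots> = 2 + 5 * q ^ 4" using q by (simp add: distrib_right)
   also have "\<dots> \<le> 7" using power_le_one[of q 4] q by simp
   finally show "(2 * real m + 1) * q ^ 4 \<le> 7" .
   show "0 \<le> L" using nq q by (metis mult_nonneg_nonneg of_nat_0_le_iff zero_le_power less_imp_le)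
  qed (use B q in auto)
  finally show "(\<integral>om. (\<Sum>i=1..n. X i om)^2 \<partial>M) \<le> (7 * L * (96 * C ^ 4 * B)) * q ^ 16" by (simp add: mult_ac)
 qed
 also have "\<dots> = sqrt (7 * L * (96 * C ^ 4 * B)) * q ^ 8" using q by (simp only: real_sqrt_mult sqrt_even_power(2) less_imp_le)
 finally show "(\<integral>om. \<bar>\<Sum>i=1..n. v (s i) x om ^ 4 * (N i om ^ 4 - 3 * (V i)^2)\<bar> \<partial>M) \<le> sqrt (7 * L * (96 * C ^ 4 * B)) * q ^ 8"
  unfolding X_def .
qed

end

section \<open>Collecting the error terms\<close>

context mild
begin

text \<open>The difference splits into the errors of the single approximations, the martingale part,
  the error of the variances and that of the Riemann sum, with bounds of order \<open>q^3\<close>,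
  \<open>q^8\<close>, \<open>q^6\<close> and \<open>q^4\<close>.\<close>

lemma quartic_variation_L1:
 assumes T1: "0 < T1"
 shows "\<exists>C\<ge>0. \<forall>n q. 0 < q \<longrightarrow> q \<le> 1 \<longrightarrow> 2 * q ^ 16 \<le> T1 \<longrightarrow> T1 + real n * q ^ 20 = T \<longrightarrow>
  (let D = (\<lambda>om. quartic_variation u T1 T x n om - 6 * (kap x)^2 / pi * (LBINT r:{T1..T}. \<sigma> (u r x om) ^ 4))
  in integrable M D \<and> (\<integral>om. \<bar>D om\<bar> \<partial>M) \<le> C * q ^ 3)"
proof -
 obtain C1 where C1: "0 \<le> C1" "\<forall>q \<tau>. 0 < q \<longrightarrow> q \<le> 1 \<longrightarrow> 2 * q ^ 16 \<le> \<tau> \<longrightarrow> \<tau> + q ^ 20 \<le> T \<longrightarrow>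
  (\<exists>N V. gauss_indep M (sub (upto_time (\<tau> - q ^ 16))) N V \<and>
   (\<forall>\<epsilon>>0. N \<in> bm (sub (upto_time (\<tau> + q ^ 20 + \<epsilon>)))) \<and>
   \<bar>V - kap x * sqrt (2 * q ^ 20) / sqrt pi\<bar> \<le> C1 * q ^ 16 \<and> V \<le> C1 * q ^ 10 \<and>
   integrable M (\<lambda>om. (u (\<tau> + q ^ 20) x om - u \<tau> x om) ^ 4) \<and>
   (\<integral>om. \<bar>(u (\<tau> + q ^ 20) x om - u \<tau> x om) ^ 4 - (v (\<tau> - 2 * q ^ 16) x om * N om) ^ 4\<bar> \<partial>M) \<le> C1 * q ^ 23)"
  using increment_L1[of x] by (elim exE conjE)
 obtain C2 where C2: "0 \<le> C2" "\<forall>q s r. 0 < q \<longrightarrow> s \<in> {0..T} \<longrightarrow> r \<in> {0..T} \<longrightarrow> \<bar>r - s\<bar> \<le> 4 * q ^ 16 \<longrightarrow>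
  (\<integral>om. \<bar>v s x om ^ 4 - v r x om ^ 4\<bar> \<partial>M) \<le> C2 * q ^ 4" using v_fourth_L1[of x] by (elim exE conjE)
 obtain B where B: "0 \<le> B" "\<forall>s\<in>{0..T}. \<forall>y. (nni M (\<lambda>om. v s y om ^ 8)) \<le> ennreal B"
  using v_moments[of 8] by auto
 define \<Lambda> where "\<Lambda> = T - T1"
 define k where "k = kap x"
 have k0: "0 \<le> k" by (simp add: k_def kap_nonneg)
 \<comment> \<open>One summand for each of the four errors.\<close>
 define A where "A = \<Lambda> * C1 + sqrt (7 * \<Lambda> * (96 * C1 ^ 4 * B)) + \<Lambda> * (3 * C1 * (C1 + 2 * k) * b4^2) + 6 * k^2 / pi * (\<Lambda> * C2)"
 have main: "integrable M (\<lambda>om. quartic_variation u T1 T x n om - 6 * (kap x)^2 / pi * (LBINT r:{T1..T}. \<sigma> (u r x om) ^ 4)) \<and>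
   (\<integral>om. \<bar>quartic_variation u T1 T x n om - 6 * (kap x)^2 / pi * (LBINT r:{T1..T}. \<sigma> (u r x om) ^ 4)\<bar> \<partial>M) \<le> A * q ^ 3"
  if q: "0 < q" "q \<le> 1" "2 * q ^ 16 \<le> T1" "T1 + real n * q ^ 20 = T" for n q
 proof -
  define h w where "h = q ^ 20" and "w = q ^ 16"
  have h: "0 < h" "h \<le> w" "0 < w" using q power_decreasing[of 16 20 q] by (auto simp: h_def w_def)
  note hq = h[unfolded h_def w_def]
  have nq: "real n * q ^ 20 = \<Lambda>" using q(4) by (simp add: \<Lambda>_def)
  have L0: "0 \<le> \<Lambda>" using nq q by (metis mult_nonneg_nonneg of_nat_0_le_iff zero_le_power less_imp_le)
  define \<tau> s where "\<tau> i = T1 + (real i - 1) * q ^ 20" and "s i = \<tau> i - 2 * q ^ 16" for i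
  have \<tau>: "2 * q ^ 16 \<le> \<tau> i" "\<tau> i + q ^ 20 \<le> T" "\<tau> i + q ^ 20 = T1 + real i * q ^ 20" if i: "i \<in> {1..n}" for i
  proof -
   have "0 \<le> (real i - 1) * q ^ 20" "real i * q ^ 20 \<le> real n * q ^ 20" using i q by auto
   moreover show e: "\<tau> i + q ^ 20 = T1 + real i * q ^ 20" by (simp add: \<tau>_def algebra_simps)
   ultimately show "2 * q ^ 16 \<le> \<tau> i" "\<tau> i + q ^ 20 \<le> T" using q unfolding e by (auto simp: \<tau>_def)
  qed
  have s: "s i \<in> {0..T}" if i: "i \<in> {1..n}" for i
  proof -
   have "0 \<le> s i" "s i \<le> T" unfolding s_def using \<tau>(1,2)[OF i] hq by linarith+
   then show ?thesis by simp
  qed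
  define \<Delta> where "\<Delta> i om = u (\<tau> i + q ^ 20) x om - u (\<tau> i) x om" for i om
  define c where "c = k * sqrt (2 * q ^ 20) / sqrt pi"
  let ?P = "\<lambda>i N V. gauss_indep M (sub (upto_time (\<tau> i - q ^ 16))) N V \<and>
   (\<forall>\<epsilon>>0. N \<in> bm (sub (upto_time (\<tau> i + q ^ 20 + \<epsilon>)))) \<and>
   \<bar>V - c\<bar> \<le> C1 * q ^ 16 \<and> V \<le> C1 * q ^ 10 \<and> integrable M (\<lambda>om. \<Delta> i om ^ 4) \<and>
   (\<integral>om. \<bar>\<Delta> i om ^ 4 - (v (s i) x om * N om) ^ 4\<bar> \<partial>M) \<le> C1 * q ^ 23"
  have "\<forall>i\<in>{1..n}. \<exists>N V. ?P i N V"
   using C1(2) q(1,2) \<tau>(1,2) unfolding c_def k_def \<Delta>_def s_def by blast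
  from bchoice[OF this] obtain N where "\<forall>i\<in>{1..n}. \<exists>V. ?P i (N i) V" by blast
  from bchoice[OF this] obtain V where NV: "\<forall>i\<in>{1..n}. ?P i (N i) (V i)" by blast
  have N: "gauss_indep M (sub (upto_time (\<tau> i - q ^ 16))) (N i) (V i)"
   "0 < \<epsilon> ==> N i \<in> bm (sub (upto_time (\<tau> i + q ^ 20 + \<epsilon>)))"
   "\<bar>V i - c\<bar> \<le> C1 * q ^ 16" "V i \<le> C1 * q ^ 10" "integrable M (\<lambda>om. \<Delta> i om ^ 4)"
   "(\<integral>om. \<bar>\<Delta> i om ^ 4 - (v (s i) x om * N i om) ^ 4\<bar> \<partial>M) \<le> C1 * q ^ 23" if "i \<in> {1..n}" for i \<epsilon>
   using NV that by blast+
  \<comment> \<open>\<open>D * h\<close> equals \<open>3 * c^2\<close>, the fourth moment of a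
    centred Gaussian variable with the limiting variance \<open>c\<close>.\<close>
  define D where "D = 6 * k^2 / pi"
  have D0: "0 \<le> D" by (simp add: D_def)
  have cD: "3 * c^2 = D * h" "0 \<le> c" "c \<le> 2 * k * q ^ 10"
  proof -
   show "3 * c^2 = D * h" using h by (simp add: c_def D_def h_def power_divide power_mult_distrib)
   show "0 \<le> c" using k0 q by (simp add: c_def)
   have "c \<le> k * sqrt (2 * q ^ 20) / 1"
    unfolding c_def using k0 q sqrt_pi_ge_1 by (intro divide_left_mono mult_nonneg_nonneg) auto
   also have "sqrt (2 * q ^ 20) = sqrt 2 * q ^ 10" using q by (simp add: real_sqrt_mult sqrt_even_power)
   also have "k * (sqrt 2 * q ^ 10) / 1 \<le> k * (2 * q ^ 10)"
    unfolding div_by_1 using k0 q sqrt2_less_2 by (intro mult_left_mono mult_right_mono) auto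
   finally show "c \<le> 2 * k * q ^ 10" by (simp add: mult_ac)
  qed
  define J where "J om = (LBINT r:{T1..T}. \<sigma> (u r x om) ^ 4)" for om
  define Z where "Z i om = v (s i) x om ^ 4" for i om
  define E1 where "E1 i om = \<Delta> i om ^ 4 - (v (s i) x om * N i om) ^ 4" for i om
  define E2 where "E2 om = (\<Sum>i=1..n. v (s i) x om ^ 4 * (N i om ^ 4 - 3 * (V i)^2))" for om
  define E4 where "E4 om = h * (\<Sum>i=1..n. Z i om) - J om" for om
  have Zi: "integrable M (Z i)" "(\<integral>om. Z i om \<partial>M) \<le> b4^2" if i: "i \<in> {1..n}" for i
   unfolding Z_def[abs_def] using v_fourth[OF s[OF i], of x] by auto
  have ZN: "integrable M (\<lambda>om. Z i om * N i om ^ 4)" if i: "i \<in> {1..n}" for i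
  proof -
   have "s i < \<tau> i - q ^ 16" unfolding s_def using hq by linarith
   then have "v (s i) x \<in> bm (sub (upto_time (\<tau> i - q ^ 16)))"
    using s[OF i] by (intro v_adapted) auto
   then have "Z i \<in> bm (sub (upto_time (\<tau> i - q ^ 16)))" unfolding Z_def[abs_def] by measurable
   from gauss_indep_moments(1)[OF sub_subalgebra[OF upto_IX] N(1)[OF i] this Zi(1)[OF i]] show ?thesis .
  qed
  have i1: "integrable M (E1 i)" if i: "i \<in> {1..n}" for i
   unfolding E1_def[abs_def] power_mult_distrib using N(5)[OF i] ZN[OF i]
   by (intro bi_diff) (simp_all add: Z_def)
  \<comment> \<open>Summation over all increments multiplies by \<open>n\<close>, that is by
    \<open>\<Lambda> / q ^ 20\<close>.\<close>
  have q16: "real n * (r * q ^ 23) = \<Lambda> * r * q ^ 3" "real n * (r * q ^ 26) = \<Lambda> * r * q ^ 6" for r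
   unfolding nq[symmetric] by (simp_all add: mult_ac flip: power_add)
  have e1: "(\<Sum>i=1..n. \<integral>om. \<bar>E1 i om\<bar> \<partial>M) \<le> \<Lambda> * C1 * q ^ 3"
  proof -
   have "(\<Sum>i=1..n. \<integral>om. \<bar>E1 i om\<bar> \<partial>M) \<le> (\<Sum>i=1..n. C1 * q ^ 23)" unfolding E1_def by (intro sum_mono N)
   then show ?thesis by (simp add: q16)
  qed
  have mp: "integrable M E2" "(\<integral>om. \<bar>E2 om\<bar> \<partial>M) \<le> sqrt (7 * \<Lambda> * (96 * C1 ^ 4 * B)) * q ^ 8"
  proof -
   show "integrable M E2" unfolding E2_def[abs_def]
    by (rule martingale_part(1)[OF q(1,2) nq \<tau>_def s_def s N(1) N(2) N(4) _ B(1)]) (use B(2) s in auto)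
   show "(\<integral>om. \<bar>E2 om\<bar> \<partial>M) \<le> sqrt (7 * \<Lambda> * (96 * C1 ^ 4 * B)) * q ^ 8" unfolding E2_def
    by (rule martingale_part(2)[OF q(1,2) nq \<tau>_def s_def s N(1) N(2) N(4) _ B(1)]) (use B(2) s in auto)
  qed
  have e3: "(\<Sum>i=1..n. \<integral>om. \<bar>(3 * (V i)^2 - D * h) * Z i om\<bar> \<partial>M) \<le> \<Lambda> * (3 * C1 * (C1 + 2 * k) * b4^2) * q ^ 6"
  proof -
   have "(\<integral>om. \<bar>(3 * (V i)^2 - D * h) * Z i om\<bar> \<partial>M) \<le> (3 * C1 * (C1 + 2 * k) * b4^2) * q ^ 26" if i: "i \<in> {1..n}" for i
   proof -
    have V0: "0 \<le> V i" using N(1)[OF i] by (simp add: gauss_indep_def)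
    have "\<bar>V i - c\<bar> * \<bar>V i + c\<bar> \<le> (C1 * q ^ 16) * ((C1 + 2 * k) * q ^ 10)"
     using N(3,4)[OF i] V0 cD C1(1) q by (intro mult_mono) (auto simp: distrib_right)
    also have "\<dots> = C1 * (C1 + 2 * k) * q ^ 26" by (simp add: mult_ac flip: power_add)
    finally have 1: "\<bar>V i - c\<bar> * \<bar>V i + c\<bar> \<le> C1 * (C1 + 2 * k) * q ^ 26" .
    \<comment> \<open>The variance enters squared: the factor \<open>V i + c\<close> of order
      \<open>q^10\<close> improves the error \<open>q^16\<close> to \<open>q^26\<close>.\<close>
    have eq: "3 * (V i)^2 - D * h = 3 * ((V i - c) * (V i + c))"
     unfolding cD(1)[symmetric] by (simp add: power2_eq_square algebra_simps)
    have 2: "\<bar>3 * (V i)^2 - D * h\<bar> \<le> 3 * (C1 * (C1 + 2 * k) * q ^ 26)" unfolding eq abs_mult using 1 by simp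
    have Zn: "0 \<le> Z i om" for om by (simp add: Z_def)
    have "(\<integral>om. \<bar>(3 * (V i)^2 - D * h) * Z i om\<bar> \<partial>M) = \<bar>3 * (V i)^2 - D * h\<bar> * (\<integral>om. Z i om \<partial>M)"
     by (simp add: abs_mult abs_of_nonneg[OF Zn])
    also have "\<dots> \<le> 3 * (C1 * (C1 + 2 * k) * q ^ 26) * b4^2"
     using 2 Zi(2)[OF i] Zn by (intro mult_mono Bochner_Integration.integral_nonneg) auto
    also have "\<dots> = (3 * C1 * (C1 + 2 * k) * b4^2) * q ^ 26" by (simp only: mult_ac)
    finally show ?thesis .
   qed
   then have "(\<Sum>i=1..n. \<integral>om. \<bar>(3 * (V i)^2 - D * h) * Z i om\<bar> \<partial>M) \<le> (\<Sum>i=1..n. (3 * C1 * (C1 + 2 * k) * b4^2) * q ^ 26)"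
    by (rule sum_mono)
   also have "\<dots> = real n * ((3 * C1 * (C1 + 2 * k) * b4^2) * q ^ 26)" by simp
   also have "\<dots> = \<Lambda> * (3 * C1 * (C1 + 2 * k) * b4^2) * q ^ 6" by (rule q16(2))
   finally show ?thesis .
  qed
  have rs: "integrable M J" "(\<integral>om. \<bar>E4 om\<bar> \<partial>M) \<le> \<Lambda> * (C2 * q ^ 4)"
  proof -
   have le: "(\<integral>om. \<bar>v (s i) x om ^ 4 - v r x om ^ 4\<bar> \<partial>M) \<le> C2 * q ^ 4"
    if i: "i \<in> {1..n}" and r: "T1 + (real i - 1) * h < r" "r \<le> T1 + real i * h" for i r
   proof -
    have "\<tau> i < r" "r \<le> \<tau> i + q ^ 20" using r \<tau>(3)[OF i] by (auto simp: \<tau>_def h_def)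
    then have "0 \<le> r" "r \<le> T" "\<bar>r - s i\<bar> \<le> 4 * q ^ 16"
     using \<tau>(1,2)[OF i] hq unfolding s_def by linarith+
    then show ?thesis using C2(2) q(1) s[OF i] by (simp add: abs_minus_commute)
   qed
   have e: "T1 + real n * h = T" "0 \<le> C2 * q ^ 4" "0 \<le> T1" using q C2 T1 by (auto simp: h_def)
   note r = riemann_sum[OF e(3,1) h(1) s e(2) le]
   show "integrable M J" unfolding J_def[abs_def] by (rule r(1))
   show "(\<integral>om. \<bar>E4 om\<bar> \<partial>M) \<le> \<Lambda> * (C2 * q ^ 4)" unfolding E4_def J_def Z_def \<Lambda>_def by (rule r(2))
  qed
  have i4: "integrable M E4" unfolding E4_def[abs_def]
   using rs(1) Zi(1) by (intro bi_diff integrable_mult_right bi_sum)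
  have i3: "integrable M (\<lambda>om. (3 * (V i)^2 - D * h) * Z i om)" if "i \<in> {1..n}" for i
   using Zi(1)[OF that] by simp
  have QV: "quartic_variation u T1 T x n om = (\<Sum>i=1..n. \<Delta> i om ^ 4)" for om
  proof -
   have "(u (T1 + real i * ((T - T1) / real n)) x om - u (T1 + real (i - 1) * ((T - T1) / real n)) x om) ^ 4 = \<Delta> i om ^ 4" if i: "i \<in> {1..n}" for i
   proof -
    have "(T - T1) / real n = q ^ 20" using nq i by (simp add: \<Lambda>_def field_simps)
    moreover have "real (i - 1) = real i - 1" using i by (simp add: of_nat_diff)
    ultimately show ?thesis unfolding \<Delta>_def \<tau>(3)[OF i] by (simp only: \<tau>_def)
   qed
   then show ?thesis unfolding quartic_variation_def Let_def by (intro sum.cong refl)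
  qed
  have dec: "quartic_variation u T1 T x n om - 6 * (kap x)^2 / pi * J om
   = (\<Sum>i=1..n. E1 i om) + E2 om + (\<Sum>i=1..n. (3 * (V i)^2 - D * h) * Z i om) + D * E4 om" for om
  proof -
   have "(\<Sum>i=1..n. E1 i om) + E2 om + (\<Sum>i=1..n. (3 * (V i)^2 - D * h) * Z i om) + (\<Sum>i=1..n. D * h * Z i om) = (\<Sum>i=1..n. \<Delta> i om ^ 4)"
    unfolding E2_def sum.distrib[symmetric]
    by (intro sum.cong refl) (simp add: E1_def Z_def power_mult_distrib algebra_simps)
   moreover have "D * E4 om = (\<Sum>i=1..n. D * h * Z i om) - D * J om"
    by (simp add: E4_def right_diff_distrib sum_distrib_left mult.assoc)
   ultimately show ?thesis unfolding QV D_def k_def by simp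
  qed
  let ?I = "\<lambda>om. (\<Sum>i=1..n. E1 i om) + E2 om + (\<Sum>i=1..n. (3 * (V i)^2 - D * h) * Z i om) + D * E4 om"
  let ?R = "\<lambda>om. (\<Sum>i=1..n. \<bar>E1 i om\<bar>) + \<bar>E2 om\<bar> + (\<Sum>i=1..n. \<bar>(3 * (V i)^2 - D * h) * Z i om\<bar>) + D * \<bar>E4 om\<bar>"
  have iI: "integrable M ?I"
   by (intro bi_add bi_sum i1 mp(1) i3 integrable_mult_right[OF i4])
  have iR1: "integrable M (\<lambda>om. \<Sum>i=1..n. \<bar>E1 i om\<bar>)" using i1 by (intro bi_sum integrable_abs)
  have iR3: "integrable M (\<lambda>om. \<Sum>i=1..n. \<bar>(3 * (V i)^2 - D * h) * Z i om\<bar>)"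
   using i3 by (intro bi_sum integrable_abs)
  have iR4: "integrable M (\<lambda>om. D * \<bar>E4 om\<bar>)" using i4 by (intro integrable_mult_right integrable_abs)
  have iR: "integrable M ?R" using mp(1) by (intro bi_add iR1 iR3 iR4 integrable_abs)
  have le: "\<bar>?I om\<bar> \<le> ?R om" for om
  proof -
   have "\<bar>\<Sum>i=1..n. E1 i om\<bar> \<le> (\<Sum>i=1..n. \<bar>E1 i om\<bar>)" by (rule sum_abs)
   moreover have "\<bar>\<Sum>i=1..n. (3 * (V i)^2 - D * h) * Z i om\<bar> \<le> (\<Sum>i=1..n. \<bar>(3 * (V i)^2 - D * h) * Z i om\<bar>)" by (rule sum_abs)
   moreover have "\<bar>D * E4 om\<bar> = D * \<bar>E4 om\<bar>" using D0 by (simp add: abs_mult)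
   ultimately show ?thesis by linarith
  qed
  have "(\<integral>om. \<bar>?I om\<bar> \<partial>M) \<le> (\<integral>om. ?R om \<partial>M)" by (rule integral_mono[OF integrable_abs[OF iI] iR le])
  also have "\<dots> = (\<Sum>i=1..n. \<integral>om. \<bar>E1 i om\<bar> \<partial>M) + (\<integral>om. \<bar>E2 om\<bar> \<partial>M)
    + (\<Sum>i=1..n. \<integral>om. \<bar>(3 * (V i)^2 - D * h) * Z i om\<bar> \<partial>M) + D * (\<integral>om. \<bar>E4 om\<bar> \<partial>M)"
  proof -
   have a: "(\<integral>om. ?R om \<partial>M) = (\<integral>om. (\<Sum>i=1..n. \<bar>E1 i om\<bar>) \<partial>M) + (\<integral>om. \<bar>E2 om\<bar> \<partial>M)
    + (\<integral>om. (\<Sum>i=1..n. \<bar>(3 * (V i)^2 - D * h) * Z i om\<bar>) \<partial>M) + (\<integral>om. D * \<bar>E4 om\<bar> \<partial>M)"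
    using iR1 iR3 iR4 integrable_abs[OF mp(1)]
    by (simp only: bo_add bi_add)
   have b: "(\<integral>om. (\<Sum>i=1..n. \<bar>E1 i om\<bar>) \<partial>M) = (\<Sum>i=1..n. \<integral>om. \<bar>E1 i om\<bar> \<partial>M)"
    using i1 by (intro bo_sum integrable_abs)
   have c: "(\<integral>om. (\<Sum>i=1..n. \<bar>(3 * (V i)^2 - D * h) * Z i om\<bar>) \<partial>M) = (\<Sum>i=1..n. \<integral>om. \<bar>(3 * (V i)^2 - D * h) * Z i om\<bar> \<partial>M)"
    using i3 by (intro bo_sum integrable_abs)
   show ?thesis unfolding a b c by simp
  qed
  also have "\<dots> \<le> \<Lambda> * C1 * q ^ 3 + sqrt (7 * \<Lambda> * (96 * C1 ^ 4 * B)) * q ^ 8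
    + \<Lambda> * (3 * C1 * (C1 + 2 * k) * b4^2) * q ^ 6 + D * (\<Lambda> * (C2 * q ^ 4))"
   by (intro add_mono mult_left_mono e1 mp(2) e3 rs(2) D0)
  also have "\<dots> \<le> \<Lambda> * C1 * q ^ 3 + sqrt (7 * \<Lambda> * (96 * C1 ^ 4 * B)) * q ^ 3
    + \<Lambda> * (3 * C1 * (C1 + 2 * k) * b4^2) * q ^ 3 + D * (\<Lambda> * (C2 * q ^ 3))"
  proof -
   have p: "q ^ 8 \<le> q ^ 3" "q ^ 6 \<le> q ^ 3" "q ^ 4 \<le> q ^ 3" using q by (auto intro!: power_decreasing)
   have "0 \<le> sqrt (7 * \<Lambda> * (96 * C1 ^ 4 * B))" using L0 C1(1) B(1) by (intro real_sqrt_ge_zero mult_nonneg_nonneg) auto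
   moreover have "0 \<le> \<Lambda> * (3 * C1 * (C1 + 2 * k) * b4^2)" using L0 C1(1) k0 by (intro mult_nonneg_nonneg add_nonneg_nonneg) auto
   ultimately show ?thesis using L0 C2(1) D0 by (intro add_mono mult_left_mono p order_refl)
  qed
  also have "\<dots> = A * q ^ 3" by (simp only: A_def D_def distrib_right mult.assoc)
  finally have "(\<integral>om. \<bar>?I om\<bar> \<partial>M) \<le> A * q ^ 3" .
  with iI show ?thesis unfolding dec[unfolded J_def] by blast
 qed
 show ?thesis
 proof (intro exI[of _ "\<bar>A\<bar>"] conjI allI impI)
  fix n q assume q: "0 < q" "q \<le> 1" "2 * q ^ 16 \<le> T1" "T1 + real n * q ^ 20 = T"
  have "A * q ^ 3 \<le> \<bar>A\<bar> * q ^ 3" using q by (intro mult_right_mono) auto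
  then show "let D = (\<lambda>om. quartic_variation u T1 T x n om - 6 * (kap x)^2 / pi * (LBINT r:{T1..T}. \<sigma> (u r x om) ^ 4))
  in integrable M D \<and> (\<integral>om. \<bar>D om\<bar> \<partial>M) \<le> \<bar>A\<bar> * q ^ 3" using main[OF q] unfolding Let_def by (blast intro: order_trans)
 qed simp
qed

end

text \<open>Markov's inequality turns a rate in L1 into convergence in probability.\<close>

lemma (in prob_space) L1_rate_tendsto_in_prob:
 fixes X :: "nat => 'a => real"
 assumes X [measurable]: "\<And>n. X n \<in> bm M" and Y [measurable]: "Y \<in> bm M" and "s < 0"
  and ev: "\<forall>\<^sub>F n in sequentially. integrable M (\<lambda>om. \<bar>X n om - Y om\<bar>) \<and> (\<integral>om. \<bar>X n om - Y om\<bar> \<partial>M) \<le> C * real n powr s"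
 shows "tendsto_in_prob M X Y"
 unfolding tendsto_in_prob_def
proof (intro conjI allI impI X Y)
 fix \<epsilon> :: real assume eps: "0 < \<epsilon>"
 show "(\<lambda>n. measure M {om \<in> space M. \<bar>X n om - Y om\<bar> > \<epsilon>}) ----> 0"
 proof (rule tendsto_sandwich[OF _ _ tendsto_const])
  show "\<forall>\<^sub>F n in sequentially. measure M {om \<in> space M. \<bar>X n om - Y om\<bar> > \<epsilon>} \<le> C * real n powr s / \<epsilon>"
   using ev
  proof eventually_elim
   case (elim n)
   have "measure M {om \<in> space M. \<bar>X n om - Y om\<bar> > \<epsilon>} \<le> measure M {om \<in> space M. \<epsilon> \<le> \<bar>X n om - Y om\<bar>}"
    by (intro finite_measure_mono) (auto simp: less_imp_le)
   also have "\<dots> \<le> (\<integral>om. \<bar>X n om - Y om\<bar> \<partial>M) / \<epsilon>"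
    by (rule integral_Markov_inequality_measure[OF conjunct1[OF elim] sets.empty_sets]) (use eps in auto)
   also have "\<dots> \<le> C * real n powr s / \<epsilon>" using elim eps by (intro divide_right_mono) auto
   finally show ?case .
  qed
  have "(\<lambda>n. C * real n powr s / \<epsilon>) ----> C * 0 / \<epsilon>"
   using eps by (intro tendsto_intros tendsto_neg_powr[OF \<open>s < 0\<close>] filterlim_real_sequentially) auto
  then show "(\<lambda>n. C * real n powr s / \<epsilon>) ----> 0" by simp
 qed simp
qed

theorem theorem3p3:
  fixes M :: "'a measure"
    and W :: "real \<Rightarrow> real set \<Rightarrow> 'a \<Rightarrow> real"
    and u :: "real \<Rightarrow> real \<Rightarrow> 'a \<Rightarrow> real"
    and \<sigma> :: "real \<Rightarrow> real"
    and a1 a2 \<rho>1 \<rho>2 K T1 T2 x :: real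
  defines "L \<equiv> (\<lambda>\<omega>. 6 * tau_fun a1 a2 \<rho>1 \<rho>2 x / (pi * coeffA a1 a2 x)
                      * (LBINT r:{T1..T2}. (\<sigma> (u r x \<omega>)) ^ 4))"
  assumes "a1 > 0" and "a2 > 0" and "\<rho>1 > 0" and "\<rho>2 > 0"
    and "prob_space M"
    and "white_noise M W"
    and "K > 0" and "K-lipschitz_on UNIV \<sigma>"
    and "mild_solution a1 a2 \<rho>1 \<rho>2 \<sigma> M W u"
    and "0 < T1" and "T1 < T2"
  shows "tendsto_in_prob M (quartic_variation u T1 T2 x) L \<and>
    (\<exists>C>0. \<forall>\<^sub>F n in sequentially.
      integrable M (\<lambda>\<omega>. \<bar>quartic_variation u T1 T2 x n \<omega> - L \<omega>\<bar>) \<and>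
      (\<integral>\<omega>. \<bar>quartic_variation u T1 T2 x n \<omega> - L \<omega>\<bar> \<partial>M) \<le> C * real n powr (- 3 / 20))"
proof -
 interpret mild M W a1 a2 \<rho>1 \<rho>2 \<sigma> K u T2
  using assms by (intro mild.intro wnoise.intro coeffs.intro wnoise_axioms.intro mild_axioms.intro) auto
 let ?Q = "quartic_variation u T1 T2 x"
 have Le: "L = (\<lambda>om. 6 * (kap x)^2 / pi * (LBINT r:{T1..T2}. \<sigma> (u r x om) ^ 4))"
  by (simp add: L_def kap_sq mult.commute)
 from quartic_variation_L1[OF \<open>0 < T1\<close>, of x] obtain C where C: "0 \<le> C"
  "\<And>n q. 0 < q ==> q \<le> 1 ==> 2 * q ^ 16 \<le> T1 ==> T1 + real n * q ^ 20 = T2 ==>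
   integrable M (\<lambda>om. ?Q n om - L om) \<and> (\<integral>om. \<bar>?Q n om - L om\<bar> \<partial>M) \<le> C * q ^ 3"
  unfolding Le Let_def by blast
 define \<Lambda> where "\<Lambda> = T2 - T1"
 have \<Lambda>: "0 < \<Lambda>" using \<open>T1 < T2\<close> by (simp add: \<Lambda>_def)
 \<comment> \<open>For \<open>q < e\<close> both smallness conditions on \<open>q\<close> hold, the
   one involving \<open>T1\<close> because \<open>q ^ 16 \<le> q\<close>.\<close>
 define e where "e = min 1 (T1 / 2)"
 have e: "0 < e" using \<open>0 < T1\<close> by (simp add: e_def)
 \<comment> \<open>The summand 1 keeps the constant positive even if \<open>C = 0\<close>.\<close>
 define D where "D = C * \<Lambda> powr (3 / 20) + 1"
 have "\<forall>\<^sub>F n in sequentially. \<Lambda> / real n < e ^ 20"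
  by (rule order_tendstoD(2)[OF lim_const_over_n[of \<Lambda>]]) (use e in simp)
 then have ev: "\<forall>\<^sub>F n in sequentially. integrable M (\<lambda>om. ?Q n om - L om) \<and> (\<integral>om. \<bar>?Q n om - L om\<bar> \<partial>M) \<le> D * real n powr (- 3 / 20)"
  using eventually_gt_at_top[of 0]
 proof eventually_elim
  case (elim n)
  \<comment> \<open>The mesh is \<open>q ^ 20 = \<Lambda> / n\<close>, so \<open>q ^ 3\<close> is a
    constant multiple of \<open>n powr (- 3 / 20)\<close>.\<close>
  define q where "q = (\<Lambda> / real n) powr (1 / 20)"
  have d: "0 < \<Lambda> / real n" using \<Lambda> elim(2) by simp
  have q0: "0 < q" using \<Lambda> elim(2) by (simp add: q_def)
  have q20: "q ^ 20 = \<Lambda> / real n" using \<Lambda> elim(2) by (simp add: q_def powr_power)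
  have q3: "q ^ 3 = (\<Lambda> / real n) powr (3 / 20)" using \<Lambda> elim(2) by (simp add: q_def powr_power)
  have "q ^ 20 < e ^ 20" using elim(1) q20 by simp
  then have qe: "q < e" using e by (rule_tac power_less_imp_less_base) auto
  have q1: "q \<le> 1" using qe by (simp add: e_def)
  have "q ^ 16 \<le> q" using power_decreasing[of 1 16 q] q0 q1 by simp
  then have q16: "2 * q ^ 16 \<le> T1" using qe by (simp add: e_def)
  have "T1 + real n * q ^ 20 = T2" using elim(2) by (simp add: q20 \<Lambda>_def)
  from C(2)[OF q0 q1 q16 this]
  have *: "integrable M (\<lambda>om. ?Q n om - L om)" "(\<integral>om. \<bar>?Q n om - L om\<bar> \<partial>M) \<le> C * q ^ 3" by auto
  have "C * q ^ 3 = C * \<Lambda> powr (3 / 20) * real n powr (- 3 / 20)"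
   unfolding q3 using \<Lambda> elim(2) by (simp add: powr_divide powr_minus_divide)
  also have "\<dots> \<le> D * real n powr (- 3 / 20)" unfolding D_def by (intro mult_right_mono) auto
  finally show ?case using * by linarith
 qed
 then have ev': "\<forall>\<^sub>F n in sequentially. integrable M (\<lambda>om. \<bar>?Q n om - L om\<bar>) \<and> (\<integral>om. \<bar>?Q n om - L om\<bar> \<partial>M) \<le> D * real n powr (- 3 / 20)"
  by eventually_elim simp
 have Qm: "?Q n \<in> bm M" for n
 proof -
  have "u (T1 + real i * ((T2 - T1) / real n)) x \<in> bm M" for i
   using \<open>0 < T1\<close> \<open>T1 < T2\<close> by (intro u_measurable add_nonneg_nonneg mult_nonneg_nonneg divide_nonneg_nonneg) auto
  then show ?thesis unfolding quartic_variation_def[abs_def] Let_def by measurable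
 qed
 have Lm: "L \<in> bm M"
 proof -
  \<comment> \<open>Measurability of the limit is inherited from one integrable difference.\<close>
  from eventually_happens'[OF sequentially_bot ev] obtain n where "integrable M (\<lambda>om. ?Q n om - L om)" by blast
  then have "(\<lambda>om. ?Q n om - (?Q n om - L om)) \<in> bm M" by (intro borel_measurable_diff[OF Qm borel_measurable_integrable])
  then show ?thesis by simp
 qed
 have "0 < D" using C(1) by (simp add: D_def add_nonneg_pos)
 then show ?thesis using L1_rate_tendsto_in_prob[OF Qm Lm _ ev'] ev' by auto
qed

end
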